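(* Let $G$ be a Lie group. The category $\underline{\mathsf{Trans}}_G$ of transport functors is a stack over the category (site) $\mathsf{Man}$ of manifolds.
   Context: $\mathsf{Man}$ is the category of smooth manifolds with the open cover Grothendieck topology; a stack over $\mathsf{Man}$ is a category fibered in groupoids over $\mathsf{Man}$ satisfying descent. Diffeology. A diffeology on a set $X$ is a collection of maps $U\to X$ ("plots"), $U$ ranging over open subsets of $\mathbb{R}^n$, $n\ge 0$, which contains all constant maps, is closed under precomposition with smooth maps $V\to U$ of such open sets, and is local (a map $U\to X$ that restricts to a plot on each member of an open cover of $U$ is a plot). A map of diffeological spaces is smooth if it sends plots to plots by composition. A manifold is a diffeological space whose plots are the smooth maps. Subspace diffeology on $Y\subset X$: plots of $X$ with image in $Y$. Quotient diffeology on $X/R$: maps $U\to X/R$ that locally on $U$ lift to plots of $X$. Thin fundamental groupoid. A path with sitting instances in a manifold $M$ is a smooth map $\gamma:[0,1]\to M$ that is constant near $0$ and near $1$; $\mathcal{P}(M)$ is the set of these, with the diffeology in which $p:U\to\mathcal{P}(M)$ is a plot iff $(u,t)\mapsto p(u)(t)$ is a smooth map $U\times[0,1]\to M$. Two such paths $\gamma_0,\gamma_1$ with the same endpoints are thinly homotopic if there is a smooth $H:[0,1]^2\to M$ with $H(s,0)=\gamma_0(s)$, $H(s,1)=\gamma_1(s)$, $H(0,t)=\gamma_0(0)$, $H(1,t)=\gamma_0(1)$, with $\mathrm{rank}(dH)\le 1$ everywhere, and with $H$ constant in $s$ near $\{0,1\}\times[0,1]$ and constant in $t$ near $[0,1]\times\{0,1\}$.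 This is an equivalence relation $\sim$. $\Pi^{\mathrm{thin}}(M)$ is the groupoid with objects the points of $M$, arrows $\mathcal{P}(M)/_\sim$ (quotient diffeology), source $[\gamma]\mapsto\gamma(0)$, target $[\gamma]\mapsto\gamma(1)$, composition $[\gamma][\tau]=[\gamma\tau]$ where $\gamma\tau$ is the concatenation ($\tau$ first, then $\gamma$, each at double speed), units the constant paths, inverses the reversed paths. $\pi_1^{\mathrm{thin}}(M,x)$ is the automorphism group of $x$ in $\Pi^{\mathrm{thin}}(M)$, with the subspace diffeology. A smooth map $f:N\to M$ induces a functor $\Pi^{\mathrm{thin}}(f):\Pi^{\mathrm{thin}}(N)\to\Pi^{\mathrm{thin}}(M)$, equal to $f$ on objects and $[\gamma]\mapsto[f\circ\gamma]$ on arrows. Transport functors. $G\text{-}\mathsf{tors}$ is the groupoid of $G$-torsors (manifolds with a smooth free transitive right $G$-action such that $X\times G\to X\times X$, $(x,g)\mapsto(x,x\cdot g)$, is a diffeomorphism) and $G$-equivariant maps. For a $G$-torsor $X$, $\mathrm{Aut}(X)$ is a Lie group via the isomorphism $\mathrm{Aut}(X)\to G$, $f\mapsto d(x,f(x))$, where $x\in X$ is any point and $x\cdot d(x,y)=y$. A functor $F:\Pi^{\mathrm{thin}}(M)\to G\text{-}\mathsf{tors}$ is a transport functor if for every $x\in M$ the map $F|_{\pi_1^{\mathrm{thin}}(M,x)}:\pi_1^{\mathrm{thin}}(M,x)\to\mathrm{Aut}(F(x))$ is smooth. The fibered category $\underline{\mathsf{Trans}}_G\to\mathsf{Man}$: objects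 are pairs $(M,F)$, $M$ a manifold and $F$ a transport functor on $M$; a morphism $(N,H)\to(M,F)$ is a pair $(f,\alpha)$ with $f:N\to M$ smooth and $\alpha:H\Rightarrow F\circ\Pi^{\mathrm{thin}}(f)$ a natural isomorphism; the projection sends $(f,\alpha)$ to $f$. *)

theory Defs
  imports
    "HOL-Analysis.Analysis"
    "HOL-Algebra.Group"
    "Jordan_Normal_Form.DL_Rank"
begin

section \<open>Categories, functors, natural isomorphisms\<close>

record ('o, 'a) cat =
  Obj :: "'o set"
  Arr :: "'a set"
  Dom :: "'a \<Rightarrow> 'o"
  Cod :: "'a \<Rightarrow> 'o"
  Ident :: "'o \<Rightarrow> 'a"
  Comp :: "'a \<Rightarrow> 'a \<Rightarrow> 'a"

text \<open>\<open>Comp C b a\<close> is \<open>b\<close> after \<open>a\<close>; it is only meaningful if \<open>Cod C a = Dom C b\<close>.\<close>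

locale category =
  fixes C :: "('o, 'a) cat"
  assumes Dom_Obj: "a \<in> Arr C \<Longrightarrow> Dom C a \<in> Obj C"
    and Cod_Obj: "a \<in> Arr C \<Longrightarrow> Cod C a \<in> Obj C"
    and Ident_Arr: "x \<in> Obj C \<Longrightarrow> Ident C x \<in> Arr C"
    and Dom_Ident: "x \<in> Obj C \<Longrightarrow> Dom C (Ident C x) = x"
    and Cod_Ident: "x \<in> Obj C \<Longrightarrow> Cod C (Ident C x) = x"
    and Comp_Arr: "a \<in> Arr C \<Longrightarrow> b \<in> Arr C \<Longrightarrow> Cod C a = Dom C b \<Longrightarrow> Comp C b a \<in> Arr C"
    and Dom_Comp: "a \<in> Arr C \<Longrightarrow> b \<in> Arr C \<Longrightarrow> Cod C a = Dom C b \<Longrightarrow> Dom C (Comp C b a) = Dom C a"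
    and Cod_Comp: "a \<in> Arr C \<Longrightarrow> b \<in> Arr C \<Longrightarrow> Cod C a = Dom C b \<Longrightarrow> Cod C (Comp C b a) = Cod C b"
    and Comp_Ident_right: "a \<in> Arr C \<Longrightarrow> Comp C a (Ident C (Dom C a)) = a"
    and Comp_Ident_left: "a \<in> Arr C \<Longrightarrow> Comp C (Ident C (Cod C a)) a = a"
    and Comp_assoc: "a \<in> Arr C \<Longrightarrow> b \<in> Arr C \<Longrightarrow> c \<in> Arr C \<Longrightarrow>
          Cod C a = Dom C b \<Longrightarrow> Cod C b = Dom C c \<Longrightarrow>
          Comp C c (Comp C b a) = Comp C (Comp C c b) a"

record ('o, 'a, 'p, 'b) func =
  fobj :: "'o \<Rightarrow> 'p"
  farr :: "'a \<Rightarrow> 'b"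

text \<open>The values of functors and of natural transformations outside of the source category are
  fixed, so that HOL equality is equality of functors, resp. of natural transformations.\<close>

definition is_functor :: "('o, 'a) cat \<Rightarrow> ('p, 'b) cat \<Rightarrow> ('o, 'a, 'p, 'b) func \<Rightarrow> bool" where
  "is_functor C D F \<longleftrightarrow> category C \<and> category D \<and>
     fobj F \<in> Obj C \<rightarrow>\<^sub>E Obj D \<and> farr F \<in> Arr C \<rightarrow>\<^sub>E Arr D \<and>
     (\<forall>a\<in>Arr C. Dom D (farr F a) = fobj F (Dom C a) \<and> Cod D (farr F a) = fobj F (Cod C a)) \<and>
     (\<forall>x\<in>Obj C. farr F (Ident C x) = Ident D (fobj F x)) \<and>
     (\<forall>a\<in>Arr C. \<forall>b\<in>Arr C. Cod C a = Dom C b \<longrightarrow>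
        farr F (Comp C b a) = Comp D (farr F b) (farr F a))"

definition func_comp ::
    "('o, 'a) cat \<Rightarrow> ('p, 'b, 'q, 'c) func \<Rightarrow> ('o, 'a, 'p, 'b) func \<Rightarrow> ('o, 'a, 'q, 'c) func" where
  "func_comp C F K = \<lparr>fobj = compose (Obj C) (fobj F) (fobj K),
                      farr = compose (Arr C) (farr F) (farr K)\<rparr>"

definition is_iso :: "('o, 'a) cat \<Rightarrow> 'a \<Rightarrow> bool" where
  "is_iso C a \<longleftrightarrow> a \<in> Arr C \<and> (\<exists>b\<in>Arr C. Dom C b = Cod C a \<and> Cod C b = Dom C a \<and>
     Comp C b a = Ident C (Dom C a) \<and> Comp C a b = Ident C (Cod C a))"

definition natural_iso ::
    "('o, 'a) cat \<Rightarrow> ('p, 'b) cat \<Rightarrow> ('o, 'a, 'p, 'b) func \<Rightarrow> ('o, 'a, 'p, 'b) func \<Rightarrow> ('o \<Rightarrow> 'b) \<Rightarrow> bool" where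
  "natural_iso C D F K \<alpha> \<longleftrightarrow> \<alpha> \<in> Obj C \<rightarrow>\<^sub>E Arr D \<and>
     (\<forall>x\<in>Obj C. Dom D (\<alpha> x) = fobj F x \<and> Cod D (\<alpha> x) = fobj K x \<and> is_iso D (\<alpha> x)) \<and>
     (\<forall>a\<in>Arr C. Comp D (farr K a) (\<alpha> (Dom C a)) = Comp D (\<alpha> (Cod C a)) (farr F a))"

definition fibered_in_groupoids ::
    "('o, 'a) cat \<Rightarrow> ('p, 'b) cat \<Rightarrow> ('o, 'a, 'p, 'b) func \<Rightarrow> bool" where
  "fibered_in_groupoids X B \<pi> \<longleftrightarrow> is_functor X B \<pi> \<and>
     (\<forall>f\<in>Arr B. \<forall>\<xi>\<in>Obj X. fobj \<pi> \<xi> = Cod B f \<longrightarrow>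
        (\<exists>a\<in>Arr X. Cod X a = \<xi> \<and> farr \<pi> a = f)) \<and>
     (\<forall>a\<in>Arr X. \<forall>b\<in>Arr X. \<forall>g\<in>Arr B.
        Cod X a = Cod X b \<longrightarrow> Dom B g = fobj \<pi> (Dom X b) \<longrightarrow> Cod B g = fobj \<pi> (Dom X a) \<longrightarrow>
        Comp B (farr \<pi> a) g = farr \<pi> b \<longrightarrow>
        (\<exists>!c. c \<in> Arr X \<and> Dom X c = Dom X b \<and> Cod X c = Dom X a \<and> farr \<pi> c = g \<and> Comp X a c = b))"


section \<open>Smooth manifolds\<close>

text \<open>\<open>\<real>\<^sup>n\<close> is the library's \<open>Euclidean_space n\<close>: the real sequences vanishing from index \<open>n\<close> on.
  \<open>Ck n U k f\<close>: the function \<open>f\<close> is \<open>k\<close> times continuously differentiable on the open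
  set \<open>U\<close> of \<open>\<real>\<^sup>n\<close>, in terms of iterated partial derivatives.\<close>

primrec Ck :: "nat \<Rightarrow> (nat \<Rightarrow> real) set \<Rightarrow> nat \<Rightarrow> ((nat \<Rightarrow> real) \<Rightarrow> real) \<Rightarrow> bool" where
  "Ck n U 0 f \<longleftrightarrow> continuous_map (subtopology (Euclidean_space n) U) euclideanreal f"
| "Ck n U (Suc k) f \<longleftrightarrow> continuous_map (subtopology (Euclidean_space n) U) euclideanreal f \<and>
     (\<forall>i<n. \<exists>g. (\<forall>x\<in>U. ((\<lambda>t. f (x(i := t))) has_real_derivative g x) (at (x i))) \<and> Ck n U k g)"

definition smooth_eucl ::
    "nat \<Rightarrow> (nat \<Rightarrow> real) set \<Rightarrow> nat \<Rightarrow> ((nat \<Rightarrow> real) \<Rightarrow> (nat \<Rightarrow> real)) \<Rightarrow> bool" where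
  "smooth_eucl n U m f \<longleftrightarrow> f ` U \<subseteq> topspace (Euclidean_space m) \<and> (\<forall>j<m. \<forall>k. Ck n U k (\<lambda>x. f x j))"

text \<open>A chart \<open>(n, U, \<phi>)\<close> is a homeomorphism \<open>\<phi>\<close> from the open set \<open>U\<close> to an open set of \<open>\<real>\<^sup>n\<close>.\<close>

type_synonym 'm chart = "nat \<times> 'm set \<times> ('m \<Rightarrow> nat \<Rightarrow> real)"

definition is_chart :: "'m topology \<Rightarrow> 'm chart \<Rightarrow> bool" where
  "is_chart T = (\<lambda>(n, U, \<phi>). openin T U \<and> openin (Euclidean_space n) (\<phi> ` U) \<and>
     homeomorphic_map (subtopology T U) (subtopology (Euclidean_space n) (\<phi> ` U)) \<phi>)"

definition compatible :: "'m chart \<Rightarrow> 'm chart \<Rightarrow> bool" where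
  "compatible = (\<lambda>(n, U, \<phi>) (m, V, \<psi>).
     smooth_eucl n (\<phi> ` (U \<inter> V)) m (\<psi> \<circ> inv_into U \<phi>) \<and>
     smooth_eucl m (\<psi> ` (U \<inter> V)) n (\<phi> \<circ> inv_into V \<psi>))"

definition max_atlas :: "'m topology \<Rightarrow> 'm chart set \<Rightarrow> 'm chart set" where
  "max_atlas T A = {c. is_chart T c \<and> (\<forall>d\<in>A. compatible c d)}"

record 'm mfd =
  mtop :: "'m topology"
  atlas :: "'m chart set"

abbreviation pts :: "'m mfd \<Rightarrow> 'm set" where
  "pts M \<equiv> topspace (mtop M)"

text \<open>The last assumption says that the charts in the atlas are charts of the topology, are
  pairwise compatible, and form a maximal atlas. Components of different dimensions are allowed.\<close>

locale manifold =
  fixes M :: "'m mfd"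
  assumes Hausdorff: "Hausdorff_space (mtop M)"
    and second_countable: "second_countable (mtop M)"
    and charts_cover: "pts M = (\<Union>(n, U, \<phi>)\<in>atlas M. U)"
    and atlas_maximal: "atlas M = max_atlas (mtop M) (atlas M)"

definition smooth_map :: "'m mfd \<Rightarrow> 'k mfd \<Rightarrow> ('m \<Rightarrow> 'k) \<Rightarrow> bool" where
  "smooth_map M N f \<longleftrightarrow> continuous_map (mtop M) (mtop N) f \<and>
     (\<forall>(n, U, \<phi>)\<in>atlas M. \<forall>(m, V, \<psi>)\<in>atlas N.
        smooth_eucl n (\<phi> ` (U \<inter> f -` V)) m (\<psi> \<circ> f \<circ> inv_into U \<phi>))"

definition diffeomorphism :: "'m mfd \<Rightarrow> 'k mfd \<Rightarrow> ('m \<Rightarrow> 'k) \<Rightarrow> bool" where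
  "diffeomorphism M N f \<longleftrightarrow> bij_betw f (pts M) (pts N) \<and> smooth_map M N f \<and>
     smooth_map N M (inv_into (pts M) f)"

definition open_sub :: "'m mfd \<Rightarrow> 'm set \<Rightarrow> 'm mfd" where
  "open_sub M U = \<lparr>mtop = subtopology (mtop M) U, atlas = {(n, V, \<phi>). (n, V, \<phi>) \<in> atlas M \<and> V \<subseteq> U}\<rparr>"

definition eucl_mfd :: "nat \<Rightarrow> (nat \<Rightarrow> real) mfd" where
  "eucl_mfd n = \<lparr>mtop = Euclidean_space n,
     atlas = max_atlas (Euclidean_space n) {(n, topspace (Euclidean_space n), \<lambda>x. x)}\<rparr>"

definition prod_mfd :: "'m mfd \<Rightarrow> 'k mfd \<Rightarrow> ('m \<times> 'k) mfd" where
  "prod_mfd M N = \<lparr>mtop = prod_topology (mtop M) (mtop N),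
     atlas = max_atlas (prod_topology (mtop M) (mtop N))
       {(n + m, U \<times> V, \<lambda>(x, y) i. if i < n then \<phi> x i else \<psi> y (i - n)) | n U \<phi> m V \<psi>.
          (n, U, \<phi>) \<in> atlas M \<and> (m, V, \<psi>) \<in> atlas N}\<rparr>"

text \<open>Smoothness of a map from an arbitrary subset \<open>A\<close> of \<open>\<real>\<^sup>k\<close>, such as \<open>[0,1]\<close>, \<open>[0,1]\<^sup>2\<close>
  or \<open>U \<times> [0,1]\<close>: locally there are smooth extensions to open sets.\<close>

definition smooth_from :: "nat \<Rightarrow> (nat \<Rightarrow> real) set \<Rightarrow> 'm mfd \<Rightarrow> ((nat \<Rightarrow> real) \<Rightarrow> 'm) \<Rightarrow> bool" where
  "smooth_from k A M f \<longleftrightarrow> A \<subseteq> topspace (Euclidean_space k) \<and>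
     (\<forall>a\<in>A. \<exists>W g. openin (Euclidean_space k) W \<and> a \<in> W \<and>
        smooth_map (open_sub (eucl_mfd k) W) M g \<and> (\<forall>y\<in>A \<inter> W. g y = f y))"

text \<open>Manifolds are those whose underlying set is a subset of the (arbitrary) type \<open>'m\<close>, which
  plays the role of a universe. An arrow \<open>(N, f, M)\<close> is a smooth map \<open>f\<close> from \<open>N\<close> to \<open>M\<close>.\<close>

type_synonym 'm man_arr = "'m mfd \<times> ('m \<Rightarrow> 'm) \<times> 'm mfd"

definition Man :: "('m mfd, 'm man_arr) cat" where
  "Man = \<lparr>Obj = {M. manifold M},
     Arr = {(N, f, M). manifold N \<and> manifold M \<and> f \<in> extensional (pts N) \<and> smooth_map N M f},
     Dom = (\<lambda>(N, f, M). N),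
     Cod = (\<lambda>(N, f, M). M),
     Ident = (\<lambda>M. (M, \<lambda>x\<in>pts M. x, M)),
     Comp = (\<lambda>(_, g, L) (N, f, _). (N, compose (pts N) g f, L))\<rparr>"


section \<open>Stacks over the site of manifolds\<close>

definition open_cover :: "'m mfd \<Rightarrow> 'm set set \<Rightarrow> bool" where
  "open_cover M \<U> \<longleftrightarrow> (\<forall>U\<in>\<U>. openin (mtop M) U) \<and> \<Union>\<U> = pts M"

definition incl :: "'m mfd \<Rightarrow> 'm mfd \<Rightarrow> 'm man_arr" where
  "incl N M = (N, \<lambda>x\<in>pts N. x, M)"

text \<open>A cleavage chooses, for each \<open>f : N \<rightarrow> M\<close> and each \<open>\<xi>\<close> over \<open>M\<close>, a pullback
  \<open>cl f \<xi> : f\<^sup>*\<xi> \<rightarrow> \<xi>\<close> over \<open>f\<close>.\<close>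

definition cleavage ::
    "('o, 'a) cat \<Rightarrow> ('p, 'b) cat \<Rightarrow> ('o, 'a, 'p, 'b) func \<Rightarrow> ('b \<Rightarrow> 'o \<Rightarrow> 'a) \<Rightarrow> bool" where
  "cleavage X B \<pi> cl \<longleftrightarrow> (\<forall>f\<in>Arr B. \<forall>\<xi>\<in>Obj X. fobj \<pi> \<xi> = Cod B f \<longrightarrow>
     cl f \<xi> \<in> Arr X \<and> Cod X (cl f \<xi>) = \<xi> \<and> farr \<pi> (cl f \<xi>) = f)"

text \<open>The unique factorization \<open>k\<close> of \<open>b\<close> through \<open>a\<close> lying over \<open>g\<close>.\<close>

definition factor :: "('o, 'a) cat \<Rightarrow> ('o, 'a, 'p, 'b) func \<Rightarrow> 'a \<Rightarrow> 'a \<Rightarrow> 'b \<Rightarrow> 'a" where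
  "factor X \<pi> a b g = (THE k. k \<in> Arr X \<and> Dom X k = Dom X b \<and> Cod X k = Dom X a \<and>
     farr \<pi> k = g \<and> Comp X a k = b)"

text \<open>\<open>lift_to \<pi> cl N \<xi> : \<xi>|N \<rightarrow> \<xi>\<close> is the chosen pullback of \<open>\<xi>\<close> to the open submanifold
  \<open>N\<close> of its base, and \<open>sub_lift X \<pi> cl L N \<xi> : \<xi>|L \<rightarrow> \<xi>|N\<close> the induced arrow for \<open>L \<subseteq> N\<close>;
  these arrows identify \<open>(\<xi>|N)|L\<close> with \<open>\<xi>|L\<close>.\<close>

definition lift_to ::
    "('o, 'a, 'm mfd, 'm man_arr) func \<Rightarrow> ('m man_arr \<Rightarrow> 'o \<Rightarrow> 'a) \<Rightarrow> 'm mfd \<Rightarrow> 'o \<Rightarrow> 'a" where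
  "lift_to \<pi> cl N \<xi> = cl (incl N (fobj \<pi> \<xi>)) \<xi>"

definition restr ::
    "('o, 'a) cat \<Rightarrow> ('o, 'a, 'm mfd, 'm man_arr) func \<Rightarrow> ('m man_arr \<Rightarrow> 'o \<Rightarrow> 'a) \<Rightarrow> 'm mfd \<Rightarrow> 'o \<Rightarrow> 'o" where
  "restr X \<pi> cl N \<xi> = Dom X (lift_to \<pi> cl N \<xi>)"

definition sub_lift ::
    "('o, 'a) cat \<Rightarrow> ('o, 'a, 'm mfd, 'm man_arr) func \<Rightarrow> ('m man_arr \<Rightarrow> 'o \<Rightarrow> 'a) \<Rightarrow>
     'm mfd \<Rightarrow> 'm mfd \<Rightarrow> 'o \<Rightarrow> 'a" where
  "sub_lift X \<pi> cl L N \<xi> = factor X \<pi> (lift_to \<pi> cl N \<xi>) (lift_to \<pi> cl L \<xi>) (incl L N)"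

text \<open>Arrows \<open>\<xi> \<rightarrow> \<eta>\<close> in the fiber over the common base of \<open>\<xi>\<close> and \<open>\<eta>\<close>.\<close>

definition fiber_hom ::
    "('o, 'a) cat \<Rightarrow> ('o, 'a, 'm mfd, 'm man_arr) func \<Rightarrow> 'o \<Rightarrow> 'o \<Rightarrow> 'a set" where
  "fiber_hom X \<pi> \<xi> \<eta> = {\<phi>\<in>Arr X. Dom X \<phi> = \<xi> \<and> Cod X \<phi> = \<eta> \<and> farr \<pi> \<phi> = Ident Man (fobj \<pi> \<xi>)}"

text \<open>The pullback of a fiber arrow \<open>\<phi> : \<xi> \<rightarrow> \<eta>\<close> along \<open>p : \<xi>' \<rightarrow> \<xi>\<close> and \<open>q : \<eta>' \<rightarrow> \<eta>\<close> lying
  over the same map: the unique fiber arrow \<open>\<psi> : \<xi>' \<rightarrow> \<eta>'\<close> with \<open>q \<psi> = \<phi> p\<close>.\<close>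

definition pull_arr ::
    "('o, 'a) cat \<Rightarrow> ('o, 'a, 'm mfd, 'm man_arr) func \<Rightarrow> 'a \<Rightarrow> 'a \<Rightarrow> 'a \<Rightarrow> 'a" where
  "pull_arr X \<pi> p q \<phi> = factor X \<pi> q (Comp X \<phi> p) (Ident Man (fobj \<pi> (Dom X p)))"

definition hom_descent ::
    "('o, 'a) cat \<Rightarrow> ('o, 'a, 'm mfd, 'm man_arr) func \<Rightarrow> ('m man_arr \<Rightarrow> 'o \<Rightarrow> 'a) \<Rightarrow>
     'm mfd \<Rightarrow> 'm set set \<Rightarrow> bool" where
  "hom_descent X \<pi> cl M \<U> \<longleftrightarrow>
     (\<forall>\<xi>\<in>Obj X. \<forall>\<eta>\<in>Obj X. \<forall>\<phi>.
        fobj \<pi> \<xi> = M \<longrightarrow> fobj \<pi> \<eta> = M \<longrightarrow>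
        (\<forall>U\<in>\<U>. \<phi> U \<in> fiber_hom X \<pi> (restr X \<pi> cl (open_sub M U) \<xi>) (restr X \<pi> cl (open_sub M U) \<eta>)) \<longrightarrow>
        (\<forall>U\<in>\<U>. \<forall>V\<in>\<U>. let UV = open_sub M (U \<inter> V); MU = open_sub M U; MV = open_sub M V in
           pull_arr X \<pi> (sub_lift X \<pi> cl UV MU \<xi>) (sub_lift X \<pi> cl UV MU \<eta>) (\<phi> U) =
           pull_arr X \<pi> (sub_lift X \<pi> cl UV MV \<xi>) (sub_lift X \<pi> cl UV MV \<eta>) (\<phi> V)) \<longrightarrow>
        (\<exists>!\<psi>. \<psi> \<in> fiber_hom X \<pi> \<xi> \<eta> \<and>
           (\<forall>U\<in>\<U>. pull_arr X \<pi> (lift_to \<pi> cl (open_sub M U) \<xi>) (lift_to \<pi> cl (open_sub M U) \<eta>) \<psi> = \<phi> U)))"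

definition descent_datum ::
    "('o, 'a) cat \<Rightarrow> ('o, 'a, 'm mfd, 'm man_arr) func \<Rightarrow> ('m man_arr \<Rightarrow> 'o \<Rightarrow> 'a) \<Rightarrow>
     'm mfd \<Rightarrow> 'm set set \<Rightarrow> ('m set \<Rightarrow> 'o) \<Rightarrow> ('m set \<Rightarrow> 'm set \<Rightarrow> 'a) \<Rightarrow> bool" where
  "descent_datum X \<pi> cl M \<U> \<xi> \<phi> \<longleftrightarrow>
     (\<forall>U\<in>\<U>. \<xi> U \<in> Obj X \<and> fobj \<pi> (\<xi> U) = open_sub M U) \<and>
     (\<forall>U\<in>\<U>. \<forall>V\<in>\<U>. let UV = open_sub M (U \<inter> V) in
        \<phi> U V \<in> fiber_hom X \<pi> (restr X \<pi> cl UV (\<xi> U)) (restr X \<pi> cl UV (\<xi> V))) \<and>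
     (\<forall>U\<in>\<U>. \<forall>V\<in>\<U>. \<forall>W\<in>\<U>.
        let UVW = open_sub M (U \<inter> V \<inter> W);
            \<phi>UVW = (\<lambda>A B. pull_arr X \<pi> (sub_lift X \<pi> cl UVW (open_sub M (A \<inter> B)) (\<xi> A))
                                       (sub_lift X \<pi> cl UVW (open_sub M (A \<inter> B)) (\<xi> B)) (\<phi> A B))
        in Comp X (\<phi>UVW V W) (\<phi>UVW U V) = \<phi>UVW U W)"

definition effective_descent_datum ::
    "('o, 'a) cat \<Rightarrow> ('o, 'a, 'm mfd, 'm man_arr) func \<Rightarrow> ('m man_arr \<Rightarrow> 'o \<Rightarrow> 'a) \<Rightarrow>
     'm mfd \<Rightarrow> 'm set set \<Rightarrow> ('m set \<Rightarrow> 'o) \<Rightarrow> ('m set \<Rightarrow> 'm set \<Rightarrow> 'a) \<Rightarrow> bool" where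
  "effective_descent_datum X \<pi> cl M \<U> \<xi> \<phi> \<longleftrightarrow>
     (\<exists>\<zeta>\<in>Obj X. \<exists>\<psi>. fobj \<pi> \<zeta> = M \<and>
        (\<forall>U\<in>\<U>. \<psi> U \<in> fiber_hom X \<pi> (restr X \<pi> cl (open_sub M U) \<zeta>) (\<xi> U)) \<and>
        (\<forall>U\<in>\<U>. \<forall>V\<in>\<U>.
           let UV = open_sub M (U \<inter> V);
               \<psi>UV = (\<lambda>A. pull_arr X \<pi> (sub_lift X \<pi> cl UV (open_sub M A) \<zeta>)
                                        (lift_to \<pi> cl UV (\<xi> A)) (\<psi> A))
           in Comp X (\<phi> U V) (\<psi>UV U) = \<psi>UV V))"

text \<open>Since the fibers are groupoids, the gluing arrows of a descent datum and the arrows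
  exhibiting it as effective are automatically isomorphisms. Cleavages exist for every fibered
  category, and the descent condition does not depend on the cleavage.\<close>

definition stack_over_Man :: "('o, 'a) cat \<Rightarrow> ('o, 'a, 'm mfd, 'm man_arr) func \<Rightarrow> bool" where
  "stack_over_Man X \<pi> \<longleftrightarrow> fibered_in_groupoids X Man \<pi> \<and>
     (\<forall>cl M \<U>. cleavage X Man \<pi> cl \<longrightarrow> manifold M \<longrightarrow> open_cover M \<U> \<longrightarrow>
        hom_descent X \<pi> cl M \<U> \<and>
        (\<forall>\<xi> \<phi>. descent_datum X \<pi> cl M \<U> \<xi> \<phi> \<longrightarrow> effective_descent_datum X \<pi> cl M \<U> \<xi> \<phi>))"


section \<open>Diffeologies\<close>

text \<open>\<open>plot X n U p\<close>: the restriction of \<open>p\<close> to the open set \<open>U\<close> of \<open>\<real>\<^sup>n\<close> is a plot.\<close>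

record 'x dspace =
  dset :: "'x set"
  plot :: "nat \<Rightarrow> (nat \<Rightarrow> real) set \<Rightarrow> ((nat \<Rightarrow> real) \<Rightarrow> 'x) \<Rightarrow> bool"

text \<open>The axioms of a diffeology; the first two only make the encoding of plots by total
  functions precise.\<close>

locale diffeological_space =
  fixes X :: "'x dspace"
  assumes plot_open: "plot X n U p \<Longrightarrow> openin (Euclidean_space n) U \<and> p ` U \<subseteq> dset X"
    and plot_cong: "plot X n U p \<Longrightarrow> (\<And>u. u \<in> U \<Longrightarrow> p u = q u) \<Longrightarrow> plot X n U q"
    and plot_const: "openin (Euclidean_space n) U \<Longrightarrow> x \<in> dset X \<Longrightarrow> plot X n U (\<lambda>u. x)"
    and plot_comp: "plot X n U p \<Longrightarrow> openin (Euclidean_space m) V \<Longrightarrow>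
          smooth_eucl m V n h \<Longrightarrow> h ` V \<subseteq> U \<Longrightarrow> plot X m V (p \<circ> h)"
    and plot_local: "openin (Euclidean_space n) U \<Longrightarrow>
          (\<And>u. u \<in> U \<Longrightarrow> \<exists>V. u \<in> V \<and> V \<subseteq> U \<and> plot X n V p) \<Longrightarrow> plot X n U p"

definition dsmooth :: "'x dspace \<Rightarrow> 'y dspace \<Rightarrow> ('x \<Rightarrow> 'y) \<Rightarrow> bool" where
  "dsmooth X Y f \<longleftrightarrow> f ` dset X \<subseteq> dset Y \<and> (\<forall>n U p. plot X n U p \<longrightarrow> plot Y n U (f \<circ> p))"

definition mfd_dspace :: "'m mfd \<Rightarrow> 'm dspace" where
  "mfd_dspace M = \<lparr>dset = pts M,
     plot = (\<lambda>n U p. openin (Euclidean_space n) U \<and> smooth_map (open_sub (eucl_mfd n) U) M p)\<rparr>"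

definition subspace_dspace :: "'x dspace \<Rightarrow> 'x set \<Rightarrow> 'x dspace" where
  "subspace_dspace X Y = \<lparr>dset = Y, plot = (\<lambda>n U p. plot X n U p \<and> p ` U \<subseteq> Y)\<rparr>"

definition quotient_dspace :: "'x dspace \<Rightarrow> ('x \<times> 'x) set \<Rightarrow> 'x set dspace" where
  "quotient_dspace X R = \<lparr>dset = dset X // R,
     plot = (\<lambda>n U q. openin (Euclidean_space n) U \<and>
       (\<forall>u\<in>U. \<exists>V p. u \<in> V \<and> V \<subseteq> U \<and> plot X n V p \<and> (\<forall>v\<in>V. q v = R `` {p v})))\<rparr>"

lemma Ck_subset: "Ck n U k f \<Longrightarrow> V \<subseteq> U \<Longrightarrow> Ck n V k f"
proof (induction k arbitrary: f)
  case 0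
  then show ?case using continuous_map_from_subtopology_mono by (metis Ck.simps(1))
next
  case (Suc k)
  have "continuous_map (subtopology (Euclidean_space n) V) euclideanreal f"
    using Suc.prems continuous_map_from_subtopology_mono by (metis Ck.simps(2))
  moreover have "\<exists>g. (\<forall>x\<in>V. ((\<lambda>t. f (x(i := t))) has_real_derivative g x) (at (x i))) \<and> Ck n V k g" if "i < n" for i
  proof -
    obtain g where "\<forall>x\<in>U. ((\<lambda>t. f (x(i := t))) has_real_derivative g x) (at (x i))" "Ck n U k g"
      using Suc.prems(1) \<open>i < n\<close> unfolding Ck.simps by blast
    then show ?thesis using Suc.IH[of g] Suc.prems(2) by blast
  qed
  ultimately show ?case by simp
qed

lemma smooth_eucl_subset: "smooth_eucl n U m f \<Longrightarrow> V \<subseteq> U \<Longrightarrow> smooth_eucl n V m f"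
  unfolding smooth_eucl_def by (meson Ck_subset image_mono subset_trans)

lemma smooth_eucl_continuous:
  assumes "smooth_eucl n U m f"
  shows "continuous_map (subtopology (Euclidean_space n) U) (Euclidean_space m) f"
proof -
  have "continuous_map (subtopology (Euclidean_space n) U) euclideanreal (\<lambda>x. f x j)" for j
  proof (cases "j < m")
    case True
    then have "Ck n U 0 (\<lambda>x. f x j)" using assms unfolding smooth_eucl_def by (simp del: Ck.simps)
    then show ?thesis by simp
  next
    case False
    have *: "f x j = 0" if "x \<in> topspace (subtopology (Euclidean_space n) U)" for x
      using that assms False by (force simp: smooth_eucl_def topspace_Euclidean_space image_subset_iff)
    show ?thesis
      by (rule continuous_map_eq[of _ _ "\<lambda>x. 0"]) (auto simp: *)
  qed
  then have "continuous_map (subtopology (Euclidean_space n) U) (powertop_real UNIV) f"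
    by (simp add: continuous_map_componentwise_UNIV)
  then show ?thesis
    using assms unfolding Euclidean_space_def smooth_eucl_def
    by (auto simp: continuous_map_in_subtopology)
qed

lemma diffeological_space_subspace:
  assumes "diffeological_space X" "Y \<subseteq> dset X"
  shows "diffeological_space (subspace_dspace X Y)"
proof -
  interpret diffeological_space X by fact
  show ?thesis
  proof
    fix n U p assume "plot (subspace_dspace X Y) n U p"
    then show "openin (Euclidean_space n) U \<and> p ` U \<subseteq> dset (subspace_dspace X Y)"
      using plot_open[of n U p] by (simp add: subspace_dspace_def)
  next
    fix n U p q assume p: "plot (subspace_dspace X Y) n U p" and q: "\<And>u. u \<in> U \<Longrightarrow> p u = q u"
    have "plot X n U q"
      by (rule plot_cong[OF _ q]) (use p in \<open>simp_all add: subspace_dspace_def\<close>)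
    moreover have "q ` U = p ` U"
      by (rule image_cong) (simp_all add: q)
    ultimately show "plot (subspace_dspace X Y) n U q"
      using p by (simp add: subspace_dspace_def)
  next
    fix n U x assume "openin (Euclidean_space n) U" "x \<in> dset (subspace_dspace X Y)"
    then show "plot (subspace_dspace X Y) n U (\<lambda>u. x)"
      using plot_const[of n U x] assms(2) by (auto simp: subspace_dspace_def)
  next
    fix n U p m V h
    assume p: "plot (subspace_dspace X Y) n U p" and h: "openin (Euclidean_space m) V"
      "smooth_eucl m V n h" "h ` V \<subseteq> U"
    have "plot X m V (p \<circ> h)"
      by (rule plot_comp[OF _ h]) (use p in \<open>simp add: subspace_dspace_def\<close>)
    moreover have "(p \<circ> h) ` V \<subseteq> Y"
      using p h(3) by (force simp: subspace_dspace_def)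
    ultimately show "plot (subspace_dspace X Y) m V (p \<circ> h)"
      by (simp add: subspace_dspace_def)
  next
    fix n U p assume U: "openin (Euclidean_space n) U"
      and "\<And>u. u \<in> U \<Longrightarrow> \<exists>V. u \<in> V \<and> V \<subseteq> U \<and> plot (subspace_dspace X Y) n V p"
    then have *: "\<exists>V. u \<in> V \<and> V \<subseteq> U \<and> plot X n V p \<and> p ` V \<subseteq> Y" if "u \<in> U" for u
      using that by (simp add: subspace_dspace_def)
    have "plot X n U p" by (rule plot_local[OF U]) (use * in blast)
    moreover have "p ` U \<subseteq> Y" using * by blast
    ultimately show "plot (subspace_dspace X Y) n U p" by (simp add: subspace_dspace_def)
  qed
qed

lemma diffeological_space_quotient:
  assumes "diffeological_space X"
  shows "diffeological_space (quotient_dspace X R)"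
proof -
  interpret diffeological_space X by fact
  show ?thesis
  proof
    fix n U q assume q: "plot (quotient_dspace X R) n U q"
    then have "q u \<in> dset X // R" if "u \<in> U" for u
    proof -
      from q that obtain V p where "u \<in> V" "plot X n V p" "\<forall>v\<in>V. q v = R `` {p v}"
        unfolding quotient_dspace_def by simp metis
      with plot_open[of n V p] show ?thesis by (auto intro: quotientI)
    qed
    then show "openin (Euclidean_space n) U \<and> q ` U \<subseteq> dset (quotient_dspace X R)"
      using q by (simp add: quotient_dspace_def image_subset_iff)
  next
    fix n U q r assume q: "plot (quotient_dspace X R) n U q" and r: "\<And>u. u \<in> U \<Longrightarrow> q u = r u"
    have "\<exists>V p. u \<in> V \<and> V \<subseteq> U \<and> plot X n V p \<and> (\<forall>v\<in>V. r v = R `` {p v})" if "u \<in> U" for u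
    proof -
      from q that obtain V p where p: "u \<in> V" "V \<subseteq> U" "plot X n V p" "\<forall>v\<in>V. q v = R `` {p v}"
        unfolding quotient_dspace_def by simp metis
      then have "\<forall>v\<in>V. r v = R `` {p v}" using r by (metis subsetD)
      with p show ?thesis by blast
    qed
    then show "plot (quotient_dspace X R) n U r"
      using q by (simp add: quotient_dspace_def)
  next
    fix n U x assume U: "openin (Euclidean_space n) U" and "x \<in> dset (quotient_dspace X R)"
    then obtain y where y: "y \<in> dset X" "x = R `` {y}"
      by (auto simp: quotient_dspace_def elim: quotientE)
    then have "plot X n U (\<lambda>u. y)" using plot_const U by blast
    then show "plot (quotient_dspace X R) n U (\<lambda>u. x)"
      using U y(2) unfolding quotient_dspace_def by simp blast
  next
    fix n U q m V h
    assume q: "plot (quotient_dspace X R) n U q" and V: "openin (Euclidean_space m) V"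
      and h: "smooth_eucl m V n h" "h ` V \<subseteq> U"
    have "\<exists>W p. u \<in> W \<and> W \<subseteq> V \<and> plot X m W p \<and> (\<forall>v\<in>W. (q \<circ> h) v = R `` {p v})" if "u \<in> V" for u
    proof -
      have "h u \<in> U" using h(2) that by blast
      with q obtain V' p where p: "h u \<in> V'" "V' \<subseteq> U" "plot X n V' p" "\<forall>v\<in>V'. q v = R `` {p v}"
        unfolding quotient_dspace_def by simp metis
      define W where "W = {v \<in> V. h v \<in> V'}"
      have "openin (subtopology (Euclidean_space m) V) {x \<in> topspace (subtopology (Euclidean_space m) V). h x \<in> V'}"
        using smooth_eucl_continuous[OF h(1)] plot_open[OF p(3)] openin_continuous_map_preimage by blast
      moreover have "topspace (subtopology (Euclidean_space m) V) = V"
        using openin_subset[OF V] by auto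
      ultimately have "openin (subtopology (Euclidean_space m) V) W"
        by (simp only: W_def)
      then have W: "openin (Euclidean_space m) W"
        using V by (simp add: openin_open_subtopology)
      have "plot X m W (p \<circ> h)"
        by (rule plot_comp[OF p(3) W smooth_eucl_subset[OF h(1)]]) (auto simp: W_def)
      moreover have "u \<in> W" "W \<subseteq> V" "\<forall>v\<in>W. (q \<circ> h) v = R `` {(p \<circ> h) v}"
        using that p by (auto simp: W_def)
      ultimately show ?thesis by blast
    qed
    then show "plot (quotient_dspace X R) m V (q \<circ> h)"
      using V by (simp add: quotient_dspace_def)
  next
    fix n U q assume U: "openin (Euclidean_space n) U"
      and *: "\<And>u. u \<in> U \<Longrightarrow> \<exists>V. u \<in> V \<and> V \<subseteq> U \<and> plot (quotient_dspace X R) n V q"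
    have "\<exists>W p. u \<in> W \<and> W \<subseteq> U \<and> plot X n W p \<and> (\<forall>v\<in>W. q v = R `` {p v})" if "u \<in> U" for u
    proof -
      from *[OF that] obtain V where "u \<in> V" "V \<subseteq> U" "plot (quotient_dspace X R) n V q" by blast
      then obtain W p where "u \<in> W" "W \<subseteq> V" "plot X n W p" "\<forall>v\<in>W. q v = R `` {p v}"
        unfolding quotient_dspace_def by simp metis
      with \<open>V \<subseteq> U\<close> show ?thesis by blast
    qed
    then show "plot (quotient_dspace X R) n U q"
      using U by (simp add: quotient_dspace_def)
  qed
qed


section \<open>The thin fundamental groupoid\<close>

text \<open>Paths are extensional functions on \<open>[0,1]\<close>, which is identified with a subset of \<open>\<real>\<^sup>1\<close>.\<close>

definition paths :: "'m mfd \<Rightarrow> (real \<Rightarrow> 'm) set" where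
  "paths M = {\<gamma> \<in> {0..1} \<rightarrow>\<^sub>E pts M.
     smooth_from 1 {x \<in> topspace (Euclidean_space 1). x 0 \<in> {0..1}} M (\<lambda>x. \<gamma> (x 0)) \<and>
     (\<exists>\<epsilon>>0. \<forall>t\<in>{0..1}. (t \<le> \<epsilon> \<longrightarrow> \<gamma> t = \<gamma> 0) \<and> (1 - \<epsilon> \<le> t \<longrightarrow> \<gamma> t = \<gamma> 1))}"

text \<open>A pair \<open>(u, t)\<close> in \<open>U \<times> [0,1]\<close> is encoded as \<open>x \<in> \<real>\<^sup>n\<^sup>+\<^sup>1\<close> with \<open>t = x n\<close> and
  \<open>u = x(n := 0)\<close>.\<close>

definition path_dspace :: "'m mfd \<Rightarrow> (real \<Rightarrow> 'm) dspace" where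
  "path_dspace M = \<lparr>dset = paths M,
     plot = (\<lambda>n U p. openin (Euclidean_space n) U \<and> p ` U \<subseteq> paths M \<and>
       smooth_from (Suc n) {x \<in> topspace (Euclidean_space (Suc n)). x(n := 0) \<in> U \<and> x n \<in> {0..1}} M
         (\<lambda>x. p (x(n := 0)) (x n)))\<rparr>"

text \<open>The rank of the differential at \<open>(s, t)\<close>, read in a chart \<open>(n, U, \<phi>)\<close> around \<open>H s t\<close>, is
  the rank of the \<open>n \<times> 2\<close> Jacobian matrix (one-sided derivatives on the boundary of the square).\<close>

definition jacobian :: "'m chart \<Rightarrow> (real \<Rightarrow> real \<Rightarrow> 'm) \<Rightarrow> real \<Rightarrow> real \<Rightarrow> real mat" where
  "jacobian = (\<lambda>(n, U, \<phi>) H s t. mat n 2 (\<lambda>(i, j).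
     if j = 0 then vector_derivative (\<lambda>r. \<phi> (H r t) i) (at s within {0..1})
     else vector_derivative (\<lambda>r. \<phi> (H s r) i) (at t within {0..1})))"

definition thin_homotopy ::
    "'m mfd \<Rightarrow> (real \<Rightarrow> 'm) \<Rightarrow> (real \<Rightarrow> 'm) \<Rightarrow> (real \<Rightarrow> real \<Rightarrow> 'm) \<Rightarrow> bool" where
  "thin_homotopy M \<gamma>0 \<gamma>1 H \<longleftrightarrow>
     (\<forall>s\<in>{0..1}. \<forall>t\<in>{0..1}. H s t \<in> pts M) \<and>
     smooth_from 2 {x \<in> topspace (Euclidean_space 2). x 0 \<in> {0..1} \<and> x 1 \<in> {0..1}} M
       (\<lambda>x. H (x 0) (x 1)) \<and>
     (\<forall>s\<in>{0..1}. H s 0 = \<gamma>0 s \<and> H s 1 = \<gamma>1 s) \<and>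
     (\<forall>t\<in>{0..1}. H 0 t = \<gamma>0 0 \<and> H 1 t = \<gamma>0 1) \<and>
     (\<forall>s\<in>{0..1}. \<forall>t\<in>{0..1}. \<forall>(n, U, \<phi>)\<in>atlas M. H s t \<in> U \<longrightarrow>
        vec_space.rank n (jacobian (n, U, \<phi>) H s t) \<le> 1) \<and>
     (\<exists>\<epsilon>>0. \<forall>s\<in>{0..1}. \<forall>t\<in>{0..1}.
        (s \<le> \<epsilon> \<longrightarrow> H s t = H 0 t) \<and> (1 - \<epsilon> \<le> s \<longrightarrow> H s t = H 1 t) \<and>
        (t \<le> \<epsilon> \<longrightarrow> H s t = H s 0) \<and> (1 - \<epsilon> \<le> t \<longrightarrow> H s t = H s 1))"

definition thin_rel :: "'m mfd \<Rightarrow> ((real \<Rightarrow> 'm) \<times> (real \<Rightarrow> 'm)) set" where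
  "thin_rel M = {(\<gamma>0, \<gamma>1). \<gamma>0 \<in> paths M \<and> \<gamma>1 \<in> paths M \<and> \<gamma>0 0 = \<gamma>1 0 \<and> \<gamma>0 1 = \<gamma>1 1 \<and>
     (\<exists>H. thin_homotopy M \<gamma>0 \<gamma>1 H)}"

definition concat_path :: "(real \<Rightarrow> 'm) \<Rightarrow> (real \<Rightarrow> 'm) \<Rightarrow> (real \<Rightarrow> 'm)" where
  "concat_path \<gamma> \<tau> = (\<lambda>t\<in>{0..1}. if t \<le> 1/2 then \<tau> (2 * t) else \<gamma> (2 * t - 1))"

definition Pi_thin :: "'m mfd \<Rightarrow> ('m, (real \<Rightarrow> 'm) set) cat" where
  "Pi_thin M = \<lparr>Obj = pts M,
     Arr = paths M // thin_rel M,
     Dom = (\<lambda>c. the_elem ((\<lambda>\<gamma>. \<gamma> 0) ` c)),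
     Cod = (\<lambda>c. the_elem ((\<lambda>\<gamma>. \<gamma> 1) ` c)),
     Ident = (\<lambda>x. thin_rel M `` {\<lambda>t\<in>{0..1}. x}),
     Comp = (\<lambda>c d. \<Union>\<gamma>\<in>c. \<Union>\<tau>\<in>d. thin_rel M `` {concat_path \<gamma> \<tau>})\<rparr>"

definition Pi_thin_map :: "'m man_arr \<Rightarrow> ('m, (real \<Rightarrow> 'm) set, 'm, (real \<Rightarrow> 'm) set) func" where
  "Pi_thin_map = (\<lambda>(N, f, M). \<lparr>fobj = restrict f (pts N),
     farr = (\<lambda>c\<in>Arr (Pi_thin N). \<Union>\<gamma>\<in>c. thin_rel M `` {compose {0..1} f \<gamma>})\<rparr>)"

definition pi1_thin :: "'m mfd \<Rightarrow> 'm \<Rightarrow> (real \<Rightarrow> 'm) set dspace" where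
  "pi1_thin M x = subspace_dspace (quotient_dspace (path_dspace M) (thin_rel M))
     {c \<in> Arr (Pi_thin M). Dom (Pi_thin M) c = x \<and> Cod (Pi_thin M) c = x}"


section \<open>Lie groups, torsors and transport functors\<close>

record 'g lie_group = "'g monoid" +
  gmfd :: "'g mfd"

definition is_lie_group :: "'g lie_group \<Rightarrow> bool" where
  "is_lie_group G \<longleftrightarrow> group G \<and> manifold (gmfd G) \<and> pts (gmfd G) = carrier G \<and>
     smooth_map (prod_mfd (gmfd G) (gmfd G)) (gmfd G) (\<lambda>(g, h). mult G g h) \<and>
     smooth_map (gmfd G) (gmfd G) (m_inv G)"

record ('q, 'g) torsor =
  tmfd :: "'q mfd"
  act :: "'q \<Rightarrow> 'g \<Rightarrow> 'q"

text \<open>A transitive action is on a nonempty set. As for functors, the values of the action map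
  outside of its domain are fixed.\<close>

definition is_torsor :: "'g lie_group \<Rightarrow> ('q, 'g) torsor \<Rightarrow> bool" where
  "is_torsor G X \<longleftrightarrow> manifold (tmfd X) \<and> pts (tmfd X) \<noteq> {} \<and>
     case_prod (act X) \<in> pts (tmfd X) \<times> carrier G \<rightarrow>\<^sub>E pts (tmfd X) \<and>
     (\<forall>x\<in>pts (tmfd X). act X x (one G) = x) \<and>
     (\<forall>x\<in>pts (tmfd X). \<forall>g\<in>carrier G. \<forall>h\<in>carrier G. act X (act X x g) h = act X x (mult G g h)) \<and>
     smooth_map (prod_mfd (tmfd X) (gmfd G)) (tmfd X) (case_prod (act X)) \<and>
     (\<forall>x\<in>pts (tmfd X). \<forall>g\<in>carrier G. act X x g = x \<longrightarrow> g = one G) \<and>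
     (\<forall>x\<in>pts (tmfd X). \<forall>y\<in>pts (tmfd X). \<exists>g\<in>carrier G. act X x g = y) \<and>
     diffeomorphism (prod_mfd (tmfd X) (gmfd G)) (prod_mfd (tmfd X) (tmfd X)) (\<lambda>(x, g). (x, act X x g))"

text \<open>An arrow \<open>(X, h, Y)\<close> is an equivariant map \<open>h\<close> from \<open>X\<close> to \<open>Y\<close>. The underlying sets of
  torsors are subsets of the (arbitrary) type \<open>'q\<close>.\<close>

type_synonym ('q, 'g) tors_arr = "('q, 'g) torsor \<times> ('q \<Rightarrow> 'q) \<times> ('q, 'g) torsor"

definition Tors :: "'g lie_group \<Rightarrow> (('q, 'g) torsor, ('q, 'g) tors_arr) cat" where
  "Tors G = \<lparr>Obj = {X. is_torsor G X},
     Arr = {(X, h, Y). is_torsor G X \<and> is_torsor G Y \<and> h \<in> pts (tmfd X) \<rightarrow>\<^sub>E pts (tmfd Y) \<and>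
              (\<forall>x\<in>pts (tmfd X). \<forall>g\<in>carrier G. h (act X x g) = act Y (h x) g)},
     Dom = (\<lambda>(X, h, Y). X),
     Cod = (\<lambda>(X, h, Y). Y),
     Ident = (\<lambda>X. (X, \<lambda>x\<in>pts (tmfd X). x, X)),
     Comp = (\<lambda>(_, k, Z) (X, h, _). (X, compose (pts (tmfd X)) k h, Z))\<rparr>"

definition tdiff :: "'g lie_group \<Rightarrow> ('q, 'g) torsor \<Rightarrow> 'q \<Rightarrow> 'q \<Rightarrow> 'g" where
  "tdiff G X x y = (THE g. g \<in> carrier G \<and> act X x g = y)"

text \<open>The smooth structure of \<open>Aut(X)\<close> is transported from \<open>G\<close> along \<open>h \<mapsto> d(x, h(x))\<close>; the
  result does not depend on \<open>x\<close>, as the maps for different \<open>x\<close> differ by an inner automorphism.\<close>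

definition Aut_dspace :: "'g lie_group \<Rightarrow> ('q, 'g) torsor \<Rightarrow> ('q, 'g) tors_arr dspace" where
  "Aut_dspace G X = \<lparr>dset = {a \<in> Arr (Tors G). Dom (Tors G) a = X \<and> Cod (Tors G) a = X},
     plot = (\<lambda>n U p.
       p ` U \<subseteq> {a \<in> Arr (Tors G). Dom (Tors G) a = X \<and> Cod (Tors G) a = X} \<and>
       (\<forall>x\<in>pts (tmfd X). plot (mfd_dspace (gmfd G)) n U (\<lambda>u. tdiff G X x (fst (snd (p u)) x))))\<rparr>"

type_synonym ('m, 'q, 'g) tfunc =
  "('m, (real \<Rightarrow> 'm) set, ('q, 'g) torsor, ('q, 'g) tors_arr) func"

definition transport_functor :: "'g lie_group \<Rightarrow> 'm mfd \<Rightarrow> ('m, 'q, 'g) tfunc \<Rightarrow> bool" where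
  "transport_functor G M F \<longleftrightarrow> is_functor (Pi_thin M) (Tors G) F \<and>
     (\<forall>x\<in>pts M. dsmooth (pi1_thin M x) (Aut_dspace G (fobj F x)) (farr F))"

text \<open>An arrow from \<open>(N, H)\<close> to \<open>(M, F)\<close> is encoded as \<open>((N, H), f, \<alpha>, (M, F))\<close>.\<close>

type_synonym ('m, 'q, 'g) trans_obj = "'m mfd \<times> ('m, 'q, 'g) tfunc"
type_synonym ('m, 'q, 'g) trans_arr =
  "('m, 'q, 'g) trans_obj \<times> ('m \<Rightarrow> 'm) \<times> ('m \<Rightarrow> ('q, 'g) tors_arr) \<times> ('m, 'q, 'g) trans_obj"

definition Trans :: "'g lie_group \<Rightarrow> (('m, 'q, 'g) trans_obj, ('m, 'q, 'g) trans_arr) cat" where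
  "Trans G = \<lparr>Obj = {(M, F). manifold M \<and> transport_functor G M F},
     Arr = {((N, H), f, \<alpha>, (M, F)). transport_functor G N H \<and> transport_functor G M F \<and>
              (N, f, M) \<in> Arr Man \<and>
              natural_iso (Pi_thin N) (Tors G) H (func_comp (Pi_thin N) F (Pi_thin_map (N, f, M))) \<alpha>},
     Dom = (\<lambda>(S, f, \<alpha>, T). S),
     Cod = (\<lambda>(S, f, \<alpha>, T). T),
     Ident = (\<lambda>(M, F). ((M, F), \<lambda>x\<in>pts M. x, \<lambda>x\<in>pts M. Ident (Tors G) (fobj F x), (M, F))),
     Comp = (\<lambda>(_, g, \<beta>, T) ((N, H), f, \<alpha>, _).
       ((N, H), compose (pts N) g f, \<lambda>x\<in>pts N. Comp (Tors G) (\<beta> (f x)) (\<alpha> x), T))\<rparr>"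

definition Trans_proj ::
    "'g lie_group \<Rightarrow> (('m, 'q, 'g) trans_obj, ('m, 'q, 'g) trans_arr, 'm mfd, 'm man_arr) func" where
  "Trans_proj G = \<lparr>fobj = (\<lambda>(M, F)\<in>Obj (Trans G). M),
     farr = (\<lambda>((N, H), f, \<alpha>, (M, F))\<in>Arr (Trans G). (N, f, M))\<rparr>"

end

theory Submission
  imports Defs
begin

text \<open>
  Transport functors glue because a thin homotopy class of paths is determined by local data: the
  holonomy of a path along a descent datum is obtained by multiplying local transports over a
  subdivision, and it is invariant under thin homotopies because the values along the edges of a
  fine grid in \<open>[0,1]\<^sup>2\<close> commute around each small square. The latter holds since a smooth
  curve in the square is mapped to a curve whose class depends only on its end points when the rank
  of the homotopy is at most one. Smoothness of the glued functor is also local: a plot of loops is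
  transported along small pieces, and each piece is closed up to a plot of loops in a member of the
  cover by running out and back along straight lines in the parameter space of the plot.
\<close>

section \<open>Smooth functions on open subsets of \<open>\<real>\<^sup>n\<close>\<close>

text \<open>The components of an arrow of \<open>Trans\<close> carry no smoothness condition and a
  transport functor is tested only on loops at a fixed point, so arrows glue point by point and the
  glued functor may take at each point the torsor of any one member of the cover. The work lies in
  the values on paths. Comparing products over different subdivisions is avoided: the holonomy is
  the end value of a section along the path that is parallel for the local transports, and
  independence of choices becomes uniqueness of such a section. That the class of a curve in the
  square depends only on its end points comes from the chain rule: a map of rank at most one keeps
  this property after composition with a smooth map into the square, so the straight-line homotopy
  between two curves becomes a thin one. Segments do not sit at their ends, hence all of them are
  traversed with a smooth step function that is constant outside the middle third. The local
  functors are known to be smooth only on loops with a fixed base point, while the pieces of a plot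
  of loops have moving end points, hence the detour to the centre of a cube.\<close>

lemma openin_Euclidean_box:
  assumes "openin (Euclidean_space n) U" "x \<in> U"
  obtains r where "r > 0" "\<And>y. y \<in> topspace (Euclidean_space n) \<Longrightarrow> (\<And>i. i < n \<Longrightarrow> \<bar>y i - x i\<bar> < r) \<Longrightarrow> y \<in> U"
proof -
  obtain T where T: "openin (powertop_real UNIV) T" "U = T \<inter> {x. \<forall>i\<ge>n. x i = 0}"
    using assms(1) by (auto simp: Euclidean_space_def openin_subtopology)
  have "x \<in> T" using T assms(2) by auto
  then obtain V where V: "\<And>i. open (V i)" "x \<in> Pi\<^sub>E UNIV V" "Pi\<^sub>E UNIV V \<subseteq> T"
    using T(1) unfolding openin_product_topology_alt by force
  have "\<exists>r>0. ball (x i) r \<subseteq> V i" for i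
    using V(1)[of i] V(2) by (auto simp: open_contains_ball PiE_iff)
  then obtain r where r: "\<And>i. r i > 0" "\<And>i. ball (x i) (r i) \<subseteq> V i" by metis
  \<comment> \<open>Only the first \<open>n\<close> factors constrain a point of
    \<open>\<real>\<^sup>n\<close>, since the later coordinates of both points are 0. The inserted 1
    keeps the minimum defined for \<open>n = 0\<close>.\<close>
  define R where "R = Min (insert 1 (r ` {..<n}))"
  have R: "R > 0" "\<And>i. i < n \<Longrightarrow> R \<le> r i"
    using r(1) by (auto simp: R_def)
  show ?thesis
  proof (rule that[OF R(1)])
    fix y assume y: "y \<in> topspace (Euclidean_space n)" "\<And>i. i < n \<Longrightarrow> \<bar>y i - x i\<bar> < R"
    have "y i \<in> V i" for i
    proof (cases "i < n")
      case True
      then show ?thesis using y(2)[OF True] R(2)[OF True] r(2)[of i] by (force simp: dist_real_def)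
    next
      case False
      then have "y i = x i" using y(1) assms(2) T(2) by (auto simp: topspace_Euclidean_space)
      then show ?thesis using V(2) by auto
    qed
    then show "y \<in> U" using T(2) V(3) y(1) by (auto simp: topspace_Euclidean_space)
  qed
qed

lemma continuous_map_Euclidean_coordinate:
  "continuous_map (Euclidean_space n) euclideanreal (\<lambda>x. x i)"
  unfolding Euclidean_space_def
  by (intro continuous_map_from_subtopology continuous_map_product_coordinates) auto

lemma openin_Euclidean_cube:
  "openin (Euclidean_space n) {y \<in> topspace (Euclidean_space n). \<forall>i<n. \<bar>y i - x i\<bar> < r}"
proof -
  \<comment> \<open>For \<open>n = 0\<close> the indexed intersection is the whole type, hence the
    extra intersection with the space.\<close>
  have "openin (Euclidean_space n) ((\<Inter>i\<in>{..<n}. {y \<in> topspace (Euclidean_space n). y i \<in> ball (x i) r})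
      \<inter> topspace (Euclidean_space n))"
    by (intro openin_INT openin_continuous_map_preimage[OF continuous_map_Euclidean_coordinate]) auto
  also have "(\<Inter>i\<in>{..<n}. {y \<in> topspace (Euclidean_space n). y i \<in> ball (x i) r}) \<inter> topspace (Euclidean_space n)
     = {y \<in> topspace (Euclidean_space n). \<forall>i<n. \<bar>y i - x i\<bar> < r}"
    by (auto simp: dist_real_def abs_minus_commute)
  finally show ?thesis .
qed

lemma upd_in_Euclidean_space:
  "x \<in> topspace (Euclidean_space n) \<Longrightarrow> i < n \<Longrightarrow> x(i := t) \<in> topspace (Euclidean_space n)"
  by (auto simp: topspace_Euclidean_space)

lemma eventually_upd_in_open:
  assumes "openin (Euclidean_space n) U" "x \<in> U" "i < n"
  shows "eventually (\<lambda>t. x(i := t) \<in> U) (nhds (x i))"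
proof -
  obtain r where r: "r > 0" "\<And>y. y \<in> topspace (Euclidean_space n) \<Longrightarrow> (\<And>i. i < n \<Longrightarrow> \<bar>y i - x i\<bar> < r) \<Longrightarrow> y \<in> U"
    using openin_Euclidean_box[OF assms(1,2)] by blast
  have x: "x \<in> topspace (Euclidean_space n)" using assms openin_subset by blast
  have "x(i := t) \<in> U" if "dist t (x i) < r" for t
    by (rule r(2)) (use that upd_in_Euclidean_space[OF x assms(3)] r(1) in \<open>auto simp: dist_real_def\<close>)
  then show ?thesis using r(1) by (auto simp: eventually_nhds_metric)
qed

lemma continuous_map_Euclidean_eps:
  assumes f: "continuous_map (subtopology (Euclidean_space n) U) euclideanreal f"
    and U: "openin (Euclidean_space n) U" "x \<in> U" and e: "e > 0"
  obtains r where "r > 0" "\<And>y. y \<in> topspace (Euclidean_space n) \<Longrightarrow> (\<And>i. i < n \<Longrightarrow> \<bar>y i - x i\<bar> < r) \<Longrightarrow> y \<in> U \<and> \<bar>f y - f x\<bar> < e"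
proof -
  have "openin (subtopology (Euclidean_space n) U) {y \<in> topspace (subtopology (Euclidean_space n) U). f y \<in> ball (f x) e}"
    by (rule openin_continuous_map_preimage[OF f]) auto
  then have o: "openin (Euclidean_space n) {y \<in> topspace (subtopology (Euclidean_space n) U). f y \<in> ball (f x) e}"
    using U openin_trans_full by blast
  have "x \<in> {y \<in> topspace (subtopology (Euclidean_space n) U). f y \<in> ball (f x) e}"
    using U e openin_subset by fastforce
  from openin_Euclidean_box[OF o this] obtain r where "r > 0"
   "\<And>y. y \<in> topspace (Euclidean_space n) \<Longrightarrow> (\<And>i. i < n \<Longrightarrow> \<bar>y i - x i\<bar> < r) \<Longrightarrow> y \<in> {y \<in> topspace (subtopology (Euclidean_space n) U). f y \<in> ball (f x) e}"
    by blast
  then show ?thesis using that[of r] by (fastforce simp: dist_real_def abs_minus_commute)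
qed

section \<open>Real-valued smooth functions and their partial derivatives\<close>

definition smooth_fn :: "nat \<Rightarrow> (nat \<Rightarrow> real) set \<Rightarrow> ((nat \<Rightarrow> real) \<Rightarrow> real) \<Rightarrow> bool" where
  "smooth_fn n U f \<longleftrightarrow> (\<forall>k. Ck n U k f)"

definition partial_deriv :: "(nat \<Rightarrow> real) set \<Rightarrow> nat \<Rightarrow> ((nat \<Rightarrow> real) \<Rightarrow> real) \<Rightarrow> ((nat \<Rightarrow> real) \<Rightarrow> real) \<Rightarrow> bool" where
  "partial_deriv U i f g \<longleftrightarrow> (\<forall>x\<in>U. ((\<lambda>t. f (x(i := t))) has_real_derivative g x) (at (x i)))"

lemma smooth_eucl_iff:
  "smooth_eucl n U m f \<longleftrightarrow> f ` U \<subseteq> topspace (Euclidean_space m) \<and> (\<forall>j<m. smooth_fn n U (\<lambda>x. f x j))"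
  by (auto simp: smooth_eucl_def smooth_fn_def)

text \<open>A partial derivative at x only sees the line through x in direction \<open>i\<close>,
  and openness keeps this line inside \<open>U\<close> near x.\<close>

lemma partial_deriv_cong:
  assumes U: "openin (Euclidean_space n) U" "i < n" and eq: "\<And>x. x \<in> U \<Longrightarrow> f x = f' x" "\<And>x. x \<in> U \<Longrightarrow> g x = g' x"
    and "partial_deriv U i f g"
  shows "partial_deriv U i f' g'"
  unfolding partial_deriv_def
proof
  fix x assume x: "x \<in> U"
  have "eventually (\<lambda>t. f (x(i := t)) = f' (x(i := t))) (nhds (x i))"
    by (rule eventually_mono[OF eventually_upd_in_open[OF U(1) x U(2)]]) (simp add: eq)
  then have "((\<lambda>t. f (x(i := t))) has_real_derivative g x) (at (x i)) \<longleftrightarrow> ((\<lambda>t. f' (x(i := t))) has_real_derivative g' x) (at (x i))"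
    by (intro DERIV_cong_ev) (auto simp: eq x)
  then show "((\<lambda>t. f' (x(i := t))) has_real_derivative g' x) (at (x i))"
    using assms(5) x by (auto simp: partial_deriv_def)
qed

lemma partial_deriv_unique:
  "partial_deriv U i f g \<Longrightarrow> partial_deriv U i f g' \<Longrightarrow> x \<in> U \<Longrightarrow> g x = g' x"
  unfolding partial_deriv_def using DERIV_unique by blast

lemma Ck_Suc: "Ck n U (Suc k) f \<longleftrightarrow> continuous_map (subtopology (Euclidean_space n) U) euclideanreal f \<and>
     (\<forall>i<n. \<exists>g. partial_deriv U i f g \<and> Ck n U k g)"
  by (simp add: partial_deriv_def)

lemma Ck_cong:
  assumes U: "openin (Euclidean_space n) U"
  shows "(\<And>x. x \<in> U \<Longrightarrow> f x = f' x) \<Longrightarrow> Ck n U k f \<Longrightarrow> Ck n U k f'"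
proof (induction k arbitrary: f f')
  case 0
  then show ?case by (auto elim!: continuous_map_eq)
next
  case (Suc k)
  have "continuous_map (subtopology (Euclidean_space n) U) euclideanreal f'"
    using Suc.prems by (auto elim!: continuous_map_eq)
  moreover have "\<exists>g. partial_deriv U i f' g \<and> Ck n U k g" if "i < n" for i
  proof -
    obtain g where g: "partial_deriv U i f g" "Ck n U k g"
      using Suc.prems(2) \<open>i < n\<close> unfolding Ck_Suc by blast
    have "partial_deriv U i f' g"
      by (rule partial_deriv_cong[OF U that _ _ g(1)]) (simp_all add: Suc.prems(1))
    then show ?thesis using g(2) by blast
  qed
  ultimately show ?case unfolding Ck_Suc by blast
qed

lemma smooth_fn_cong:
  "openin (Euclidean_space n) U \<Longrightarrow> (\<And>x. x \<in> U \<Longrightarrow> f x = f' x) \<Longrightarrow> smooth_fn n U f \<Longrightarrow> smooth_fn n U f'"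
  unfolding smooth_fn_def using Ck_cong by blast

lemma smooth_eucl_cong:
  assumes "openin (Euclidean_space n) U" "\<And>x. x \<in> U \<Longrightarrow> f x = f' x" "smooth_eucl n U m f"
  shows "smooth_eucl n U m f'"
  unfolding smooth_eucl_iff
proof (intro conjI allI impI)
  show "f' ` U \<subseteq> topspace (Euclidean_space m)" using assms by (force simp: smooth_eucl_iff)
  fix j assume "j < m"
  then have "smooth_fn n U (\<lambda>x. f x j)" using assms(3) by (auto simp: smooth_eucl_iff)
  then show "smooth_fn n U (\<lambda>x. f' x j)" by (rule smooth_fn_cong[OF assms(1), rotated]) (simp add: assms)
qed

lemma smooth_fn_subset: "smooth_fn n U f \<Longrightarrow> V \<subseteq> U \<Longrightarrow> smooth_fn n V f"
  unfolding smooth_fn_def using Ck_subset by blast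

lemma smooth_fn_continuous: "smooth_fn n U f \<Longrightarrow> continuous_map (subtopology (Euclidean_space n) U) euclideanreal f"
  unfolding smooth_fn_def by (metis Ck.simps(1))

text \<open>\<open>Ck\<close> supplies a partial derivative for each order \<open>k\<close>
  separately; by uniqueness of derivatives these functions coincide on \<open>U\<close>, so any one
  of them has all orders of differentiability.\<close>

lemma smooth_fn_partial:
  assumes U: "openin (Euclidean_space n) U" and f: "smooth_fn n U f" and i: "i < n"
  obtains g where "partial_deriv U i f g" "smooth_fn n U g"
proof -
  have "\<exists>g. partial_deriv U i f g \<and> Ck n U k g" for k
    using f i unfolding smooth_fn_def by (metis Ck_Suc)
  then obtain g where g: "\<And>k. partial_deriv U i f (g k)" "\<And>k. Ck n U k (g k)" by metis
  have "Ck n U k (g 0)" for k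
    by (rule Ck_cong[OF U _ g(2)[of k]]) (rule partial_deriv_unique[OF g(1)[of k] g(1)])
  then show ?thesis using that[OF g(1)[of 0]] unfolding smooth_fn_def by blast
qed

text \<open>Smoothness is the largest class of continuous functions closed under partial
  derivatives. Later proofs exhibit such a class instead of inducting on \<open>k\<close>.\<close>

lemma smooth_fn_coinduct:
  assumes "P f"
    and step: "\<And>f. P f \<Longrightarrow> continuous_map (subtopology (Euclidean_space n) U) euclideanreal f \<and>
      (\<forall>i<n. \<exists>g. partial_deriv U i f g \<and> P g)"
  shows "smooth_fn n U f"
proof -
  have "Ck n U k f" if "P f" for k f
    using that
  proof (induction k arbitrary: f)
    case 0
    then show ?case using step by auto
  next
    case (Suc k)
    then show ?case using step[OF Suc.prems] unfolding Ck_Suc by blast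
  qed
  then show ?thesis using assms(1) by (auto simp: smooth_fn_def)
qed

text \<open>The partial derivatives found on the small sets have to be merged into one function on
  \<open>U\<close>; uniqueness of derivatives makes them match.\<close>

lemma Ck_local:
  assumes U: "openin (Euclidean_space n) U"
  shows "(\<And>x. x \<in> U \<Longrightarrow> \<exists>W. openin (Euclidean_space n) W \<and> x \<in> W \<and> Ck n W k f) \<Longrightarrow> Ck n U k f"
proof (induction k arbitrary: f)
  have cont: "continuous_map (subtopology (Euclidean_space n) U) euclideanreal f"
    if "\<And>x. x \<in> U \<Longrightarrow> \<exists>W. openin (Euclidean_space n) W \<and> x \<in> W \<and> continuous_map (subtopology (Euclidean_space n) W) euclideanreal f" for f
  proof -
    have sub: "topspace (subtopology (Euclidean_space n) U) = U" using openin_subset[OF U] by auto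
    define I where "I = {W. openin (Euclidean_space n) W \<and> continuous_map (subtopology (Euclidean_space n) W) euclideanreal f}"
    show ?thesis
    proof (rule pasting_lemma[of I "subtopology (Euclidean_space n) U" "\<lambda>W. W \<inter> U" _ "\<lambda>_. f"])
      fix W assume W: "W \<in> I"
      show "openin (subtopology (Euclidean_space n) U) (W \<inter> U)"
        using W openin_subtopology unfolding I_def by blast
      show "continuous_map (subtopology (subtopology (Euclidean_space n) U) (W \<inter> U)) euclideanreal f"
        unfolding subtopology_subtopology
        by (rule continuous_map_from_subtopology_mono[of _ W]) (use W in \<open>auto simp: I_def\<close>)
    next
      fix x assume "x \<in> topspace (subtopology (Euclidean_space n) U)"
      then have "x \<in> U" using sub by simp
      then show "\<exists>W. W \<in> I \<and> x \<in> W \<inter> U \<and> f x = f x" using that[of x] unfolding I_def by blast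
    qed auto
  qed
  {
    case 0
    then show ?case using cont[of f] by simp
  next
    case (Suc k)
    have c: "continuous_map (subtopology (Euclidean_space n) U) euclideanreal f"
    proof (rule cont)
      fix x assume "x \<in> U"
      then obtain W where "openin (Euclidean_space n) W" "x \<in> W" "Ck n W (Suc k) f" using Suc.prems by blast
      then show "\<exists>W. openin (Euclidean_space n) W \<and> x \<in> W \<and> continuous_map (subtopology (Euclidean_space n) W) euclideanreal f"
        unfolding Ck_Suc by blast
    qed
    have "\<exists>g. partial_deriv U i f g \<and> Ck n U k g" if i: "i < n" for i
    proof -
      \<comment> \<open>A definition that refers to \<open>f\<close> alone, so that it agrees with
        the derivative found on each small set \<open>W\<close>.\<close>
      define g where "g x = (THE D. ((\<lambda>t. f (x(i := t))) has_real_derivative D) (at (x i)))" for x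
      have *: "\<exists>W. openin (Euclidean_space n) W \<and> x \<in> W \<and> partial_deriv W i f g \<and> Ck n W k g" if x: "x \<in> U" for x
      proof -
        obtain W where W: "openin (Euclidean_space n) W" "x \<in> W" "Ck n W (Suc k) f" using Suc.prems[OF x] by blast
        obtain h where h: "partial_deriv W i f h" "Ck n W k h" using W(3)[unfolded Ck_Suc] i by blast
        have eq: "h y = g y" if "y \<in> W" for y
        proof -
          have d: "((\<lambda>t. f (y(i := t))) has_real_derivative h y) (at (y i))" using h(1) that by (simp add: partial_deriv_def)
          show ?thesis unfolding g_def
            by (rule the_equality[symmetric]) (rule d, rule DERIV_unique[OF _ d], assumption)
        qed
        have "partial_deriv W i f g"
          by (rule partial_deriv_cong[OF W(1) i refl eq h(1)])
        then show ?thesis using W(1,2) Ck_cong[OF W(1) eq h(2)] by blast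
      qed
      have "partial_deriv U i f g" unfolding partial_deriv_def
      proof
        fix x assume "x \<in> U"
        then obtain W where "x \<in> W" "partial_deriv W i f g" using * by blast
        then show "((\<lambda>t. f (x(i := t))) has_real_derivative g x) (at (x i))" by (simp add: partial_deriv_def)
      qed
      moreover have "Ck n U k g"
      proof (rule Suc.IH)
        fix x assume "x \<in> U"
        from *[OF this] show "\<exists>W. openin (Euclidean_space n) W \<and> x \<in> W \<and> Ck n W k g" by blast
      qed
      ultimately show ?thesis by blast
    qed
    then show ?case using c unfolding Ck_Suc by blast
  }
qed

lemma smooth_fn_local:
  assumes "openin (Euclidean_space n) U" "\<And>x. x \<in> U \<Longrightarrow> \<exists>W. openin (Euclidean_space n) W \<and> x \<in> W \<and> smooth_fn n W f"
  shows "smooth_fn n U f"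
  unfolding smooth_fn_def
proof (intro allI Ck_local[OF assms(1)])
  fix k x assume "x \<in> U"
  from assms(2)[OF this] show "\<exists>W. openin (Euclidean_space n) W \<and> x \<in> W \<and> Ck n W k f"
    unfolding smooth_fn_def by blast
qed

lemma smooth_eucl_local:
  assumes "openin (Euclidean_space n) U" "\<And>x. x \<in> U \<Longrightarrow> \<exists>W. openin (Euclidean_space n) W \<and> x \<in> W \<and> smooth_eucl n W m f"
  shows "smooth_eucl n U m f"
  unfolding smooth_eucl_iff
proof (intro conjI allI impI)
  show "f ` U \<subseteq> topspace (Euclidean_space m)" using assms(2) by (force simp: smooth_eucl_iff)
  show "smooth_fn n U (\<lambda>x. f x j)" if "j < m" for j
  proof (rule smooth_fn_local[OF assms(1)])
    fix x assume "x \<in> U"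
    then obtain W where "openin (Euclidean_space n) W" "x \<in> W" "smooth_eucl n W m f" using assms(2) by blast
    then show "\<exists>W. openin (Euclidean_space n) W \<and> x \<in> W \<and> smooth_fn n W (\<lambda>x. f x j)"
      using that by (auto simp: smooth_eucl_iff)
  qed
qed

section \<open>Increments and the chain rule\<close>

lemma mean_value_segment:
  fixes f f' :: "real \<Rightarrow> real"
  assumes "\<And>z. z \<in> closed_segment a b \<Longrightarrow> (f has_real_derivative f' z) (at z)"
  shows "\<exists>z\<in>closed_segment a b. f b - f a = f' z * (b - a)"
proof (cases a b rule: linorder_cases)
  case less
  then show ?thesis using MVT2[of a b f f'] assms by (force simp: closed_segment_eq_real_ivl mult.commute)
next
  case equal
  then show ?thesis by auto
next
  case greater
  then obtain z where "b < z" "z < a" "f a - f b = (a - b) * f' z"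
    using MVT2[of b a f f'] assms by (force simp: closed_segment_eq_real_ivl)
  moreover have "f b - f a = f' z * (b - a)" using calculation(3) by (simp add: algebra_simps)
  ultimately show ?thesis using greater by (intro bexI[of _ z]) (auto simp: closed_segment_eq_real_ivl)
qed

text \<open>The point is moved from \<open>x\<close> to \<open>y\<close> one coordinate at a time,
  with the mean value theorem on each leg. All intermediate points stay in the box because each of
  their coordinates lies between those of \<open>x\<close> and \<open>y\<close>.\<close>

lemma increment_partials:
  assumes r: "\<And>y. y \<in> topspace (Euclidean_space n) \<Longrightarrow> (\<And>i. i < n \<Longrightarrow> \<bar>y i - x i\<bar> < r) \<Longrightarrow> y \<in> U"
    and x: "x \<in> topspace (Euclidean_space n)"
    and g: "\<And>i. i < n \<Longrightarrow> partial_deriv U i f (g i)"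
    and y: "y \<in> topspace (Euclidean_space n)" "\<And>i. i < n \<Longrightarrow> \<bar>y i - x i\<bar> < r"
  shows "\<exists>\<xi>. (\<forall>j<n. \<xi> j \<in> topspace (Euclidean_space n) \<and> (\<forall>i<n. \<bar>\<xi> j i - x i\<bar> \<le> \<bar>y i - x i\<bar>)) \<and>
    f y - f x = (\<Sum>j<n. g j (\<xi> j) * (y j - x j))"
proof -
  \<comment> \<open>The induction is on the number \<open>m\<close> of leading coordinates in which
    \<open>y\<close> may differ from \<open>x\<close>; the point \<open>y'\<close> below undoes the
    last of these changes.\<close>
  have "\<exists>\<xi>. (\<forall>j<m. \<xi> j \<in> topspace (Euclidean_space n) \<and> (\<forall>i<n. \<bar>\<xi> j i - x i\<bar> \<le> \<bar>y i - x i\<bar>)) \<and>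
    f y - f x = (\<Sum>j<m. g j (\<xi> j) * (y j - x j))"
    if "m \<le> n" "y \<in> topspace (Euclidean_space n)" "\<And>i. i < n \<Longrightarrow> \<bar>y i - x i\<bar> < r" "\<And>i. i \<ge> m \<Longrightarrow> y i = x i" for m y
    using that
  proof (induction m arbitrary: y)
    case 0
    then have "y = x" by auto
    then show ?case by simp
  next
    case (Suc m)
    have m: "m < n" using Suc.prems by simp
    define y' where "y' = y(m := x m)"
    have y'top: "y' \<in> topspace (Euclidean_space n)" unfolding y'_def by (rule upd_in_Euclidean_space[OF Suc.prems(2) m])
    have le: "\<bar>y' i - x i\<bar> \<le> \<bar>y i - x i\<bar>" for i by (simp add: y'_def)
    have "\<exists>\<xi>. (\<forall>j<m. \<xi> j \<in> topspace (Euclidean_space n) \<and> (\<forall>i<n. \<bar>\<xi> j i - x i\<bar> \<le> \<bar>y' i - x i\<bar>)) \<and>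
      f y' - f x = (\<Sum>j<m. g j (\<xi> j) * (y' j - x j))"
    proof (rule Suc.IH)
      show "\<bar>y' i - x i\<bar> < r" if "i < n" for i using Suc.prems(3)[OF that] le[of i] by linarith
      show "y' i = x i" if "m \<le> i" for i using Suc.prems(4)[of i] that by (cases "i = m") (auto simp: y'_def)
    qed (use m y'top in auto)
    then obtain \<xi> where \<xi>: "\<And>j. j < m \<Longrightarrow> \<xi> j \<in> topspace (Euclidean_space n)" "\<And>j i. j < m \<Longrightarrow> i < n \<Longrightarrow> \<bar>\<xi> j i - x i\<bar> \<le> \<bar>y' i - x i\<bar>"
      "f y' - f x = (\<Sum>j<m. g j (\<xi> j) * (y' j - x j))" by blast
    have inU: "y(m := z) \<in> U" if z: "z \<in> closed_segment (x m) (y m)" for z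
    proof (rule r[OF upd_in_Euclidean_space[OF Suc.prems(2) m]])
      fix i assume "i < n"
      then show "\<bar>(y(m := z)) i - x i\<bar> < r"
        using z Suc.prems(3)[OF \<open>i < n\<close>] Suc.prems(3)[OF m] by (auto simp: closed_segment_eq_real_ivl split: if_splits)
    qed
    have "\<exists>z\<in>closed_segment (x m) (y m). f (y(m := y m)) - f (y(m := x m)) = g m (y(m := z)) * (y m - x m)"
    proof (rule mean_value_segment[where f = "\<lambda>t. f (y(m := t))" and f' = "\<lambda>z. g m (y(m := z))"])
      fix z assume "z \<in> closed_segment (x m) (y m)"
      then show "((\<lambda>t. f (y(m := t))) has_real_derivative g m (y(m := z))) (at z)"
        using g[OF m, unfolded partial_deriv_def, rule_format, OF inU[of z]] by simp
    qed
    then obtain z where z: "z \<in> closed_segment (x m) (y m)" "f y - f y' = g m (y(m := z)) * (y m - x m)"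
      by (auto simp: y'_def)
    define \<xi>' where "\<xi>' = \<xi>(m := y(m := z))"
    have 1: "\<xi>' j \<in> topspace (Euclidean_space n)" if "j < Suc m" for j
      using that \<xi>(1) upd_in_Euclidean_space[OF Suc.prems(2) m] by (auto simp: \<xi>'_def less_Suc_eq)
    have 2: "\<bar>\<xi>' j i - x i\<bar> \<le> \<bar>y i - x i\<bar>" if "j < Suc m" "i < n" for j i
      using that \<xi>(2)[of j i] le[of i] z(1) by (auto simp: \<xi>'_def less_Suc_eq closed_segment_eq_real_ivl split: if_splits)
    have "(\<Sum>j<m. g j (\<xi>' j) * (y j - x j)) = (\<Sum>j<m. g j (\<xi> j) * (y' j - x j))"
      by (rule sum.cong) (auto simp: \<xi>'_def y'_def)
    then have "f y - f x = (\<Sum>j<Suc m. g j (\<xi>' j) * (y j - x j))"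
      using \<xi>(3) z(2) by (simp add: \<xi>'_def)
    then show ?case using 1 2 by blast
  qed
  from this[of n y] show ?thesis using y x by (simp add: topspace_Euclidean_space)
qed

text \<open>The increment formula is divided by \<open>r - t\<close>; the intermediate points tend
  to \<open>c t\<close>, where the partials are continuous. The derivative is taken within
  \<open>S\<close>, so that one-sided derivatives at the ends of the unit interval are
  covered.\<close>

lemma chain_rule_partials:
  assumes U: "openin (Euclidean_space n) U"
    and g: "\<And>i. i < n \<Longrightarrow> partial_deriv U i f (g i)"
    and gc: "\<And>i. i < n \<Longrightarrow> continuous_map (subtopology (Euclidean_space n) U) euclideanreal (g i)"
    and ct: "c t \<in> U" and ctop: "eventually (\<lambda>r. c r \<in> topspace (Euclidean_space n)) (at t within S)"
    and c': "\<And>j. j < n \<Longrightarrow> ((\<lambda>r. c r j) has_real_derivative c' j) (at t within S)"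
  shows "((\<lambda>r. f (c r)) has_real_derivative (\<Sum>j<n. g j (c t) * c' j)) (at t within S)"
proof -
  have cttop: "c t \<in> topspace (Euclidean_space n)" using U ct openin_subset by blast
  have lim: "((\<lambda>r. c r j) \<longlongrightarrow> c t j) (at t within S)" if "j < n" for j
    using has_field_derivative_imp_has_derivative[OF c'[OF that]] has_derivative_continuous continuous_within by blast
  have close: "eventually (\<lambda>r. \<forall>i\<in>{..<n}. \<bar>c r i - c t i\<bar> < e) (at t within S)" if "e > 0" for e
    by (rule eventually_ball_finite) (use lim that in \<open>auto simp: tendsto_iff dist_real_def\<close>)
  obtain \<rho> where \<rho>: "\<rho> > 0" "\<And>y. y \<in> topspace (Euclidean_space n) \<Longrightarrow> (\<And>i. i < n \<Longrightarrow> \<bar>y i - c t i\<bar> < \<rho>) \<Longrightarrow> y \<in> U"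
    using openin_Euclidean_box[OF U ct] by blast
  define Q where "Q y \<xi> \<longleftrightarrow> (\<forall>j<n. \<xi> j \<in> topspace (Euclidean_space n) \<and> (\<forall>i<n. \<bar>\<xi> j i - c t i\<bar> \<le> \<bar>y i - c t i\<bar>)) \<and>
    f y - f (c t) = (\<Sum>j<n. g j (\<xi> j) * (y j - c t j))" for y \<xi>
  \<comment> \<open>Intermediate points exist only for \<open>r\<close> close to \<open>t\<close>;
    the arbitrary values elsewhere do not affect the limit.\<close>
  define \<xi> where "\<xi> r = (SOME \<xi>. Q (c r) \<xi>)" for r
  have ev: "eventually (\<lambda>r. Q (c r) (\<xi> r)) (at t within S)"
    using ctop close[OF \<rho>(1)]
  proof eventually_elim
    case (elim r)
    have "\<exists>\<xi>. Q (c r) \<xi>" unfolding Q_def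
      by (rule increment_partials[OF \<rho>(2) cttop g]) (use elim in auto)
    then show ?case unfolding \<xi>_def by (rule someI_ex)
  qed
  have limg: "((\<lambda>r. g j (\<xi> r j)) \<longlongrightarrow> g j (c t)) (at t within S)" if j: "j < n" for j
    unfolding tendsto_iff
  proof (intro allI impI)
    fix e :: real assume "e > 0"
    obtain d where d: "d > 0" "\<And>y. y \<in> topspace (Euclidean_space n) \<Longrightarrow> (\<And>i. i < n \<Longrightarrow> \<bar>y i - c t i\<bar> < d) \<Longrightarrow> y \<in> U \<and> \<bar>g j y - g j (c t)\<bar> < e"
      using continuous_map_Euclidean_eps[OF gc[OF j] U ct \<open>e > 0\<close>] by blast
    show "eventually (\<lambda>r. dist (g j (\<xi> r j)) (g j (c t)) < e) (at t within S)"
      using ev close[OF d(1)]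
    proof eventually_elim
      case (elim r)
      have 1: "\<xi> r j \<in> topspace (Euclidean_space n)" "\<And>i. i < n \<Longrightarrow> \<bar>\<xi> r j i - c t i\<bar> \<le> \<bar>c r i - c t i\<bar>"
        using elim(1) j by (auto simp: Q_def)
      have "\<bar>\<xi> r j i - c t i\<bar> < d" if "i < n" for i
        using 1(2)[OF that] elim(2) that by (meson lessThan_iff order_le_less_trans)
      then have "\<bar>g j (\<xi> r j) - g j (c t)\<bar> < e"
        using d(2)[OF 1(1)] by blast
      then show ?case by (simp add: dist_real_def)
    qed
  qed
  have "((\<lambda>r. \<Sum>j<n. g j (\<xi> r j) * ((c r j - c t j) / (r - t))) \<longlongrightarrow> (\<Sum>j<n. g j (c t) * c' j)) (at t within S)"
    by (intro tendsto_sum tendsto_mult limg) (use c' in \<open>auto simp: has_field_derivative_iff\<close>)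
  moreover have ev2: "eventually (\<lambda>r. (\<Sum>j<n. g j (\<xi> r j) * ((c r j - c t j) / (r - t))) = (f (c r) - f (c t)) / (r - t)) (at t within S)"
    using ev by eventually_elim (auto simp: Q_def sum_divide_distrib)
  ultimately show ?thesis
    unfolding has_field_derivative_iff tendsto_cong[OF ev2] by simp
qed

text \<open>The derivative of a composite is a sum of products of composites and smooth functions,
  so composites alone are not closed under differentiation. This class is, and so it is fit for
  \<open>smooth_fn_coinduct\<close>.\<close>

inductive smooth_closure :: "nat \<Rightarrow> (nat \<Rightarrow> real) set \<Rightarrow> ((nat \<Rightarrow> real) \<Rightarrow> real) \<Rightarrow> bool" for n U where
  base: "smooth_fn n U f \<Longrightarrow> smooth_closure n U f"
| add: "smooth_closure n U f \<Longrightarrow> smooth_closure n U g \<Longrightarrow> smooth_closure n U (\<lambda>x. f x + g x)"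
| mult: "smooth_closure n U f \<Longrightarrow> smooth_closure n U g \<Longrightarrow> smooth_closure n U (\<lambda>x. f x * g x)"
| comp: "openin (Euclidean_space m) V \<Longrightarrow> smooth_fn m V g \<Longrightarrow> smooth_eucl n U m h \<Longrightarrow> h ` U \<subseteq> V
     \<Longrightarrow> smooth_closure n U (\<lambda>x. g (h x))"

lemma smooth_fn_const: "smooth_fn n U (\<lambda>x. c)"
proof (rule smooth_fn_coinduct[where P = "\<lambda>f. \<exists>c. f = (\<lambda>x. c)"])
  fix f :: "(nat \<Rightarrow> real) \<Rightarrow> real" assume "\<exists>c. f = (\<lambda>x. c)"
  then show "continuous_map (subtopology (Euclidean_space n) U) euclideanreal f \<and>
      (\<forall>i<n. \<exists>g. partial_deriv U i f g \<and> (\<exists>c. g = (\<lambda>x. c)))"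
    by (auto simp: partial_deriv_def intro!: exI[of _ "\<lambda>x. 0"])
qed auto

lemma smooth_closure_sum:
  "finite I \<Longrightarrow> (\<And>i. i \<in> I \<Longrightarrow> smooth_closure n U (f i)) \<Longrightarrow> smooth_closure n U (\<lambda>x. \<Sum>i\<in>I. f i x)"
proof (induction I rule: finite_induct)
  case empty
  then show ?case using base[OF smooth_fn_const] by simp
next
  case (insert i I)
  then show ?case using add by simp
qed

text \<open>Each generating operation differentiates into the class: sums and products by the usual
  rules, a composite by the chain rule, in which the inner map stays the same and the outer function
  is replaced by its partials.\<close>

lemma smooth_fn_closure:
  assumes U: "openin (Euclidean_space n) U" and "smooth_closure n U f"
  shows "smooth_fn n U f"
proof (rule smooth_fn_coinduct[where P = "smooth_closure n U", OF assms(2)])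
  fix f assume "smooth_closure n U f"
  then show "continuous_map (subtopology (Euclidean_space n) U) euclideanreal f \<and>
      (\<forall>i<n. \<exists>g. partial_deriv U i f g \<and> smooth_closure n U g)"
  proof induction
    case (base f)
    have "\<exists>g. partial_deriv U i f g \<and> smooth_closure n U g" if "i < n" for i
      using smooth_fn_partial[OF U base that] smooth_closure.base by blast
    then show ?case using smooth_fn_continuous[OF base] by blast
  next
    case (add f g)
    have "\<exists>h. partial_deriv U i (\<lambda>x. f x + g x) h \<and> smooth_closure n U h" if i: "i < n" for i
    proof -
      obtain f' g' where "partial_deriv U i f f'" "smooth_closure n U f'" "partial_deriv U i g g'" "smooth_closure n U g'"
        using add i by blast
      then show ?thesis
        by (intro exI[of _ "\<lambda>x. f' x + g' x"] conjI smooth_closure.add)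
          (auto simp: partial_deriv_def intro!: derivative_intros)
    qed
    then show ?case using add by (auto intro: continuous_map_add)
  next
    case (mult f g)
    have "\<exists>h. partial_deriv U i (\<lambda>x. f x * g x) h \<and> smooth_closure n U h" if i: "i < n" for i
    proof -
      obtain f' g' where "partial_deriv U i f f'" "smooth_closure n U f'" "partial_deriv U i g g'" "smooth_closure n U g'"
        using mult i by blast
      then show ?thesis
        by (intro exI[of _ "\<lambda>x. f' x * g x + g' x * f x"] conjI smooth_closure.add smooth_closure.mult mult)
          (auto simp: partial_deriv_def intro!: derivative_eq_intros)
    qed
    then show ?case using mult by (auto intro: continuous_map_real_mult)
  next
    case (comp m V g h)
    have sub: "topspace (subtopology (Euclidean_space n) U) = U" using openin_subset[OF U] by auto
    have Vtop: "V \<subseteq> topspace (Euclidean_space m)" using comp openin_subset by blast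
    have "continuous_map (subtopology (Euclidean_space n) U) (subtopology (Euclidean_space m) V) h"
      using smooth_eucl_continuous[OF comp(3)] comp(4) sub by (simp add: continuous_map_in_subtopology image_subset_iff_funcset)
    then have cont: "continuous_map (subtopology (Euclidean_space n) U) euclideanreal (\<lambda>x. g (h x))"
      using continuous_map_compose[OF _ smooth_fn_continuous[OF comp(2)]] by (auto simp: o_def)
    have "\<exists>d. partial_deriv U i (\<lambda>x. g (h x)) d \<and> smooth_closure n U d" if i: "i < n" for i
    proof -
      have "\<exists>d. partial_deriv V j g d \<and> smooth_fn m V d" if "j < m" for j
        using smooth_fn_partial[OF comp(1,2) that] by blast
      then obtain G where G: "\<And>j. j < m \<Longrightarrow> partial_deriv V j g (G j)" "\<And>j. j < m \<Longrightarrow> smooth_fn m V (G j)" by metis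
      have "\<exists>d. partial_deriv U i (\<lambda>x. h x j) d \<and> smooth_fn n U d" if "j < m" for j
        using smooth_fn_partial[OF U _ i] comp(3) that by (metis smooth_eucl_iff)
      then obtain H where H: "\<And>j. j < m \<Longrightarrow> partial_deriv U i (\<lambda>x. h x j) (H j)" "\<And>j. j < m \<Longrightarrow> smooth_fn n U (H j)" by metis
      have "partial_deriv U i (\<lambda>x. g (h x)) (\<lambda>x. \<Sum>j<m. G j (h x) * H j x)"
        unfolding partial_deriv_def
      proof
        fix x assume x: "x \<in> U"
        have "((\<lambda>r. g (h (x(i := r)))) has_real_derivative (\<Sum>j<m. G j (h (x(i := x i))) * H j x)) (at (x i))"
        proof (rule chain_rule_partials[OF comp(1) G(1), where c = "\<lambda>r. h (x(i := r))"])
          show "h (x(i := x i)) \<in> V" using comp(4) x by auto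
          show "eventually (\<lambda>r. h (x(i := r)) \<in> topspace (Euclidean_space m)) (at (x i))"
            unfolding eventually_at_filter
            by (rule eventually_mono[OF eventually_upd_in_open[OF U x i]]) (use comp(4) Vtop in blast)
          show "((\<lambda>r. h (x(i := r)) j) has_real_derivative H j x) (at (x i))" if "j < m" for j
            using H(1)[OF that] x by (auto simp: partial_deriv_def)
          show "continuous_map (subtopology (Euclidean_space m) V) euclideanreal (G j)" if "j < m" for j
            using G(2)[OF that] smooth_fn_continuous by blast
        qed
        then show "((\<lambda>r. g (h (x(i := r)))) has_real_derivative (\<Sum>j<m. G j (h x) * H j x)) (at (x i))" by simp
      qed
      moreover have "smooth_closure n U (\<lambda>x. \<Sum>j<m. G j (h x) * H j x)"
        by (rule smooth_closure_sum)
          (auto intro!: smooth_closure.mult[OF smooth_closure.comp[OF comp(1) G(2) comp(3,4)] smooth_closure.base] H)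
      ultimately show ?thesis by blast
    qed
    then show ?case using cont by blast
  qed
qed

lemma smooth_fn_add: "openin (Euclidean_space n) U \<Longrightarrow> smooth_fn n U f \<Longrightarrow> smooth_fn n U g \<Longrightarrow> smooth_fn n U (\<lambda>x. f x + g x)"
  by (rule smooth_fn_closure[OF _ smooth_closure.add[OF smooth_closure.base smooth_closure.base]])
lemma smooth_fn_mult: "openin (Euclidean_space n) U \<Longrightarrow> smooth_fn n U f \<Longrightarrow> smooth_fn n U g \<Longrightarrow> smooth_fn n U (\<lambda>x. f x * g x)"
  by (rule smooth_fn_closure[OF _ smooth_closure.mult[OF smooth_closure.base smooth_closure.base]])
lemma smooth_fn_diff: "openin (Euclidean_space n) U \<Longrightarrow> smooth_fn n U f \<Longrightarrow> smooth_fn n U g \<Longrightarrow> smooth_fn n U (\<lambda>x. f x - g x)"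
  using smooth_fn_add[of n U f "\<lambda>x. (-1) * g x"] smooth_fn_mult[of n U "\<lambda>_. -1" g] smooth_fn_const[of n U "-1"] by simp
lemma smooth_fn_compose: "openin (Euclidean_space n) U \<Longrightarrow> openin (Euclidean_space m) V \<Longrightarrow> smooth_fn m V g \<Longrightarrow> smooth_eucl n U m h \<Longrightarrow> h ` U \<subseteq> V
     \<Longrightarrow> smooth_fn n U (\<lambda>x. g (h x))"
  by (rule smooth_fn_closure[OF _ smooth_closure.comp])

text \<open>The coordinate together with the constants forms a class closed under partial
  derivatives.\<close>

lemma smooth_fn_coordinate: "smooth_fn n U (\<lambda>x. x i)"
proof (rule smooth_fn_coinduct[where P = "\<lambda>f. f = (\<lambda>x. x i) \<or> smooth_fn n U f \<and> (\<exists>c. f = (\<lambda>x. c))"])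
  fix f assume "f = (\<lambda>x. x i) \<or> smooth_fn n U f \<and> (\<exists>c. f = (\<lambda>x. c))"
  then consider "f = (\<lambda>x. x i)" | c where "f = (\<lambda>x. c)" by blast
  then show "continuous_map (subtopology (Euclidean_space n) U) euclideanreal f \<and>
      (\<forall>j<n. \<exists>g. partial_deriv U j f g \<and> (g = (\<lambda>x. x i) \<or> smooth_fn n U g \<and> (\<exists>c. g = (\<lambda>x. c))))"
  proof cases
    case 1
    have "partial_deriv U j f (\<lambda>x. if j = i then 1 else 0)" for j
      unfolding partial_deriv_def 1 by (cases "j = i") auto
    moreover have "continuous_map (subtopology (Euclidean_space n) U) euclideanreal f"
      unfolding 1 by (intro continuous_map_from_subtopology continuous_map_Euclidean_coordinate)
    ultimately show ?thesis using smooth_fn_const by blast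
  next
    case (2 c)
    have "partial_deriv U j f (\<lambda>x. 0)" for j
      unfolding partial_deriv_def 2 by auto
    moreover have "continuous_map (subtopology (Euclidean_space n) U) euclideanreal f"
      unfolding 2 by auto
    ultimately show ?thesis using smooth_fn_const by blast
  qed
qed auto

lemma smooth_eucl_compose:
  assumes "openin (Euclidean_space n) U" "openin (Euclidean_space m) V" "smooth_eucl m V k g" "smooth_eucl n U m h" "h ` U \<subseteq> V"
  shows "smooth_eucl n U k (\<lambda>x. g (h x))"
  unfolding smooth_eucl_iff
proof (intro conjI allI impI)
  show "(\<lambda>x. g (h x)) ` U \<subseteq> topspace (Euclidean_space k)" using assms(3,5) by (auto simp: smooth_eucl_iff)
  show "smooth_fn n U (\<lambda>x. g (h x) j)" if "j < k" for j
    using smooth_fn_compose[OF assms(1,2) _ assms(4,5), of "\<lambda>y. g y j"] assms(3) that by (simp add: smooth_eucl_iff)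
qed

lemma smooth_eucl_id: "U \<subseteq> topspace (Euclidean_space n) \<Longrightarrow> smooth_eucl n U n (\<lambda>x. x)"
  by (auto simp: smooth_eucl_iff smooth_fn_coordinate)

lemma smooth_eucl_coords:
  assumes "\<And>j. j < m \<Longrightarrow> smooth_fn n U (f j)"
  shows "smooth_eucl n U m (\<lambda>x i. if i < m then f i x else 0)"
  using assms by (auto simp: smooth_eucl_iff topspace_Euclidean_space)

subsection \<open>A smooth step function\<close>

lemma poly_exp_tendsto_0: "((\<lambda>x::real. poly p x * exp (- x)) \<longlongrightarrow> 0) at_top"
proof -
  have "((\<lambda>x. \<Sum>i\<le>degree p. coeff p i * (x ^ i / exp x)) \<longlongrightarrow> (\<Sum>i\<le>degree p. coeff p i * 0)) at_top"
    by (intro tendsto_sum tendsto_mult tendsto_const tendsto_power_div_exp_0)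
  moreover have "(\<lambda>x. \<Sum>i\<le>degree p. coeff p i * (x ^ i / exp x)) = (\<lambda>x. poly p x * exp (- x))"
    by (auto simp: poly_altdef sum_distrib_right exp_minus divide_inverse mult.assoc)
  ultimately show ?thesis by simp
qed

text \<open>The polynomial parameter turns the classical flat function exp(-1/x) into a family that
  is closed under differentiation.\<close>

definition flat_exp :: "real poly \<Rightarrow> real \<Rightarrow> real" where
  "flat_exp p x = (if x \<le> 0 then 0 else poly p (1 / x) * exp (- (1 / x)))"

text \<open>With y = 1/x one has dy/dx = -y^2, so p(y) exp(-y) differentiates to y^2 (p(y) - p'(y))
  exp(-y). At 0 the difference quotient is again a polynomial in 1/h times exp(-1/h) and tends to
  0.\<close>

lemma flat_exp_deriv:
  "(flat_exp p has_real_derivative flat_exp ([:0, 0, 1:] * (p - pderiv p)) x) (at x)"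
proof (cases x "0 :: real" rule: linorder_cases)
  case less
  have "((\<lambda>x. 0) has_real_derivative 0) (at x)" by simp
  then have "(flat_exp p has_real_derivative 0) (at x)"
    by (rule has_field_derivative_transform_within_open[of _ _ _ "{..<0}"]) (use less in \<open>auto simp: flat_exp_def\<close>)
  then show ?thesis using less by (simp add: flat_exp_def)
next
  case greater
  have "((\<lambda>x. poly p (1 / x) * exp (- (1 / x))) has_real_derivative
      poly ([:0, 0, 1:] * (p - pderiv p)) (1 / x) * exp (- (1 / x))) (at x)"
    using greater
    by (auto intro!: derivative_eq_intros DERIV_chain2[where f = "poly p" and g = "\<lambda>x. 1 / x"] poly_DERIV simp: field_simps power2_eq_square)
  then have "(flat_exp p has_real_derivative poly ([:0, 0, 1:] * (p - pderiv p)) (1 / x) * exp (- (1 / x))) (at x)"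
    by (rule has_field_derivative_transform_within_open[of _ _ _ "{0<..}"]) (use greater in \<open>auto simp: flat_exp_def\<close>)
  then show ?thesis using greater by (simp add: flat_exp_def)
next
  case equal
  have 1: "((\<lambda>h. flat_exp p h / h) \<longlongrightarrow> 0) (at_left 0)"
    by (rule tendsto_eventually) (auto simp: flat_exp_def eventually_at_filter)
  \<comment> \<open>Dividing by \<open>h\<close> multiplies the polynomial in 1/h by its variable,
    which is what \<open>pCons 0\<close> does.\<close>
  have "((\<lambda>y. poly (pCons 0 p) y * exp (- y)) \<longlongrightarrow> 0) at_top" by (rule poly_exp_tendsto_0)
  then have "((\<lambda>h. poly (pCons 0 p) (inverse h) * exp (- inverse h)) \<longlongrightarrow> 0) (at_right 0)"
    by (rule filterlim_compose[OF _ filterlim_inverse_at_top_right])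
  then have 2: "((\<lambda>h. flat_exp p h / h) \<longlongrightarrow> 0) (at_right 0)"
    by (rule Lim_transform_eventually) (auto simp: flat_exp_def eventually_at_filter field_simps)
  have "((\<lambda>h. flat_exp p h / h) \<longlongrightarrow> 0) (at 0)"
    using 1 2 by (simp add: filterlim_at_split)
  then show ?thesis using equal by (simp add: has_field_derivative_iff flat_exp_def)
qed

text \<open>Smooth functions of one variable are functions on \<open>\<real>\<^sup>1\<close>, that is, of the coordinate \<open>x 0\<close>.\<close>

lemma smooth_fn_compose1:
  assumes U: "openin (Euclidean_space n) U" and V: "openin (Euclidean_space 1) V"
    and f: "smooth_fn 1 V (\<lambda>x. f (x 0))"
    and h: "smooth_fn n U h" and hV: "\<And>x. x \<in> U \<Longrightarrow> (\<lambda>i. if i < 1 then h x else 0) \<in> V"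
  shows "smooth_fn n U (\<lambda>x. f (h x))"
proof -
  have "smooth_fn n U (\<lambda>x. (\<lambda>x. f (x 0)) (\<lambda>i::nat. if i < 1 then h x else 0))"
    by (rule smooth_fn_compose[OF U V f smooth_eucl_coords]) (use h hV in auto)
  then show ?thesis by simp
qed

lemma smooth_fn_flat_exp: "smooth_fn 1 U (\<lambda>x. flat_exp p (x 0))"
proof (rule smooth_fn_coinduct[where P = "\<lambda>f. \<exists>p. f = (\<lambda>x. flat_exp p (x 0))"])
  fix f :: "(nat \<Rightarrow> real) \<Rightarrow> real" assume "\<exists>p. f = (\<lambda>x. flat_exp p (x 0))"
  then obtain p where f: "f = (\<lambda>x. flat_exp p (x 0))" by blast
  have "continuous_on UNIV (flat_exp p)"
    using flat_exp_deriv DERIV_isCont continuous_at_imp_continuous_on by blast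
  then have "continuous_map euclideanreal euclideanreal (flat_exp p)" by simp
  then have "continuous_map (subtopology (Euclidean_space 1) U) euclideanreal (flat_exp p \<circ> (\<lambda>x. x 0))"
    by (rule continuous_map_compose[OF continuous_map_from_subtopology[OF continuous_map_Euclidean_coordinate]])
  moreover have "\<exists>g. partial_deriv U i f g \<and> (\<exists>p. g = (\<lambda>x. flat_exp p (x 0)))" if "i < 1" for i
    using that flat_exp_deriv[of p] by (intro exI[of _ "\<lambda>x. flat_exp ([:0, 0, 1:] * (p - pderiv p)) (x 0)"])
      (auto simp: partial_deriv_def f)
  ultimately show "continuous_map (subtopology (Euclidean_space 1) U) euclideanreal f \<and>
      (\<forall>i<1. \<exists>g. partial_deriv U i f g \<and> (\<exists>p. g = (\<lambda>x. flat_exp p (x 0))))"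
    by (simp add: f o_def)
qed auto

text \<open>Multiples of powers of the inverse form a class closed under differentiation.\<close>

lemma smooth_fn_inverse:
  assumes U: "U = {x \<in> topspace (Euclidean_space 1). x 0 > 0}"
  shows "smooth_fn 1 U (\<lambda>x. inverse (x 0))"
proof (rule smooth_fn_coinduct[where P = "\<lambda>f. \<exists>c k. f = (\<lambda>x. c * inverse (x 0) ^ k)"])
  show "\<exists>c k. (\<lambda>x::nat \<Rightarrow> real. inverse (x 0)) = (\<lambda>x. c * inverse (x 0) ^ k)"
    by (rule exI[of _ 1], rule exI[of _ 1]) simp
  fix f :: "(nat \<Rightarrow> real) \<Rightarrow> real" assume "\<exists>c k. f = (\<lambda>x. c * inverse (x 0) ^ k)"
  then obtain c k where f: "f = (\<lambda>x. c * inverse (x 0) ^ k)" by blast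
  have "continuous_on {0<..} (\<lambda>t::real. c * inverse t ^ k)"
    by (auto intro!: continuous_intros)
  then have "continuous_map (top_of_set {0<..}) euclideanreal (\<lambda>t::real. c * inverse t ^ k)" by simp
  moreover have "continuous_map (subtopology (Euclidean_space 1) U) (top_of_set {0<..}) (\<lambda>x. x 0)"
    by (auto simp: continuous_map_in_subtopology U intro!: continuous_map_from_subtopology[OF continuous_map_Euclidean_coordinate])
  ultimately have "continuous_map (subtopology (Euclidean_space 1) U) euclideanreal ((\<lambda>t::real. c * inverse t ^ k) \<circ> (\<lambda>x. x 0))"
    by (rule continuous_map_compose[rotated])
  moreover have "\<exists>g. partial_deriv U i f g \<and> (\<exists>c k. g = (\<lambda>x. c * inverse (x 0) ^ k))" if "i < 1" for i
  proof (rule exI[of _ "\<lambda>x. (- c * real k) * inverse (x 0) ^ (k + 1)"], rule conjI)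
    show "\<exists>c' k'. (\<lambda>x. (- c * real k) * inverse (x 0) ^ (k + 1)) = (\<lambda>x::nat \<Rightarrow> real. c' * inverse (x 0) ^ k')"
      by (rule exI[of _ "- c * real k"], rule exI[of _ "k + 1"], rule refl)
    show "partial_deriv U i f (\<lambda>x. (- c * real k) * inverse (x 0) ^ (k + 1))"
      unfolding partial_deriv_def f
    proof
      fix x assume "x \<in> U"
      then have "x 0 > 0" by (simp add: U)
      then have "((\<lambda>t. c * inverse t ^ k) has_real_derivative (- c * real k) * inverse (x 0) ^ (k + 1)) (at (x 0))"
      proof -
        have "((\<lambda>t. c * inverse t ^ k) has_real_derivative
            c * (real k * (- (inverse (x 0) ^ Suc (Suc 0)) * inverse (x 0) ^ (k - Suc 0)))) (at (x 0))"
          by (rule DERIV_cmult[OF DERIV_power[OF DERIV_inverse]]) (use \<open>x 0 > 0\<close> in auto)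
        moreover have "c * (real k * (- (inverse (x 0) ^ Suc (Suc 0)) * inverse (x 0) ^ (k - Suc 0)))
            = (- c * real k) * inverse (x 0) ^ (k + 1)"
          by (cases k) (simp_all add: algebra_simps)
        ultimately show ?thesis by (simp only:)
      qed
      then show "((\<lambda>t. c * inverse ((x(i := t)) 0) ^ k) has_real_derivative (- c * real k) * inverse (x 0) ^ (k + 1)) (at (x i))"
        using that by simp
    qed
  qed
  ultimately show "continuous_map (subtopology (Euclidean_space 1) U) euclideanreal f \<and>
      (\<forall>i<1. \<exists>g. partial_deriv U i f g \<and> (\<exists>c k. g = (\<lambda>x. c * inverse (x 0) ^ k)))"
    by (simp add: f o_def)
qed

text \<open>The usual smooth transition function, with its rise confined to the middle third. The
  constant outer thirds provide sitting instances as well as the overlaps on which maps are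
  pasted.\<close>

definition step :: "real \<Rightarrow> real" where
  "step t = flat_exp 1 (t - 1/3) * inverse (flat_exp 1 (t - 1/3) + flat_exp 1 (2/3 - t))"

lemma flat_exp_1: "flat_exp 1 t \<ge> 0" "flat_exp 1 t > 0 \<longleftrightarrow> t > 0" "flat_exp 1 t = 0 \<longleftrightarrow> t \<le> 0"
  by (auto simp: flat_exp_def)

lemma step_denominator_pos: "flat_exp 1 (t - 1/3) + flat_exp 1 (2/3 - t) > 0"
proof (cases "t > 1/3")
  case True
  then show ?thesis using flat_exp_1(2)[of "t - 1/3"] flat_exp_1(1)[of "2/3 - t"] by linarith
next
  case False
  then show ?thesis using flat_exp_1(2)[of "2/3 - t"] flat_exp_1(1)[of "t - 1/3"] by linarith
qed

lemma step_eq_0 [simp]: "t \<le> 1/3 \<Longrightarrow> step t = 0"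
  by (simp add: step_def flat_exp_def)

lemma step_eq_1 [simp]: "t \<ge> 2/3 \<Longrightarrow> step t = 1"
  using step_denominator_pos[of t] by (simp add: step_def flat_exp_def[of _ "2/3 - t"])

lemma step_nonneg: "0 \<le> step t"
  using step_denominator_pos[of t] flat_exp_1(1) by (simp add: step_def)

lemma step_le_1: "step t \<le> 1"
  using step_denominator_pos[of t] flat_exp_1(1)[of "2/3 - t"] by (simp add: step_def field_simps)

lemma smooth_fn_step:
  assumes U: "openin (Euclidean_space n) U" and h: "smooth_fn n U h"
  shows "smooth_fn n U (\<lambda>x. step (h x))"
proof -
  have top: "openin (Euclidean_space 1) (topspace (Euclidean_space 1))" by simp
  have pos: "openin (Euclidean_space 1) {x \<in> topspace (Euclidean_space 1). x 0 > 0}"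
    using openin_continuous_map_preimage[OF continuous_map_Euclidean_coordinate[of 1 0], of "{0<..}"] by simp
  have fl: "smooth_fn n U (\<lambda>x. flat_exp 1 (g x))" if "smooth_fn n U g" for g
    by (rule smooth_fn_compose1[OF U top smooth_fn_flat_exp that]) (auto simp: topspace_Euclidean_space)
  have 1: "smooth_fn n U (\<lambda>x. flat_exp 1 (h x - 1/3))" "smooth_fn n U (\<lambda>x. flat_exp 1 (2/3 - h x))"
    by (intro fl smooth_fn_diff U h smooth_fn_const)+
  have "smooth_fn n U (\<lambda>x. inverse (flat_exp 1 (h x - 1/3) + flat_exp 1 (2/3 - h x)))"
    by (rule smooth_fn_compose1[OF U pos smooth_fn_inverse[OF refl] smooth_fn_add[OF U 1]])
      (auto simp: topspace_Euclidean_space step_denominator_pos)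
  then show ?thesis unfolding step_def by (intro smooth_fn_mult U 1)
qed

section \<open>Smooth maps between manifolds\<close>

lemma continuous_map_local:
  assumes "\<And>x. x \<in> topspace X \<Longrightarrow> \<exists>W. openin X W \<and> x \<in> W \<and> continuous_map (subtopology X W) Y f"
  shows "continuous_map X Y f"
proof -
  define I where "I = {W. openin X W \<and> continuous_map (subtopology X W) Y f}"
  show ?thesis
  proof (rule pasting_lemma[of I X "\<lambda>W. W" _ "\<lambda>_. f"])
    fix x assume "x \<in> topspace X"
    from assms[OF this] show "\<exists>W. W \<in> I \<and> x \<in> W \<and> f x = f x" unfolding I_def by blast
  qed (auto simp: I_def)
qed

section \<open>Charts and atlases\<close>

lemma is_chart_topspace:
  "is_chart T (n, U, \<phi>) \<Longrightarrow> topspace (subtopology T U) = U"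
  using openin_subset[of T U] by (auto simp: is_chart_def)

lemma is_chart_homeomorphic:
  "is_chart T (n, U, \<phi>) \<Longrightarrow> homeomorphic_map (subtopology T U) (subtopology (Euclidean_space n) (\<phi> ` U)) \<phi>"
  by (simp add: is_chart_def)

lemma is_chart_open: "is_chart T (n, U, \<phi>) \<Longrightarrow> openin T U"
  by (simp add: is_chart_def)

lemma is_chart_image_open:
  assumes "is_chart T (n, U, \<phi>)" "openin T W" "W \<subseteq> U"
  shows "openin (Euclidean_space n) (\<phi> ` W)"
proof -
  have "openin (subtopology T U) W" using assms openin_subset_topspace_eq openin_subtopology by blast
  then have "openin (subtopology (Euclidean_space n) (\<phi> ` U)) (\<phi> ` W)"
    using homeomorphic_imp_open_map[OF is_chart_homeomorphic[OF assms(1)]] by (simp add: open_map_def)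
  then show ?thesis using assms(1) openin_trans_full by (auto simp: is_chart_def)
qed

lemma is_chart_inj: "is_chart T (n, U, \<phi>) \<Longrightarrow> inj_on \<phi> U"
  using homeomorphic_imp_injective_map[OF is_chart_homeomorphic] is_chart_topspace by metis

lemma is_chart_continuous: "is_chart T (n, U, \<phi>) \<Longrightarrow> continuous_map (subtopology T U) (Euclidean_space n) \<phi>"
  using homeomorphic_imp_continuous_map[OF is_chart_homeomorphic] continuous_map_in_subtopology by blast

lemma is_chart_restrict:
  assumes c: "is_chart T (n, U, \<phi>)" and W: "openin T W" "W \<subseteq> U"
  shows "is_chart T (n, W, \<phi>)"
proof -
  have o: "openin (Euclidean_space n) (\<phi> ` U)" using c by (simp add: is_chart_def)
  have "homeomorphic_map (subtopology (subtopology T U) W) (subtopology (subtopology (Euclidean_space n) (\<phi> ` U)) (\<phi> ` W)) \<phi>"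
    by (rule homeomorphic_map_subtopologies[OF is_chart_homeomorphic[OF c]])
      (use is_chart_topspace[OF c] W openin_subset[OF o] in auto)
  moreover have "U \<inter> W = W" "\<phi> ` U \<inter> \<phi> ` W = \<phi> ` W" using W by auto
  ultimately show ?thesis
    using W is_chart_image_open[OF c W] by (simp add: is_chart_def subtopology_subtopology)
qed

text \<open>Transition maps are written with \<open>inv_into\<close> of the domain of the chart, a
  different function once the domain shrinks; this identifies the two where it matters.\<close>

lemma inv_into_restrict:
  assumes "inj_on f U" "W \<subseteq> U" "y \<in> f ` W"
  shows "inv_into W f y = inv_into U f y"
  using assms by (auto simp: inv_into_f_f inj_on_subset subset_iff)

lemma compatible_iff:
  "compatible (n, U, \<phi>) (m, V, \<psi>) \<longleftrightarrow>
     smooth_eucl n (\<phi> ` (U \<inter> V)) m (\<psi> \<circ> inv_into U \<phi>) \<and>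
     smooth_eucl m (\<psi> ` (U \<inter> V)) n (\<phi> \<circ> inv_into V \<psi>)"
  by (simp add: compatible_def)

lemma compatible_sym: "compatible c d \<Longrightarrow> compatible d c"
  by (cases c, cases d) (auto simp: compatible_iff Int_commute)

lemma compatible_restrict:
  assumes c: "is_chart T (n, U, \<phi>)" and d: "is_chart T (m, V, \<psi>)"
    and W: "openin T W" "W \<subseteq> U" and cd: "compatible (n, U, \<phi>) (m, V, \<psi>)"
  shows "compatible (n, W, \<phi>) (m, V, \<psi>)"
  unfolding compatible_iff
proof
  have o: "openin T (W \<inter> V)" using W d is_chart_open by blast
  have "smooth_eucl n (\<phi> ` (W \<inter> V)) m (\<psi> \<circ> inv_into U \<phi>)"
    by (rule smooth_eucl_subset) (use cd W in \<open>auto simp: compatible_iff\<close>)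
  then show "smooth_eucl n (\<phi> ` (W \<inter> V)) m (\<psi> \<circ> inv_into W \<phi>)"
    by (rule smooth_eucl_cong[OF is_chart_image_open[OF c o, OF le_infI1[OF W(2)]], rotated])
      (use W inv_into_restrict[OF is_chart_inj[OF c] W(2)] in auto)
  show "smooth_eucl m (\<psi> ` (W \<inter> V)) n (\<phi> \<circ> inv_into V \<psi>)"
    by (rule smooth_eucl_subset) (use cd W in \<open>auto simp: compatible_iff\<close>)
qed

text \<open>The atlas conditions alone, so that maps out of \<open>eucl_mfd n\<close> and its open
  subsets are covered by the same lemmas as maps between manifolds.\<close>

definition locally_euclidean :: "'m mfd \<Rightarrow> bool" where
  "locally_euclidean M \<longleftrightarrow> pts M = (\<Union>(n, U, \<phi>)\<in>atlas M. U) \<and> atlas M = max_atlas (mtop M) (atlas M)"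

lemma manifold_locally_euclidean: "manifold M \<Longrightarrow> locally_euclidean M"
  by (simp add: manifold_def locally_euclidean_def)

lemma atlas_is_chart: "locally_euclidean M \<Longrightarrow> c \<in> atlas M \<Longrightarrow> is_chart (mtop M) c"
  unfolding locally_euclidean_def max_atlas_def by blast

lemma atlas_compatible: "locally_euclidean M \<Longrightarrow> c \<in> atlas M \<Longrightarrow> d \<in> atlas M \<Longrightarrow> compatible c d"
  unfolding locally_euclidean_def max_atlas_def by blast

lemma atlasI:
  "locally_euclidean M \<Longrightarrow> is_chart (mtop M) c \<Longrightarrow> (\<And>d. d \<in> atlas M \<Longrightarrow> compatible c d) \<Longrightarrow> c \<in> atlas M"
  unfolding locally_euclidean_def max_atlas_def by blast

lemma chart_at:
  assumes "locally_euclidean M" "x \<in> pts M"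
  obtains n U \<phi> where "(n, U, \<phi>) \<in> atlas M" "x \<in> U"
  using assms unfolding locally_euclidean_def by auto

text \<open>Maximality puts the restriction of a chart back into the atlas. Open submanifolds depend
  on this, as \<open>open_sub\<close> keeps only the charts with domain inside the open set.\<close>

lemma atlas_restrict:
  assumes M: "locally_euclidean M" and c: "(n, U, \<phi>) \<in> atlas M" and W: "openin (mtop M) W" "W \<subseteq> U"
  shows "(n, W, \<phi>) \<in> atlas M"
proof (rule atlasI[OF M])
  show "is_chart (mtop M) (n, W, \<phi>)" by (rule is_chart_restrict[OF atlas_is_chart[OF M c] W])
  fix d assume d: "d \<in> atlas M"
  then show "compatible (n, W, \<phi>) d"
    using compatible_restrict[OF atlas_is_chart[OF M c] _ W] atlas_is_chart[OF M d] atlas_compatible[OF M c d]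
    by (cases d) auto
qed

section \<open>Smooth maps and their composition\<close>

lemma smooth_mapD:
  "smooth_map M N f \<Longrightarrow> (n, U, \<phi>) \<in> atlas M \<Longrightarrow> (m, V, \<psi>) \<in> atlas N \<Longrightarrow>
    smooth_eucl n (\<phi> ` (U \<inter> f -` V)) m (\<psi> \<circ> f \<circ> inv_into U \<phi>)"
  unfolding smooth_map_def by fastforce

lemma smooth_mapI:
  "continuous_map (mtop M) (mtop N) f \<Longrightarrow>
    (\<And>n U \<phi> m V \<psi>. (n, U, \<phi>) \<in> atlas M \<Longrightarrow> (m, V, \<psi>) \<in> atlas N \<Longrightarrow>
    smooth_eucl n (\<phi> ` (U \<inter> f -` V)) m (\<psi> \<circ> f \<circ> inv_into U \<phi>)) \<Longrightarrow> smooth_map M N f"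
  unfolding smooth_map_def by fastforce

lemma smooth_map_continuous: "smooth_map M N f \<Longrightarrow> continuous_map (mtop M) (mtop N) f"
  by (simp add: smooth_map_def)

lemma smooth_map_pts: "smooth_map M N f \<Longrightarrow> x \<in> pts M \<Longrightarrow> f x \<in> pts N"
  using smooth_map_continuous continuous_map_image_subset_topspace by blast

lemma openin_preimage_Int:
  assumes "continuous_map X Y f" "openin X U" "openin Y V"
  shows "openin X (U \<inter> f -` V)"
proof -
  have "openin X (U \<inter> {x \<in> topspace X. f x \<in> V})"
    using assms openin_continuous_map_preimage by blast
  moreover have "U \<inter> {x \<in> topspace X. f x \<in> V} = U \<inter> f -` V"
    using openin_subset[OF assms(2)] by auto
  ultimately show ?thesis by simp
qed

text \<open>Near a point the coordinate expression factors through a chart of the middle manifold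
  around the image point; smoothness is local, so this suffices.\<close>

lemma smooth_map_compose:
  assumes M: "locally_euclidean M" and N: "locally_euclidean N" and L: "locally_euclidean L"
    and f: "smooth_map M N f" and g: "smooth_map N L g"
  shows "smooth_map M L (\<lambda>x. g (f x))"
proof (rule smooth_mapI)
  show cont: "continuous_map (mtop M) (mtop L) (\<lambda>x. g (f x))"
    using continuous_map_compose[OF smooth_map_continuous[OF f] smooth_map_continuous[OF g]] by (simp add: o_def)
  fix n U \<phi> k W \<kappa> assume c: "(n, U, \<phi>) \<in> atlas M" and d: "(k, W, \<kappa>) \<in> atlas L"
  note c' = atlas_is_chart[OF M c] and d' = atlas_is_chart[OF L d]
  have injc: "inj_on \<phi> U" using is_chart_inj[OF c'] .
  have o: "openin (mtop M) (U \<inter> (\<lambda>x. g (f x)) -` W)"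
    by (rule openin_preimage_Int[OF cont is_chart_open[OF c'] is_chart_open[OF d']])
  show "smooth_eucl n (\<phi> ` (U \<inter> (\<lambda>x. g (f x)) -` W)) k (\<kappa> \<circ> (\<lambda>x. g (f x)) \<circ> inv_into U \<phi>)"
  proof (rule smooth_eucl_local)
    show "openin (Euclidean_space n) (\<phi> ` (U \<inter> (\<lambda>x. g (f x)) -` W))"
      by (rule is_chart_image_open[OF c' o]) auto
    fix y assume "y \<in> \<phi> ` (U \<inter> (\<lambda>x. g (f x)) -` W)"
    then obtain x where x: "x \<in> U" "g (f x) \<in> W" "y = \<phi> x" by auto
    have "f x \<in> pts N" using smooth_map_pts[OF f] openin_subset[OF is_chart_open[OF c']] x(1) by blast
    then obtain m V \<psi> where e: "(m, V, \<psi>) \<in> atlas N" "f x \<in> V" using chart_at[OF N] by metis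
    note e' = atlas_is_chart[OF N e(1)]
    have oVW: "openin (mtop N) (V \<inter> g -` W)"
      by (rule openin_preimage_Int[OF smooth_map_continuous[OF g] is_chart_open[OF e'] is_chart_open[OF d']])
    define S where "S = U \<inter> f -` (V \<inter> g -` W)"
    have oS: "openin (mtop M) S" unfolding S_def
      by (rule openin_preimage_Int[OF smooth_map_continuous[OF f] is_chart_open[OF c'] oVW])
    have oS': "openin (Euclidean_space n) (\<phi> ` S)" by (rule is_chart_image_open[OF c' oS]) (simp add: S_def)
    have 1: "smooth_eucl n (\<phi> ` S) m (\<psi> \<circ> f \<circ> inv_into U \<phi>)"
      by (rule smooth_eucl_subset[OF smooth_mapD[OF f c e(1)]]) (auto simp: S_def)
    have "smooth_eucl n (\<phi> ` S) k (\<lambda>z. (\<kappa> \<circ> g \<circ> inv_into V \<psi>) ((\<psi> \<circ> f \<circ> inv_into U \<phi>) z))"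
    proof (rule smooth_eucl_compose[OF oS' _ smooth_mapD[OF g e(1) d] 1])
      show "openin (Euclidean_space m) (\<psi> ` (V \<inter> g -` W))" by (rule is_chart_image_open[OF e' oVW]) auto
      show "(\<psi> \<circ> f \<circ> inv_into U \<phi>) ` \<phi> ` S \<subseteq> \<psi> ` (V \<inter> g -` W)"
        using injc by (auto simp: S_def)
    qed
    then have "smooth_eucl n (\<phi> ` S) k (\<kappa> \<circ> (\<lambda>x. g (f x)) \<circ> inv_into U \<phi>)"
      by (rule smooth_eucl_cong[OF oS', rotated]) (use injc is_chart_inj[OF e'] in \<open>auto simp: S_def\<close>)
    then show "\<exists>W'. openin (Euclidean_space n) W' \<and> y \<in> W' \<and> smooth_eucl n W' k (\<kappa> \<circ> (\<lambda>x. g (f x)) \<circ> inv_into U \<phi>)"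
      using oS' x e(2) by (intro exI[of _ "\<phi> ` S"]) (auto simp: S_def)
  qed
qed

lemma smooth_map_id: "locally_euclidean M \<Longrightarrow> smooth_map M M (\<lambda>x. x)"
proof (rule smooth_mapI)
  fix n U \<phi> m V \<psi> assume "locally_euclidean M" "(n, U, \<phi>) \<in> atlas M" "(m, V, \<psi>) \<in> atlas M"
  then have "compatible (n, U, \<phi>) (m, V, \<psi>)" using atlas_compatible by blast
  then show "smooth_eucl n (\<phi> ` (U \<inter> (\<lambda>x. x) -` V)) m (\<psi> \<circ> (\<lambda>x. x) \<circ> inv_into U \<phi>)"
    by (simp add: compatible_iff o_def vimage_def)
qed auto

lemma smooth_map_cong:
  assumes M: "locally_euclidean M" and N: "locally_euclidean N" and f: "smooth_map M N f" and eq: "\<And>x. x \<in> pts M \<Longrightarrow> f x = g x"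
  shows "smooth_map M N g"
proof (rule smooth_mapI)
  show cg: "continuous_map (mtop M) (mtop N) g"
    using continuous_map_eq[OF smooth_map_continuous[OF f]] eq by blast
  fix n U \<phi> m V \<psi> assume c: "(n, U, \<phi>) \<in> atlas M" and d: "(m, V, \<psi>) \<in> atlas N"
  note c' = atlas_is_chart[OF M c] and d' = atlas_is_chart[OF N d]
  have U: "U \<subseteq> pts M" using openin_subset[OF is_chart_open[OF c']] .
  then have s: "U \<inter> f -` V = U \<inter> g -` V" using eq by auto
  have o: "openin (Euclidean_space n) (\<phi> ` (U \<inter> g -` V))"
    by (rule is_chart_image_open[OF c' openin_preimage_Int[OF cg is_chart_open[OF c'] is_chart_open[OF d']]]) auto
  show "smooth_eucl n (\<phi> ` (U \<inter> g -` V)) m (\<psi> \<circ> g \<circ> inv_into U \<phi>)"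
    by (rule smooth_eucl_cong[OF o _ smooth_mapD[OF f c d, unfolded s]])
      (use is_chart_inj[OF c'] U eq in auto)
qed

lemma smooth_eucl_empty: "smooth_eucl n {} m f"
  by (auto simp: smooth_eucl_iff intro!: smooth_fn_local)

lemma smooth_map_const:
  assumes M: "locally_euclidean M" and N: "locally_euclidean N" and y: "y \<in> pts N"
  shows "smooth_map M N (\<lambda>x. y)"
proof (rule smooth_mapI)
  show "continuous_map (mtop M) (mtop N) (\<lambda>x. y)" using y by simp
  fix n U \<phi> m V \<psi> assume c: "(n, U, \<phi>) \<in> atlas M" and d: "(m, V, \<psi>) \<in> atlas N"
  show "smooth_eucl n (\<phi> ` (U \<inter> (\<lambda>x. y) -` V)) m (\<psi> \<circ> (\<lambda>x. y) \<circ> inv_into U \<phi>)"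
  proof (cases "y \<in> V")
    case True
    have "\<psi> y \<in> topspace (Euclidean_space m)"
      using atlas_is_chart[OF N d] True openin_subset unfolding is_chart_def by blast
    then show ?thesis by (auto simp: smooth_eucl_iff o_def smooth_fn_const)
  next
    case False
    then have "U \<inter> (\<lambda>x. y) -` V = {}" by auto
    then show ?thesis by (simp only: image_empty smooth_eucl_empty)
  qed
qed

section \<open>Open submanifolds\<close>

lemma mtop_open_sub [simp]: "mtop (open_sub M U) = subtopology (mtop M) U"
  and atlas_open_sub: "(n, V, \<phi>) \<in> atlas (open_sub M U) \<longleftrightarrow> (n, V, \<phi>) \<in> atlas M \<and> V \<subseteq> U"
  by (auto simp: open_sub_def)

lemma pts_open_sub: "openin (mtop M) U \<Longrightarrow> pts (open_sub M U) = U"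
  using openin_subset by fastforce

lemma open_sub_open_sub: "open_sub (open_sub M U) V = open_sub M (U \<inter> V)"
  by (auto simp: open_sub_def subtopology_subtopology)

lemma is_chart_subtopology:
  assumes U: "openin T U"
  shows "is_chart (subtopology T U) (n, V, \<phi>) \<longleftrightarrow> is_chart T (n, V, \<phi>) \<and> V \<subseteq> U"
proof (cases "V \<subseteq> U")
  case True
  then have "subtopology (subtopology T U) V = subtopology T V"
    by (simp add: subtopology_subtopology Int_absorb1)
  moreover have "openin (subtopology T U) V \<longleftrightarrow> openin T V"
    using True U openin_open_subtopology by blast
  ultimately show ?thesis using True by (simp add: is_chart_def)
next
  case False
  then show ?thesis using openin_subset[of "subtopology T U" V] by (auto simp: is_chart_def)
qed

text \<open>For maximality, a chart with domain in \<open>U\<close> meets a chart of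
  \<open>M\<close> in the same set as it meets the restriction of that chart to \<open>U\<close>, so
  compatibility inside \<open>U\<close> gives compatibility with the whole atlas.\<close>

lemma locally_euclidean_open_sub:
  assumes M: "locally_euclidean M" and U: "openin (mtop M) U"
  shows "locally_euclidean (open_sub M U)"
  unfolding locally_euclidean_def pts_open_sub[OF U]
proof
  show "U = (\<Union>(n, V, \<phi>)\<in>atlas (open_sub M U). V)"
  proof (intro equalityI subsetI)
    fix x assume x: "x \<in> U"
    then have "x \<in> pts M" using U openin_subset by blast
    then obtain n V \<phi> where c: "(n, V, \<phi>) \<in> atlas M" "x \<in> V" using chart_at[OF M] by metis
    have "(n, V \<inter> U, \<phi>) \<in> atlas M"
      by (rule atlas_restrict[OF M c(1)]) (use U is_chart_open[OF atlas_is_chart[OF M c(1)]] in auto)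
    then have "(n, V \<inter> U, \<phi>) \<in> atlas (open_sub M U)" by (simp add: atlas_open_sub)
    then show "x \<in> (\<Union>(n, V, \<phi>)\<in>atlas (open_sub M U). V)"
      by (rule UN_I) (use x c(2) in simp)
  qed (auto simp: atlas_open_sub)
  show "atlas (open_sub M U) = max_atlas (mtop (open_sub M U)) (atlas (open_sub M U))"
  proof (intro equalityI subsetI)
    fix c assume c: "c \<in> atlas (open_sub M U)"
    then have "is_chart (mtop (open_sub M U)) c"
      using atlas_is_chart[OF M] by (cases c) (auto simp: atlas_open_sub is_chart_subtopology[OF U])
    moreover have "compatible c d" if "d \<in> atlas (open_sub M U)" for d
      using atlas_compatible[OF M] c that by (cases c, cases d) (auto simp: atlas_open_sub)
    ultimately show "c \<in> max_atlas (mtop (open_sub M U)) (atlas (open_sub M U))"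
      by (simp add: max_atlas_def)
  next
    fix c assume c: "c \<in> max_atlas (mtop (open_sub M U)) (atlas (open_sub M U))"
    obtain n V \<phi> where ceq: "c = (n, V, \<phi>)" by (cases c)
    have ch: "is_chart (mtop M) (n, V, \<phi>)" "V \<subseteq> U"
      using c by (auto simp: max_atlas_def ceq is_chart_subtopology[OF U])
    have "compatible (n, V, \<phi>) d" if d: "d \<in> atlas M" for d
    proof -
      obtain m W \<psi> where deq: "d = (m, W, \<psi>)" by (cases d)
      note d' = atlas_is_chart[OF M d[unfolded deq]]
      have oW: "openin (mtop M) (W \<inter> U)" using is_chart_open[OF d'] U by blast
      have "(m, W \<inter> U, \<psi>) \<in> atlas (open_sub M U)"
        using atlas_restrict[OF M d[unfolded deq] oW] by (simp add: atlas_open_sub)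
      then have "compatible (n, V, \<phi>) (m, W \<inter> U, \<psi>)" using c by (auto simp: max_atlas_def ceq)
      moreover have "V \<inter> (W \<inter> U) = V \<inter> W" using ch(2) by auto
      ultimately have 1: "smooth_eucl n (\<phi> ` (V \<inter> W)) m (\<psi> \<circ> inv_into V \<phi>)"
        and 2: "smooth_eucl m (\<psi> ` (V \<inter> W)) n (\<phi> \<circ> inv_into (W \<inter> U) \<psi>)"
        by (simp_all add: compatible_iff)
      have o: "openin (Euclidean_space m) (\<psi> ` (V \<inter> W))"
        by (rule is_chart_image_open[OF d']) (use is_chart_open[OF d'] is_chart_open[OF ch(1)] in auto)
      have "smooth_eucl m (\<psi> ` (V \<inter> W)) n (\<phi> \<circ> inv_into W \<psi>)"
        by (rule smooth_eucl_cong[OF o _ 2])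
          (use inv_into_restrict[OF is_chart_inj[OF d'], of "W \<inter> U"] ch(2) in auto)
      then show ?thesis using 1 by (simp add: compatible_iff deq)
    qed
    then have "(n, V, \<phi>) \<in> atlas M" by (rule atlasI[OF M ch(1)])
    then show "c \<in> atlas (open_sub M U)" using ch(2) by (simp add: ceq atlas_open_sub)
  qed
qed

lemma manifold_open_sub:
  assumes "manifold M" "openin (mtop M) U"
  shows "manifold (open_sub M U)"
proof -
  have "locally_euclidean (open_sub M U)"
    using assms locally_euclidean_open_sub manifold_locally_euclidean by blast
  moreover have "Hausdorff_space (mtop (open_sub M U))" "second_countable (mtop (open_sub M U))"
    using assms by (simp_all add: manifold_def Hausdorff_space_subtopology second_countable_subtopology)
  ultimately show ?thesis by (simp add: manifold_def locally_euclidean_def)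
qed

lemma smooth_map_restrict: "smooth_map M N f \<Longrightarrow> smooth_map (open_sub M U) N f"
  by (rule smooth_mapI) (auto simp: atlas_open_sub smooth_mapD intro: continuous_map_from_subtopology smooth_map_continuous)

lemma smooth_map_corestrict:
  assumes f: "smooth_map M N f" and V: "\<And>x. x \<in> pts M \<Longrightarrow> f x \<in> V"
  shows "smooth_map M (open_sub N V) f"
  by (rule smooth_mapI) (use V f in \<open>auto simp: atlas_open_sub smooth_mapD continuous_map_in_subtopology smooth_map_continuous\<close>)

lemma smooth_map_inclusion:
  assumes M: "locally_euclidean M" and UV: "U \<subseteq> V"
  shows "smooth_map (open_sub M U) (open_sub M V) (\<lambda>x. x)"
  by (rule smooth_map_corestrict[OF smooth_map_restrict[OF smooth_map_id[OF M]]]) (use UV in auto)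

lemma smooth_map_local:
  assumes M: "locally_euclidean M" and N: "locally_euclidean N"
    and f: "\<And>x. x \<in> pts M \<Longrightarrow> \<exists>W. openin (mtop M) W \<and> x \<in> W \<and> smooth_map (open_sub M W) N f"
  shows "smooth_map M N f"
proof (rule smooth_mapI)
  show cont: "continuous_map (mtop M) (mtop N) f"
  proof (rule continuous_map_local)
    fix x assume "x \<in> pts M"
    then obtain W where "openin (mtop M) W" "x \<in> W" "smooth_map (open_sub M W) N f" using f by blast
    then show "\<exists>W. openin (mtop M) W \<and> x \<in> W \<and> continuous_map (subtopology (mtop M) W) (mtop N) f"
      using smooth_map_continuous[of "open_sub M W" N f] by auto
  qed
  fix n U \<phi> m V \<psi> assume c: "(n, U, \<phi>) \<in> atlas M" and d: "(m, V, \<psi>) \<in> atlas N"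
  note c' = atlas_is_chart[OF M c] and d' = atlas_is_chart[OF N d]
  have o: "openin (mtop M) (U \<inter> f -` V)"
    by (rule openin_preimage_Int[OF cont is_chart_open[OF c'] is_chart_open[OF d']])
  show "smooth_eucl n (\<phi> ` (U \<inter> f -` V)) m (\<psi> \<circ> f \<circ> inv_into U \<phi>)"
  proof (rule smooth_eucl_local)
    show "openin (Euclidean_space n) (\<phi> ` (U \<inter> f -` V))" by (rule is_chart_image_open[OF c' o]) auto
    fix y assume "y \<in> \<phi> ` (U \<inter> f -` V)"
    then obtain x where x: "x \<in> U" "f x \<in> V" "y = \<phi> x" by auto
    then have "x \<in> pts M" using openin_subset[OF is_chart_open[OF c']] by blast
    then obtain W where W: "openin (mtop M) W" "x \<in> W" "smooth_map (open_sub M W) N f" using f by blast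
    have oUW: "openin (mtop M) (U \<inter> W)" using W(1) is_chart_open[OF c'] by blast
    have cW: "(n, U \<inter> W, \<phi>) \<in> atlas (open_sub M W)"
      using atlas_restrict[OF M c oUW] by (simp add: atlas_open_sub)
    have 1: "smooth_eucl n (\<phi> ` (U \<inter> W \<inter> f -` V)) m (\<psi> \<circ> f \<circ> inv_into (U \<inter> W) \<phi>)"
      by (rule smooth_mapD[OF W(3) cW d])
    have o': "openin (Euclidean_space n) (\<phi> ` (U \<inter> W \<inter> f -` V))"
      by (rule is_chart_image_open[OF c' openin_preimage_Int[OF cont oUW is_chart_open[OF d']]]) auto
    have "smooth_eucl n (\<phi> ` (U \<inter> W \<inter> f -` V)) m (\<psi> \<circ> f \<circ> inv_into U \<phi>)"
      by (rule smooth_eucl_cong[OF o' _ 1]) (use inv_into_restrict[OF is_chart_inj[OF c'], of "U \<inter> W"] in auto)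
    then show "\<exists>W. openin (Euclidean_space n) W \<and> y \<in> W \<and> smooth_eucl n W m (\<psi> \<circ> f \<circ> inv_into U \<phi>)"
      using o' x W(2) by (intro exI[of _ "\<phi> ` (U \<inter> W \<inter> f -` V)"]) auto
  qed
qed

text \<open>Compatibility is not transitive by itself, but it is through a covering family: on the
  overlap the transition map factors locally through a chart of \<open>A\<close>.\<close>

lemma compatible_trans_local:
  assumes A: "\<And>a. a \<in> A \<Longrightarrow> is_chart T a" and cover: "topspace T = (\<Union>(n, U, \<phi>)\<in>A. U)"
    and c: "is_chart T (n, U, \<phi>)" "\<And>a. a \<in> A \<Longrightarrow> compatible (n, U, \<phi>) a"
    and d: "is_chart T (m, V, \<psi>)" "\<And>a. a \<in> A \<Longrightarrow> compatible (m, V, \<psi>) a"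
  shows "smooth_eucl n (\<phi> ` (U \<inter> V)) m (\<psi> \<circ> inv_into U \<phi>)"
proof (rule smooth_eucl_local)
  have oUV: "openin T (U \<inter> V)" using is_chart_open[OF c(1)] is_chart_open[OF d(1)] by blast
  then show "openin (Euclidean_space n) (\<phi> ` (U \<inter> V))" by (rule is_chart_image_open[OF c(1)]) auto
  fix y assume "y \<in> \<phi> ` (U \<inter> V)"
  then obtain x where x: "x \<in> U" "x \<in> V" "y = \<phi> x" by auto
  then have "x \<in> topspace T" using oUV openin_subset by blast
  then obtain k W \<kappa> where a: "(k, W, \<kappa>) \<in> A" "x \<in> W" using cover by auto
  note a' = A[OF a(1)]
  define S where "S = U \<inter> V \<inter> W"
  have S: "S \<subseteq> U" "S \<subseteq> W" "openin T S" using oUV is_chart_open[OF a'] by (auto simp: S_def)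
  have oS: "openin (Euclidean_space n) (\<phi> ` S)" "openin (Euclidean_space k) (\<kappa> ` S)"
    using is_chart_image_open[OF c(1)] is_chart_image_open[OF a'] S by auto
  have 1: "smooth_eucl n (\<phi> ` S) k (\<kappa> \<circ> inv_into U \<phi>)"
    by (rule smooth_eucl_subset[of _ "\<phi> ` (U \<inter> W)"]) (use c(2)[OF a(1)] in \<open>auto simp: S_def compatible_iff\<close>)
  have 2: "smooth_eucl k (\<kappa> ` S) m (\<psi> \<circ> inv_into W \<kappa>)"
    by (rule smooth_eucl_subset[of _ "\<kappa> ` (V \<inter> W)"]) (use d(2)[OF a(1)] in \<open>auto simp: S_def compatible_iff\<close>)
  have "smooth_eucl n (\<phi> ` S) m (\<lambda>z. (\<psi> \<circ> inv_into W \<kappa>) ((\<kappa> \<circ> inv_into U \<phi>) z))"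
    by (rule smooth_eucl_compose[OF oS 2 1]) (use is_chart_inj[OF c(1)] S in \<open>auto simp: subset_iff\<close>)
  then have "smooth_eucl n (\<phi> ` S) m (\<psi> \<circ> inv_into U \<phi>)"
    by (rule smooth_eucl_cong[OF oS(1), rotated]) (use is_chart_inj[OF c(1)] is_chart_inj[OF a'] S in \<open>auto simp: subset_iff\<close>)
  then show "\<exists>W. openin (Euclidean_space n) W \<and> y \<in> W \<and> smooth_eucl n W m (\<psi> \<circ> inv_into U \<phi>)"
    using oS(1) x a(2) by (intro exI[of _ "\<phi> ` S"]) (auto simp: S_def)
qed

lemma locally_euclidean_max_atlas:
  assumes A: "\<And>a. a \<in> A \<Longrightarrow> is_chart T a" "\<And>a b. a \<in> A \<Longrightarrow> b \<in> A \<Longrightarrow> compatible a b"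
    and cover: "topspace T = (\<Union>(n, U, \<phi>)\<in>A. U)"
  shows "locally_euclidean \<lparr>mtop = T, atlas = max_atlas T A\<rparr>"
proof -
  have sub: "A \<subseteq> max_atlas T A" using A by (auto simp: max_atlas_def)
  have comp: "compatible c d" if cd: "c \<in> max_atlas T A" "d \<in> max_atlas T A" for c d
  proof -
    obtain n U \<phi> m V \<psi> where e: "c = (n, U, \<phi>)" "d = (m, V, \<psi>)" by (cases c, cases d)
    have *: "is_chart T (n, U, \<phi>)" "\<And>a. a \<in> A \<Longrightarrow> compatible (n, U, \<phi>) a"
      "is_chart T (m, V, \<psi>)" "\<And>a. a \<in> A \<Longrightarrow> compatible (m, V, \<psi>) a"
      using cd by (auto simp: max_atlas_def e)
    show ?thesis
      using compatible_trans_local[OF A(1) cover *] compatible_trans_local[OF A(1) cover *(3,4,1,2)]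
      by (simp add: e compatible_iff Int_commute)
  qed
  have "max_atlas T A = max_atlas T (max_atlas T A)"
  proof (intro equalityI subsetI)
    fix c assume c: "c \<in> max_atlas T A"
    then have "is_chart T c" by (simp add: max_atlas_def)
    then show "c \<in> max_atlas T (max_atlas T A)" using comp[OF c] unfolding max_atlas_def[of T "max_atlas T A"] by blast
  next
    fix c assume c: "c \<in> max_atlas T (max_atlas T A)"
    then have "is_chart T c" "\<And>a. a \<in> A \<Longrightarrow> compatible c a"
      using sub unfolding max_atlas_def[of T "max_atlas T A"] by blast+
    then show "c \<in> max_atlas T A" unfolding max_atlas_def by blast
  qed
  moreover have "topspace T = (\<Union>(n, U, \<phi>)\<in>max_atlas T A. U)"
  proof
    show "topspace T \<subseteq> (\<Union>(n, U, \<phi>)\<in>max_atlas T A. U)" using cover sub by fastforce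
    show "(\<Union>(n, U, \<phi>)\<in>max_atlas T A. U) \<subseteq> topspace T"
      using openin_subset[OF is_chart_open] by (fastforce simp: max_atlas_def)
  qed
  ultimately show ?thesis by (simp add: locally_euclidean_def)
qed

subsection \<open>Maps from open subsets of \<open>\<real>\<^sup>n\<close>\<close>

lemma is_chart_eucl: "openin (Euclidean_space n) W \<Longrightarrow> is_chart (Euclidean_space n) (n, W, \<lambda>x. x)"
  by (simp add: is_chart_def homeomorphic_map_id[unfolded id_def])

lemma inv_into_ident: "y \<in> W \<Longrightarrow> inv_into W (\<lambda>x. x) y = y"
  using inv_into_f_f[of "\<lambda>x. x" W y] by simp

lemma smooth_eucl_inv_ident:
  assumes S: "openin (Euclidean_space n) S" "S \<subseteq> W"
  shows "smooth_eucl n S m (f \<circ> inv_into W (\<lambda>x. x)) \<longleftrightarrow> smooth_eucl n S m f"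
proof -
  have "(f \<circ> inv_into W (\<lambda>x. x)) x = f x" if "x \<in> S" for x
    using that S(2) inv_into_ident[of x W] by auto
  then show ?thesis
    using smooth_eucl_cong[OF S(1), of "f \<circ> inv_into W (\<lambda>x. x)" f m] smooth_eucl_cong[OF S(1), of f "f \<circ> inv_into W (\<lambda>x. x)" m]
    by auto
qed

lemma mtop_eucl [simp]: "mtop (eucl_mfd n) = Euclidean_space n"
  by (simp add: eucl_mfd_def)

lemma locally_euclidean_eucl: "locally_euclidean (eucl_mfd n)"
  unfolding eucl_mfd_def
proof (rule locally_euclidean_max_atlas)
  let ?T = "topspace (Euclidean_space n)"
  have "compatible (n, ?T, \<lambda>x. x) (n, ?T, \<lambda>x. x)"
    using smooth_eucl_inv_ident[of n ?T ?T n "\<lambda>x. x"] smooth_eucl_id[of ?T n] by (simp add: compatible_iff)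
  then show "compatible a b" if "a \<in> {(n, ?T, \<lambda>x. x)}" "b \<in> {(n, ?T, \<lambda>x. x)}" for a b
    using that by blast
qed (auto simp: is_chart_eucl)

lemma atlas_eucl: "openin (Euclidean_space n) W \<Longrightarrow> (n, W, \<lambda>x. x) \<in> atlas (eucl_mfd n)"
proof -
  assume W: "openin (Euclidean_space n) W"
  let ?T = "topspace (Euclidean_space n)"
  have "compatible (n, ?T, \<lambda>x. x) (n, ?T, \<lambda>x. x)"
    using smooth_eucl_inv_ident[of n ?T ?T n "\<lambda>x. x"] smooth_eucl_id[of ?T n] by (simp add: compatible_iff)
  then have "(n, ?T, \<lambda>x. x) \<in> atlas (eucl_mfd n)"
    by (simp add: eucl_mfd_def max_atlas_def is_chart_eucl)
  then show ?thesis by (rule atlas_restrict[OF locally_euclidean_eucl]) (use W openin_subset in auto)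
qed

lemma locally_euclidean_open_eucl:
  "openin (Euclidean_space n) W \<Longrightarrow> locally_euclidean (open_sub (eucl_mfd n) W)"
  by (rule locally_euclidean_open_sub[OF locally_euclidean_eucl]) simp

text \<open>Every chart of the source is compatible with the identity chart, so the coordinate
  expressions in the identity chart determine all others.\<close>

lemma smooth_map_eucl_iff:
  assumes W: "openin (Euclidean_space n) W" and N: "locally_euclidean N"
  shows "smooth_map (open_sub (eucl_mfd n) W) N f \<longleftrightarrow>
    continuous_map (subtopology (Euclidean_space n) W) (mtop N) f \<and>
    (\<forall>(m, V, \<psi>)\<in>atlas N. smooth_eucl n (W \<inter> f -` V) m (\<psi> \<circ> f))"
proof
  assume f: "smooth_map (open_sub (eucl_mfd n) W) N f"
  have cont: "continuous_map (subtopology (Euclidean_space n) W) (mtop N) f"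
    using smooth_map_continuous[OF f] by simp
  have "smooth_eucl n (W \<inter> f -` V) m (\<psi> \<circ> f)" if d: "(m, V, \<psi>) \<in> atlas N" for m V \<psi>
  proof -
    have "(n, W, \<lambda>x. x) \<in> atlas (open_sub (eucl_mfd n) W)" using atlas_eucl[OF W] by (simp add: atlas_open_sub)
    from smooth_mapD[OF f this d] have "smooth_eucl n (W \<inter> f -` V) m (\<psi> \<circ> f \<circ> inv_into W (\<lambda>x. x))" by simp
    moreover have "openin (Euclidean_space n) (W \<inter> f -` V)"
    proof -
      have "openin (subtopology (Euclidean_space n) W) (W \<inter> f -` V)"
        by (rule openin_preimage_Int[OF cont]) (use W is_chart_open[OF atlas_is_chart[OF N d]] in \<open>auto simp: openin_open_subtopology\<close>)
      then show ?thesis using W openin_trans_full by blast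
    qed
    ultimately show ?thesis using smooth_eucl_inv_ident[of n "W \<inter> f -` V" W] W by blast
  qed
  then show "continuous_map (subtopology (Euclidean_space n) W) (mtop N) f \<and>
    (\<forall>(m, V, \<psi>)\<in>atlas N. smooth_eucl n (W \<inter> f -` V) m (\<psi> \<circ> f))" using cont by auto
next
  assume f: "continuous_map (subtopology (Euclidean_space n) W) (mtop N) f \<and>
    (\<forall>(m, V, \<psi>)\<in>atlas N. smooth_eucl n (W \<inter> f -` V) m (\<psi> \<circ> f))"
  show "smooth_map (open_sub (eucl_mfd n) W) N f"
  proof (rule smooth_mapI)
    show "continuous_map (mtop (open_sub (eucl_mfd n) W)) (mtop N) f" using f by simp
    fix k U \<phi> m V \<psi> assume "(k, U, \<phi>) \<in> atlas (open_sub (eucl_mfd n) W)" and d: "(m, V, \<psi>) \<in> atlas N"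
    then have c: "(k, U, \<phi>) \<in> atlas (eucl_mfd n)" "U \<subseteq> W" by (auto simp: atlas_open_sub)
    have c': "is_chart (Euclidean_space n) (k, U, \<phi>)" using atlas_is_chart[OF locally_euclidean_eucl c(1)] by simp
    have fV: "smooth_eucl n (W \<inter> f -` V) m (\<psi> \<circ> f)" using f d by auto
    have oV: "openin (mtop N) V" using is_chart_open[OF atlas_is_chart[OF N d]] .
    have oU: "openin (subtopology (Euclidean_space n) W) U" "openin (subtopology (Euclidean_space n) W) W"
      using is_chart_open[OF c'] c(2) W by (auto simp: openin_open_subtopology)
    have "openin (subtopology (Euclidean_space n) W) (W \<inter> f -` V)" "openin (subtopology (Euclidean_space n) W) (U \<inter> f -` V)"
      using openin_preimage_Int[OF conjunct1[OF f] _ oV] oU by blast+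
    then have o: "openin (Euclidean_space n) (W \<inter> f -` V)" "openin (Euclidean_space n) (U \<inter> f -` V)"
      using W openin_trans_full by blast+
    have "compatible (k, U, \<phi>) (n, W, \<lambda>x. x)"
      using atlas_compatible[OF locally_euclidean_eucl c(1) atlas_eucl[OF W]] .
    then have "smooth_eucl k (\<phi> ` (U \<inter> W)) n (inv_into U \<phi>)" by (simp add: compatible_iff o_def)
    then have s: "smooth_eucl k (\<phi> ` (U \<inter> f -` V)) n (inv_into U \<phi>)"
      by (rule smooth_eucl_subset) (use c(2) in auto)
    have "smooth_eucl k (\<phi> ` (U \<inter> f -` V)) m (\<lambda>x. (\<psi> \<circ> f) (inv_into U \<phi> x))"
      by (rule smooth_eucl_compose[OF is_chart_image_open[OF c' o(2)] o(1) fV s])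
        (use is_chart_inj[OF c'] c(2) in auto)
    then show "smooth_eucl k (\<phi> ` (U \<inter> f -` V)) m (\<psi> \<circ> f \<circ> inv_into U \<phi>)" by (simp add: o_def)
  qed
qed

lemma smooth_map_eucl_eucl:
  assumes W: "openin (Euclidean_space n) W" and V: "openin (Euclidean_space m) V"
    and h: "smooth_eucl n W m h" "h ` W \<subseteq> V"
  shows "smooth_map (open_sub (eucl_mfd n) W) (open_sub (eucl_mfd m) V) h"
proof (rule smooth_map_corestrict)
  show "smooth_map (open_sub (eucl_mfd n) W) (eucl_mfd m) h"
    unfolding smooth_map_eucl_iff[OF W locally_euclidean_eucl]
  proof (intro conjI ballI)
    show cont: "continuous_map (subtopology (Euclidean_space n) W) (mtop (eucl_mfd m)) h"
      using smooth_eucl_continuous[OF h(1)] by simp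
    fix d assume "d \<in> atlas (eucl_mfd m)"
    then obtain k U \<psi> where d: "d = (k, U, \<psi>)" "(k, U, \<psi>) \<in> atlas (eucl_mfd m)" by (metis prod_cases3)
    have d': "is_chart (Euclidean_space m) (k, U, \<psi>)" using atlas_is_chart[OF locally_euclidean_eucl d(2)] by simp
    have oU: "openin (Euclidean_space m) U" using is_chart_open[OF d'] .
    have "compatible (k, U, \<psi>) (m, U, \<lambda>x. x)"
      using atlas_compatible[OF locally_euclidean_eucl d(2) atlas_eucl[OF oU]] .
    then have "smooth_eucl m U k (\<psi> \<circ> inv_into U (\<lambda>x. x))" by (simp add: compatible_iff)
    then have s: "smooth_eucl m U k \<psi>" using smooth_eucl_inv_ident[of m U U k \<psi>] oU by blast
    have "openin (subtopology (Euclidean_space n) W) (W \<inter> h -` U)"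
      by (rule openin_preimage_Int[OF cont]) (use W oU in \<open>auto simp: openin_open_subtopology\<close>)
    then have o: "openin (Euclidean_space n) (W \<inter> h -` U)" using W openin_trans_full by blast
    have "smooth_eucl n (W \<inter> h -` U) k (\<lambda>x. \<psi> (h x))"
      by (rule smooth_eucl_compose[OF o oU s smooth_eucl_subset[OF h(1)]]) auto
    then show "case d of (k, U, \<psi>) \<Rightarrow> smooth_eucl n (W \<inter> h -` U) k (\<psi> \<circ> h)"
      by (simp add: d o_def)
  qed
  show "\<And>x. x \<in> pts (open_sub (eucl_mfd n) W) \<Longrightarrow> h x \<in> V" using h(2) by auto
qed

lemma smooth_map_eucl_compose:
  assumes "openin (Euclidean_space n) W" "openin (Euclidean_space m) V" "locally_euclidean N"
    "smooth_eucl n W m h" "h ` W \<subseteq> V" "smooth_map (open_sub (eucl_mfd m) V) N f"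
  shows "smooth_map (open_sub (eucl_mfd n) W) N (\<lambda>x. f (h x))"
  using smooth_map_compose[OF locally_euclidean_open_eucl[OF assms(1)] locally_euclidean_open_eucl[OF assms(2)] assms(3)
      smooth_map_eucl_eucl[OF assms(1,2,4,5)] assms(6)] .

lemma smooth_map_eucl_subset:
  "smooth_map (open_sub (eucl_mfd n) W) N f \<Longrightarrow> V \<subseteq> W \<Longrightarrow> smooth_map (open_sub (eucl_mfd n) V) N f"
  using smooth_map_restrict[of "open_sub (eucl_mfd n) W" N f V] by (simp add: open_sub_open_sub Int_absorb1)

subsection \<open>Products\<close>

lemma continuous_map_EuclideanI:
  assumes "\<And>i. i < k \<Longrightarrow> continuous_map X euclideanreal (\<lambda>x. f x i)"
    and top: "\<And>x. x \<in> topspace X \<Longrightarrow> f x \<in> topspace (Euclidean_space k)"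
  shows "continuous_map X (Euclidean_space k) f"
proof -
  have "continuous_map X euclideanreal (\<lambda>x. f x i)" for i
  proof (cases "i < k")
    case False
    show ?thesis
      by (rule continuous_map_eq[of _ _ "\<lambda>x. 0"]) (use top False in \<open>auto simp: topspace_Euclidean_space\<close>)
  qed (rule assms(1))
  then show ?thesis
    using top unfolding Euclidean_space_def
    by (auto simp: continuous_map_in_subtopology continuous_map_componentwise_UNIV topspace_Euclidean_space)
qed

definition split_fst :: "nat \<Rightarrow> (nat \<Rightarrow> real) \<Rightarrow> nat \<Rightarrow> real" where
  "split_fst n z = (\<lambda>i. if i < n then z i else 0)"

definition split_snd :: "nat \<Rightarrow> nat \<Rightarrow> (nat \<Rightarrow> real) \<Rightarrow> nat \<Rightarrow> real" where
  "split_snd n m z = (\<lambda>i. if i < m then z (n + i) else 0)"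

text \<open>The chart that occurs in the atlas of \<open>prod_mfd\<close>; \<open>split_fst\<close>
  and \<open>split_snd\<close> recover the two blocks of coordinates.\<close>

definition prod_coords :: "nat \<Rightarrow> ('m \<Rightarrow> nat \<Rightarrow> real) \<Rightarrow> ('k \<Rightarrow> nat \<Rightarrow> real) \<Rightarrow> 'm \<times> 'k \<Rightarrow> nat \<Rightarrow> real" where
  "prod_coords n \<phi> \<psi> = (\<lambda>(x, y) i. if i < n then \<phi> x i else \<psi> y (i - n))"

lemma smooth_eucl_split:
  "smooth_eucl k U n (split_fst n)" "smooth_eucl k U m (split_snd n m)"
  unfolding split_fst_def split_snd_def
  by (rule smooth_eucl_coords[where f = "\<lambda>i x. x i"], rule smooth_fn_coordinate)
    (rule smooth_eucl_coords[where f = "\<lambda>i x. x (n + i)"], rule smooth_fn_coordinate)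

lemma prod_coords_split:
  assumes "\<phi> x \<in> topspace (Euclidean_space n)" "\<psi> y \<in> topspace (Euclidean_space m)"
  shows "split_fst n (prod_coords n \<phi> \<psi> (x, y)) = \<phi> x" "split_snd n m (prod_coords n \<phi> \<psi> (x, y)) = \<psi> y"
    "prod_coords n \<phi> \<psi> (x, y) \<in> topspace (Euclidean_space (n + m))"
  using assms by (auto simp: split_fst_def split_snd_def prod_coords_def topspace_Euclidean_space)

lemma prod_coords_eq:
  assumes "z \<in> topspace (Euclidean_space (n + m))" "\<phi> x = split_fst n z" "\<psi> y = split_snd n m z"
  shows "prod_coords n \<phi> \<psi> (x, y) = z"
proof
  fix i
  show "prod_coords n \<phi> \<psi> (x, y) i = z i"
    using assms by (cases "i < n"; cases "i < n + m") (auto simp: split_fst_def split_snd_def prod_coords_def topspace_Euclidean_space)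
qed

lemma chart_topspace: "is_chart T (n, U, \<phi>) \<Longrightarrow> x \<in> U \<Longrightarrow> \<phi> x \<in> topspace (Euclidean_space n)"
  unfolding is_chart_def using openin_subset by blast

lemma prod_coords_image:
  assumes c: "is_chart T1 (n, U, \<phi>)" and d: "is_chart T2 (m, V, \<psi>)" and "U' \<subseteq> U" "V' \<subseteq> V"
  shows "prod_coords n \<phi> \<psi> ` (U' \<times> V') =
    {z \<in> topspace (Euclidean_space (n + m)). split_fst n z \<in> \<phi> ` U' \<and> split_snd n m z \<in> \<psi> ` V'}"
proof (intro equalityI subsetI)
  fix z assume "z \<in> prod_coords n \<phi> \<psi> ` (U' \<times> V')"
  then obtain x y where xy: "x \<in> U'" "y \<in> V'" "z = prod_coords n \<phi> \<psi> (x, y)" by auto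
  then show "z \<in> {z \<in> topspace (Euclidean_space (n + m)). split_fst n z \<in> \<phi> ` U' \<and> split_snd n m z \<in> \<psi> ` V'}"
    using prod_coords_split[of \<phi> x n \<psi> y m] chart_topspace[OF c, of x] chart_topspace[OF d, of y] assms(3,4) by auto
next
  fix z assume "z \<in> {z \<in> topspace (Euclidean_space (n + m)). split_fst n z \<in> \<phi> ` U' \<and> split_snd n m z \<in> \<psi> ` V'}"
  then obtain x y where xy: "x \<in> U'" "y \<in> V'" "\<phi> x = split_fst n z" "\<psi> y = split_snd n m z"
    and z: "z \<in> topspace (Euclidean_space (n + m))" by auto
  show "z \<in> prod_coords n \<phi> \<psi> ` (U' \<times> V')"
    by (rule image_eqI[of _ _ "(x, y)"]) (use xy prod_coords_eq[of z n m \<phi> x \<psi> y, OF z xy(3,4)] in auto)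
qed

lemma continuous_map_split:
  "continuous_map (Euclidean_space k) (Euclidean_space n) (split_fst n)"
  "continuous_map (Euclidean_space k) (Euclidean_space m) (split_snd n m)"
  using smooth_eucl_continuous[OF smooth_eucl_split(1)[of k "topspace (Euclidean_space k)" n]]
    smooth_eucl_continuous[OF smooth_eucl_split(2)[of k "topspace (Euclidean_space k)" m n]]
  by simp_all

text \<open>The inverse is obtained by splitting the coordinates after the first \<open>n\<close>
  and inverting the two charts separately, so continuity in both directions reduces to the
  factors.\<close>

lemma is_chart_prod:
  assumes c: "is_chart T1 (n, U, \<phi>)" and d: "is_chart T2 (m, V, \<psi>)"
  shows "is_chart (prod_topology T1 T2) (n + m, U \<times> V, prod_coords n \<phi> \<psi>)"
proof -
  let ?E = "Euclidean_space (n + m)" and ?\<Phi> = "prod_coords n \<phi> \<psi>"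
  note im = prod_coords_image[OF c d order_refl order_refl]
  have o: "openin ?E (?\<Phi> ` (U \<times> V))"
  proof -
    have "openin ?E {z \<in> topspace ?E. split_fst n z \<in> \<phi> ` U}"
      by (rule openin_continuous_map_preimage[OF continuous_map_split(1)]) (use c in \<open>simp add: is_chart_def\<close>)
    moreover have "openin ?E {z \<in> topspace ?E. split_snd n m z \<in> \<psi> ` V}"
      by (rule openin_continuous_map_preimage[OF continuous_map_split(2)]) (use d in \<open>simp add: is_chart_def\<close>)
    ultimately have "openin ?E ({z \<in> topspace ?E. split_fst n z \<in> \<phi> ` U} \<inter> {z \<in> topspace ?E. split_snd n m z \<in> \<psi> ` V})"
      by (rule openin_Int)
    also have "{z \<in> topspace ?E. split_fst n z \<in> \<phi> ` U} \<inter> {z \<in> topspace ?E. split_snd n m z \<in> \<psi> ` V} = ?\<Phi> ` (U \<times> V)"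
      unfolding im by blast
    finally show ?thesis .
  qed
  obtain g1 where g1: "homeomorphic_maps (subtopology T1 U) (subtopology (Euclidean_space n) (\<phi> ` U)) \<phi> g1"
    using is_chart_homeomorphic[OF c] homeomorphic_map_maps by blast
  obtain g2 where g2: "homeomorphic_maps (subtopology T2 V) (subtopology (Euclidean_space m) (\<psi> ` V)) \<psi> g2"
    using is_chart_homeomorphic[OF d] homeomorphic_map_maps by blast
  have tops: "topspace (subtopology T1 U) = U" "topspace (subtopology T2 V) = V"
    "topspace (subtopology (Euclidean_space n) (\<phi> ` U)) = \<phi> ` U" "topspace (subtopology (Euclidean_space m) (\<psi> ` V)) = \<psi> ` V"
    using is_chart_topspace[OF c] is_chart_topspace[OF d] chart_topspace[OF c] chart_topspace[OF d] by auto
  have top1: "topspace (subtopology ?E (?\<Phi> ` (U \<times> V))) = ?\<Phi> ` (U \<times> V)"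
    using openin_subset[OF o] by auto
  have sub: "subtopology (prod_topology T1 T2) (U \<times> V) = prod_topology (subtopology T1 U) (subtopology T2 V)"
    by (simp add: subtopology_Times)
  have cont\<Phi>: "continuous_map (prod_topology (subtopology T1 U) (subtopology T2 V)) ?E ?\<Phi>"
  proof (rule continuous_map_EuclideanI)
    fix p assume "p \<in> topspace (prod_topology (subtopology T1 U) (subtopology T2 V))"
    then have "p \<in> U \<times> V" using tops by simp
    then show "?\<Phi> p \<in> topspace ?E" using im by blast
  next
    fix i
    have 1: "continuous_map (prod_topology (subtopology T1 U) (subtopology T2 V)) euclideanreal (\<lambda>p. \<phi> (fst p) i)"
      using continuous_map_compose[OF continuous_map_fst[of "subtopology T1 U" "subtopology T2 V"]
          continuous_map_compose[OF is_chart_continuous[OF c] continuous_map_Euclidean_coordinate]] by (simp add: o_def)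
    have 2: "continuous_map (prod_topology (subtopology T1 U) (subtopology T2 V)) euclideanreal (\<lambda>p. \<psi> (snd p) (i - n))"
      using continuous_map_compose[OF continuous_map_snd[of "subtopology T1 U" "subtopology T2 V"]
          continuous_map_compose[OF is_chart_continuous[OF d] continuous_map_Euclidean_coordinate]] by (simp add: o_def)
    show "continuous_map (prod_topology (subtopology T1 U) (subtopology T2 V)) euclideanreal (\<lambda>p. ?\<Phi> p i)"
      using 1 2 by (cases "i < n") (simp_all add: prod_coords_def case_prod_beta)
  qed
  have "homeomorphic_maps (prod_topology (subtopology T1 U) (subtopology T2 V)) (subtopology ?E (?\<Phi> ` (U \<times> V)))
     ?\<Phi> (\<lambda>z. (g1 (split_fst n z), g2 (split_snd n m z)))"
    unfolding homeomorphic_maps_def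
  proof (intro conjI ballI)
    show "continuous_map (prod_topology (subtopology T1 U) (subtopology T2 V)) (subtopology ?E (?\<Phi> ` (U \<times> V))) ?\<Phi>"
      using cont\<Phi> tops by (auto simp: continuous_map_in_subtopology)
    have "continuous_map (subtopology ?E (?\<Phi> ` (U \<times> V))) (subtopology (Euclidean_space n) (\<phi> ` U)) (split_fst n)"
      "continuous_map (subtopology ?E (?\<Phi> ` (U \<times> V))) (subtopology (Euclidean_space m) (\<psi> ` V)) (split_snd n m)"
      by (intro continuous_map_into_subtopology continuous_map_from_subtopology continuous_map_split;
          use top1 im in auto)+
    then have "continuous_map (subtopology ?E (?\<Phi> ` (U \<times> V))) (subtopology T1 U) (g1 \<circ> split_fst n)"
      "continuous_map (subtopology ?E (?\<Phi> ` (U \<times> V))) (subtopology T2 V) (g2 \<circ> split_snd n m)"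
      using g1 g2 continuous_map_compose unfolding homeomorphic_maps_def by blast+
    then show "continuous_map (subtopology ?E (?\<Phi> ` (U \<times> V))) (prod_topology (subtopology T1 U) (subtopology T2 V))
       (\<lambda>z. (g1 (split_fst n z), g2 (split_snd n m z)))"
      by (simp add: continuous_map_paired o_def)
  next
    fix p assume "p \<in> topspace (prod_topology (subtopology T1 U) (subtopology T2 V))"
    then have "p \<in> U \<times> V" using tops by simp
    then obtain x y where p: "p = (x, y)" "x \<in> U" "y \<in> V" by blast
    then show "(g1 (split_fst n (?\<Phi> p)), g2 (split_snd n m (?\<Phi> p))) = p"
      using g1 g2 tops prod_coords_split[of \<phi> x n \<psi> y m] chart_topspace[OF c p(2)] chart_topspace[OF d p(3)]
      by (simp add: homeomorphic_maps_def)
  next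
    fix z assume "z \<in> topspace (subtopology ?E (?\<Phi> ` (U \<times> V)))"
    then have z: "z \<in> topspace ?E" "split_fst n z \<in> \<phi> ` U" "split_snd n m z \<in> \<psi> ` V"
      unfolding top1 im by auto
    show "?\<Phi> (g1 (split_fst n z), g2 (split_snd n m z)) = z"
      by (rule prod_coords_eq[OF z(1)]) (use g1 g2 tops z(2,3) in \<open>auto simp: homeomorphic_maps_def\<close>)
  qed
  then have "homeomorphic_map (subtopology (prod_topology T1 T2) (U \<times> V)) (subtopology ?E (?\<Phi> ` (U \<times> V))) ?\<Phi>"
    unfolding sub homeomorphic_map_maps by blast
  then show ?thesis
    using o is_chart_open[OF c] is_chart_open[OF d] by (simp add: is_chart_def openin_prod_Times_iff)
qed

lemma smooth_eucl_prod_transition: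
  assumes c: "is_chart T1 (n, U, \<phi>)" and d: "is_chart T2 (m, V, \<psi>)"
    and c': "is_chart T1 (n', U', \<phi>')" and d': "is_chart T2 (m', V', \<psi>')"
    and cc': "compatible (n, U, \<phi>) (n', U', \<phi>')" and dd': "compatible (m, V, \<psi>) (m', V', \<psi>')"
  shows "smooth_eucl (n + m) (prod_coords n \<phi> \<psi> ` ((U \<times> V) \<inter> (U' \<times> V'))) (n' + m')
     (prod_coords n' \<phi>' \<psi>' \<circ> inv_into (U \<times> V) (prod_coords n \<phi> \<psi>))"
proof -
  let ?\<Phi> = "prod_coords n \<phi> \<psi>" and ?S = "(U \<inter> U') \<times> (V \<inter> V')"
  note p = is_chart_prod[OF c d]
  have S: "(U \<times> V) \<inter> (U' \<times> V') = ?S" by auto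
  have oUV: "openin T1 (U \<inter> U')" "openin T2 (V \<inter> V')"
    using is_chart_open[OF c] is_chart_open[OF c'] is_chart_open[OF d] is_chart_open[OF d'] by auto
  have oS: "openin (Euclidean_space (n + m)) (?\<Phi> ` ?S)"
    by (rule is_chart_image_open[OF p]) (use oUV in \<open>auto simp: openin_prod_Times_iff\<close>)
  have oI: "openin (Euclidean_space n) (\<phi> ` (U \<inter> U'))" "openin (Euclidean_space m) (\<psi> ` (V \<inter> V'))"
    using is_chart_image_open[OF c oUV(1)] is_chart_image_open[OF d oUV(2)] by auto
  note im = prod_coords_image[OF c d, of "U \<inter> U'" "V \<inter> V'"]
  have 1: "smooth_eucl (n + m) (?\<Phi> ` ?S) n' (\<lambda>z. (\<phi>' \<circ> inv_into U \<phi>) (split_fst n z))"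
    by (rule smooth_eucl_compose[OF oS oI(1) cc'[unfolded compatible_iff, THEN conjunct1] smooth_eucl_split(1)]) (use im in blast)
  have 2: "smooth_eucl (n + m) (?\<Phi> ` ?S) m' (\<lambda>z. (\<psi>' \<circ> inv_into V \<psi>) (split_snd n m z))"
    by (rule smooth_eucl_compose[OF oS oI(2) dd'[unfolded compatible_iff, THEN conjunct1] smooth_eucl_split(2)]) (use im in blast)
  have "smooth_eucl (n + m) (?\<Phi> ` ?S) (n' + m')
     (\<lambda>z i. if i < n' + m' then if i < n' then (\<phi>' \<circ> inv_into U \<phi>) (split_fst n z) i else (\<psi>' \<circ> inv_into V \<psi>) (split_snd n m z) (i - n') else 0)"
    (is "smooth_eucl _ _ _ ?f")
  proof (rule smooth_eucl_coords)
    fix j assume "j < n' + m'"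
    then show "smooth_fn (n + m) (?\<Phi> ` ?S) (\<lambda>z. if j < n' then (\<phi>' \<circ> inv_into U \<phi>) (split_fst n z) j else (\<psi>' \<circ> inv_into V \<psi>) (split_snd n m z) (j - n'))"
      using 1 2 by (cases "j < n'") (simp_all add: smooth_eucl_iff)
  qed
  moreover have "?f z = (prod_coords n' \<phi>' \<psi>' \<circ> inv_into (U \<times> V) ?\<Phi>) z" if zS: "z \<in> ?\<Phi> ` ?S" for z
  proof -
    obtain x y where z: "z = ?\<Phi> (x, y)" "x \<in> U" "x \<in> U'" "y \<in> V" "y \<in> V'" using zS by blast
    have "inv_into (U \<times> V) ?\<Phi> z = (x, y)"
      unfolding z by (rule inv_into_f_f[OF is_chart_inj[OF p]]) (use z in auto)
    moreover have "split_fst n z = \<phi> x" "split_snd n m z = \<psi> y"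
      using prod_coords_split[of \<phi> x n \<psi> y m] chart_topspace[OF c z(2)] chart_topspace[OF d z(4)] by (simp_all add: z)
    moreover have "inv_into U \<phi> (\<phi> x) = x" "inv_into V \<psi> (\<psi> y) = y"
      using z is_chart_inj[OF c] is_chart_inj[OF d] by simp_all
    ultimately have 3: "(prod_coords n' \<phi>' \<psi>' \<circ> inv_into (U \<times> V) ?\<Phi>) z = prod_coords n' \<phi>' \<psi>' (x, y)"
      "(\<phi>' \<circ> inv_into U \<phi>) (split_fst n z) = \<phi>' x" "(\<psi>' \<circ> inv_into V \<psi>) (split_snd n m z) = \<psi>' y"
      by (simp_all only: o_apply)
    show ?thesis
      unfolding 3 using chart_topspace[OF c' z(3)] chart_topspace[OF d' z(5)]
      by (auto simp: prod_coords_def topspace_Euclidean_space)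
  qed
  ultimately show ?thesis unfolding S by (rule smooth_eucl_cong[OF oS, rotated])
qed

lemma prod_chart_in_atlas:
  assumes M: "locally_euclidean M" and N: "locally_euclidean N"
    and c: "(n, U, \<phi>) \<in> atlas M" and d: "(m, V, \<psi>) \<in> atlas N"
  shows "(n + m, U \<times> V, prod_coords n \<phi> \<psi>) \<in> atlas (prod_mfd M N)"
  unfolding prod_mfd_def max_atlas_def
proof (simp, intro conjI allI impI)
  show "is_chart (prod_topology (mtop M) (mtop N)) (n + m, U \<times> V, prod_coords n \<phi> \<psi>)"
    by (rule is_chart_prod[OF atlas_is_chart[OF M c] atlas_is_chart[OF N d]])
  fix a U' a' assume "\<exists>n U \<phi> m. a = n + m \<and> (\<exists>V. U' = U \<times> V \<and>
      (\<exists>\<psi>. a' = (\<lambda>(x, y) i. if i < n then \<phi> x i else \<psi> y (i - n)) \<and> (n, U, \<phi>) \<in> atlas M \<and> (m, V, \<psi>) \<in> atlas N))"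
  then obtain n' V' \<phi>' m' W' \<psi>' where e: "a = n' + m'" "U' = V' \<times> W'" "a' = prod_coords n' \<phi>' \<psi>'"
    "(n', V', \<phi>') \<in> atlas M" "(m', W', \<psi>') \<in> atlas N"
    unfolding prod_coords_def by blast
  note ch = atlas_is_chart[OF M c] atlas_is_chart[OF N d] atlas_is_chart[OF M e(4)] atlas_is_chart[OF N e(5)]
  note co = atlas_compatible[OF M c e(4)] atlas_compatible[OF N d e(5)]
  show "compatible (n + m, U \<times> V, prod_coords n \<phi> \<psi>) (a, U', a')"
    unfolding e compatible_iff
    using smooth_eucl_prod_transition[OF ch co]
      smooth_eucl_prod_transition[OF ch(3,4,1,2) co[THEN compatible_sym]]
    by (simp add: Int_commute)
qed

text \<open>In a product chart the pair of \<open>a\<close> and \<open>b\<close> is smooth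
  coordinate by coordinate. This is what makes a pointwise product of smooth families in a Lie group
  smooth.\<close>

lemma smooth_map_prod_compose:
  assumes M: "locally_euclidean M" and N: "locally_euclidean N" and L: "locally_euclidean L"
    and W: "openin (Euclidean_space k) W"
    and f: "smooth_map (prod_mfd M N) L f"
    and a: "smooth_map (open_sub (eucl_mfd k) W) M a" and b: "smooth_map (open_sub (eucl_mfd k) W) N b"
  shows "smooth_map (open_sub (eucl_mfd k) W) L (\<lambda>u. f (a u, b u))"
  unfolding smooth_map_eucl_iff[OF W L]
proof
  have ca: "continuous_map (subtopology (Euclidean_space k) W) (mtop M) a" and cb: "continuous_map (subtopology (Euclidean_space k) W) (mtop N) b"
    using smooth_map_continuous[OF a] smooth_map_continuous[OF b] by auto
  have cf: "continuous_map (prod_topology (mtop M) (mtop N)) (mtop L) f"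
    using smooth_map_continuous[OF f] by (simp add: prod_mfd_def)
  have cab: "continuous_map (subtopology (Euclidean_space k) W) (prod_topology (mtop M) (mtop N)) (\<lambda>u. (a u, b u))"
    using ca cb by (simp add: continuous_map_paired)
  show cont: "continuous_map (subtopology (Euclidean_space k) W) (mtop L) (\<lambda>u. f (a u, b u))"
    using continuous_map_compose[OF cab cf] by (simp add: o_def)
  have topW: "topspace (subtopology (Euclidean_space k) W) = W" using openin_subset[OF W] by auto
  have oW: "openin (subtopology (Euclidean_space k) W) W" using topW openin_topspace by metis
  show "\<forall>(l, Z, \<kappa>)\<in>atlas L. smooth_eucl k (W \<inter> (\<lambda>u. f (a u, b u)) -` Z) l (\<kappa> \<circ> (\<lambda>u. f (a u, b u)))"
  proof clarify
    fix l Z \<kappa> assume z: "(l, Z, \<kappa>) \<in> atlas L"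
    note oZ = is_chart_open[OF atlas_is_chart[OF L z]]
    show "smooth_eucl k (W \<inter> (\<lambda>u. f (a u, b u)) -` Z) l (\<kappa> \<circ> (\<lambda>u. f (a u, b u)))"
    proof (rule smooth_eucl_local)
      have "openin (subtopology (Euclidean_space k) W) (W \<inter> (\<lambda>u. f (a u, b u)) -` Z)"
        by (rule openin_preimage_Int[OF cont oW oZ])
      then show o: "openin (Euclidean_space k) (W \<inter> (\<lambda>u. f (a u, b u)) -` Z)" using W openin_trans_full by blast
      fix u assume u: "u \<in> W \<inter> (\<lambda>u. f (a u, b u)) -` Z"
      have "a u \<in> pts M" "b u \<in> pts N"
        using smooth_map_pts[OF a, of u] smooth_map_pts[OF b, of u] u topW by auto
      then obtain p U \<phi> q V \<psi> where c: "(p, U, \<phi>) \<in> atlas M" "a u \<in> U" and d: "(q, V, \<psi>) \<in> atlas N" "b u \<in> V"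
        using chart_at[OF M] chart_at[OF N] by metis
      note c' = atlas_is_chart[OF M c(1)] and d' = atlas_is_chart[OF N d(1)]
      let ?\<Phi> = "prod_coords p \<phi> \<psi>"
      note P = is_chart_prod[OF c' d']
      define S where "S = (U \<times> V) \<inter> f -` Z"
      have oS: "openin (prod_topology (mtop M) (mtop N)) S"
        unfolding S_def by (rule openin_preimage_Int[OF cf is_chart_open[OF P] oZ])
      have F: "smooth_eucl (p + q) (?\<Phi> ` S) l (\<kappa> \<circ> f \<circ> inv_into (U \<times> V) ?\<Phi>)"
        unfolding S_def by (rule smooth_mapD[OF f prod_chart_in_atlas[OF M N c(1) d(1)] z])
      have o\<Phi>: "openin (Euclidean_space (p + q)) (?\<Phi> ` S)"
        by (rule is_chart_image_open[OF P oS]) (simp add: S_def)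
      define W' where "W' = W \<inter> (\<lambda>u. (a u, b u)) -` S"
      have "openin (subtopology (Euclidean_space k) W) W'"
        unfolding W'_def by (rule openin_preimage_Int[OF cab oW oS])
      then have oW': "openin (Euclidean_space k) W'" using W openin_trans_full by blast
      have sa: "smooth_eucl k (W \<inter> a -` U) p (\<phi> \<circ> a)" and sb: "smooth_eucl k (W \<inter> b -` V) q (\<psi> \<circ> b)"
        using a b c(1) d(1) unfolding smooth_map_eucl_iff[OF W M] smooth_map_eucl_iff[OF W N] by auto
      have sa': "smooth_eucl k W' p (\<phi> \<circ> a)" and sb': "smooth_eucl k W' q (\<psi> \<circ> b)"
        by (rule smooth_eucl_subset[OF sa] smooth_eucl_subset[OF sb]; auto simp: W'_def S_def)+
      have "smooth_eucl k W' (p + q) (\<lambda>u i. if i < p + q then if i < p then \<phi> (a u) i else \<psi> (b u) (i - p) else 0)"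
      proof (rule smooth_eucl_coords)
        fix j assume "j < p + q"
        then show "smooth_fn k W' (\<lambda>x. if j < p then \<phi> (a x) j else \<psi> (b x) (j - p))"
          using sa' sb' by (cases "j < p") (simp_all add: smooth_eucl_iff)
      qed
      then have "smooth_eucl k W' (p + q) (\<lambda>u. ?\<Phi> (a u, b u))"
      proof (rule smooth_eucl_cong[OF oW', rotated])
        fix v assume "v \<in> W'"
        then have "\<psi> (b v) \<in> topspace (Euclidean_space q)" by (intro chart_topspace[OF d']) (auto simp: W'_def S_def)
        then show "(\<lambda>i. if i < p + q then if i < p then \<phi> (a v) i else \<psi> (b v) (i - p) else 0) = ?\<Phi> (a v, b v)"
          by (auto simp: prod_coords_def topspace_Euclidean_space fun_eq_iff)
      qed
      from smooth_eucl_compose[OF oW' o\<Phi> F this]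
      have "smooth_eucl k W' l (\<lambda>u. (\<kappa> \<circ> f \<circ> inv_into (U \<times> V) ?\<Phi>) (?\<Phi> (a u, b u)))" by (auto simp: W'_def)
      then have "smooth_eucl k W' l (\<kappa> \<circ> (\<lambda>u. f (a u, b u)))"
        by (rule smooth_eucl_cong[OF oW', rotated])
          (auto simp: W'_def S_def inv_into_f_f[OF is_chart_inj[OF P]])
      then show "\<exists>W. openin (Euclidean_space k) W \<and> u \<in> W \<and> smooth_eucl k W l (\<kappa> \<circ> (\<lambda>u. f (a u, b u)))"
        using oW' u c(2) d(2) by (intro exI[of _ W']) (auto simp: W'_def S_def)
    qed
  qed
qed

section \<open>Paths and thin homotopies\<close>

lemma smooth_fromE:
  assumes "smooth_from k A M f" "a \<in> A"
  obtains W g where "openin (Euclidean_space k) W" "a \<in> W" "smooth_map (open_sub (eucl_mfd k) W) M g"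
    "\<And>y. y \<in> A \<Longrightarrow> y \<in> W \<Longrightarrow> g y = f y"
  using assms unfolding smooth_from_def by blast

lemma smooth_from_topspace: "smooth_from k A M f \<Longrightarrow> A \<subseteq> topspace (Euclidean_space k)"
  by (simp add: smooth_from_def)

lemma smooth_from_pts:
  assumes "smooth_from k A M f" "a \<in> A" shows "f a \<in> pts M"
proof -
  obtain W g where "openin (Euclidean_space k) W" "a \<in> W" "smooth_map (open_sub (eucl_mfd k) W) M g"
    "\<And>y. y \<in> A \<Longrightarrow> y \<in> W \<Longrightarrow> g y = f y" using smooth_fromE[OF assms] by blast
  then show ?thesis
    using smooth_map_pts[of "open_sub (eucl_mfd k) W" M g a] pts_open_sub[of "eucl_mfd k" W] assms(2)
    by (metis mtop_eucl)
qed

lemma openin_preimage_eucl: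
  assumes "openin (Euclidean_space k) W" "continuous_map (subtopology (Euclidean_space k) W) Y g" "openin Y U"
  shows "openin (Euclidean_space k) (W \<inter> g -` U)"
proof -
  have "topspace (subtopology (Euclidean_space k) W) = W" using openin_subset[OF assms(1)] by auto
  then have "openin (subtopology (Euclidean_space k) W) W" using openin_topspace by metis
  then have "openin (subtopology (Euclidean_space k) W) (W \<inter> g -` U)"
    by (rule openin_preimage_Int[OF assms(2) _ assms(3)])
  then show ?thesis using assms(1) openin_trans_full by blast
qed

lemma smooth_from_nhd:
  assumes f: "smooth_from k A M f" "a \<in> A" and U: "openin (mtop M) U" "f a \<in> U"
  obtains W where "openin (Euclidean_space k) W" "a \<in> W" "\<And>y. y \<in> A \<Longrightarrow> y \<in> W \<Longrightarrow> f y \<in> U"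
proof -
  obtain W g where W: "openin (Euclidean_space k) W" "a \<in> W" "smooth_map (open_sub (eucl_mfd k) W) M g"
    "\<And>y. y \<in> A \<Longrightarrow> y \<in> W \<Longrightarrow> g y = f y" using smooth_fromE[OF f] by blast
  have c: "continuous_map (subtopology (Euclidean_space k) W) (mtop M) g" using smooth_map_continuous[OF W(3)] by simp
  show ?thesis
    by (rule that[OF openin_preimage_eucl[OF W(1) c U(1)]]) (use W f(2) U(2) in force)+
qed

text \<open>A local extension of \<open>K\<close> around \<open>h a\<close>, precomposed with
  \<open>h\<close>, is a local extension of \<open>G\<close> around \<open>a\<close>. The data
  \<open>W\<close>, \<open>K\<close>, \<open>h\<close> may vary with the point, which is the form
  needed for pasted maps.\<close>

lemma smooth_from_local_compose:
  assumes M: "locally_euclidean M" and A: "A \<subseteq> topspace (Euclidean_space k)"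
    and loc: "\<And>a. a \<in> A \<Longrightarrow> \<exists>W j B K h. openin (Euclidean_space k) W \<and> a \<in> W \<and> smooth_from j B M K \<and>
      smooth_eucl k W j h \<and> (\<forall>y\<in>A \<inter> W. h y \<in> B \<and> G y = K (h y))"
  shows "smooth_from k A M G"
  unfolding smooth_from_def
proof (intro conjI ballI A)
  fix a assume a: "a \<in> A"
  then obtain W j B K h where W: "openin (Euclidean_space k) W" "a \<in> W" "smooth_from j B M K"
      "smooth_eucl k W j h" "\<And>y. y \<in> A \<Longrightarrow> y \<in> W \<Longrightarrow> h y \<in> B \<and> G y = K (h y)" using loc[OF a] by blast
  have "h a \<in> B" using W a by blast
  then obtain W' g where g: "openin (Euclidean_space j) W'" "h a \<in> W'" "smooth_map (open_sub (eucl_mfd j) W') M g"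
    "\<And>y. y \<in> B \<Longrightarrow> y \<in> W' \<Longrightarrow> g y = K y" using smooth_fromE[OF W(3)] by blast
  have o: "openin (Euclidean_space k) (W \<inter> h -` W')"
    by (rule openin_preimage_eucl[OF W(1) smooth_eucl_continuous[OF W(4)] g(1)])
  have "smooth_map (open_sub (eucl_mfd k) (W \<inter> h -` W')) M (\<lambda>x. g (h x))"
    by (rule smooth_map_eucl_compose[OF o g(1) M smooth_eucl_subset[OF W(4)] _ g(3)]) auto
  moreover have "g (h y) = G y" if "y \<in> A \<inter> (W \<inter> h -` W')" for y using that W(5)[of y] g(4)[of "h y"] by auto
  ultimately show "\<exists>W g. openin (Euclidean_space k) W \<and> a \<in> W \<and> smooth_map (open_sub (eucl_mfd k) W) M g \<and> (\<forall>y\<in>A \<inter> W. g y = G y)"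
    using o W(2) g(2) by (intro exI[of _ "W \<inter> h -` W'"] exI[of _ "\<lambda>x. g (h x)"]) auto
qed

lemma smooth_from_compose:
  assumes M: "locally_euclidean M" and A: "A \<subseteq> W" and W: "openin (Euclidean_space k) W"
    and K: "smooth_from j B M K" and h: "smooth_eucl k W j h" "\<And>y. y \<in> A \<Longrightarrow> h y \<in> B" "\<And>y. y \<in> A \<Longrightarrow> G y = K (h y)"
  shows "smooth_from k A M G"
proof (rule smooth_from_local_compose[OF M])
  show "A \<subseteq> topspace (Euclidean_space k)" using A openin_subset[OF W] by blast
  show "\<exists>W j B K h. openin (Euclidean_space k) W \<and> a \<in> W \<and> smooth_from j B M K \<and>
      smooth_eucl k W j h \<and> (\<forall>y\<in>A \<inter> W. h y \<in> B \<and> G y = K (h y))" if "a \<in> A" for a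
  proof -
    have "\<forall>y\<in>A \<inter> W. h y \<in> B \<and> G y = K (h y)" using h(2,3) by blast
    moreover have "a \<in> W" using that A by blast
    ultimately show ?thesis
      using W K h(1) by (intro exI[of _ W] exI[of _ j] exI[of _ B] exI[of _ K] exI[of _ h]) simp
  qed
qed

lemma smooth_from_cong:
  assumes "smooth_from k A M f" "\<And>x. x \<in> A \<Longrightarrow> f x = g x"
  shows "smooth_from k A M g"
  using assms unfolding smooth_from_def by (metis IntD1)

lemma smooth_from_subset: "smooth_from k A M f \<Longrightarrow> B \<subseteq> A \<Longrightarrow> smooth_from k B M f"
  unfolding smooth_from_def
proof (intro conjI ballI)
  fix a assume *: "A \<subseteq> topspace (Euclidean_space k) \<and> (\<forall>a\<in>A. \<exists>W g. openin (Euclidean_space k) W \<and> a \<in> W \<and>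
     smooth_map (open_sub (eucl_mfd k) W) M g \<and> (\<forall>y\<in>A \<inter> W. g y = f y))" "B \<subseteq> A" "a \<in> B"
  then obtain W g where "openin (Euclidean_space k) W" "a \<in> W" "smooth_map (open_sub (eucl_mfd k) W) M g" "\<forall>y\<in>A \<inter> W. g y = f y"
    by blast
  then show "\<exists>W g. openin (Euclidean_space k) W \<and> a \<in> W \<and> smooth_map (open_sub (eucl_mfd k) W) M g \<and> (\<forall>y\<in>B \<inter> W. g y = f y)"
    using *(2) by (intro exI[of _ W] exI[of _ g]) auto
qed auto

lemma smooth_from_postcompose:
  assumes M: "locally_euclidean M" and N: "locally_euclidean N" and f: "smooth_map M N f" and K: "smooth_from k A M K"
  shows "smooth_from k A N (\<lambda>x. f (K x))"
  unfolding smooth_from_def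
proof (intro conjI ballI)
  fix a assume "a \<in> A"
  then obtain W g where W: "openin (Euclidean_space k) W" "a \<in> W" "smooth_map (open_sub (eucl_mfd k) W) M g"
    "\<And>y. y \<in> A \<Longrightarrow> y \<in> W \<Longrightarrow> g y = K y" using smooth_fromE[OF K] by blast
  have "smooth_map (open_sub (eucl_mfd k) W) N (\<lambda>x. f (g x))"
    by (rule smooth_map_compose[OF locally_euclidean_open_eucl[OF W(1)] M N W(3) f])
  then show "\<exists>W g. openin (Euclidean_space k) W \<and> a \<in> W \<and> smooth_map (open_sub (eucl_mfd k) W) N g \<and> (\<forall>y\<in>A \<inter> W. g y = f (K y))"
    using W by (intro exI[of _ W] exI[of _ "\<lambda>x. f (g x)"]) auto
qed (rule smooth_from_topspace[OF K])

text \<open>The values lie in \<open>U\<close> only on \<open>A\<close>; a local extension may leave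
  \<open>U\<close> and is cut down to the open preimage of \<open>U\<close>.\<close>

lemma smooth_from_corestrict:
  assumes K: "smooth_from k A M K" and U: "openin (mtop M) U" "\<And>x. x \<in> A \<Longrightarrow> K x \<in> U"
  shows "smooth_from k A (open_sub M U) K"
  unfolding smooth_from_def
proof (intro conjI ballI)
  fix a assume a: "a \<in> A"
  then obtain W g where W: "openin (Euclidean_space k) W" "a \<in> W" "smooth_map (open_sub (eucl_mfd k) W) M g"
    "\<And>y. y \<in> A \<Longrightarrow> y \<in> W \<Longrightarrow> g y = K y" using smooth_fromE[OF K] by blast
  have c: "continuous_map (subtopology (Euclidean_space k) W) (mtop M) g" using smooth_map_continuous[OF W(3)] by simp
  have "smooth_map (open_sub (eucl_mfd k) (W \<inter> g -` U)) (open_sub M U) g"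
    by (rule smooth_map_corestrict[OF smooth_map_eucl_subset[OF W(3)]]) auto
  then show "\<exists>W g. openin (Euclidean_space k) W \<and> a \<in> W \<and> smooth_map (open_sub (eucl_mfd k) W) (open_sub M U) g \<and> (\<forall>y\<in>A \<inter> W. g y = K y)"
    using W a U openin_preimage_eucl[OF W(1) c U(1)] by (intro exI[of _ "W \<inter> g -` U"] exI[of _ g]) auto
qed (rule smooth_from_topspace[OF K])

lemma smooth_from_extend:
  assumes M: "locally_euclidean M" and U: "openin (mtop M) U" and K: "smooth_from k A (open_sub M U) K"
  shows "smooth_from k A M K"
  using smooth_from_postcompose[OF locally_euclidean_open_sub[OF M U] M smooth_map_restrict[OF smooth_map_id[OF M]] K] .

lemma smooth_from_const:
  assumes M: "locally_euclidean M" and "x \<in> pts M" "A \<subseteq> topspace (Euclidean_space k)"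
  shows "smooth_from k A M (\<lambda>_. x)"
  unfolding smooth_from_def
proof (intro conjI ballI assms)
  fix a assume "a \<in> A"
  then show "\<exists>W g. openin (Euclidean_space k) W \<and> a \<in> W \<and> smooth_map (open_sub (eucl_mfd k) W) M g \<and> (\<forall>y\<in>A \<inter> W. g y = x)"
    using smooth_map_const[OF locally_euclidean_open_eucl[of k "topspace (Euclidean_space k)"] M assms(2)] assms(3)
    by (intro exI[of _ "topspace (Euclidean_space k)"] exI[of _ "\<lambda>_. x"]) auto
qed

definition vec1 :: "real \<Rightarrow> nat \<Rightarrow> real" where
  "vec1 t = (\<lambda>i. if i = 0 then t else 0)"

definition vec2 :: "real \<Rightarrow> real \<Rightarrow> nat \<Rightarrow> real" where
  "vec2 s t = (\<lambda>i. if i = 0 then s else if i = 1 then t else 0)"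

lemma vec2_simps [simp]: "vec2 s t 0 = s" "vec2 s t 1 = t" "vec2 s t (Suc 0) = t" "vec1 t 0 = t"
  by (simp_all add: vec2_def vec1_def)

lemma vec_topspace [simp]: "vec2 s t \<in> topspace (Euclidean_space 2)" "vec1 t \<in> topspace (Euclidean_space 1)"
  "vec1 t \<in> topspace (Euclidean_space (Suc 0))"
  by (auto simp: vec2_def vec1_def topspace_Euclidean_space)

lemma vec2_eq: "x \<in> topspace (Euclidean_space 2) \<Longrightarrow> vec2 (x 0) (x 1) = x"
  by (auto simp: vec2_def topspace_Euclidean_space)

lemma vec2_upd: "(vec2 s t)(0 := r) = vec2 r t" "(vec2 s t)(1 := r) = vec2 s r" "(vec2 s t)(Suc 0 := r) = vec2 s r"
  by (auto simp: vec2_def)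

lemma smooth_eucl_vec:
  assumes "smooth_fn k W f"
  shows "smooth_eucl k W 1 (\<lambda>x. vec1 (f x))" and "smooth_fn k W g \<Longrightarrow> smooth_eucl k W 2 (\<lambda>x. vec2 (f x) (g x))"
  using assms by (auto simp: smooth_eucl_iff less_2_cases_iff vec1_def vec2_def topspace_Euclidean_space image_subset_iff)

section \<open>Maps of the square of rank at most one\<close>

abbreviation I01 :: "real set" where "I01 \<equiv> {0..1}"

abbreviation unit_line :: "(nat \<Rightarrow> real) set" where
  "unit_line \<equiv> {x \<in> topspace (Euclidean_space 1). x 0 \<in> I01}"

abbreviation unit_square :: "(nat \<Rightarrow> real) set" where
  "unit_square \<equiv> {x \<in> topspace (Euclidean_space 2). x 0 \<in> I01 \<and> x 1 \<in> I01}"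

text \<open>Turns the rank condition into identities between 2 by 2 minors, which the chain rule can
  be applied to. A dependence between the columns kills all minors; conversely, a nonzero entry
  \<open>a k\<close> exhibits the second column as \<open>b k / a k\<close> times the first.\<close>

lemma rank_le_1_iff:
  fixes a b :: "nat \<Rightarrow> real"
  shows "vec_space.rank n (mat n 2 (\<lambda>(i, j). if j = 0 then a i else b i)) \<le> 1 \<longleftrightarrow> (\<forall>i<n. \<forall>j<n. a i * b j = a j * b i)"
    (is "vec_space.rank n ?A \<le> 1 \<longleftrightarrow> ?R")
proof
  have A: "?A \<in> carrier_mat n 2" by simp
  assume r: "vec_space.rank n ?A \<le> 1"
  have cols: "cols ?A = [col ?A 0, col ?A 1]" by (simp add: cols_def numeral_2_eq_2)
  show ?R
  \<comment> \<open>Linear dependence speaks of the set of columns, so two equal columns have to be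
    treated apart.\<close>
  proof (cases "distinct (cols ?A)")
    case False
    then have e: "col ?A 0 = col ?A 1" by (simp add: cols)
    have "a i = b i" if "i < n" for i
      using arg_cong[OF e, of "\<lambda>v. v $ i"] that by simp
    then show ?thesis by simp
  next
    case True
    have "module.lin_dep class_ring (module_vec TYPE(real) n) (set (cols ?A))"
      using vec_space.lin_indpt_full_rank[OF A True] r by fastforce
    then obtain v where v: "v \<in> carrier_vec 2" "v \<noteq> 0\<^sub>v 2" "?A *\<^sub>v v = 0\<^sub>v n"
      using vec_space.lin_depE[OF A _ True] by blast
    have eq: "a i * v $ 0 + b i * v $ 1 = 0" if "i < n" for i
    proof -
      have "(?A *\<^sub>v v) $ i = 0" using v(3) that by simp
      then show ?thesis using that v(1) by (simp add: scalar_prod_def numeral_2_eq_2)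
    qed
    have "v $ 0 \<noteq> 0 \<or> v $ 1 \<noteq> 0"
    proof (rule ccontr)
      assume "\<not> ?thesis"
      then have "v = 0\<^sub>v 2" using v(1) by (intro eq_vecI) (auto simp: less_2_cases_iff)
      then show False using v(2) by simp
    qed
    then show ?thesis
    proof (elim disjE; intro allI impI)
      fix i j assume ij: "i < n" "j < n" and nz: "v $ 0 \<noteq> 0"
      \<comment> \<open>Rows \<open>i\<close> and \<open>j\<close> of the relation
        \<open>?A *\<^sub>v v = 0\<close> are combined so that the other coordinate of
        \<open>v\<close> is eliminated.\<close>
      have "v $ 0 * (a i * b j - a j * b i) = (a i * v $ 0 + b i * v $ 1) * b j - (a j * v $ 0 + b j * v $ 1) * b i"
        by (simp add: algebra_simps)
      then show "a i * b j = a j * b i" using eq ij nz by simp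
    next
      fix i j assume ij: "i < n" "j < n" and nz: "v $ 1 \<noteq> 0"
      have "v $ 1 * (a i * b j - a j * b i) = a i * (a j * v $ 0 + b j * v $ 1) - a j * (a i * v $ 0 + b i * v $ 1)"
        by (simp add: algebra_simps)
      then show "a i * b j = a j * b i" using eq ij nz by simp
    qed
  qed
next
  have A: "?A \<in> carrier_mat n 2" by simp
  assume R: ?R
  show "vec_space.rank n ?A \<le> 1"
  proof (cases "\<forall>i<n. a i = 0")
    case True
    show ?thesis
      by (rule vec_space.rank_le_1_product_entries[OF A, where f = b and g = "\<lambda>j. if j = 0 then 0 else 1"])
        (use True in auto)
  next
    case False
    then obtain k where k: "k < n" "a k \<noteq> 0" by auto
    have "b i = a i * (b k / a k)" if "i < n" for i
      using R k that by (simp add: field_simps)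
    then show ?thesis
      by (intro vec_space.rank_le_1_product_entries[OF A, where f = a and g = "\<lambda>j. if j = 0 then 1 else b k / a k"]) auto
  qed
qed

text \<open>The part of a thin homotopy that is stable under composition, free of boundary and
  collar conditions.\<close>

definition thin_map :: "'m mfd \<Rightarrow> (real \<Rightarrow> real \<Rightarrow> 'm) \<Rightarrow> bool" where
  "thin_map M H \<longleftrightarrow> smooth_from 2 unit_square M (\<lambda>x. H (x 0) (x 1)) \<and>
     (\<forall>s\<in>I01. \<forall>t\<in>I01. \<forall>(n, U, \<phi>)\<in>atlas M. H s t \<in> U \<longrightarrow> vec_space.rank n (jacobian (n, U, \<phi>) H s t) \<le> 1)"

definition dfst :: "(real \<Rightarrow> real \<Rightarrow> 'm) \<Rightarrow> ('m \<Rightarrow> nat \<Rightarrow> real) \<Rightarrow> real \<Rightarrow> real \<Rightarrow> nat \<Rightarrow> real" where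
  "dfst H \<phi> s t i = vector_derivative (\<lambda>r. \<phi> (H r t) i) (at s within I01)"
definition dsnd :: "(real \<Rightarrow> real \<Rightarrow> 'm) \<Rightarrow> ('m \<Rightarrow> nat \<Rightarrow> real) \<Rightarrow> real \<Rightarrow> real \<Rightarrow> nat \<Rightarrow> real" where
  "dsnd H \<phi> s t i = vector_derivative (\<lambda>r. \<phi> (H s r) i) (at t within I01)"

lemma jacobian_rank_iff:
  "vec_space.rank n (jacobian (n, U, \<phi>) H s t) \<le> 1 \<longleftrightarrow>
    (\<forall>i<n. \<forall>j<n. dfst H \<phi> s t i * dsnd H \<phi> s t j = dfst H \<phi> s t j * dsnd H \<phi> s t i)"
  unfolding dfst_def dsnd_def by (subst rank_le_1_iff[symmetric]) (simp add: jacobian_def)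

lemma vector_derivative_I01:
  assumes "(f has_real_derivative D) (at s within I01)" "s \<in> I01"
  shows "vector_derivative f (at s within I01) = D"
  using vector_derivative_within_closed_interval[of 0 1 s f D] assms
  by (simp add: has_real_derivative_iff_has_vector_derivative)

lemma eventually_vec2_in_open:
  assumes W: "openin (Euclidean_space 2) W" "vec2 (h1 r0) (h2 r0) \<in> W"
    and h: "(h1 has_real_derivative d1) (at r0 within S)" "(h2 has_real_derivative d2) (at r0 within S)"
  shows "eventually (\<lambda>r. vec2 (h1 r) (h2 r) \<in> W) (at r0 within S)"
proof -
  obtain e where e: "e > 0" "\<And>y. y \<in> topspace (Euclidean_space 2) \<Longrightarrow> (\<And>i. i < 2 \<Longrightarrow> \<bar>y i - vec2 (h1 r0) (h2 r0) i\<bar> < e) \<Longrightarrow> y \<in> W"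
    using openin_Euclidean_box[OF W] by blast
  have "(h1 \<longlongrightarrow> h1 r0) (at r0 within S)" "(h2 \<longlongrightarrow> h2 r0) (at r0 within S)"
    using h has_field_derivative_imp_has_derivative has_derivative_continuous continuous_within by blast+
  then have "eventually (\<lambda>r. dist (h1 r) (h1 r0) < e) (at r0 within S)" "eventually (\<lambda>r. dist (h2 r) (h2 r0) < e) (at r0 within S)"
    using e(1) by (auto simp: tendsto_iff)
  then show ?thesis
    by eventually_elim (rule e(2), auto simp: less_2_cases_iff dist_real_def)
qed

lemma chart_partials:
  assumes M: "locally_euclidean M" and K: "smooth_from 2 unit_square M (\<lambda>x. K (x 0) (x 1))"
    and st: "s \<in> I01" "t \<in> I01" and c: "(n, U, \<phi>) \<in> atlas M" "K s t \<in> U"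
  obtains W f where "openin (Euclidean_space 2) W" "vec2 s t \<in> W"
    "\<And>s' t'. s' \<in> I01 \<Longrightarrow> t' \<in> I01 \<Longrightarrow> vec2 s' t' \<in> W \<Longrightarrow> K s' t' \<in> U \<and> (\<forall>i<n. \<phi> (K s' t') i = f i (vec2 s' t'))"
    "\<And>i. i < n \<Longrightarrow> smooth_fn 2 W (f i)"
proof -
  have "vec2 s t \<in> unit_square" using st by simp
  then obtain W g where W: "openin (Euclidean_space 2) W" "vec2 s t \<in> W" "smooth_map (open_sub (eucl_mfd 2) W) M g"
    "\<And>y. y \<in> unit_square \<Longrightarrow> y \<in> W \<Longrightarrow> g y = K (y 0) (y 1)" using smooth_fromE[OF K] by blast
  have g: "continuous_map (subtopology (Euclidean_space 2) W) (mtop M) g" "smooth_eucl 2 (W \<inter> g -` U) n (\<phi> \<circ> g)"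
    using W(3) c(1) unfolding smooth_map_eucl_iff[OF W(1) M] by auto
  have o: "openin (Euclidean_space 2) (W \<inter> g -` U)"
    by (rule openin_preimage_eucl[OF W(1) g(1) is_chart_open[OF atlas_is_chart[OF M c(1)]]])
  show ?thesis
  proof (rule that[OF o, of "\<lambda>i x. \<phi> (g x) i"])
    show "vec2 s t \<in> W \<inter> g -` U" using W(2) W(4)[of "vec2 s t"] st c(2) by simp
    fix s' t' assume "s' \<in> I01" "t' \<in> I01" "vec2 s' t' \<in> W \<inter> g -` U"
    then show "K s' t' \<in> U \<and> (\<forall>i<n. \<phi> (K s' t') i = \<phi> (g (vec2 s' t')) i)"
      using W(4)[of "vec2 s' t'"] by simp
  next
    fix i assume "i < n"
    then show "smooth_fn 2 (W \<inter> g -` U) (\<lambda>x. \<phi> (g x) i)" using g(2) by (simp add: smooth_eucl_iff)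
  qed
qed

text \<open>\<open>A\<close> and \<open>B\<close> are the partial derivatives at the point,
  characterized by their effect on all differentiable curves in the square, boundary points
  included. The one-sided partials of \<open>jacobian\<close> and the chain rule for
  reparametrizations are both instances.\<close>

definition square_chain ::
    "nat \<Rightarrow> ('m \<Rightarrow> nat \<Rightarrow> real) \<Rightarrow> (real \<Rightarrow> real \<Rightarrow> 'm) \<Rightarrow> real \<Rightarrow> real \<Rightarrow> (nat \<Rightarrow> real) \<Rightarrow> (nat \<Rightarrow> real) \<Rightarrow> bool" where
  "square_chain n \<phi> K s t A B \<longleftrightarrow> (\<forall>i h1 h2 d1 d2 r0. i < n \<longrightarrow> h1 r0 = s \<longrightarrow> h2 r0 = t \<longrightarrow> r0 \<in> I01 \<longrightarrow>
     eventually (\<lambda>r. h1 r \<in> I01 \<and> h2 r \<in> I01) (at r0 within I01) \<longrightarrow>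
     (h1 has_real_derivative d1) (at r0 within I01) \<longrightarrow> (h2 has_real_derivative d2) (at r0 within I01) \<longrightarrow>
     ((\<lambda>r. \<phi> (K (h1 r) (h2 r)) i) has_real_derivative (A i * d1 + B i * d2)) (at r0 within I01))"

text \<open>A smooth extension to an open set of the plane, read in the chart, supplies the partial
  derivatives; a curve that stays in the square does not see the difference between \<open>K\<close>
  and the extension.\<close>

lemma square_chain_rule:
  assumes M: "locally_euclidean M" and K: "smooth_from 2 unit_square M (\<lambda>x. K (x 0) (x 1))"
    and st: "s \<in> I01" "t \<in> I01" and c: "(n, U, \<phi>) \<in> atlas M" "K s t \<in> U"
  obtains A B where "square_chain n \<phi> K s t A B"
proof -
  obtain W f where W: "openin (Euclidean_space 2) W" "vec2 s t \<in> W"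
    "\<And>s' t'. s' \<in> I01 \<Longrightarrow> t' \<in> I01 \<Longrightarrow> vec2 s' t' \<in> W \<Longrightarrow> K s' t' \<in> U \<and> (\<forall>i<n. \<phi> (K s' t') i = f i (vec2 s' t'))"
    "\<And>i. i < n \<Longrightarrow> smooth_fn 2 W (f i)" using chart_partials[OF assms] by blast
  have "\<exists>g. partial_deriv W j (f i) g \<and> smooth_fn 2 W g" if "i < n" "j < 2" for i j
    using smooth_fn_partial[OF W(1) W(4)[OF that(1)] that(2)] by blast
  then obtain G where G: "\<And>i j. i < n \<Longrightarrow> j < 2 \<Longrightarrow> partial_deriv W j (f i) (G i j)" "\<And>i j. i < n \<Longrightarrow> j < 2 \<Longrightarrow> smooth_fn 2 W (G i j)"
    by metis
  show ?thesis
  proof (rule that[of "\<lambda>i. G i 0 (vec2 s t)" "\<lambda>i. G i 1 (vec2 s t)"], unfold square_chain_def, intro allI impI)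
    fix i h1 h2 d1 d2 and r0 :: real
    assume i: "i < n" and h0: "h1 r0 = s" "h2 r0 = t" and r0: "r0 \<in> I01"
      and ev: "eventually (\<lambda>r. h1 r \<in> I01 \<and> h2 r \<in> I01) (at r0 within I01)"
      and d: "(h1 has_real_derivative d1) (at r0 within I01)" "(h2 has_real_derivative d2) (at r0 within I01)"
    have "((\<lambda>r. f i (vec2 (h1 r) (h2 r))) has_real_derivative (\<Sum>j<2. G i j (vec2 (h1 r0) (h2 r0)) * (if j = 0 then d1 else d2))) (at r0 within I01)"
    proof (rule chain_rule_partials[OF W(1), where c = "\<lambda>r. vec2 (h1 r) (h2 r)" and g = "G i"])
      show "((\<lambda>r. vec2 (h1 r) (h2 r) j) has_real_derivative (if j = 0 then d1 else d2)) (at r0 within I01)" if "j < 2" for j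
        using that d by (auto simp: less_2_cases_iff)
      show "partial_deriv W j (f i) (G i j)" if "j < 2" for j by (rule G(1)[OF i that])
      show "continuous_map (subtopology (Euclidean_space 2) W) euclideanreal (G i j)" if "j < 2" for j
        by (rule smooth_fn_continuous[OF G(2)[OF i that]])
      show "vec2 (h1 r0) (h2 r0) \<in> W" using W(2) h0 by simp
    qed simp
    then have 1: "((\<lambda>r. f i (vec2 (h1 r) (h2 r))) has_real_derivative (G i 0 (vec2 s t) * d1 + G i 1 (vec2 s t) * d2)) (at r0 within I01)"
      by (simp add: numeral_2_eq_2 h0)
    have "eventually (\<lambda>r. vec2 (h1 r) (h2 r) \<in> W) (at r0 within I01)"
      by (rule eventually_vec2_in_open[OF W(1) _ d]) (use W(2) h0 in simp)
    with ev have ev': "eventually (\<lambda>r. f i (vec2 (h1 r) (h2 r)) = \<phi> (K (h1 r) (h2 r)) i) (at r0 within I01)"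
      by eventually_elim (use W(3) i in auto)
    show "((\<lambda>r. \<phi> (K (h1 r) (h2 r)) i) has_real_derivative (G i 0 (vec2 s t) * d1 + G i 1 (vec2 s t) * d2)) (at r0 within I01)"
      using has_field_derivative_cong_eventually[OF ev'] 1 W(2,3) st i h0 by auto
  qed
qed

text \<open>Multiplicativity of the 2 by 2 determinant: the difference of both sides is
  \<open>a * d - c * b\<close> times \<open>p * u - q * r\<close>.\<close>

lemma minor_combination:
  fixes a :: "'a :: comm_ring"
  assumes "a * d = c * b"
  shows "(a * p + b * q) * (c * r + d * u) = (c * p + d * q) * (a * r + b * u)"
proof -
  have "(a * p + b * q) * (c * r + d * u) - (c * p + d * q) * (a * r + b * u) = (a * d - c * b) * (p * u - q * r)"
    by (simp add: algebra_simps)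
  then show ?thesis using assms by simp
qed

lemma square_chainD:
  "square_chain n \<phi> K s t A B \<Longrightarrow> i < n \<Longrightarrow> h1 r0 = s \<Longrightarrow> h2 r0 = t \<Longrightarrow> r0 \<in> I01 \<Longrightarrow>
     eventually (\<lambda>r. h1 r \<in> I01 \<and> h2 r \<in> I01) (at r0 within I01) \<Longrightarrow>
     (h1 has_real_derivative d1) (at r0 within I01) \<Longrightarrow> (h2 has_real_derivative d2) (at r0 within I01) \<Longrightarrow>
     ((\<lambda>r. \<phi> (K (h1 r) (h2 r)) i) has_real_derivative (A i * d1 + B i * d2)) (at r0 within I01)"
  unfolding square_chain_def by blast

lemma square_chain_partials:
  assumes D: "square_chain n \<phi> K s t A B"
    and st: "s \<in> I01" "t \<in> I01" and i: "i < n"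
  shows "((\<lambda>r. \<phi> (K r t) i) has_real_derivative A i) (at s within I01)" "((\<lambda>r. \<phi> (K s r) i) has_real_derivative B i) (at t within I01)"
    "dfst K \<phi> s t i = A i" "dsnd K \<phi> s t i = B i"
proof -
  have I: "eventually (\<lambda>r. r \<in> I01) (at r0 within I01)" for r0 by (simp add: eventually_at_filter)
  show 1: "((\<lambda>r. \<phi> (K r t) i) has_real_derivative A i) (at s within I01)"
    using square_chainD[OF D i, of "\<lambda>r. r" s "\<lambda>r. t" 1 0] I[of s] st by simp
  show 2: "((\<lambda>r. \<phi> (K s r) i) has_real_derivative B i) (at t within I01)"
    using square_chainD[OF D i, of "\<lambda>r. s" t "\<lambda>r. r" 0 1] I[of t] st by simp
  show "dfst K \<phi> s t i = A i" "dsnd K \<phi> s t i = B i"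
    unfolding dfst_def dsnd_def using vector_derivative_I01[OF 1 st(1)] vector_derivative_I01[OF 2 st(2)] by auto
qed

lemma thin_map_smooth: "thin_map M H \<Longrightarrow> smooth_from 2 unit_square M (\<lambda>x. H (x 0) (x 1))"
  by (simp add: thin_map_def)

lemma thin_map_minors:
  "thin_map M H \<Longrightarrow> s \<in> I01 \<Longrightarrow> t \<in> I01 \<Longrightarrow> (n, U, \<phi>) \<in> atlas M \<Longrightarrow> H s t \<in> U \<Longrightarrow> i < n \<Longrightarrow> j < n \<Longrightarrow>
    dfst H \<phi> s t i * dsnd H \<phi> s t j = dfst H \<phi> s t j * dsnd H \<phi> s t i"
proof -
  assume H: "thin_map M H" and st: "s \<in> I01" "t \<in> I01" and c: "(n, U, \<phi>) \<in> atlas M" "H s t \<in> U" and ij: "i < n" "j < n"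
  have "\<forall>c\<in>atlas M. case c of (n, U, \<phi>) \<Rightarrow> H s t \<in> U \<longrightarrow> vec_space.rank n (jacobian (n, U, \<phi>) H s t) \<le> 1"
    using H st unfolding thin_map_def by blast
  from bspec[OF this c(1)] show ?thesis using c(2) ij by (simp only: jacobian_rank_iff prod.case)
qed

lemma thin_mapI:
  assumes "smooth_from 2 unit_square M (\<lambda>x. H (x 0) (x 1))"
    "\<And>s t n U \<phi> i j. s \<in> I01 \<Longrightarrow> t \<in> I01 \<Longrightarrow> (n, U, \<phi>) \<in> atlas M \<Longrightarrow> H s t \<in> U \<Longrightarrow> i < n \<Longrightarrow> j < n \<Longrightarrow>
    dfst H \<phi> s t i * dsnd H \<phi> s t j = dfst H \<phi> s t j * dsnd H \<phi> s t i"
  shows "thin_map M H"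
  unfolding thin_map_def
proof (intro conjI ballI assms(1))
  fix s t c assume "s \<in> I01" "t \<in> I01" "c \<in> atlas M"
  then show "case c of (n, U, \<phi>) \<Rightarrow> H s t \<in> U \<longrightarrow> vec_space.rank n (jacobian (n, U, \<phi>) H s t) \<le> 1"
    using assms(2) by (cases c) (simp only: jacobian_rank_iff prod.case, blast)
qed

text \<open>Thinness is inherited by composites with smooth maps of the square, because the rank of a product of
  matrices is at most the rank of each factor.\<close>

lemma thin_map_local_compose:
  assumes M: "locally_euclidean M"
    and loc: "\<And>s t. s \<in> I01 \<Longrightarrow> t \<in> I01 \<Longrightarrow> \<exists>W K h1 h2. openin (Euclidean_space 2) W \<and> vec2 s t \<in> W \<and> thin_map M K \<and>
      smooth_fn 2 W h1 \<and> smooth_fn 2 W h2 \<and>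
      (\<forall>s'\<in>I01. \<forall>t'\<in>I01. vec2 s' t' \<in> W \<longrightarrow> h1 (vec2 s' t') \<in> I01 \<and> h2 (vec2 s' t') \<in> I01 \<and>
         G s' t' = K (h1 (vec2 s' t')) (h2 (vec2 s' t')))"
  shows "thin_map M G"
proof (rule thin_mapI)
  show sm: "smooth_from 2 unit_square M (\<lambda>x. G (x 0) (x 1))"
  proof (rule smooth_from_local_compose[OF M])
    fix a assume a: "a \<in> unit_square"
    then obtain W K h1 h2 where W: "openin (Euclidean_space 2) W" "vec2 (a 0) (a 1) \<in> W" "thin_map M K"
      "smooth_fn 2 W h1" "smooth_fn 2 W h2"
      "\<forall>s'\<in>I01. \<forall>t'\<in>I01. vec2 s' t' \<in> W \<longrightarrow> h1 (vec2 s' t') \<in> I01 \<and> h2 (vec2 s' t') \<in> I01 \<and>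
         G s' t' = K (h1 (vec2 s' t')) (h2 (vec2 s' t'))" using loc[of "a 0" "a 1"] by auto
    have "\<forall>y\<in>unit_square \<inter> W. vec2 (h1 y) (h2 y) \<in> unit_square \<and> G (y 0) (y 1) = (\<lambda>x. K (x 0) (x 1)) (vec2 (h1 y) (h2 y))"
    proof
      fix y assume y: "y \<in> unit_square \<inter> W"
      then have "vec2 (y 0) (y 1) = y" using vec2_eq[of y] by blast
      then show "vec2 (h1 y) (h2 y) \<in> unit_square \<and> G (y 0) (y 1) = (\<lambda>x. K (x 0) (x 1)) (vec2 (h1 y) (h2 y))"
        using W(6)[rule_format, of "y 0" "y 1"] y by simp
    qed
    then show "\<exists>W j B K h. openin (Euclidean_space 2) W \<and> a \<in> W \<and> smooth_from j B M K \<and>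
      smooth_eucl 2 W j h \<and> (\<forall>y\<in>unit_square \<inter> W. h y \<in> B \<and> G (y 0) (y 1) = K (h y))"
      using W(1,2) vec2_eq[of a] a thin_map_smooth[OF W(3)] smooth_eucl_vec(2)[OF W(4,5)]
      by (intro exI[of _ W] exI[of _ 2] exI[of _ unit_square] exI[of _ "\<lambda>x. K (x 0) (x 1)"] exI[of _ "\<lambda>x. vec2 (h1 x) (h2 x)"])
        simp
  qed auto
  fix s t n U \<phi> i j
  assume st: "s \<in> I01" "t \<in> I01" and c: "(n, U, \<phi>) \<in> atlas M" "G s t \<in> U" and ij: "i < n" "j < n"
  obtain W K h1 h2 where W: "openin (Euclidean_space 2) W" "vec2 s t \<in> W" "thin_map M K"
      "smooth_fn 2 W h1" "smooth_fn 2 W h2"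
      "\<And>s' t'. s'\<in>I01 \<Longrightarrow> t'\<in>I01 \<Longrightarrow> vec2 s' t' \<in> W \<Longrightarrow> h1 (vec2 s' t') \<in> I01 \<and> h2 (vec2 s' t') \<in> I01 \<and>
         G s' t' = K (h1 (vec2 s' t')) (h2 (vec2 s' t'))" using loc[OF st] by blast
  define s0 t0 where "s0 = h1 (vec2 s t)" and "t0 = h2 (vec2 s t)"
  have st0: "s0 \<in> I01" "t0 \<in> I01" and cK: "K s0 t0 \<in> U" using W(6)[OF st W(2)] c(2) by (auto simp: s0_def t0_def)
  obtain A B where AB: "square_chain n \<phi> K s0 t0 A B"
    using square_chain_rule[OF M thin_map_smooth[OF W(3)] st0 c(1) cK] by blast
  note ABeq = square_chain_partials(3,4)[OF AB st0]
  have minor: "A i * B j = A j * B i"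
    using thin_map_minors[OF W(3) st0 c(1) cK ij] by (simp add: ABeq ij)
  obtain p1 q1 where p1: "partial_deriv W 0 h1 p1" and q1: "partial_deriv W 1 h1 q1"
    using smooth_fn_partial[OF W(1,4)] by (metis one_less_numeral_iff semiring_norm(76) zero_less_numeral)
  obtain p2 q2 where p2: "partial_deriv W 0 h2 p2" and q2: "partial_deriv W 1 h2 q2"
    using smooth_fn_partial[OF W(1,5)] by (metis one_less_numeral_iff semiring_norm(76) zero_less_numeral)
  have I: "eventually (\<lambda>r. r \<in> I01) (at r0 within I01)" for r0 by (simp add: eventually_at_filter)
  have ev1: "eventually (\<lambda>r. vec2 r t \<in> W) (at s within I01)"
    by (rule eventually_vec2_in_open[OF W(1,2) DERIV_ident DERIV_const])
  have ev2: "eventually (\<lambda>r. vec2 s r \<in> W) (at t within I01)"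
    by (rule eventually_vec2_in_open[OF W(1,2) DERIV_const DERIV_ident])
  have F: "dfst G \<phi> s t i = A i * p1 (vec2 s t) + B i * p2 (vec2 s t)" if i: "i < n" for i
  proof -
    have "((\<lambda>r. \<phi> (K (h1 (vec2 r t)) (h2 (vec2 r t))) i) has_real_derivative A i * p1 (vec2 s t) + B i * p2 (vec2 s t)) (at s within I01)"
    proof (rule square_chainD[OF AB i, where ?h1.0 = "\<lambda>r. h1 (vec2 r t)" and ?h2.0 = "\<lambda>r. h2 (vec2 r t)"])
      show "eventually (\<lambda>r. h1 (vec2 r t) \<in> I01 \<and> h2 (vec2 r t) \<in> I01) (at s within I01)"
        using ev1 I[of s] by eventually_elim (use W(6) st(2) in blast)
      show "((\<lambda>r. h1 (vec2 r t)) has_real_derivative p1 (vec2 s t)) (at s within I01)"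
        "((\<lambda>r. h2 (vec2 r t)) has_real_derivative p2 (vec2 s t)) (at s within I01)"
        using p1[unfolded partial_deriv_def, rule_format, OF W(2)] p2[unfolded partial_deriv_def, rule_format, OF W(2)]
        by (simp_all add: vec2_upd has_field_derivative_at_within)
    qed (use st in \<open>simp_all add: s0_def t0_def\<close>)
    moreover have ev: "eventually (\<lambda>r. \<phi> (K (h1 (vec2 r t)) (h2 (vec2 r t))) i = \<phi> (G r t) i) (at s within I01)"
      using ev1 I[of s] by eventually_elim (use W(6) st(2) in simp)
    ultimately have "((\<lambda>r. \<phi> (G r t) i) has_real_derivative A i * p1 (vec2 s t) + B i * p2 (vec2 s t)) (at s within I01)"
      using has_field_derivative_cong_eventually[OF ev] W(6)[OF st W(2)] by simp
    then show ?thesis unfolding dfst_def by (rule vector_derivative_I01[OF _ st(1)])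
  qed
  have S: "dsnd G \<phi> s t i = A i * q1 (vec2 s t) + B i * q2 (vec2 s t)" if i: "i < n" for i
  proof -
    have "((\<lambda>r. \<phi> (K (h1 (vec2 s r)) (h2 (vec2 s r))) i) has_real_derivative A i * q1 (vec2 s t) + B i * q2 (vec2 s t)) (at t within I01)"
    proof (rule square_chainD[OF AB i, where ?h1.0 = "\<lambda>r. h1 (vec2 s r)" and ?h2.0 = "\<lambda>r. h2 (vec2 s r)"])
      show "eventually (\<lambda>r. h1 (vec2 s r) \<in> I01 \<and> h2 (vec2 s r) \<in> I01) (at t within I01)"
        using ev2 I[of t] by eventually_elim (use W(6) st(1) in blast)
      show "((\<lambda>r. h1 (vec2 s r)) has_real_derivative q1 (vec2 s t)) (at t within I01)"
        "((\<lambda>r. h2 (vec2 s r)) has_real_derivative q2 (vec2 s t)) (at t within I01)"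
        using q1[unfolded partial_deriv_def, rule_format, OF W(2)] q2[unfolded partial_deriv_def, rule_format, OF W(2)]
        by (simp_all add: vec2_upd has_field_derivative_at_within)
    qed (use st in \<open>simp_all add: s0_def t0_def\<close>)
    moreover have ev: "eventually (\<lambda>r. \<phi> (K (h1 (vec2 s r)) (h2 (vec2 s r))) i = \<phi> (G s r) i) (at t within I01)"
      using ev2 I[of t] by eventually_elim (use W(6) st(1) in simp)
    ultimately have "((\<lambda>r. \<phi> (G s r) i) has_real_derivative A i * q1 (vec2 s t) + B i * q2 (vec2 s t)) (at t within I01)"
      using has_field_derivative_cong_eventually[OF ev] W(6)[OF st W(2)] by simp
    then show ?thesis unfolding dsnd_def by (rule vector_derivative_I01[OF _ st(2)])
  qed
  show "dfst G \<phi> s t i * dsnd G \<phi> s t j = dfst G \<phi> s t j * dsnd G \<phi> s t i"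
    unfolding F[OF ij(1)] F[OF ij(2)] S[OF ij(1)] S[OF ij(2)] by (rule minor_combination[OF minor])
qed

text \<open>In coordinates the differential of \<open>f\<close> multiplies both columns by the same
  matrix \<open>P\<close>, and a minor of the product is a combination of minors of the Jacobian of
  \<open>H\<close>.\<close>

lemma thin_map_postcompose:
  assumes M: "locally_euclidean M" and N: "locally_euclidean N" and f: "smooth_map M N f" and H: "thin_map M H"
  shows "thin_map N (\<lambda>s t. f (H s t))"
proof (rule thin_mapI)
  show "smooth_from 2 unit_square N (\<lambda>x. f (H (x 0) (x 1)))"
    by (rule smooth_from_postcompose[OF M N f thin_map_smooth[OF H]])
  fix s t m V \<psi> k l
  assume st: "s \<in> I01" "t \<in> I01" and d: "(m, V, \<psi>) \<in> atlas N" "f (H s t) \<in> V" and kl: "k < m" "l < m"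
  have "H s t \<in> pts M" using smooth_from_pts[OF thin_map_smooth[OF H], of "vec2 s t"] st by simp
  then obtain n U \<phi> where c: "(n, U, \<phi>) \<in> atlas M" "H s t \<in> U" using chart_at[OF M] by metis
  note c' = atlas_is_chart[OF M c(1)] and d' = atlas_is_chart[OF N d(1)]
  let ?S = "U \<inter> f -` V"
  have oS: "openin (mtop M) ?S"
    by (rule openin_preimage_Int[OF smooth_map_continuous[OF f] is_chart_open[OF c'] is_chart_open[OF d']])
  have o: "openin (Euclidean_space n) (\<phi> ` ?S)" by (rule is_chart_image_open[OF c' oS]) auto
  define F where "F k = (\<lambda>x. (\<psi> \<circ> f \<circ> inv_into U \<phi>) x k)" for k
  have F: "smooth_fn n (\<phi> ` ?S) (F k)" if "k < m" for k
    using smooth_mapD[OF f c(1) d(1)] that by (simp add: smooth_eucl_iff F_def)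
  have "\<exists>g. partial_deriv (\<phi> ` ?S) j (F k) g \<and> smooth_fn n (\<phi> ` ?S) g" if "k < m" "j < n" for k j
    using smooth_fn_partial[OF o F[OF that(1)] that(2)] by blast
  then obtain P where P: "\<And>k j. k < m \<Longrightarrow> j < n \<Longrightarrow> partial_deriv (\<phi> ` ?S) j (F k) (P k j)"
     "\<And>k j. k < m \<Longrightarrow> j < n \<Longrightarrow> smooth_fn n (\<phi> ` ?S) (P k j)" by metis
  obtain A B where AB: "square_chain n \<phi> H s t A B"
    using square_chain_rule[OF M thin_map_smooth[OF H] st c] by blast
  note ABd = square_chain_partials[OF AB st]
  have minor: "A i * B j = A j * B i" if "i < n" "j < n" for i j
    using thin_map_minors[OF H st c that] unfolding ABd(3,4)[OF that(1)] ABd(3,4)[OF that(2)] .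
  let ?y = "\<phi> (H s t)"
  have y: "?y \<in> \<phi> ` ?S" using c(2) d(2) by blast
  obtain W where W: "openin (Euclidean_space 2) W" "vec2 s t \<in> W" "\<And>y. y \<in> unit_square \<Longrightarrow> y \<in> W \<Longrightarrow> H (y 0) (y 1) \<in> U"
    using smooth_from_nhd[OF thin_map_smooth[OF H] _ is_chart_open[OF c'], of "vec2 s t"] st c(2) by auto
  have I: "eventually (\<lambda>r. r \<in> I01) (at r0 within I01)" for r0 by (simp add: eventually_at_filter)
  have chain: "((\<lambda>r. \<psi> (f (\<gamma> r)) k) has_real_derivative (\<Sum>j<n. P k j ?y * D j)) (at r0 within I01)"
    if k: "k < m" and \<gamma>: "\<gamma> r0 = H s t" "eventually (\<lambda>r. \<gamma> r \<in> U) (at r0 within I01)"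
      and D: "\<And>j. j < n \<Longrightarrow> ((\<lambda>r. \<phi> (\<gamma> r) j) has_real_derivative D j) (at r0 within I01)" for k \<gamma> r0 D
  proof -
    have 1: "((\<lambda>r. F k (\<phi> (\<gamma> r))) has_real_derivative (\<Sum>j<n. P k j (\<phi> (\<gamma> r0)) * D j)) (at r0 within I01)"
    proof (rule chain_rule_partials[OF o P(1)[OF k], where c = "\<lambda>r. \<phi> (\<gamma> r)"])
      show "eventually (\<lambda>r. \<phi> (\<gamma> r) \<in> topspace (Euclidean_space n)) (at r0 within I01)"
        using \<gamma>(2) by eventually_elim (rule chart_topspace[OF c'])
    qed (use smooth_fn_continuous[OF P(2)[OF k]] D y \<gamma>(1) in auto)
    have F\<phi>: "F k (\<phi> x) = \<psi> (f x) k" if "x \<in> U" for x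
      using that is_chart_inj[OF c'] by (simp add: F_def)
    have "eventually (\<lambda>r. F k (\<phi> (\<gamma> r)) = \<psi> (f (\<gamma> r)) k) (at r0 within I01)"
      using \<gamma>(2) by eventually_elim (rule F\<phi>)
    from has_field_derivative_cong_eventually[OF this] show ?thesis using 1 F\<phi> c(2) by (simp add: \<gamma>(1))
  qed
  have e1: "eventually (\<lambda>r. H r t \<in> U) (at s within I01)"
  proof -
    have "eventually (\<lambda>r. vec2 r t \<in> W) (at s within I01)"
      by (rule eventually_vec2_in_open[OF W(1,2) DERIV_ident DERIV_const])
    with I[of s] show ?thesis by eventually_elim (use W(3)[of "vec2 r t" for r] st(2) in simp)
  qed
  have e2: "eventually (\<lambda>r. H s r \<in> U) (at t within I01)"
  proof -
    have "eventually (\<lambda>r. vec2 s r \<in> W) (at t within I01)"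
      by (rule eventually_vec2_in_open[OF W(1,2) DERIV_const DERIV_ident])
    with I[of t] show ?thesis by eventually_elim (use W(3)[of "vec2 s r" for r] st(1) in simp)
  qed
  have dF: "dfst (\<lambda>s t. f (H s t)) \<psi> s t k = (\<Sum>j<n. P k j ?y * A j)" if "k < m" for k
    unfolding dfst_def by (rule vector_derivative_I01[OF chain[OF that] st(1)]) (use e1 ABd in auto)
  have dS: "dsnd (\<lambda>s t. f (H s t)) \<psi> s t k = (\<Sum>j<n. P k j ?y * B j)" if "k < m" for k
    unfolding dsnd_def by (rule vector_derivative_I01[OF chain[OF that] st(2)]) (use e2 ABd in auto)
  have "(\<Sum>i<n. P k i ?y * A i) * (\<Sum>j<n. P l j ?y * B j) = (\<Sum>i<n. \<Sum>j<n. P k i ?y * P l j ?y * (A i * B j))"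
    by (simp add: sum_product algebra_simps)
  \<comment> \<open>The vanishing of the minors is applied term by term; renaming the indices then
    exchanges the roles of \<open>k\<close> and \<open>l\<close>.\<close>
  also have "\<dots> = (\<Sum>i<n. \<Sum>j<n. P k i ?y * P l j ?y * (A j * B i))"
    by (intro sum.cong refl) (simp add: minor)
  also have "\<dots> = (\<Sum>j<n. P l j ?y * A j) * (\<Sum>i<n. P k i ?y * B i)"
    by (subst sum.swap) (simp add: sum_product algebra_simps)
  finally show "dfst (\<lambda>s t. f (H s t)) \<psi> s t k * dsnd (\<lambda>s t. f (H s t)) \<psi> s t l = dfst (\<lambda>s t. f (H s t)) \<psi> s t l * dsnd (\<lambda>s t. f (H s t)) \<psi> s t k"
    using dF dS kl by simp
qed

lemma thin_map_corestrict:
  assumes H: "thin_map M H" and U: "openin (mtop M) U" "\<And>s t. s \<in> I01 \<Longrightarrow> t \<in> I01 \<Longrightarrow> H s t \<in> U"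
  shows "thin_map (open_sub M U) H"
proof (rule thin_mapI)
  show "smooth_from 2 unit_square (open_sub M U) (\<lambda>x. H (x 0) (x 1))"
    by (rule smooth_from_corestrict[OF thin_map_smooth[OF H] U(1)]) (use U(2) in auto)
qed (use thin_map_minors[OF H] in \<open>auto simp: atlas_open_sub\<close>)

lemma openin_coordinate: "open S \<Longrightarrow> openin (Euclidean_space k) {x \<in> topspace (Euclidean_space k). x i \<in> S}"
  using openin_continuous_map_preimage[OF continuous_map_Euclidean_coordinate[of k i], of S] by simp

lemmas smooth_fn_intros = smooth_fn_add smooth_fn_mult smooth_fn_diff smooth_fn_step smooth_fn_const smooth_fn_coordinate

section \<open>Paths and the thin homotopy relation\<close>

definition smooth_curve :: "'m mfd \<Rightarrow> (real \<Rightarrow> 'm) \<Rightarrow> bool" where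
  "smooth_curve M \<gamma> \<longleftrightarrow> smooth_from 1 unit_line M (\<lambda>x. \<gamma> (x 0))"

definition sitting :: "(real \<Rightarrow> 'm) \<Rightarrow> bool" where
  "sitting \<gamma> \<longleftrightarrow> (\<exists>\<epsilon>>0. \<forall>t\<in>I01. (t \<le> \<epsilon> \<longrightarrow> \<gamma> t = \<gamma> 0) \<and> (1 - \<epsilon> \<le> t \<longrightarrow> \<gamma> t = \<gamma> 1))"

lemma sittingE:
  assumes "sitting \<gamma>"
  obtains \<epsilon> where "\<epsilon> > 0" "\<And>t. t \<in> I01 \<Longrightarrow> (t \<le> \<epsilon> \<longrightarrow> \<gamma> t = \<gamma> 0) \<and> (1 - \<epsilon> \<le> t \<longrightarrow> \<gamma> t = \<gamma> 1)"
  using assms unfolding sitting_def by blast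

lemma paths_iff: "\<gamma> \<in> paths M \<longleftrightarrow> \<gamma> \<in> extensional I01 \<and> smooth_curve M \<gamma> \<and> sitting \<gamma>"
proof
  assume "\<gamma> \<in> paths M"
  then show "\<gamma> \<in> extensional I01 \<and> smooth_curve M \<gamma> \<and> sitting \<gamma>"
    by (auto simp: paths_def smooth_curve_def sitting_def PiE_def)
next
  assume *: "\<gamma> \<in> extensional I01 \<and> smooth_curve M \<gamma> \<and> sitting \<gamma>"
  have "\<gamma> t \<in> pts M" if "t \<in> I01" for t
    using smooth_from_pts[of 1 unit_line M "\<lambda>x. \<gamma> (x 0)" "vec1 t"] * that by (simp add: smooth_curve_def)
  then show "\<gamma> \<in> paths M" using * by (auto simp: paths_def smooth_curve_def sitting_def PiE_def)
qed

lemma smooth_curve_pts: "smooth_curve M \<gamma> \<Longrightarrow> t \<in> I01 \<Longrightarrow> \<gamma> t \<in> pts M"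
  using smooth_from_pts[of 1 unit_line M "\<lambda>x. \<gamma> (x 0)" "vec1 t"] by (simp add: smooth_curve_def)

lemma path_smooth: "\<gamma> \<in> paths M \<Longrightarrow> smooth_curve M \<gamma>"
  by (simp add: paths_iff)

lemma path_pts: "\<gamma> \<in> paths M \<Longrightarrow> t \<in> I01 \<Longrightarrow> \<gamma> t \<in> pts M"
  using path_smooth smooth_curve_pts by blast

lemma smooth_curve_cong: "smooth_curve M \<gamma> \<Longrightarrow> (\<And>t. t \<in> I01 \<Longrightarrow> \<gamma> t = \<gamma>' t) \<Longrightarrow> smooth_curve M \<gamma>'"
  unfolding smooth_curve_def by (erule smooth_from_cong) auto

definition collared :: "(real \<Rightarrow> real \<Rightarrow> 'm) \<Rightarrow> bool" where
  "collared H \<longleftrightarrow> (\<exists>\<epsilon>>0. \<forall>s\<in>I01. \<forall>t\<in>I01.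
        (s \<le> \<epsilon> \<longrightarrow> H s t = H 0 t) \<and> (1 - \<epsilon> \<le> s \<longrightarrow> H s t = H 1 t) \<and>
        (t \<le> \<epsilon> \<longrightarrow> H s t = H s 0) \<and> (1 - \<epsilon> \<le> t \<longrightarrow> H s t = H s 1))"

lemma thin_homotopy_iff:
  "thin_homotopy M \<gamma>0 \<gamma>1 H \<longleftrightarrow> thin_map M H \<and> (\<forall>s\<in>I01. H s 0 = \<gamma>0 s \<and> H s 1 = \<gamma>1 s) \<and>
     (\<forall>t\<in>I01. H 0 t = \<gamma>0 0 \<and> H 1 t = \<gamma>0 1) \<and> collared H"
proof -
  have "H s t \<in> pts M" if "thin_map M H" "s \<in> I01" "t \<in> I01" for s t
    using smooth_from_pts[OF thin_map_smooth[OF that(1)], of "vec2 s t"] that by simp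
  then have pts: "thin_map M H \<Longrightarrow> \<forall>s\<in>I01. \<forall>t\<in>I01. H s t \<in> pts M" by blast
  show ?thesis
  proof
    assume "thin_homotopy M \<gamma>0 \<gamma>1 H"
    then show "thin_map M H \<and> (\<forall>s\<in>I01. H s 0 = \<gamma>0 s \<and> H s 1 = \<gamma>1 s) \<and> (\<forall>t\<in>I01. H 0 t = \<gamma>0 0 \<and> H 1 t = \<gamma>0 1) \<and> collared H"
      unfolding thin_homotopy_def thin_map_def collared_def
      by (elim conjE) (intro conjI; assumption)
  next
    assume *: "thin_map M H \<and> (\<forall>s\<in>I01. H s 0 = \<gamma>0 s \<and> H s 1 = \<gamma>1 s) \<and> (\<forall>t\<in>I01. H 0 t = \<gamma>0 0 \<and> H 1 t = \<gamma>0 1) \<and> collared H"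
    from pts[OF conjunct1[OF this]] * show "thin_homotopy M \<gamma>0 \<gamma>1 H"
      unfolding thin_homotopy_def thin_map_def collared_def
      by (elim conjE) (intro conjI; assumption)
  qed
qed

lemma thin_relE:
  assumes "(\<gamma>0, \<gamma>1) \<in> thin_rel M"
  obtains H where "\<gamma>0 \<in> paths M" "\<gamma>1 \<in> paths M" "\<gamma>0 0 = \<gamma>1 0" "\<gamma>0 1 = \<gamma>1 1" "thin_map M H"
    "\<And>s. s \<in> I01 \<Longrightarrow> H s 0 = \<gamma>0 s" "\<And>s. s \<in> I01 \<Longrightarrow> H s 1 = \<gamma>1 s"
    "\<And>t. t \<in> I01 \<Longrightarrow> H 0 t = \<gamma>0 0" "\<And>t. t \<in> I01 \<Longrightarrow> H 1 t = \<gamma>0 1" "collared H"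
  using assms unfolding thin_rel_def thin_homotopy_iff by auto

lemma thin_relI:
  assumes "\<gamma>0 \<in> paths M" "\<gamma>1 \<in> paths M" "thin_map M H"
    "\<And>s. s \<in> I01 \<Longrightarrow> H s 0 = \<gamma>0 s" "\<And>s. s \<in> I01 \<Longrightarrow> H s 1 = \<gamma>1 s"
    "\<And>t. t \<in> I01 \<Longrightarrow> H 0 t = \<gamma>0 0" "\<And>t. t \<in> I01 \<Longrightarrow> H 1 t = \<gamma>0 1" "collared H"
  shows "(\<gamma>0, \<gamma>1) \<in> thin_rel M"
proof -
  have "\<gamma>0 0 = \<gamma>1 0" "\<gamma>0 1 = \<gamma>1 1" using assms(4-7)[of 0] assms(4-7)[of 1] by force+
  then show ?thesis using assms unfolding thin_rel_def thin_homotopy_iff by blast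
qed

lemma smooth_curve_local:
  assumes M: "locally_euclidean M"
    and loc: "\<And>t. t \<in> I01 \<Longrightarrow> \<exists>T \<tau> h. open T \<and> t \<in> T \<and> smooth_curve M \<tau> \<and> smooth_fn 1 (topspace (Euclidean_space 1)) (\<lambda>x. h (x 0)) \<and>
      (\<forall>t'\<in>I01 \<inter> T. h t' \<in> I01 \<and> \<gamma> t' = \<tau> (h t'))"
  shows "smooth_curve M \<gamma>"
  unfolding smooth_curve_def
proof (rule smooth_from_local_compose[OF M])
  fix a assume a: "a \<in> unit_line"
  then have "a 0 \<in> I01" by simp
  then obtain T \<tau> h where T: "open T" "a 0 \<in> T" "smooth_curve M \<tau>" "smooth_fn 1 (topspace (Euclidean_space 1)) (\<lambda>x. h (x 0))"
    "\<forall>t'\<in>I01 \<inter> T. h t' \<in> I01 \<and> \<gamma> t' = \<tau> (h t')" using loc by blast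
  let ?W = "{x \<in> topspace (Euclidean_space 1). x 0 \<in> T}"
  have "smooth_eucl 1 ?W 1 (\<lambda>x. vec1 (h (x 0)))"
    by (rule smooth_eucl_vec(1), rule smooth_fn_subset[OF T(4)]) auto
  moreover have "\<forall>y\<in>unit_line \<inter> ?W. vec1 (h (y 0)) \<in> unit_line \<and> \<gamma> (y 0) = (\<lambda>x. \<tau> (x 0)) (vec1 (h (y 0)))"
    using T(5) by auto
  ultimately show "\<exists>W j B K h. openin (Euclidean_space 1) W \<and> a \<in> W \<and> smooth_from j B M K \<and>
      smooth_eucl 1 W j h \<and> (\<forall>y\<in>unit_line \<inter> W. h y \<in> B \<and> \<gamma> (y 0) = K (h y))"
    using openin_coordinate[OF T(1), of 1 0] a T(2,3) unfolding smooth_curve_def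
    by (intro exI[of _ ?W] exI[of _ 1] exI[of _ unit_line] exI[of _ "\<lambda>x. \<tau> (x 0)"] exI[of _ "\<lambda>x. vec1 (h (x 0))"]) simp
qed auto

text \<open>The form of local composition that the pastings below use: rectangular neighbourhoods
  and reparametrizations that are smooth on the whole plane.\<close>

lemma thin_map_local:
  assumes M: "locally_euclidean M"
    and loc: "\<And>s t. s \<in> I01 \<Longrightarrow> t \<in> I01 \<Longrightarrow> \<exists>S T K h1 h2. open S \<and> open T \<and> s \<in> S \<and> t \<in> T \<and> thin_map M K \<and>
      smooth_fn 2 (topspace (Euclidean_space 2)) (\<lambda>x. h1 (x 0) (x 1)) \<and> smooth_fn 2 (topspace (Euclidean_space 2)) (\<lambda>x. h2 (x 0) (x 1)) \<and>
      (\<forall>s'\<in>I01 \<inter> S. \<forall>t'\<in>I01 \<inter> T. h1 s' t' \<in> I01 \<and> h2 s' t' \<in> I01 \<and> G s' t' = K (h1 s' t') (h2 s' t'))"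
  shows "thin_map M G"
proof (rule thin_map_local_compose[OF M])
  fix s t :: real assume st: "s \<in> I01" "t \<in> I01"
  obtain S T K h1 h2 where *: "open S" "open T" "s \<in> S" "t \<in> T" "thin_map M K"
      "smooth_fn 2 (topspace (Euclidean_space 2)) (\<lambda>x. h1 (x 0) (x 1))" "smooth_fn 2 (topspace (Euclidean_space 2)) (\<lambda>x. h2 (x 0) (x 1))"
      "\<forall>s'\<in>I01 \<inter> S. \<forall>t'\<in>I01 \<inter> T. h1 s' t' \<in> I01 \<and> h2 s' t' \<in> I01 \<and> G s' t' = K (h1 s' t') (h2 s' t')"
    using loc[OF st] by (elim exE conjE) (rule that; assumption)
  let ?W = "{x \<in> topspace (Euclidean_space 2). x 0 \<in> S} \<inter> {x \<in> topspace (Euclidean_space 2). x 1 \<in> T}"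
  have "openin (Euclidean_space 2) ?W" using openin_coordinate[OF *(1)] openin_coordinate[OF *(2)] by blast
  moreover have "smooth_fn 2 ?W (\<lambda>x. h1 (x 0) (x 1))" "smooth_fn 2 ?W (\<lambda>x. h2 (x 0) (x 1))"
    by (rule smooth_fn_subset[OF *(6)], blast) (rule smooth_fn_subset[OF *(7)], blast)
  ultimately show "\<exists>W K h1 h2. openin (Euclidean_space 2) W \<and> vec2 s t \<in> W \<and> thin_map M K \<and>
      smooth_fn 2 W h1 \<and> smooth_fn 2 W h2 \<and>
      (\<forall>s'\<in>I01. \<forall>t'\<in>I01. vec2 s' t' \<in> W \<longrightarrow> h1 (vec2 s' t') \<in> I01 \<and> h2 (vec2 s' t') \<in> I01 \<and>
         G s' t' = K (h1 (vec2 s' t')) (h2 (vec2 s' t')))"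
    using *(3,4,5,8)
    by (intro exI[of _ ?W] exI[of _ K] exI[of _ "\<lambda>x. h1 (x 0) (x 1)"] exI[of _ "\<lambda>x. h2 (x 0) (x 1)"]) simp
qed

lemma thin_map_compose:
  assumes M: "locally_euclidean M" and K: "thin_map M K"
    and h: "smooth_fn 2 (topspace (Euclidean_space 2)) (\<lambda>x. h1 (x 0) (x 1))" "smooth_fn 2 (topspace (Euclidean_space 2)) (\<lambda>x. h2 (x 0) (x 1))"
    and G: "\<And>s t. s \<in> I01 \<Longrightarrow> t \<in> I01 \<Longrightarrow> h1 s t \<in> I01 \<and> h2 s t \<in> I01 \<and> G s t = K (h1 s t) (h2 s t)"
  shows "thin_map M G"
proof (rule thin_map_local[OF M])
  fix s t :: real assume "s \<in> I01" "t \<in> I01"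
  show "\<exists>S T K h1 h2. open S \<and> open T \<and> s \<in> S \<and> t \<in> T \<and> thin_map M K \<and>
      smooth_fn 2 (topspace (Euclidean_space 2)) (\<lambda>x. h1 (x 0) (x 1)) \<and> smooth_fn 2 (topspace (Euclidean_space 2)) (\<lambda>x. h2 (x 0) (x 1)) \<and>
      (\<forall>s'\<in>I01 \<inter> S. \<forall>t'\<in>I01 \<inter> T. h1 s' t' \<in> I01 \<and> h2 s' t' \<in> I01 \<and> G s' t' = K (h1 s' t') (h2 s' t'))"
    using K h G by (intro exI[of _ UNIV] exI[of _ K] exI[of _ h1] exI[of _ h2]) simp
qed

text \<open>Nothing depends on the second variable, so the second column of the Jacobian vanishes. A
  curve thereby becomes a degenerate square, and statements about arcs in squares apply to
  it.\<close>

lemma thin_map_curve: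
  assumes M: "locally_euclidean M" and \<gamma>: "smooth_curve M \<gamma>"
  shows "thin_map M (\<lambda>s t. \<gamma> s)"
proof (rule thin_mapI)
  show "smooth_from 2 unit_square M (\<lambda>x. \<gamma> (x 0))"
    by (rule smooth_from_compose[OF M _ openin_topspace \<gamma>[unfolded smooth_curve_def] smooth_eucl_vec(1)[OF smooth_fn_coordinate[of _ _ 0]]])
      auto
  fix s t n U \<phi> i j assume "t \<in> I01"
  then have "dsnd (\<lambda>s t. \<gamma> s) \<phi> s t i = 0" for i
    unfolding dsnd_def by (intro vector_derivative_I01[OF DERIV_const])
  then show "dfst (\<lambda>s t. \<gamma> s) \<phi> s t i * dsnd (\<lambda>s t. \<gamma> s) \<phi> s t j = dfst (\<lambda>s t. \<gamma> s) \<phi> s t j * dsnd (\<lambda>s t. \<gamma> s) \<phi> s t i"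
    by simp
qed

text \<open>Only transitivity needs care: the two homotopies are stacked in the \<open>t\<close>
  direction, with \<open>step\<close> applied to the rescaled \<open>t\<close>, so that both stand
  still at the middle path near the seam.\<close>

lemma thin_rel_equiv:
  assumes M: "locally_euclidean M"
  shows "equiv (paths M) (thin_rel M)"
proof (rule equivI)
  show "thin_rel M \<subseteq> paths M \<times> paths M" by (auto simp: thin_rel_def)
  show "refl_on (paths M) (thin_rel M)"
    unfolding refl_on_def
  proof (intro conjI ballI)
    fix \<gamma> assume \<gamma>: "\<gamma> \<in> paths M"
    then have "collared (\<lambda>s t. \<gamma> s)" by (auto simp: paths_iff sitting_def collared_def)
    then show "(\<gamma>, \<gamma>) \<in> thin_rel M"
      by (intro thin_relI[OF \<gamma> \<gamma> thin_map_curve[OF M path_smooth[OF \<gamma>]]]) auto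
  qed
  show "sym (thin_rel M)"
  proof (rule symI)
    fix \<gamma> \<gamma>' assume "(\<gamma>, \<gamma>') \<in> thin_rel M"
    then obtain H where H: "\<gamma> \<in> paths M" "\<gamma>' \<in> paths M" "\<gamma> 0 = \<gamma>' 0" "\<gamma> 1 = \<gamma>' 1" "thin_map M H"
      "\<And>s. s \<in> I01 \<Longrightarrow> H s 0 = \<gamma> s" "\<And>s. s \<in> I01 \<Longrightarrow> H s 1 = \<gamma>' s"
      "\<And>t. t \<in> I01 \<Longrightarrow> H 0 t = \<gamma> 0" "\<And>t. t \<in> I01 \<Longrightarrow> H 1 t = \<gamma> 1" "collared H" by (elim thin_relE) blast
    have t: "thin_map M (\<lambda>s t. H s (1 - t))"
      by (rule thin_map_compose[OF M H(5), of "\<lambda>s t. s" "\<lambda>s t. 1 - t"]) (auto intro!: smooth_fn_intros)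
    obtain \<epsilon> where "\<epsilon> > 0" and e: "\<And>s t. s \<in> I01 \<Longrightarrow> t \<in> I01 \<Longrightarrow>
        (s \<le> \<epsilon> \<longrightarrow> H s t = H 0 t) \<and> (1 - \<epsilon> \<le> s \<longrightarrow> H s t = H 1 t) \<and>
        (t \<le> \<epsilon> \<longrightarrow> H s t = H s 0) \<and> (1 - \<epsilon> \<le> t \<longrightarrow> H s t = H s 1)"
      using H(10) unfolding collared_def by blast
    have c: "collared (\<lambda>s t. H s (1 - t))"
      unfolding collared_def
    proof (intro exI[of _ \<epsilon>] conjI ballI impI \<open>\<epsilon> > 0\<close>)
      fix s t :: real assume st: "s \<in> I01" "t \<in> I01"
      have "1 - t \<in> I01" using st by simp
      note e' = e[OF st(1) this]
      { assume "s \<le> \<epsilon>" then show "H s (1 - t) = H 0 (1 - t)" using e' by simp }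
      { assume "1 - \<epsilon> \<le> s" then show "H s (1 - t) = H 1 (1 - t)" using e' by simp }
      { assume "t \<le> \<epsilon>" then show "H s (1 - t) = H s (1 - 0)" using e' by simp }
      { assume "1 - \<epsilon> \<le> t" then show "H s (1 - t) = H s (1 - 1)" using e' by simp }
    qed
    show "(\<gamma>', \<gamma>) \<in> thin_rel M"
      by (rule thin_relI[OF H(2,1) t _ _ _ _ c]) (use H in auto)
  qed
  show "trans (thin_rel M)"
  proof (rule transI)
    fix \<gamma> \<gamma>' \<gamma>'' assume "(\<gamma>, \<gamma>') \<in> thin_rel M" "(\<gamma>', \<gamma>'') \<in> thin_rel M"
    then obtain H H' where H: "\<gamma> \<in> paths M" "\<gamma>' \<in> paths M" "\<gamma> 0 = \<gamma>' 0" "\<gamma> 1 = \<gamma>' 1" "thin_map M H"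
      "\<And>s. s \<in> I01 \<Longrightarrow> H s 0 = \<gamma> s" "\<And>s. s \<in> I01 \<Longrightarrow> H s 1 = \<gamma>' s"
      "\<And>t. t \<in> I01 \<Longrightarrow> H 0 t = \<gamma> 0" "\<And>t. t \<in> I01 \<Longrightarrow> H 1 t = \<gamma> 1" "collared H"
      and H': "\<gamma>'' \<in> paths M" "thin_map M H'"
      "\<And>s. s \<in> I01 \<Longrightarrow> H' s 0 = \<gamma>' s" "\<And>s. s \<in> I01 \<Longrightarrow> H' s 1 = \<gamma>'' s"
      "\<And>t. t \<in> I01 \<Longrightarrow> H' 0 t = \<gamma>' 0" "\<And>t. t \<in> I01 \<Longrightarrow> H' 1 t = \<gamma>' 1" "collared H'" by (elim thin_relE) blast
    define G where "G s t = (if t \<le> 1/2 then H s (step (2 * t)) else H' s (step (2 * t - 1)))" for s t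
    \<comment> \<open>Each formula holds beyond the seam \<open>t = 1/2\<close>: on the strip
      between 1/3 and 2/3 both give \<open>\<gamma>' s\<close>. The two open sets therefore cover
      the square and the pasting is smooth.\<close>
    have G1: "G s t = H s (step (2 * t))" if "s \<in> I01" "t < 2/3" for s t
      using that H(7) H'(3) by (simp add: G_def)
    have G2: "G s t = H' s (step (2 * t - 1))" if "s \<in> I01" "t > 1/3" for s t
      using that H(7) H'(3) by (simp add: G_def)
    have t: "thin_map M G"
    proof (rule thin_map_local[OF M])
      fix s t :: real assume st: "s \<in> I01" "t \<in> I01"
      show "\<exists>S T K h1 h2. open S \<and> open T \<and> s \<in> S \<and> t \<in> T \<and> thin_map M K \<and>
        smooth_fn 2 (topspace (Euclidean_space 2)) (\<lambda>x. h1 (x 0) (x 1)) \<and> smooth_fn 2 (topspace (Euclidean_space 2)) (\<lambda>x. h2 (x 0) (x 1)) \<and>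
        (\<forall>s'\<in>I01 \<inter> S. \<forall>t'\<in>I01 \<inter> T. h1 s' t' \<in> I01 \<and> h2 s' t' \<in> I01 \<and> G s' t' = K (h1 s' t') (h2 s' t'))"
      proof (cases "t < 2/3")
        case True
        then show ?thesis
          by (intro exI[of _ UNIV] exI[of _ "{..<2/3}"] exI[of _ H] exI[of _ "\<lambda>s t. s"] exI[of _ "\<lambda>s t. step (2 * t)"])
            (auto intro!: smooth_fn_intros H(5) G1 simp: step_nonneg step_le_1)
      next
        case False
        then show ?thesis
          by (intro exI[of _ UNIV] exI[of _ "{1/3<..}"] exI[of _ H'] exI[of _ "\<lambda>s t. s"] exI[of _ "\<lambda>s t. step (2 * t - 1)"])
            (auto intro!: smooth_fn_intros H'(2) G2 simp: step_nonneg step_le_1)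
      qed
    qed
    obtain \<epsilon> where "\<epsilon> > 0" and e: "\<And>s t. s \<in> I01 \<Longrightarrow> t \<in> I01 \<Longrightarrow>
        (s \<le> \<epsilon> \<longrightarrow> H s t = H 0 t) \<and> (1 - \<epsilon> \<le> s \<longrightarrow> H s t = H 1 t)"
      using H(10) unfolding collared_def by blast
    obtain \<epsilon>' where "\<epsilon>' > 0" and e': "\<And>s t. s \<in> I01 \<Longrightarrow> t \<in> I01 \<Longrightarrow>
        (s \<le> \<epsilon>' \<longrightarrow> H' s t = H' 0 t) \<and> (1 - \<epsilon>' \<le> s \<longrightarrow> H' s t = H' 1 t)"
      using H'(7) unfolding collared_def by blast
    have c: "collared G"
      unfolding collared_def
    \<comment> \<open>At double speed the constant outer thirds of \<open>step\<close> become
      sixths, at both the lower and the upper edge.\<close>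
    proof (intro exI[of _ "min (min \<epsilon> \<epsilon>') (1/6)"] conjI ballI impI)
      fix s t :: real assume st: "s \<in> I01" "t \<in> I01"
      have st': "step (2 * t) \<in> I01" "step (2 * t - 1) \<in> I01" by (simp_all add: step_nonneg step_le_1)
      { assume "s \<le> min (min \<epsilon> \<epsilon>') (1/6)" then show "G s t = G 0 t"
          using e[OF st(1) st'(1)] e'[OF st(1) st'(2)] by (auto simp: G_def) }
      { assume "1 - min (min \<epsilon> \<epsilon>') (1/6) \<le> s" then show "G s t = G 1 t"
          using e[OF st(1) st'(1)] e'[OF st(1) st'(2)] by (auto simp: G_def min_def split: if_splits) }
      { assume "t \<le> min (min \<epsilon> \<epsilon>') (1/6)" then show "G s t = G s 0" by (auto simp: G_def) }
      { assume "1 - min (min \<epsilon> \<epsilon>') (1/6) \<le> t" then have "t \<ge> 5/6" by linarith then show "G s t = G s 1" by (auto simp: G_def) }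
    qed (use \<open>\<epsilon> > 0\<close> \<open>\<epsilon>' > 0\<close> in auto)
    have st': "step t \<in> I01" for t by (simp add: step_nonneg step_le_1)
    show "(\<gamma>, \<gamma>'') \<in> thin_rel M"
      by (rule thin_relI[OF H(1) H'(1) t _ _ _ _ c]) (use H H' st' in \<open>auto simp: G_def\<close>)
  qed
qed

section \<open>Concatenation of paths\<close>

lemma concat_path_simps:
  "t \<in> I01 \<Longrightarrow> t \<le> 1/2 \<Longrightarrow> concat_path \<gamma> \<tau> t = \<tau> (2 * t)"
  "t \<in> I01 \<Longrightarrow> \<not> t \<le> 1/2 \<Longrightarrow> concat_path \<gamma> \<tau> t = \<gamma> (2 * t - 1)"
  "concat_path \<gamma> \<tau> 0 = \<tau> 0" "concat_path \<gamma> \<tau> 1 = \<gamma> 1"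
  by (simp_all add: concat_path_def)

lemma concat_path_simp2: "\<tau> 1 = \<gamma> 0 \<Longrightarrow> t \<in> I01 \<Longrightarrow> t \<ge> 1/2 \<Longrightarrow> concat_path \<gamma> \<tau> t = \<gamma> (2 * t - 1)"
proof (cases "t = 1/2")
  case True
  assume "\<tau> 1 = \<gamma> 0"
  then show ?thesis unfolding True by (simp add: concat_path_def)
qed (auto simp: concat_path_def)

lemma smooth_curve_const: "locally_euclidean M \<Longrightarrow> x \<in> pts M \<Longrightarrow> smooth_curve M (\<lambda>t. x)"
  unfolding smooth_curve_def by (rule smooth_from_const) auto

text \<open>Smoothness is in question only at \<open>t = 1/2\<close>, and there the sitting
  instances of the two factors make the concatenation constant.\<close>

lemma concat_path_in_paths:
  assumes M: "locally_euclidean M" and \<gamma>: "\<gamma> \<in> paths M" and \<tau>: "\<tau> \<in> paths M" and e: "\<tau> 1 = \<gamma> 0"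
  shows "concat_path \<gamma> \<tau> \<in> paths M"
  unfolding paths_iff
proof (intro conjI)
  show "concat_path \<gamma> \<tau> \<in> extensional I01" by (simp add: concat_path_def)
  obtain \<epsilon> where \<epsilon>: "\<epsilon> > 0" "\<And>t. t \<in> I01 \<Longrightarrow> (t \<le> \<epsilon> \<longrightarrow> \<gamma> t = \<gamma> 0) \<and> (1 - \<epsilon> \<le> t \<longrightarrow> \<gamma> t = \<gamma> 1)"
    using sittingE[of \<gamma>] \<gamma> unfolding paths_iff by blast
  obtain \<epsilon>' where \<epsilon>': "\<epsilon>' > 0" "\<And>t. t \<in> I01 \<Longrightarrow> (t \<le> \<epsilon>' \<longrightarrow> \<tau> t = \<tau> 0) \<and> (1 - \<epsilon>' \<le> t \<longrightarrow> \<tau> t = \<tau> 1)"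
    using sittingE[of \<tau>] \<tau> unfolding paths_iff by blast
  \<comment> \<open>Halved because each factor runs at double speed; the bound 1/4 keeps the outer
    windows within the half to which they belong.\<close>
  define d where "d = min (min \<epsilon> \<epsilon>' / 2) (1/4)"
  have d: "d > 0" "2 * d \<le> \<epsilon>" "2 * d \<le> \<epsilon>'" "d \<le> 1/4" using \<epsilon> \<epsilon>' by (auto simp: d_def)
  show "sitting (concat_path \<gamma> \<tau>)"
    unfolding sitting_def
  proof (intro exI[of _ d] conjI ballI impI d(1))
    fix t :: real assume t: "t \<in> I01"
    { assume "t \<le> d" then show "concat_path \<gamma> \<tau> t = concat_path \<gamma> \<tau> 0"
        using t d \<epsilon>'(2)[of "2 * t"] by (simp add: concat_path_def) }
    { assume "1 - d \<le> t" then show "concat_path \<gamma> \<tau> t = concat_path \<gamma> \<tau> 1"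
        using t d \<epsilon>(2)[of "2 * t - 1"] by (simp add: concat_path_def) }
  qed
  show "smooth_curve M (concat_path \<gamma> \<tau>)"
  proof (rule smooth_curve_local[OF M])
    fix t :: real assume t: "t \<in> I01"
    consider "t < 1/2" | "t > 1/2" | "t = 1/2" by linarith
    then show "\<exists>T \<delta> h. open T \<and> t \<in> T \<and> smooth_curve M \<delta> \<and> smooth_fn 1 (topspace (Euclidean_space 1)) (\<lambda>x. h (x 0)) \<and>
      (\<forall>t'\<in>I01 \<inter> T. h t' \<in> I01 \<and> concat_path \<gamma> \<tau> t' = \<delta> (h t'))"
    proof cases
      case 1
      then show ?thesis using path_smooth[OF \<tau>]
        by (intro exI[of _ "{..<1/2}"] exI[of _ \<tau>] exI[of _ "\<lambda>t. 2 * t"]) (auto intro!: smooth_fn_intros simp: concat_path_def)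
    next
      case 2
      then show ?thesis using path_smooth[OF \<gamma>]
        by (intro exI[of _ "{1/2<..}"] exI[of _ \<gamma>] exI[of _ "\<lambda>t. 2 * t - 1"]) (auto intro!: smooth_fn_intros simp: concat_path_def)
    next
      case 3
      have "concat_path \<gamma> \<tau> t' = \<gamma> 0" if "t' \<in> {1/2 - d<..<1/2 + d}" for t'
        using that d e \<epsilon>(2)[of "2 * t' - 1"] \<epsilon>'(2)[of "2 * t'"] by (simp add: concat_path_def)
      then show ?thesis using smooth_curve_const[OF M path_pts[OF \<gamma>, of 0]] d 3
        by (intro exI[of _ "{1/2 - d<..<1/2 + d}"] exI[of _ "\<lambda>_. \<gamma> 0"] exI[of _ "\<lambda>t. t"]) (auto intro!: smooth_fn_intros)
    qed
  qed
qed

text \<open>The homotopies are placed side by side in the \<open>s\<close> direction; their collars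
  and the fixed end points make the result constant around the seam.\<close>

lemma thin_rel_concat:
  assumes M: "locally_euclidean M" and \<gamma>: "(\<gamma>, \<gamma>') \<in> thin_rel M" and \<tau>: "(\<tau>, \<tau>') \<in> thin_rel M" and e: "\<tau> 1 = \<gamma> 0"
  shows "(concat_path \<gamma> \<tau>, concat_path \<gamma>' \<tau>') \<in> thin_rel M"
proof -
  obtain H where H: "\<gamma> \<in> paths M" "\<gamma>' \<in> paths M" "\<gamma> 0 = \<gamma>' 0" "\<gamma> 1 = \<gamma>' 1" "thin_map M H"
      "\<And>s. s \<in> I01 \<Longrightarrow> H s 0 = \<gamma> s" "\<And>s. s \<in> I01 \<Longrightarrow> H s 1 = \<gamma>' s"
      "\<And>t. t \<in> I01 \<Longrightarrow> H 0 t = \<gamma> 0" "\<And>t. t \<in> I01 \<Longrightarrow> H 1 t = \<gamma> 1" "collared H" using \<gamma> by (elim thin_relE) blast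
  obtain K where K: "\<tau> \<in> paths M" "\<tau>' \<in> paths M" "\<tau> 0 = \<tau>' 0" "\<tau> 1 = \<tau>' 1" "thin_map M K"
      "\<And>s. s \<in> I01 \<Longrightarrow> K s 0 = \<tau> s" "\<And>s. s \<in> I01 \<Longrightarrow> K s 1 = \<tau>' s"
      "\<And>t. t \<in> I01 \<Longrightarrow> K 0 t = \<tau> 0" "\<And>t. t \<in> I01 \<Longrightarrow> K 1 t = \<tau> 1" "collared K" using \<tau> by (elim thin_relE) blast
  obtain \<epsilon> where \<epsilon>: "\<epsilon> > 0" "\<And>s t. s \<in> I01 \<Longrightarrow> t \<in> I01 \<Longrightarrow>
        (s \<le> \<epsilon> \<longrightarrow> H s t = H 0 t) \<and> (1 - \<epsilon> \<le> s \<longrightarrow> H s t = H 1 t) \<and>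
        (t \<le> \<epsilon> \<longrightarrow> H s t = H s 0) \<and> (1 - \<epsilon> \<le> t \<longrightarrow> H s t = H s 1)"
    using H(10) unfolding collared_def by blast
  obtain \<epsilon>' where \<epsilon>': "\<epsilon>' > 0" "\<And>s t. s \<in> I01 \<Longrightarrow> t \<in> I01 \<Longrightarrow>
        (s \<le> \<epsilon>' \<longrightarrow> K s t = K 0 t) \<and> (1 - \<epsilon>' \<le> s \<longrightarrow> K s t = K 1 t) \<and>
        (t \<le> \<epsilon>' \<longrightarrow> K s t = K s 0) \<and> (1 - \<epsilon>' \<le> t \<longrightarrow> K s t = K s 1)"
    using K(10) unfolding collared_def by blast
  define d where "d = min (min \<epsilon> \<epsilon>' / 2) (1/4)"
  have d: "d > 0" "2 * d \<le> \<epsilon>" "2 * d \<le> \<epsilon>'" "d \<le> 1/4" using \<epsilon> \<epsilon>' by (auto simp: d_def)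
  define G where "G s t = (if s \<le> 1/2 then K (2 * s) t else H (2 * s - 1) t)" for s t
  \<comment> \<open>Independent of \<open>t\<close> as well: near the seam both homotopies take
    their value on a vertical edge, which is the common end point.\<close>
  have mid: "G s t = K 1 0" if "s \<in> {1/2 - d<..<1/2 + d}" "t \<in> I01" for s t
    using that d e \<epsilon>(2)[of "2 * s - 1" t] \<epsilon>'(2)[of "2 * s" t] H(8)[of t] K(9)[of t] K(9)[of 0] by (simp add: G_def)
  have t: "thin_map M G"
  proof (rule thin_map_local[OF M])
    fix s t :: real assume st: "s \<in> I01" "t \<in> I01"
    consider "s < 1/2" | "s > 1/2" | "s = 1/2" by linarith
    then show "\<exists>S T K h1 h2. open S \<and> open T \<and> s \<in> S \<and> t \<in> T \<and> thin_map M K \<and>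
        smooth_fn 2 (topspace (Euclidean_space 2)) (\<lambda>x. h1 (x 0) (x 1)) \<and> smooth_fn 2 (topspace (Euclidean_space 2)) (\<lambda>x. h2 (x 0) (x 1)) \<and>
        (\<forall>s'\<in>I01 \<inter> S. \<forall>t'\<in>I01 \<inter> T. h1 s' t' \<in> I01 \<and> h2 s' t' \<in> I01 \<and> G s' t' = K (h1 s' t') (h2 s' t'))"
    proof cases
      case 1
      then show ?thesis using K(5)
        by (intro exI[of _ "{..<1/2}"] exI[of _ UNIV] exI[of _ K] exI[of _ "\<lambda>s t. 2 * s"] exI[of _ "\<lambda>s t. t"])
          (auto intro!: smooth_fn_intros simp: G_def)
    next
      case 2
      then show ?thesis using H(5)
        by (intro exI[of _ "{1/2<..}"] exI[of _ UNIV] exI[of _ H] exI[of _ "\<lambda>s t. 2 * s - 1"] exI[of _ "\<lambda>s t. t"])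
          (auto intro!: smooth_fn_intros simp: G_def)
    next
      case 3
      then show ?thesis using K(5) d mid
        by (intro exI[of _ "{1/2 - d<..<1/2 + d}"] exI[of _ UNIV] exI[of _ K] exI[of _ "\<lambda>s t. 1"] exI[of _ "\<lambda>s t. 0"])
          (auto intro!: smooth_fn_intros)
    qed
  qed
  have c: "collared G"
    unfolding collared_def
  proof (intro exI[of _ d] conjI ballI impI d(1))
    fix s t :: real assume st: "s \<in> I01" "t \<in> I01"
    { assume "s \<le> d" then show "G s t = G 0 t" using st d \<epsilon>'(2)[of "2 * s" t] by (simp add: G_def) }
    { assume "1 - d \<le> s" then show "G s t = G 1 t" using st d \<epsilon>(2)[of "2 * s - 1" t] by (simp add: G_def) }
    { assume "t \<le> d" then show "G s t = G s 0" using st d \<epsilon>(2)[of "2 * s - 1" t] \<epsilon>'(2)[of "2 * s" t] by (simp add: G_def) }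
    { assume "1 - d \<le> t" then show "G s t = G s 1" using st d \<epsilon>(2)[of "2 * s - 1" t] \<epsilon>'(2)[of "2 * s" t] by (simp add: G_def) }
  qed
  show ?thesis
  proof (rule thin_relI[OF _ _ t _ _ _ _ c])
    show "concat_path \<gamma> \<tau> \<in> paths M" "concat_path \<gamma>' \<tau>' \<in> paths M"
      using concat_path_in_paths[OF M] H(1-4) K(1-4) e by auto
  qed (use H K in \<open>auto simp: G_def concat_path_def\<close>)
qed

section \<open>Paths and homotopies inside open submanifolds\<close>

lemma open_sub_pts: "open_sub M (pts M) = M"
  if "locally_euclidean M" for M :: "'m mfd"
proof (rule mfd.equality)
  show "atlas (open_sub M (pts M)) = atlas M"
    using openin_subset[OF is_chart_open[OF atlas_is_chart[OF that]]] by (auto simp: open_sub_def)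
qed auto

lemma paths_open_sub:
  assumes M: "locally_euclidean M" and U: "openin (mtop M) U"
  shows "\<gamma> \<in> paths (open_sub M U) \<longleftrightarrow> \<gamma> \<in> paths M \<and> (\<forall>t\<in>I01. \<gamma> t \<in> U)"
proof
  assume \<gamma>: "\<gamma> \<in> paths (open_sub M U)"
  then have "smooth_curve M \<gamma>"
    using smooth_from_extend[OF M U] by (auto simp: paths_iff smooth_curve_def)
  then show "\<gamma> \<in> paths M \<and> (\<forall>t\<in>I01. \<gamma> t \<in> U)"
    using \<gamma> path_pts[OF \<gamma>] pts_open_sub[OF U] by (auto simp: paths_iff)
next
  assume \<gamma>: "\<gamma> \<in> paths M \<and> (\<forall>t\<in>I01. \<gamma> t \<in> U)"
  then have "smooth_curve (open_sub M U) \<gamma>"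
    unfolding smooth_curve_def paths_iff by (intro smooth_from_corestrict U) auto
  then show "\<gamma> \<in> paths (open_sub M U)" using \<gamma> by (simp add: paths_iff)
qed

lemma thin_rel_open_subI:
  assumes M: "locally_euclidean M" and U: "openin (mtop M) U"
    and \<gamma>: "\<gamma>0 \<in> paths M" "\<gamma>1 \<in> paths M" and H: "thin_map M H"
    "\<And>s. s \<in> I01 \<Longrightarrow> H s 0 = \<gamma>0 s" "\<And>s. s \<in> I01 \<Longrightarrow> H s 1 = \<gamma>1 s"
    "\<And>t. t \<in> I01 \<Longrightarrow> H 0 t = \<gamma>0 0" "\<And>t. t \<in> I01 \<Longrightarrow> H 1 t = \<gamma>0 1" "collared H"
    and HU: "\<And>s t. s \<in> I01 \<Longrightarrow> t \<in> I01 \<Longrightarrow> H s t \<in> U"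
  shows "(\<gamma>0, \<gamma>1) \<in> thin_rel (open_sub M U)"
proof (rule thin_relI[OF _ _ thin_map_corestrict[OF H(1) U HU] H(2-6)])
  have "\<gamma>0 s \<in> U" "\<gamma>1 s \<in> U" if "s \<in> I01" for s
    using HU[of s 0] HU[of s 1] H(2,3)[of s] that by auto
  then show "\<gamma>0 \<in> paths (open_sub M U)" "\<gamma>1 \<in> paths (open_sub M U)"
    using \<gamma> paths_open_sub[OF M U] by auto
qed

text \<open>The step function turns an arbitrary segment in the square into a path with sitting instances.\<close>

definition arc2 :: "(real \<Rightarrow> real \<Rightarrow> 'm) \<Rightarrow> real \<times> real \<Rightarrow> real \<times> real \<Rightarrow> real \<Rightarrow> 'm" where
  "arc2 H p q = (\<lambda>r\<in>I01. H (fst p + step r * (fst q - fst p)) (snd p + step r * (snd q - snd p)))"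

abbreviation arc :: "(real \<Rightarrow> 'm) \<Rightarrow> real \<Rightarrow> real \<Rightarrow> real \<Rightarrow> 'm" where
  "arc \<gamma> a b \<equiv> arc2 (\<lambda>s t. \<gamma> s) (a, 0) (b, 0)"

lemma arc2_ends [simp]: "arc2 H p q 0 = H (fst p) (snd p)" "arc2 H p q 1 = H (fst q) (snd q)"
  by (simp_all add: arc2_def)

lemma arc_eq: "arc \<gamma> a b = (\<lambda>r\<in>I01. \<gamma> (a + step r * (b - a)))"
  by (simp add: arc2_def)

lemma convex_pair:
  assumes "convex C" "(a1, a2) \<in> C" "(b1, b2) \<in> C" "0 \<le> u" "u \<le> (1::real)"
  shows "(a1 + u * (b1 - a1), a2 + u * (b2 - a2)) \<in> C"
proof -
  have "(1 - u) *\<^sub>R (a1, a2) + u *\<^sub>R (b1, b2) \<in> C" using assms convexD_alt by blast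
  moreover have "(1 - u) *\<^sub>R (a1, a2) + u *\<^sub>R (b1, b2) = (a1 + u * (b1 - a1), a2 + u * (b2 - a2))"
    by (simp add: algebra_simps)
  ultimately show ?thesis by simp
qed

lemma convex_pair_step:
  assumes "convex C" "p \<in> C" "q \<in> C"
  shows "(fst p + step r * (fst q - fst p), snd p + step r * (snd q - snd p)) \<in> C"
  using convex_pair[OF assms(1), of "fst p" "snd p" "fst q" "snd q" "step r"] assms step_nonneg step_le_1 by simp

lemma arc2_in_paths:
  assumes M: "locally_euclidean M" and H: "thin_map M H" and p: "p \<in> I01 \<times> I01" and q: "q \<in> I01 \<times> I01"
  shows "arc2 H p q \<in> paths M"
  unfolding paths_iff
proof (intro conjI)
  let ?h = "\<lambda>x. vec2 (fst p + step (x 0) * (fst q - fst p)) (snd p + step (x 0) * (snd q - snd p))"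
  have C: "(fst p + step r * (fst q - fst p), snd p + step r * (snd q - snd p)) \<in> I01 \<times> I01" for r
    by (rule convex_pair_step) (auto intro!: convex_Times p q)
  show "smooth_curve M (arc2 H p q)"
    unfolding smooth_curve_def
  proof (rule smooth_from_compose[OF M _ openin_topspace thin_map_smooth[OF H], where h = ?h])
    show "smooth_eucl 1 (topspace (Euclidean_space 1)) 2 ?h"
      by (intro smooth_eucl_vec smooth_fn_intros) auto
  qed (use C in \<open>auto simp: arc2_def\<close>)
  show "sitting (arc2 H p q)"
    unfolding sitting_def by (intro exI[of _ "1/3"]) (auto simp: arc2_def)
qed (simp add: arc2_def)

lemma arc2_in_paths_open_sub:
  assumes M: "locally_euclidean M" and H: "thin_map M H" and U: "openin (mtop M) U"
    and C: "convex C" "C \<subseteq> I01 \<times> I01" "\<And>s t. (s, t) \<in> C \<Longrightarrow> H s t \<in> U" and pq: "p \<in> C" "q \<in> C"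
  shows "arc2 H p q \<in> paths (open_sub M U)"
proof -
  have "H (fst p + step r * (fst q - fst p)) (snd p + step r * (snd q - snd p)) \<in> U" for r
    by (rule C(3), rule convex_pair_step[OF C(1) pq])
  then have "arc2 H p q t \<in> U" if "t \<in> I01" for t using that by (simp add: arc2_def)
  moreover have "arc2 H p q \<in> paths M" by (rule arc2_in_paths[OF M H]) (use C pq in blast)+
  ultimately show ?thesis using paths_open_sub[OF M U] by blast
qed

text \<open>Both paths are images under \<open>H\<close> of curves in \<open>C\<close> from
  \<open>p\<close> to \<open>r\<close>. The straight-line homotopy between these curves stays in the
  convex set \<open>C\<close>, and its composite with \<open>H\<close> has rank at most one, hence
  is thin and stays in \<open>U\<close>.\<close>

lemma arc2_triangle:
  assumes M: "locally_euclidean M" and H: "thin_map M H" and U: "openin (mtop M) U"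
    and C: "convex C" "C \<subseteq> I01 \<times> I01" "\<And>s t. (s, t) \<in> C \<Longrightarrow> H s t \<in> U" and pqr: "p \<in> C" "q \<in> C" "r \<in> C"
  shows "(concat_path (arc2 H q r) (arc2 H p q), arc2 H p r) \<in> thin_rel (open_sub M U)"
proof -
  \<comment> \<open>The broken line through \<open>p\<close>, \<open>q\<close>, \<open>r\<close>
    with the timing of the concatenation. One smooth formula serves for both halves, since the first
    step has reached 1 before the second leaves 0.\<close>
  define c where "c f s = f p + step (2 * s) * (f q - f p) + step (2 * s - 1) * (f r - f q)" for f :: "real \<times> real \<Rightarrow> real" and s
  define a where "a f s = f p + step s * (f r - f p)" for f :: "real \<times> real \<Rightarrow> real" and s
  define h where "h f s t = c f s + step t * (a f s - c f s)" for f :: "real \<times> real \<Rightarrow> real" and s t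
  have cC: "(c fst s, c snd s) \<in> C" for s
  proof (cases "s \<le> 1/2")
    case True
    then show ?thesis using convex_pair_step[OF C(1) pqr(1,2), of "2 * s"] by (simp add: c_def)
  next
    case False
    then show ?thesis using convex_pair_step[OF C(1) pqr(2,3), of "2 * s - 1"] by (simp add: c_def)
  qed
  have aC: "(a fst s, a snd s) \<in> C" for s
    unfolding a_def by (rule convex_pair_step[OF C(1) pqr(1,3)])
  have hC: "(h fst s t, h snd s t) \<in> C" for s t
    unfolding h_def by (rule convex_pair[OF C(1) cC aC step_nonneg step_le_1])
  define G where "G s t = H (h fst s t) (h snd s t)" for s t
  have t: "thin_map M G"
  proof (rule thin_map_compose[OF M H, of "h fst" "h snd"])
    show "smooth_fn 2 (topspace (Euclidean_space 2)) (\<lambda>x. h fst (x 0) (x 1))" "smooth_fn 2 (topspace (Euclidean_space 2)) (\<lambda>x. h snd (x 0) (x 1))"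
      unfolding h_def a_def c_def by (intro smooth_fn_intros openin_topspace)+
    have "(h fst s t, h snd s t) \<in> I01 \<times> I01" for s t using hC C(2) by blast
    then show "h fst s t \<in> I01 \<and> h snd s t \<in> I01 \<and> G s t = H (h fst s t) (h snd s t)" for s t
      by (simp add: G_def)
  qed
  have col: "collared G"
    unfolding collared_def
  \<comment> \<open>All steps involved, including those at double speed, are constant on the first
    and on the last sixth.\<close>
  proof (intro exI[of _ "1/6"] conjI ballI impI)
    fix s t :: real
    { assume "s \<le> 1/6" then show "G s t = G 0 t" by (simp add: G_def h_def a_def c_def) }
    { assume "1 - 1/6 \<le> s" then show "G s t = G 1 t" by (simp add: G_def h_def a_def c_def) }
    { assume "t \<le> 1/6" then show "G s t = G s 0" by (simp add: G_def h_def) }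
    { assume "1 - 1/6 \<le> t" then show "G s t = G s 1" by (simp add: G_def h_def) }
  qed auto
  have pI: "p \<in> I01 \<times> I01" "q \<in> I01 \<times> I01" "r \<in> I01 \<times> I01" using pqr C(2) by auto
  note arcs = arc2_in_paths[OF M H pI(1,2)] arc2_in_paths[OF M H pI(2,3)] arc2_in_paths[OF M H pI(1,3)]
  show ?thesis
  proof (rule thin_rel_open_subI[OF M U _ arcs(3) t _ _ _ _ col])
    show "concat_path (arc2 H q r) (arc2 H p q) \<in> paths M"
      by (rule concat_path_in_paths[OF M arcs(2,1)]) simp
    fix s :: real assume s: "s \<in> I01"
    show "G s 0 = concat_path (arc2 H q r) (arc2 H p q) s"
      using s by (cases "s \<le> 1/2") (simp_all add: concat_path_def arc2_def G_def h_def c_def)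
    show "G s 1 = arc2 H p r s" using s by (simp add: arc2_def G_def h_def a_def)
  next
    fix t :: real
    show "G 0 t = concat_path (arc2 H q r) (arc2 H p q) 0" "G 1 t = concat_path (arc2 H q r) (arc2 H p q) 1"
      by (simp_all add: concat_path_simps G_def h_def a_def c_def)
  next
    fix s t show "G s t \<in> U" unfolding G_def by (rule C(3)[OF hC])
  qed
qed

text \<open>The parameter \<open>s\<close> is moved linearly to \<open>step s\<close>. A curve of
  parameters sweeps out no area, so the homotopy is thin; near the ends the path is already
  constant.\<close>

lemma path_thin_arc:
  assumes M: "locally_euclidean M" and \<gamma>: "\<gamma> \<in> paths M"
  shows "(\<gamma>, arc \<gamma> 0 1) \<in> thin_rel M"
proof -
  have H: "thin_map M (\<lambda>s t. \<gamma> s)" by (rule thin_map_curve[OF M path_smooth[OF \<gamma>]])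
  obtain \<epsilon>0 where \<epsilon>0: "\<epsilon>0 > 0" "\<And>t. t \<in> I01 \<Longrightarrow> (t \<le> \<epsilon>0 \<longrightarrow> \<gamma> t = \<gamma> 0) \<and> (1 - \<epsilon>0 \<le> t \<longrightarrow> \<gamma> t = \<gamma> 1)"
    using sittingE[of \<gamma>] \<gamma> unfolding paths_iff by blast
  \<comment> \<open>The bound 1/3 makes \<open>step\<close> constant on the same margins, both for
    the parameter and for the time of the homotopy.\<close>
  define \<epsilon> where "\<epsilon> = min \<epsilon>0 (1/3)"
  have \<epsilon>: "\<epsilon> > 0" "\<epsilon> \<le> 1/3" "\<epsilon> \<le> \<epsilon>0" using \<epsilon>0 by (auto simp: \<epsilon>_def)
  define h where "h s t = s + step t * (step s - s)" for s t
  have hI: "h s t \<in> I01" if "s \<in> I01" for s t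
  proof -
    have "(s + step t * (step s - s), 0 + step t * (0 - 0)) \<in> I01 \<times> I01"
      by (rule convex_pair) (use that in \<open>auto intro!: convex_Times simp: step_nonneg step_le_1\<close>)
    then show ?thesis by (simp add: h_def)
  qed
  define G where "G s t = \<gamma> (h s t)" for s t
  have t: "thin_map M G"
    by (rule thin_map_compose[OF M H, of h "\<lambda>s t. 0"])
      (use hI in \<open>auto simp: G_def h_def intro!: smooth_fn_intros\<close>)
  have lo: "G s t = \<gamma> 0" if "s \<in> I01" "s \<le> \<epsilon>" for s t
  proof -
    have "h s t = (1 - step t) * s" using that \<epsilon> by (simp add: h_def algebra_simps)
    also have "\<dots> \<le> 1 * s" using that by (intro mult_right_mono) (auto simp: step_nonneg)
    finally show ?thesis using \<epsilon>0(2)[OF hI[OF that(1)], of t] that \<epsilon> by (simp add: G_def)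
  qed
  have hi: "G s t = \<gamma> 1" if "s \<in> I01" "1 - \<epsilon> \<le> s" for s t
  proof -
    have "h s t = s + step t * (1 - s)" using that \<epsilon> by (simp add: h_def)
    moreover have "step t * (1 - s) \<ge> 0" using that by (simp add: step_nonneg)
    ultimately show ?thesis using \<epsilon>0(2)[OF hI[OF that(1)], of t] that \<epsilon> by (simp add: G_def)
  qed
  have col: "collared G"
    unfolding collared_def
  proof (intro exI[of _ \<epsilon>] conjI ballI impI \<epsilon>(1))
    fix s t :: real assume st: "s \<in> I01" "t \<in> I01"
    { assume "s \<le> \<epsilon>" then show "G s t = G 0 t" using lo[of s t] lo[of 0 t] st \<epsilon> by simp }
    { assume "1 - \<epsilon> \<le> s" then show "G s t = G 1 t" using hi[of s t] hi[of 1 t] st \<epsilon> by simp }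
    { assume "t \<le> \<epsilon>" then show "G s t = G s 0" using \<epsilon> by (simp add: G_def h_def) }
    { assume "1 - \<epsilon> \<le> t" then show "G s t = G s 1" using \<epsilon> by (simp add: G_def h_def) }
  qed
  show ?thesis
    by (rule thin_relI[OF \<gamma> arc2_in_paths[OF M H] t _ _ _ _ col])
      (use lo[of 0] hi[of 1] \<epsilon> in \<open>auto simp: arc_eq G_def h_def\<close>)
qed

section \<open>The thin fundamental groupoid\<close>

definition cls :: "'m mfd \<Rightarrow> (real \<Rightarrow> 'm) \<Rightarrow> (real \<Rightarrow> 'm) set" where
  "cls M \<gamma> = thin_rel M `` {\<gamma>}"

lemma mem_cls: "\<gamma>' \<in> cls M \<gamma> \<longleftrightarrow> (\<gamma>, \<gamma>') \<in> thin_rel M"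
  by (simp add: cls_def)

lemma cls_eqI: "locally_euclidean M \<Longrightarrow> (\<gamma>, \<gamma>') \<in> thin_rel M \<Longrightarrow> cls M \<gamma> = cls M \<gamma>'"
  unfolding cls_def by (rule equiv_class_eq[OF thin_rel_equiv])

lemma cls_eqD:
  assumes "locally_euclidean M" "\<gamma>' \<in> paths M" "cls M \<gamma> = cls M \<gamma>'"
  shows "(\<gamma>, \<gamma>') \<in> thin_rel M"
  using eq_equiv_class[OF assms(3)[unfolded cls_def] thin_rel_equiv[OF assms(1)] assms(2)] .

lemma thin_rel_refl: "locally_euclidean M \<Longrightarrow> \<gamma> \<in> paths M \<Longrightarrow> (\<gamma>, \<gamma>) \<in> thin_rel M"
  using equiv_class_self[OF thin_rel_equiv] by blast

lemma thin_rel_ends: "(\<gamma>, \<gamma>') \<in> thin_rel M \<Longrightarrow> \<gamma> \<in> paths M \<and> \<gamma>' \<in> paths M \<and> \<gamma> 0 = \<gamma>' 0 \<and> \<gamma> 1 = \<gamma>' 1"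
  by (auto simp: thin_rel_def)

lemma Obj_Pi_thin [simp]: "Obj (Pi_thin M) = pts M"
  by (simp add: Pi_thin_def)

lemma Arr_Pi_thin: "Arr (Pi_thin M) = cls M ` paths M"
  by (auto simp: Pi_thin_def quotient_def cls_def)

lemma Dom_cls: "locally_euclidean M \<Longrightarrow> \<gamma> \<in> paths M \<Longrightarrow> Dom (Pi_thin M) (cls M \<gamma>) = \<gamma> 0"
  and Cod_cls: "locally_euclidean M \<Longrightarrow> \<gamma> \<in> paths M \<Longrightarrow> Cod (Pi_thin M) (cls M \<gamma>) = \<gamma> 1"
proof -
  assume M: "locally_euclidean M" and \<gamma>: "\<gamma> \<in> paths M"
  have "\<gamma> \<in> cls M \<gamma>" by (simp add: mem_cls thin_rel_refl[OF M \<gamma>])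
  have "(\<lambda>\<gamma>. \<gamma> t) ` cls M \<gamma> = {\<gamma> t}" if t: "t = 0 \<or> t = 1" for t
  proof -
    have "\<gamma>' t = \<gamma> t" if "\<gamma>' \<in> cls M \<gamma>" for \<gamma>'
      using thin_rel_ends[of \<gamma> \<gamma>' M] that t by (auto simp: mem_cls)
    then have "(\<lambda>\<gamma>. \<gamma> t) ` cls M \<gamma> = (\<lambda>_. \<gamma> t) ` cls M \<gamma>" by (rule image_cong[OF refl])
    then show ?thesis using image_constant[OF \<open>\<gamma> \<in> cls M \<gamma>\<close>] by simp
  qed
  then show "Dom (Pi_thin M) (cls M \<gamma>) = \<gamma> 0" "Cod (Pi_thin M) (cls M \<gamma>) = \<gamma> 1"
    by (simp_all add: Pi_thin_def)
qed

lemma Comp_cls: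
  assumes M: "locally_euclidean M" and \<gamma>: "\<gamma> \<in> paths M" and \<tau>: "\<tau> \<in> paths M" and e: "\<tau> 1 = \<gamma> 0"
  shows "Comp (Pi_thin M) (cls M \<gamma>) (cls M \<tau>) = cls M (concat_path \<gamma> \<tau>)"
proof -
  have "thin_rel M `` {concat_path \<gamma>' \<tau>'} = cls M (concat_path \<gamma> \<tau>)" if "\<gamma>' \<in> cls M \<gamma>" "\<tau>' \<in> cls M \<tau>" for \<gamma>' \<tau>'
  proof -
    have "(\<gamma>, \<gamma>') \<in> thin_rel M" "(\<tau>, \<tau>') \<in> thin_rel M" using that by (simp_all add: mem_cls)
    from cls_eqI[OF M thin_rel_concat[OF M this e]] show ?thesis by (simp add: cls_def)
  qed
  moreover have "\<gamma> \<in> cls M \<gamma>" "\<tau> \<in> cls M \<tau>" by (simp_all add: mem_cls thin_rel_refl[OF M] \<gamma> \<tau>)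
  ultimately show ?thesis by (auto simp: Pi_thin_def)
qed

lemma Ident_cls: "Ident (Pi_thin M) x = cls M (\<lambda>t\<in>I01. x)"
  by (simp add: Pi_thin_def cls_def)

lemma const_path_in_paths:
  assumes "locally_euclidean M" "x \<in> pts M"
  shows "(\<lambda>t\<in>I01. x) \<in> paths M"
  unfolding paths_iff
proof (intro conjI)
  show "smooth_curve M (\<lambda>t\<in>I01. x)"
    by (rule smooth_curve_cong[OF smooth_curve_const[OF assms]]) simp
  show "sitting (\<lambda>t\<in>I01. x)" unfolding sitting_def by (intro exI[of _ 1]) auto
qed simp

lemma arc2_triangle_cls:
  assumes M: "locally_euclidean M" and H: "thin_map M H" and pqr: "p \<in> I01 \<times> I01" "q \<in> I01 \<times> I01" "r \<in> I01 \<times> I01"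
  shows "cls M (concat_path (arc2 H q r) (arc2 H p q)) = cls M (arc2 H p r)"
proof -
  have "H s t \<in> pts M" if "(s, t) \<in> I01 \<times> I01" for s t
    using smooth_from_pts[OF thin_map_smooth[OF H], of "vec2 s t"] that by simp
  then have "(concat_path (arc2 H q r) (arc2 H p q), arc2 H p r) \<in> thin_rel (open_sub M (pts M))"
    by (intro arc2_triangle[OF M H openin_topspace, where C = "I01 \<times> I01"]) (auto intro!: convex_Times pqr)
  then show ?thesis using cls_eqI[OF M] open_sub_pts[OF M] by metis
qed

lemma arc_in_paths: "locally_euclidean M \<Longrightarrow> smooth_curve M \<gamma> \<Longrightarrow> a \<in> I01 \<Longrightarrow> b \<in> I01 \<Longrightarrow> arc \<gamma> a b \<in> paths M"
  by (rule arc2_in_paths[OF _ thin_map_curve]) auto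

text \<open>The degenerate case of the triangle, with all three points on one curve and in any
  order. The laws of the thin groupoid are all read off from it.\<close>

lemma Comp_arc:
  assumes M: "locally_euclidean M" and \<gamma>: "smooth_curve M \<gamma>" and "a \<in> I01" "b \<in> I01" "c \<in> I01"
  shows "Comp (Pi_thin M) (cls M (arc \<gamma> b c)) (cls M (arc \<gamma> a b)) = cls M (arc \<gamma> a c)"
proof -
  have "Comp (Pi_thin M) (cls M (arc \<gamma> b c)) (cls M (arc \<gamma> a b)) = cls M (concat_path (arc \<gamma> b c) (arc \<gamma> a b))"
    by (rule Comp_cls[OF M]) (use arc_in_paths[OF M \<gamma>] assms(3-5) in auto)
  also have "\<dots> = cls M (arc \<gamma> a c)"
    by (rule arc2_triangle_cls[OF M thin_map_curve[OF M \<gamma>]]) (use assms(3-5) in auto)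
  finally show ?thesis .
qed

lemma cls_arc: "locally_euclidean M \<Longrightarrow> \<gamma> \<in> paths M \<Longrightarrow> cls M (arc \<gamma> 0 1) = cls M \<gamma>"
  using cls_eqI[OF _ path_thin_arc] by metis

lemma arc_const: "arc \<gamma> a a = (\<lambda>t\<in>I01. \<gamma> a)"
  by (simp add: arc_eq)

text \<open>No reparametrization homotopy has to be written down: identities are arcs of length
  zero, and for associativity the three paths are consecutive arcs of a single concatenation, where
  \<open>Comp_arc\<close> applies to either bracketing.\<close>

lemma category_Pi_thin:
  assumes M: "locally_euclidean M"
  shows "category (Pi_thin M)"
proof
  note [simp] = Dom_cls[OF M] Cod_cls[OF M]
  note cp = const_path_in_paths[OF M] concat_path_in_paths[OF M]
  fix a assume a: "a \<in> Arr (Pi_thin M)"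
  then obtain \<gamma> where \<gamma>: "\<gamma> \<in> paths M" "a = cls M \<gamma>" by (auto simp: Arr_Pi_thin)
  show "Dom (Pi_thin M) a \<in> Obj (Pi_thin M)" "Cod (Pi_thin M) a \<in> Obj (Pi_thin M)"
    using \<gamma> path_pts[OF \<gamma>(1)] by auto
  have "Comp (Pi_thin M) (cls M (arc \<gamma> 0 1)) (cls M (arc \<gamma> 0 0)) = cls M (arc \<gamma> 0 1)"
    "Comp (Pi_thin M) (cls M (arc \<gamma> 1 1)) (cls M (arc \<gamma> 0 1)) = cls M (arc \<gamma> 0 1)"
    by (rule Comp_arc[OF M path_smooth[OF \<gamma>(1)]]; simp)+
  then show "Comp (Pi_thin M) a (Ident (Pi_thin M) (Dom (Pi_thin M) a)) = a"
    "Comp (Pi_thin M) (Ident (Pi_thin M) (Cod (Pi_thin M) a)) a = a"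
    using cls_arc[OF M \<gamma>(1)] \<gamma> by (simp_all add: Ident_cls arc_const)
  fix b assume b: "b \<in> Arr (Pi_thin M)" and ab: "Cod (Pi_thin M) a = Dom (Pi_thin M) b"
  then obtain \<tau> where \<tau>: "\<tau> \<in> paths M" "b = cls M \<tau>" by (auto simp: Arr_Pi_thin)
  have e: "\<gamma> 1 = \<tau> 0" using ab \<gamma> \<tau> by simp
  note ba = Comp_cls[OF M \<tau>(1) \<gamma>(1) e] and p1 = cp(2)[OF \<tau>(1) \<gamma>(1) e]
  show "Comp (Pi_thin M) b a \<in> Arr (Pi_thin M)" "Dom (Pi_thin M) (Comp (Pi_thin M) b a) = Dom (Pi_thin M) a"
    "Cod (Pi_thin M) (Comp (Pi_thin M) b a) = Cod (Pi_thin M) b"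
    using ba p1 \<gamma> \<tau> by (auto simp: Arr_Pi_thin concat_path_simps)
  fix c assume c: "c \<in> Arr (Pi_thin M)" and bc: "Cod (Pi_thin M) b = Dom (Pi_thin M) c"
  then obtain \<rho> where \<rho>: "\<rho> \<in> paths M" "c = cls M \<rho>" by (auto simp: Arr_Pi_thin)
  have e': "\<tau> 1 = \<rho> 0" using bc \<rho> \<tau> by simp
  \<comment> \<open>This bracketing puts \<open>\<gamma>\<close>, \<open>\<tau>\<close> and
    \<open>\<rho>\<close> on the intervals with break points 0, 1/2, 3/4 and 1.\<close>
  define p where "p = concat_path (concat_path \<rho> \<tau>) \<gamma>"
  have p: "p \<in> paths M" unfolding p_def by (rule cp(2)[OF cp(2)[OF \<rho>(1) \<tau>(1) e'] \<gamma>(1)]) (simp add: concat_path_simps e)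
  note step = step_nonneg step_le_1
  have 1: "arc \<gamma> 0 1 = arc p 0 (1/2)"
    unfolding arc_eq
  proof (rule restrict_ext)
    fix r
    have "p (0 + step r * (1/2 - 0)) = \<gamma> (2 * (0 + step r * (1/2 - 0)))"
      unfolding p_def by (rule concat_path_simps(1)) (use step[of r] in auto)
    then show "\<gamma> (0 + step r * (1 - 0)) = p (0 + step r * (1/2 - 0))" by simp
  qed
  have 2: "arc \<tau> 0 1 = arc p (1/2) (3/4)"
    unfolding arc_eq
  proof (rule restrict_ext)
    fix r
    have "p (1/2 + step r * (3/4 - 1/2)) = concat_path \<rho> \<tau> (2 * (1/2 + step r * (3/4 - 1/2)) - 1)"
      unfolding p_def by (rule concat_path_simp2) (use step[of r] in \<open>auto simp: e concat_path_simps\<close>)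
    also have "\<dots> = \<tau> (2 * (2 * (1/2 + step r * (3/4 - 1/2)) - 1))"
      by (rule concat_path_simps(1)) (use step[of r] in auto)
    finally show "\<tau> (0 + step r * (1 - 0)) = p (1/2 + step r * (3/4 - 1/2))" by simp
  qed
  have 3: "arc \<rho> 0 1 = arc p (3/4) 1"
    unfolding arc_eq
  proof (rule restrict_ext)
    fix r
    have "p (3/4 + step r * (1 - 3/4)) = concat_path \<rho> \<tau> (2 * (3/4 + step r * (1 - 3/4)) - 1)"
      unfolding p_def by (rule concat_path_simp2) (use step[of r] in \<open>auto simp: e concat_path_simps\<close>)
    also have "\<dots> = \<rho> (2 * (2 * (3/4 + step r * (1 - 3/4)) - 1) - 1)"
      by (rule concat_path_simp2[of \<tau> \<rho>, OF e']) (use step[of r] in auto)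
    finally show "\<rho> (0 + step r * (1 - 0)) = p (3/4 + step r * (1 - 3/4))" by simp
  qed
  note ps = path_smooth[OF p]
  have "Comp (Pi_thin M) c (Comp (Pi_thin M) b a) =
     Comp (Pi_thin M) (cls M (arc p (3/4) 1)) (Comp (Pi_thin M) (cls M (arc p (1/2) (3/4))) (cls M (arc p 0 (1/2))))"
    unfolding \<gamma>(2) \<tau>(2) \<rho>(2) by (simp only: cls_arc[OF M \<gamma>(1), symmetric] cls_arc[OF M \<tau>(1), symmetric] cls_arc[OF M \<rho>(1), symmetric] 1 2 3)
  also have "\<dots> = cls M (arc p 0 1)"
    using Comp_arc[OF M ps, of 0 "1/2" "3/4"] Comp_arc[OF M ps, of 0 "3/4" 1] by simp
  also have "\<dots> = cls M p" by (rule cls_arc[OF M p])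
  also have "\<dots> = Comp (Pi_thin M) (Comp (Pi_thin M) c b) a"
    using Comp_cls[OF M \<rho>(1) \<tau>(1) e'] Comp_cls[OF M cp(2)[OF \<rho>(1) \<tau>(1) e'] \<gamma>(1)] e
    by (simp add: \<gamma> \<tau> \<rho> p_def concat_path_simps)
  finally show "Comp (Pi_thin M) c (Comp (Pi_thin M) b a) = Comp (Pi_thin M) (Comp (Pi_thin M) c b) a" .
next
  fix x assume "x \<in> Obj (Pi_thin M)"
  then have x: "(\<lambda>t\<in>I01. x) \<in> paths M" using const_path_in_paths[OF M] by simp
  then show "Ident (Pi_thin M) x \<in> Arr (Pi_thin M)" "Dom (Pi_thin M) (Ident (Pi_thin M) x) = x"
    "Cod (Pi_thin M) (Ident (Pi_thin M) x) = x"
    using Dom_cls[OF M x] Cod_cls[OF M x] by (auto simp: Ident_cls Arr_Pi_thin)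
qed

text \<open>The value on a class is taken from an arbitrary representative; invariance under thin
  homotopy makes the choice harmless.\<close>

lemma functor_of_paths:
  assumes M: "locally_euclidean M" and D: "category D"
    and X: "\<And>x. x \<in> pts M \<Longrightarrow> X x \<in> Obj D"
    and E: "\<And>\<gamma>. \<gamma> \<in> paths M \<Longrightarrow> E \<gamma> \<in> Arr D \<and> Dom D (E \<gamma>) = X (\<gamma> 0) \<and> Cod D (E \<gamma>) = X (\<gamma> 1)"
    and thin: "\<And>\<gamma> \<gamma>'. (\<gamma>, \<gamma>') \<in> thin_rel M \<Longrightarrow> E \<gamma> = E \<gamma>'"
    and const: "\<And>x. x \<in> pts M \<Longrightarrow> E (\<lambda>t\<in>I01. x) = Ident D (X x)"
    and concat: "\<And>\<gamma> \<tau>. \<gamma> \<in> paths M \<Longrightarrow> \<tau> \<in> paths M \<Longrightarrow> \<tau> 1 = \<gamma> 0 \<Longrightarrow> E (concat_path \<gamma> \<tau>) = Comp D (E \<gamma>) (E \<tau>)"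
  obtains F where "is_functor (Pi_thin M) D F" "fobj F = restrict X (pts M)" "\<And>\<gamma>. \<gamma> \<in> paths M \<Longrightarrow> farr F (cls M \<gamma>) = E \<gamma>"
proof -
  define F where "F = \<lparr>fobj = restrict X (pts M), farr = (\<lambda>c\<in>Arr (Pi_thin M). E (SOME \<gamma>. \<gamma> \<in> paths M \<and> cls M \<gamma> = c))\<rparr>"
  have F: "farr F (cls M \<gamma>) = E \<gamma>" if \<gamma>: "\<gamma> \<in> paths M" for \<gamma>
  proof -
    let ?\<tau> = "SOME \<tau>. \<tau> \<in> paths M \<and> cls M \<tau> = cls M \<gamma>"
    have "?\<tau> \<in> paths M \<and> cls M ?\<tau> = cls M \<gamma>" by (rule someI[of _ \<gamma>]) (simp add: \<gamma>)
    then have "(?\<tau>, \<gamma>) \<in> thin_rel M" using cls_eqD[OF M \<gamma>] by blast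
    then show ?thesis using thin \<gamma> by (simp add: F_def Arr_Pi_thin)
  qed
  show ?thesis
  proof (rule that[of F])
    show "is_functor (Pi_thin M) D F"
      unfolding is_functor_def
    proof (intro conjI ballI impI category_Pi_thin[OF M] D)
      show "fobj F \<in> Obj (Pi_thin M) \<rightarrow>\<^sub>E Obj D" using X by (auto simp: F_def)
      show "farr F \<in> Arr (Pi_thin M) \<rightarrow>\<^sub>E Arr D"
        using F E by (auto simp: Arr_Pi_thin PiE_iff) (simp add: F_def Arr_Pi_thin)
    next
      fix a assume "a \<in> Arr (Pi_thin M)"
      then obtain \<gamma> where \<gamma>: "\<gamma> \<in> paths M" "a = cls M \<gamma>" by (auto simp: Arr_Pi_thin)
      show "Dom D (farr F a) = fobj F (Dom (Pi_thin M) a)" "Cod D (farr F a) = fobj F (Cod (Pi_thin M) a)"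
        using F[OF \<gamma>(1)] E[OF \<gamma>(1)] \<gamma> path_pts[OF \<gamma>(1)] Dom_cls[OF M \<gamma>(1)] Cod_cls[OF M \<gamma>(1)] by (simp_all add: F_def)
      fix b assume "b \<in> Arr (Pi_thin M)" and ab: "Cod (Pi_thin M) a = Dom (Pi_thin M) b"
      then obtain \<tau> where \<tau>: "\<tau> \<in> paths M" "b = cls M \<tau>" by (auto simp: Arr_Pi_thin)
      have e: "\<gamma> 1 = \<tau> 0" using ab \<gamma> \<tau> Dom_cls[OF M \<tau>(1)] Cod_cls[OF M \<gamma>(1)] by simp
      show "farr F (Comp (Pi_thin M) b a) = Comp D (farr F b) (farr F a)"
        using Comp_cls[OF M \<tau>(1) \<gamma>(1) e] F[OF concat_path_in_paths[OF M \<tau>(1) \<gamma>(1) e]] concat[OF \<tau>(1) \<gamma>(1) e] F \<gamma> \<tau> by simp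
    next
      fix x assume "x \<in> Obj (Pi_thin M)"
      then show "farr F (Ident (Pi_thin M) x) = Ident D (fobj F x)"
        using F[OF const_path_in_paths[OF M]] const by (simp add: Ident_cls) (simp add: F_def)
    qed
  qed (use F in \<open>auto simp: F_def\<close>)
qed

subsection \<open>Functoriality\<close>

lemma smooth_curve_postcompose:
  "locally_euclidean N \<Longrightarrow> locally_euclidean M \<Longrightarrow> smooth_map N M f \<Longrightarrow> smooth_curve N \<gamma> \<Longrightarrow> smooth_curve M (\<lambda>t. f (\<gamma> t))"
  unfolding smooth_curve_def by (rule smooth_from_postcompose)

lemma compose_in_paths:
  assumes N: "locally_euclidean N" and M: "locally_euclidean M" and f: "smooth_map N M f" and \<gamma>: "\<gamma> \<in> paths N"
  shows "compose I01 f \<gamma> \<in> paths M"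
  unfolding paths_iff
proof (intro conjI)
  show "smooth_curve M (compose I01 f \<gamma>)"
    by (rule smooth_curve_cong[OF smooth_curve_postcompose[OF N M f path_smooth[OF \<gamma>]]]) (simp add: compose_def)
  obtain \<epsilon> where \<epsilon>: "\<epsilon> > 0" "\<And>t. t \<in> I01 \<Longrightarrow> (t \<le> \<epsilon> \<longrightarrow> \<gamma> t = \<gamma> 0) \<and> (1 - \<epsilon> \<le> t \<longrightarrow> \<gamma> t = \<gamma> 1)"
    using sittingE[of \<gamma>] \<gamma> unfolding paths_iff by blast
  then show "sitting (compose I01 f \<gamma>)"
    unfolding sitting_def
  proof (intro exI[of _ \<epsilon>] conjI ballI impI)
    fix t :: real assume t: "t \<in> I01"
    { assume "t \<le> \<epsilon>" then show "compose I01 f \<gamma> t = compose I01 f \<gamma> 0" using \<epsilon>(2)[OF t] t by (simp add: compose_def) }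
    { assume "1 - \<epsilon> \<le> t" then show "compose I01 f \<gamma> t = compose I01 f \<gamma> 1" using \<epsilon>(2)[OF t] t by (simp add: compose_def) }
  qed
qed (simp add: compose_def)

lemma thin_rel_postcompose:
  assumes N: "locally_euclidean N" and M: "locally_euclidean M" and f: "smooth_map N M f" and \<gamma>: "(\<gamma>, \<gamma>') \<in> thin_rel N"
  shows "(compose I01 f \<gamma>, compose I01 f \<gamma>') \<in> thin_rel M"
proof -
  obtain H where H: "\<gamma> \<in> paths N" "\<gamma>' \<in> paths N" "\<gamma> 0 = \<gamma>' 0" "\<gamma> 1 = \<gamma>' 1" "thin_map N H"
      "\<And>s. s \<in> I01 \<Longrightarrow> H s 0 = \<gamma> s" "\<And>s. s \<in> I01 \<Longrightarrow> H s 1 = \<gamma>' s"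
      "\<And>t. t \<in> I01 \<Longrightarrow> H 0 t = \<gamma> 0" "\<And>t. t \<in> I01 \<Longrightarrow> H 1 t = \<gamma> 1" "collared H" using \<gamma> by (elim thin_relE) blast
  obtain \<epsilon> where "\<epsilon> > 0" and e: "\<And>s t. s \<in> I01 \<Longrightarrow> t \<in> I01 \<Longrightarrow>
        (s \<le> \<epsilon> \<longrightarrow> H s t = H 0 t) \<and> (1 - \<epsilon> \<le> s \<longrightarrow> H s t = H 1 t) \<and>
        (t \<le> \<epsilon> \<longrightarrow> H s t = H s 0) \<and> (1 - \<epsilon> \<le> t \<longrightarrow> H s t = H s 1)"
    using H(10) unfolding collared_def by blast
  have c: "collared (\<lambda>s t. f (H s t))"
    unfolding collared_def
  proof (intro exI[of _ \<epsilon>] conjI ballI impI \<open>\<epsilon> > 0\<close>)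
    fix s t :: real assume st: "s \<in> I01" "t \<in> I01"
    { assume "s \<le> \<epsilon>" then show "f (H s t) = f (H 0 t)" using e[OF st] by simp }
    { assume "1 - \<epsilon> \<le> s" then show "f (H s t) = f (H 1 t)" using e[OF st] by simp }
    { assume "t \<le> \<epsilon>" then show "f (H s t) = f (H s 0)" using e[OF st] by simp }
    { assume "1 - \<epsilon> \<le> t" then show "f (H s t) = f (H s 1)" using e[OF st] by simp }
  qed
  show ?thesis
    by (rule thin_relI[OF compose_in_paths[OF N M f H(1)] compose_in_paths[OF N M f H(2)] thin_map_postcompose[OF N M f H(5)] _ _ _ _ c])
      (use H in \<open>auto simp: compose_def\<close>)
qed

lemma compose_concat: "compose I01 f (concat_path \<gamma> \<tau>) = concat_path (compose I01 f \<gamma>) (compose I01 f \<tau>)"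
proof
  fix t
  show "compose I01 f (concat_path \<gamma> \<tau>) t = concat_path (compose I01 f \<gamma>) (compose I01 f \<tau>) t"
    by (cases "t \<in> I01"; cases "t \<le> 1/2") (simp_all add: compose_def concat_path_def)
qed

lemma Pi_thin_map_cls:
  assumes N: "locally_euclidean N" and M: "locally_euclidean M" and f: "smooth_map N M f" and \<gamma>: "\<gamma> \<in> paths N"
  shows "farr (Pi_thin_map (N, f, M)) (cls N \<gamma>) = cls M (compose I01 f \<gamma>)"
proof -
  have "thin_rel M `` {compose I01 f \<gamma>'} = cls M (compose I01 f \<gamma>)" if "\<gamma>' \<in> cls N \<gamma>" for \<gamma>'
    using cls_eqI[OF M thin_rel_postcompose[OF N M f, of \<gamma> \<gamma>']] that by (simp add: mem_cls cls_def[symmetric])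
  moreover have "\<gamma> \<in> cls N \<gamma>" by (simp add: mem_cls thin_rel_refl[OF N \<gamma>])
  ultimately show ?thesis using \<gamma> by (auto simp: Pi_thin_map_def Arr_Pi_thin)
qed

lemma functor_Pi_thin_map:
  assumes N: "locally_euclidean N" and M: "locally_euclidean M" and f: "smooth_map N M f"
  shows "is_functor (Pi_thin N) (Pi_thin M) (Pi_thin_map (N, f, M))"
  unfolding is_functor_def
proof (intro conjI ballI impI category_Pi_thin N M)
  let ?F = "Pi_thin_map (N, f, M)"
  note F = Pi_thin_map_cls[OF N M f] and cp = compose_in_paths[OF N M f]
  show "fobj ?F \<in> Obj (Pi_thin N) \<rightarrow>\<^sub>E Obj (Pi_thin M)"
    using smooth_map_pts[OF f] by (auto simp: Pi_thin_map_def)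
  show "farr ?F \<in> Arr (Pi_thin N) \<rightarrow>\<^sub>E Arr (Pi_thin M)"
    using F cp by (auto simp: Arr_Pi_thin PiE_iff) (simp add: Pi_thin_map_def Arr_Pi_thin)
  fix a assume "a \<in> Arr (Pi_thin N)"
  then obtain \<gamma> where \<gamma>: "\<gamma> \<in> paths N" "a = cls N \<gamma>" by (auto simp: Arr_Pi_thin)
  show "Dom (Pi_thin M) (farr ?F a) = fobj ?F (Dom (Pi_thin N) a)" "Cod (Pi_thin M) (farr ?F a) = fobj ?F (Cod (Pi_thin N) a)"
    using F[OF \<gamma>(1)] \<gamma> path_pts[OF \<gamma>(1)] Dom_cls[OF N \<gamma>(1)] Cod_cls[OF N \<gamma>(1)]
      Dom_cls[OF M cp[OF \<gamma>(1)]] Cod_cls[OF M cp[OF \<gamma>(1)]] by (simp_all add: Pi_thin_map_def compose_def)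
  fix b assume "b \<in> Arr (Pi_thin N)" and ab: "Cod (Pi_thin N) a = Dom (Pi_thin N) b"
  then obtain \<tau> where \<tau>: "\<tau> \<in> paths N" "b = cls N \<tau>" by (auto simp: Arr_Pi_thin)
  have e: "\<gamma> 1 = \<tau> 0" using ab \<gamma> \<tau> Dom_cls[OF N \<tau>(1)] Cod_cls[OF N \<gamma>(1)] by simp
  have e': "compose I01 f \<gamma> 1 = compose I01 f \<tau> 0" using e by (simp add: compose_def)
  show "farr ?F (Comp (Pi_thin N) b a) = Comp (Pi_thin M) (farr ?F b) (farr ?F a)"
    using Comp_cls[OF N \<tau>(1) \<gamma>(1) e] F[OF concat_path_in_paths[OF N \<tau>(1) \<gamma>(1) e]] F \<gamma> \<tau>
      Comp_cls[OF M cp[OF \<tau>(1)] cp[OF \<gamma>(1)] e'] by (simp add: compose_concat)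
next
  let ?F = "Pi_thin_map (N, f, M)"
  fix x assume x: "x \<in> Obj (Pi_thin N)"
  have "compose I01 f (\<lambda>t\<in>I01. x) = (\<lambda>t\<in>I01. f x)" by (auto simp: compose_def restrict_def)
  then show "farr ?F (Ident (Pi_thin N) x) = Ident (Pi_thin M) (fobj ?F x)"
    using Pi_thin_map_cls[OF N M f const_path_in_paths[OF N]] x by (simp add: Ident_cls) (simp add: Pi_thin_map_def)
qed

subsection \<open>Subdivision of paths\<close>

lemma smooth_curve_nhd:
  assumes \<gamma>: "smooth_curve M \<gamma>" and a: "a \<in> I01" and U: "openin (mtop M) U" "\<gamma> a \<in> U"
  obtains r where "r > 0" "\<And>t. t \<in> I01 \<Longrightarrow> \<bar>t - a\<bar> < r \<Longrightarrow> \<gamma> t \<in> U"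
proof -
  obtain W where W: "openin (Euclidean_space 1) W" "vec1 a \<in> W" "\<And>y. y \<in> unit_line \<Longrightarrow> y \<in> W \<Longrightarrow> \<gamma> (y 0) \<in> U"
    using smooth_from_nhd[OF \<gamma>[unfolded smooth_curve_def], of "vec1 a" U] a U by auto
  obtain r where r: "r > 0" "\<And>y. y \<in> topspace (Euclidean_space 1) \<Longrightarrow> (\<And>i. i < 1 \<Longrightarrow> \<bar>y i - vec1 a i\<bar> < r) \<Longrightarrow> y \<in> W"
    using openin_Euclidean_box[OF W(1,2)] by blast
  show ?thesis
  proof (rule that[OF r(1)])
    fix t :: real assume t: "t \<in> I01" "\<bar>t - a\<bar> < r"
    have "vec1 t \<in> W" by (rule r(2)) (use t in auto)
    then show "\<gamma> t \<in> U" using W(3)[of "vec1 t"] t by simp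
  qed
qed

lemma thin_map_nhd:
  assumes H: "thin_map M H" and a: "a \<in> I01" "b \<in> I01" and U: "openin (mtop M) U" "H a b \<in> U"
  obtains r where "r > 0" "\<And>s t. s \<in> I01 \<Longrightarrow> t \<in> I01 \<Longrightarrow> \<bar>s - a\<bar> < r \<Longrightarrow> \<bar>t - b\<bar> < r \<Longrightarrow> H s t \<in> U"
proof -
  obtain W where W: "openin (Euclidean_space 2) W" "vec2 a b \<in> W" "\<And>y. y \<in> unit_square \<Longrightarrow> y \<in> W \<Longrightarrow> H (y 0) (y 1) \<in> U"
    using smooth_from_nhd[OF thin_map_smooth[OF H], of "vec2 a b" U] a U by auto
  obtain r where r: "r > 0" "\<And>y. y \<in> topspace (Euclidean_space 2) \<Longrightarrow> (\<And>i. i < 2 \<Longrightarrow> \<bar>y i - vec2 a b i\<bar> < r) \<Longrightarrow> y \<in> W"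
    using openin_Euclidean_box[OF W(1,2)] by blast
  show ?thesis
  proof (rule that[OF r(1)])
    fix s t :: real assume t: "s \<in> I01" "t \<in> I01" "\<bar>s - a\<bar> < r" "\<bar>t - b\<bar> < r"
    have "vec2 s t \<in> W" by (rule r(2)) (use t in \<open>auto simp: less_2_cases_iff\<close>)
    then show "H s t \<in> U" using W(3)[of "vec2 s t"] t by simp
  qed
qed

text \<open>The form of connectedness of the unit interval that replaces all Lebesgue number arguments.\<close>

lemma I01_induct:
  assumes "t \<in> I01" "P 0"
    and step: "\<And>a. a \<in> I01 \<Longrightarrow> \<exists>r>0. \<forall>x\<in>I01. \<forall>y\<in>I01. \<bar>x - a\<bar> < r \<longrightarrow> \<bar>y - a\<bar> < r \<longrightarrow> P x \<longrightarrow> P y"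
  shows "P t"
proof (rule connected_induction_simple[of I01 0 t P])
  fix a :: real assume a: "a \<in> I01"
  then obtain r where r: "r > 0" "\<forall>x\<in>I01. \<forall>y\<in>I01. \<bar>x - a\<bar> < r \<longrightarrow> \<bar>y - a\<bar> < r \<longrightarrow> P x \<longrightarrow> P y" using step by blast
  show "\<exists>T. openin (top_of_set I01) T \<and> a \<in> T \<and> (\<forall>x\<in>T. \<forall>y\<in>T. P x \<longrightarrow> P y)"
    by (rule exI[of _ "I01 \<inter> ball a r"])
      (use a r in \<open>auto simp: openin_open dist_real_def abs_minus_commute\<close>)
qed (use assms in auto)

lemma arc_in_paths_open_sub:
  assumes M: "locally_euclidean M" and \<gamma>: "smooth_curve M \<gamma>" and U: "openin (mtop M) U"
    and J: "convex J" "J \<subseteq> I01" "\<And>t. t \<in> J \<Longrightarrow> \<gamma> t \<in> U" "a \<in> J" "b \<in> J"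
  shows "arc \<gamma> a b \<in> paths (open_sub M U)"
  by (rule arc2_in_paths_open_sub[OF M thin_map_curve[OF M \<gamma>] U, where C = "J \<times> {0}"])
    (use J in \<open>auto intro!: convex_Times\<close>)

lemma convex_I01_ball: "convex (I01 \<inter> {t. \<bar>t - a\<bar> < r})"
proof -
  have "{t. \<bar>t - a\<bar> < r} = ball a r" by (auto simp: dist_real_def)
  then show ?thesis by (simp add: convex_Int)
qed

text \<open>In place of a subdivision, the property is spread over the arcs of
  \<open>\<gamma>\<close> from 0 to \<open>t\<close>: near each time the curve stays in one member
  of the cover, and one local arc is composed on.\<close>

lemma path_class_induct:
  assumes M: "locally_euclidean M" and cover: "open_cover M \<U>" and \<gamma>: "\<gamma> \<in> paths M"
    and loc: "\<And>U \<gamma>. U \<in> \<U> \<Longrightarrow> \<gamma> \<in> paths (open_sub M U) \<Longrightarrow> P (cls M \<gamma>)"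
    and comp: "\<And>\<gamma> \<tau>. \<gamma> \<in> paths M \<Longrightarrow> \<tau> \<in> paths M \<Longrightarrow> \<tau> 1 = \<gamma> 0 \<Longrightarrow> P (cls M \<gamma>) \<Longrightarrow> P (cls M \<tau>) \<Longrightarrow> P (cls M (concat_path \<gamma> \<tau>))"
  shows "P (cls M \<gamma>)"
proof -
  note \<gamma>s = path_smooth[OF \<gamma>]
  have "P (cls M (arc \<gamma> 0 t))" if "t \<in> I01" for t
  proof (rule I01_induct[OF that])
    obtain U where U: "U \<in> \<U>" "\<gamma> 0 \<in> U" using path_pts[OF \<gamma>, of 0] cover by (auto simp: open_cover_def)
    then have oU: "openin (mtop M) U" using cover by (auto simp: open_cover_def)
    show "P (cls M (arc \<gamma> 0 0))"
      by (rule loc[OF U(1)], rule arc_in_paths_open_sub[OF M \<gamma>s oU, where J = "{0}"]) (use U in auto)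
  next
    fix a :: real assume a: "a \<in> I01"
    obtain U where U: "U \<in> \<U>" "\<gamma> a \<in> U" using path_pts[OF \<gamma> a] cover by (auto simp: open_cover_def)
    then have oU: "openin (mtop M) U" using cover by (auto simp: open_cover_def)
    obtain r where r: "r > 0" "\<And>t. t \<in> I01 \<Longrightarrow> \<bar>t - a\<bar> < r \<Longrightarrow> \<gamma> t \<in> U"
      using smooth_curve_nhd[OF \<gamma>s a oU U(2)] by blast
    show "\<exists>r>0. \<forall>x\<in>I01. \<forall>y\<in>I01. \<bar>x - a\<bar> < r \<longrightarrow> \<bar>y - a\<bar> < r \<longrightarrow> P (cls M (arc \<gamma> 0 x)) \<longrightarrow> P (cls M (arc \<gamma> 0 y))"
    proof (intro exI[of _ r] conjI r(1) ballI impI)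
      fix x y :: real assume xy: "x \<in> I01" "y \<in> I01" "\<bar>x - a\<bar> < r" "\<bar>y - a\<bar> < r" and P: "P (cls M (arc \<gamma> 0 x))"
      have "P (cls M (arc \<gamma> x y))"
        by (rule loc[OF U(1)], rule arc_in_paths_open_sub[OF M \<gamma>s oU convex_I01_ball[of a r]]) (use xy r in auto)
      then have "P (cls M (concat_path (arc \<gamma> x y) (arc \<gamma> 0 x)))"
        by (intro comp P) (use arc_in_paths[OF M \<gamma>s] xy in auto)
      then show "P (cls M (arc \<gamma> 0 y))"
        using arc2_triangle_cls[OF M thin_map_curve[OF M \<gamma>s], of "(0, 0)" "(x, 0)" "(y, 0)"] xy by simp
    qed
  qed
  from this[of 1] show ?thesis using cls_arc[OF M \<gamma>] by simp
qed

section \<open>Gluing local systems\<close>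

text \<open>Compatibility on overlaps is built in, as \<open>E\<close> depends on the path alone and
  not on the member that contains it. The target is an arbitrary category; torsors enter only when
  this is applied.\<close>

locale local_system = category D for D :: "('o, 'a) cat" +
  fixes M :: "'m mfd" and \<U> :: "'m set set" and X :: "'m \<Rightarrow> 'o" and E :: "(real \<Rightarrow> 'm) \<Rightarrow> 'a"
  assumes M: "locally_euclidean M" and cover: "open_cover M \<U>"
    and X: "x \<in> pts M \<Longrightarrow> X x \<in> Obj D"
    and E: "U \<in> \<U> \<Longrightarrow> \<gamma> \<in> paths (open_sub M U) \<Longrightarrow> E \<gamma> \<in> Arr D \<and> Dom D (E \<gamma>) = X (\<gamma> 0) \<and> Cod D (E \<gamma>) = X (\<gamma> 1)"
    and E_thin: "U \<in> \<U> \<Longrightarrow> (\<gamma>, \<gamma>') \<in> thin_rel (open_sub M U) \<Longrightarrow> E \<gamma> = E \<gamma>'"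
    and E_const: "x \<in> pts M \<Longrightarrow> E (\<lambda>t\<in>I01. x) = Ident D (X x)"
    and E_concat: "U \<in> \<U> \<Longrightarrow> \<gamma> \<in> paths (open_sub M U) \<Longrightarrow> \<tau> \<in> paths (open_sub M U) \<Longrightarrow> \<tau> 1 = \<gamma> 0 \<Longrightarrow>
      E (concat_path \<gamma> \<tau>) = Comp D (E \<gamma>) (E \<tau>)"
begin

lemma cover_open: "U \<in> \<U> \<Longrightarrow> openin (mtop M) U"
  using cover by (simp add: open_cover_def)

lemma cover_at:
  assumes "x \<in> pts M"
  obtains U where "U \<in> \<U>" "x \<in> U" "openin (mtop M) U"
  using assms cover by (auto simp: open_cover_def)

lemma E_arc2:
  assumes H: "thin_map M H" and U: "U \<in> \<U>" and C: "convex C" "C \<subseteq> I01 \<times> I01" "\<forall>s t. (s, t) \<in> C \<longrightarrow> H s t \<in> U"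
    and pq: "p \<in> C" "q \<in> C"
  shows "E (arc2 H p q) \<in> Arr D" "Dom D (E (arc2 H p q)) = X (H (fst p) (snd p))" "Cod D (E (arc2 H p q)) = X (H (fst q) (snd q))"
  using E[OF U arc2_in_paths_open_sub[OF M H cover_open[OF U] C(1,2) C(3)[rule_format] pq]] by auto

lemma E_arc2_triangle:
  assumes H: "thin_map M H" and U: "U \<in> \<U>" and C: "convex C" "C \<subseteq> I01 \<times> I01" "\<forall>s t. (s, t) \<in> C \<longrightarrow> H s t \<in> U"
    and pqr: "p \<in> C" "q \<in> C" "r \<in> C"
  shows "E (arc2 H p r) = Comp D (E (arc2 H q r)) (E (arc2 H p q))"
  using E_thin[OF U arc2_triangle[OF M H cover_open[OF U] C(1,2) C(3)[rule_format] pqr]]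
    E_concat[OF U arc2_in_paths_open_sub[OF M H cover_open[OF U] C(1,2) C(3)[rule_format] pqr(2,3)] arc2_in_paths_open_sub[OF M H cover_open[OF U] C(1,2) C(3)[rule_format] pqr(1,2)]]
  by simp

text \<open>A closed segment makes sense for \<open>a\<close> and \<open>b\<close> in either order,
  so parallel sections are controlled in both directions.\<close>

definition local_seg :: "(real \<Rightarrow> 'm) \<Rightarrow> real \<Rightarrow> real \<Rightarrow> bool" where
  "local_seg \<gamma> a b \<longleftrightarrow> (\<exists>U\<in>\<U>. \<forall>t\<in>closed_segment a b. \<gamma> t \<in> U)"

lemma E_arc_seg:
  assumes \<gamma>: "smooth_curve M \<gamma>" and U: "U \<in> \<U>" and J: "convex J" "J \<subseteq> I01" "\<And>t. t \<in> J \<Longrightarrow> \<gamma> t \<in> U"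
    and abc: "a \<in> J" "b \<in> J"
  shows "E (arc \<gamma> a b) \<in> Arr D" "Dom D (E (arc \<gamma> a b)) = X (\<gamma> a)" "Cod D (E (arc \<gamma> a b)) = X (\<gamma> b)"
    and "c \<in> J \<Longrightarrow> E (arc \<gamma> a c) = Comp D (E (arc \<gamma> b c)) (E (arc \<gamma> a b))"
proof -
  have C: "convex (J \<times> {0::real})" "J \<times> {0} \<subseteq> I01 \<times> I01" "\<forall>s t. (s, t) \<in> J \<times> {0::real} \<longrightarrow> \<gamma> s \<in> U"
    using J by (auto intro!: convex_Times)
  note H = thin_map_curve[OF M \<gamma>]
  show "E (arc \<gamma> a b) \<in> Arr D" "Dom D (E (arc \<gamma> a b)) = X (\<gamma> a)" "Cod D (E (arc \<gamma> a b)) = X (\<gamma> b)"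
    using E_arc2[OF H U C, where p = "(a, 0)" and q = "(b, 0)"] abc by auto
  show "c \<in> J \<Longrightarrow> E (arc \<gamma> a c) = Comp D (E (arc \<gamma> b c)) (E (arc \<gamma> a b))"
    using E_arc2_triangle[OF H U C, where p = "(a, 0)" and q = "(b, 0)" and r = "(c, 0)"] abc by auto
qed

section \<open>Parallel sections along curves\<close>

lemma segment_I01: "a \<in> I01 \<Longrightarrow> b \<in> I01 \<Longrightarrow> closed_segment a b \<subseteq> I01"
  by (rule closed_segment_subset) auto

text \<open>\<open>S t\<close> stands for the transport along \<open>\<gamma>\<close> from a fixed
  object \<open>Y\<close> to time \<open>t\<close>. The second clause replaces the differential
  equation of a parallel section.\<close>

definition parallel :: "(real \<Rightarrow> 'm) \<Rightarrow> 'o \<Rightarrow> real set \<Rightarrow> (real \<Rightarrow> 'a) \<Rightarrow> bool" where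
  "parallel \<gamma> Y J S \<longleftrightarrow> (\<forall>t\<in>J. S t \<in> Arr D \<and> Dom D (S t) = Y \<and> Cod D (S t) = X (\<gamma> t)) \<and>
     (\<forall>a\<in>J. \<forall>b\<in>J. local_seg \<gamma> a b \<longrightarrow> S b = Comp D (E (arc \<gamma> a b)) (S a))"

text \<open>Around each time the curve stays in one member of the cover, and there the value at one
  time determines the values at all others.\<close>

lemma parallel_unique:
  assumes \<gamma>: "smooth_curve M \<gamma>" and S: "parallel \<gamma> Y I01 S" and S': "parallel \<gamma> Y I01 S'" and 0: "S 0 = S' 0" and t: "t \<in> I01"
  shows "S t = S' t"
proof (rule I01_induct[where P = "\<lambda>t. S t = S' t", OF t 0])
  fix a :: real assume a: "a \<in> I01"
  obtain U where U: "U \<in> \<U>" "\<gamma> a \<in> U" "openin (mtop M) U" using cover_at[OF smooth_curve_pts[OF \<gamma> a]] by blast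
  obtain r where r: "r > 0" "\<And>t. t \<in> I01 \<Longrightarrow> \<bar>t - a\<bar> < r \<Longrightarrow> \<gamma> t \<in> U"
    using smooth_curve_nhd[OF \<gamma> a U(3,2)] by blast
  show "\<exists>r>0. \<forall>x\<in>I01. \<forall>y\<in>I01. \<bar>x - a\<bar> < r \<longrightarrow> \<bar>y - a\<bar> < r \<longrightarrow> S x = S' x \<longrightarrow> S y = S' y"
  proof (intro exI[of _ r] conjI r(1) ballI impI)
    fix x y :: real assume xy: "x \<in> I01" "y \<in> I01" "\<bar>x - a\<bar> < r" "\<bar>y - a\<bar> < r" and eq: "S x = S' x"
    have "closed_segment x y \<subseteq> I01 \<inter> {t. \<bar>t - a\<bar> < r}"
      by (rule closed_segment_subset[OF _ _ convex_I01_ball]) (use xy in auto)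
    then have "local_seg \<gamma> x y" unfolding local_seg_def using r(2) U(1) by blast
    then show "S y = S' y" using S S' xy eq by (auto simp: parallel_def)
  qed
qed

text \<open>By spreading over the right end \<open>c\<close> of the interval: a section up to
  \<open>x\<close> is continued to a nearby \<open>y\<close> by the local transport along the arc
  from \<open>x\<close>, and is merely restricted if \<open>y\<close> is smaller.\<close>

lemma parallel_exists:
  assumes \<gamma>: "smooth_curve M \<gamma>"
  obtains S where "parallel \<gamma> (X (\<gamma> 0)) I01 S" "S 0 = Ident D (X (\<gamma> 0))"
proof -
  have "\<exists>S. parallel \<gamma> (X (\<gamma> 0)) {0..c} S \<and> S 0 = Ident D (X (\<gamma> 0))" if "c \<in> I01" for c
  proof (rule I01_induct[OF that])
    have x: "\<gamma> 0 \<in> pts M" by (rule smooth_curve_pts[OF \<gamma>]) simp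
    note i = Ident_Arr[OF X[OF x]] Dom_Ident[OF X[OF x]] Cod_Ident[OF X[OF x]]
    have "parallel \<gamma> (X (\<gamma> 0)) {0..0} (\<lambda>t. Ident D (X (\<gamma> 0)))"
      using i Comp_Ident_right[OF i(1)] E_const[OF x] by (auto simp: parallel_def arc_const)
    then show "\<exists>S. parallel \<gamma> (X (\<gamma> 0)) {0..0} S \<and> S 0 = Ident D (X (\<gamma> 0))" by blast
  next
    fix a :: real assume a: "a \<in> I01"
    obtain U where U: "U \<in> \<U>" "\<gamma> a \<in> U" "openin (mtop M) U" using cover_at[OF smooth_curve_pts[OF \<gamma> a]] by blast
    obtain r where r: "r > 0" "\<And>t. t \<in> I01 \<Longrightarrow> \<bar>t - a\<bar> < r \<Longrightarrow> \<gamma> t \<in> U"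
      using smooth_curve_nhd[OF \<gamma> a U(3,2)] by blast
    show "\<exists>r>0. \<forall>x\<in>I01. \<forall>y\<in>I01. \<bar>x - a\<bar> < r \<longrightarrow> \<bar>y - a\<bar> < r \<longrightarrow>
        (\<exists>S. parallel \<gamma> (X (\<gamma> 0)) {0..x} S \<and> S 0 = Ident D (X (\<gamma> 0))) \<longrightarrow>
        (\<exists>S. parallel \<gamma> (X (\<gamma> 0)) {0..y} S \<and> S 0 = Ident D (X (\<gamma> 0)))"
    proof (intro exI[of _ r] conjI r(1) ballI impI)
      fix x y :: real assume xy: "x \<in> I01" "y \<in> I01" "\<bar>x - a\<bar> < r" "\<bar>y - a\<bar> < r"
        and "\<exists>S. parallel \<gamma> (X (\<gamma> 0)) {0..x} S \<and> S 0 = Ident D (X (\<gamma> 0))"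
      then obtain S where S: "parallel \<gamma> (X (\<gamma> 0)) {0..x} S" "S 0 = Ident D (X (\<gamma> 0))" by blast
      show "\<exists>S. parallel \<gamma> (X (\<gamma> 0)) {0..y} S \<and> S 0 = Ident D (X (\<gamma> 0))"
      proof (cases "y \<le> x")
        case True
        then show ?thesis using S by (intro exI[of _ S]) (auto simp: parallel_def)
      next
        case False
        let ?J = "I01 \<inter> {t. \<bar>t - a\<bar> < r}"
        note EJ = E_arc_seg[OF \<gamma> U(1) convex_I01_ball[of a r] Int_lower1]
        have rU: "\<And>t. t \<in> ?J \<Longrightarrow> \<gamma> t \<in> U" using r(2) by blast
        have inJ: "t \<in> ?J" if "x \<le> t" "t \<le> y" for t using that xy by auto
        have xx: "x \<in> {0..x}" using xy by simp
        \<comment> \<open>Every new value refers back to the single value at \<open>x\<close>, so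
          consistency has to be checked only against the break point \<open>x\<close>.\<close>
        define S' where "S' t = (if t \<le> x then S t else Comp D (E (arc \<gamma> x t)) (S x))" for t
        have Sx: "S x \<in> Arr D" "Dom D (S x) = X (\<gamma> 0)" "Cod D (S x) = X (\<gamma> x)" using S(1) xx by (auto simp: parallel_def)
        have ty: "S' t \<in> Arr D \<and> Dom D (S' t) = X (\<gamma> 0) \<and> Cod D (S' t) = X (\<gamma> t)" if "t \<in> {0..y}" for t
        proof (cases "t \<le> x")
          case True
          then show ?thesis using S(1) that by (auto simp: parallel_def S'_def)
        next
          case False
          then have "t \<in> ?J" "x \<in> ?J" using inJ[of t] inJ[of x] that \<open>\<not> y \<le> x\<close> by auto
          then have "E (arc \<gamma> x t) \<in> Arr D" "Dom D (E (arc \<gamma> x t)) = X (\<gamma> x)" "Cod D (E (arc \<gamma> x t)) = X (\<gamma> t)"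
            using EJ(1-3)[OF rU] by blast+
          then show ?thesis using Sx False by (simp add: S'_def Comp_Arr Dom_Comp Cod_Comp)
        qed
        have "S' d = Comp D (E (arc \<gamma> c d)) (S' c)" if cd: "c \<in> {0..y}" "d \<in> {0..y}" "local_seg \<gamma> c d" for c d
        proof -
          have cdI: "c \<in> I01" "d \<in> I01" using cd xy by auto
          obtain V where V: "V \<in> \<U>" "\<And>t. t \<in> closed_segment c d \<Longrightarrow> \<gamma> t \<in> V" using cd(3) by (auto simp: local_seg_def)
          note EV = E_arc_seg[OF \<gamma> V(1) convex_closed_segment segment_I01[OF cdI]]
          have cdV: "c \<in> closed_segment c d" "d \<in> closed_segment c d" by auto
          \<comment> \<open>If \<open>x\<close> separates \<open>c\<close> from \<open>d\<close>, it
            lies on their segment and hence in the member \<open>V\<close> containing that segment,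
            where the arc can be split at \<open>x\<close>. If both lie beyond \<open>x\<close>, the
            member \<open>U\<close> around \<open>a\<close> serves instead.\<close>
          consider "c \<le> x" "d \<le> x" | "x < c" "x < d" | "c \<le> x" "x < d" | "x < c" "d \<le> x" by linarith
          then show ?thesis
          proof cases
            case 1
            then show ?thesis using S(1) cd by (auto simp: parallel_def S'_def)
          next
            case 2
            have J: "x \<in> ?J" "c \<in> ?J" "d \<in> ?J" using inJ[of x] inJ[of c] inJ[of d] cd 2 \<open>\<not> y \<le> x\<close> by auto
            note e = EJ(1-3)[OF rU J(1,2)] EJ(1-3)[OF rU J(2,3)] EJ(4)[OF rU J(1,2,3)]
            have "Comp D (E (arc \<gamma> c d)) (Comp D (E (arc \<gamma> x c)) (S x)) = Comp D (Comp D (E (arc \<gamma> c d)) (E (arc \<gamma> x c))) (S x)"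
              by (rule Comp_assoc[OF Sx(1)]) (use e Sx in auto)
            then show ?thesis using 2 e by (simp add: S'_def)
          next
            case 3
            have xs: "x \<in> closed_segment c d" using 3 by (simp add: closed_segment_eq_real_ivl)
            note e = EV(1-3)[OF V(2) cdV(1) xs] EV(1-3)[OF V(2) xs cdV(2)] EV(4)[OF V(2) cdV(1) xs cdV(2)]
            have "local_seg \<gamma> c x" unfolding local_seg_def
              using V subset_closed_segment[of c x c d] xs cdV by blast
            then have "S x = Comp D (E (arc \<gamma> c x)) (S c)" using S(1) 3 cd xx by (auto simp: parallel_def)
            moreover have Sc: "S c \<in> Arr D" "Dom D (S c) = X (\<gamma> 0)" "Cod D (S c) = X (\<gamma> c)"
              using S(1) cd 3 by (auto simp: parallel_def)
            moreover have "Comp D (E (arc \<gamma> x d)) (Comp D (E (arc \<gamma> c x)) (S c)) = Comp D (Comp D (E (arc \<gamma> x d)) (E (arc \<gamma> c x))) (S c)"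
              by (rule Comp_assoc[OF Sc(1)]) (use e Sc in auto)
            ultimately show ?thesis using 3 e by (simp add: S'_def)
          next
            case 4
            have xs: "x \<in> closed_segment c d" using 4 by (simp add: closed_segment_eq_real_ivl)
            note e = EV(1-3)[OF V(2) xs cdV(1)] EV(1-3)[OF V(2) cdV(1,2)] EV(4)[OF V(2) xs cdV(1,2)]
            have "local_seg \<gamma> x d" unfolding local_seg_def
              using V subset_closed_segment[of x d c d] xs cdV by blast
            then have "S d = Comp D (E (arc \<gamma> x d)) (S x)" using S(1) 4 cd xx by (auto simp: parallel_def)
            moreover have "Comp D (E (arc \<gamma> c d)) (Comp D (E (arc \<gamma> x c)) (S x)) = Comp D (Comp D (E (arc \<gamma> c d)) (E (arc \<gamma> x c))) (S x)"
              by (rule Comp_assoc[OF Sx(1)]) (use e Sx in auto)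
            ultimately show ?thesis using 4 e by (simp add: S'_def)
          qed
        qed
        then have "parallel \<gamma> (X (\<gamma> 0)) {0..y} S'" using ty unfolding parallel_def by blast
        moreover have "S' 0 = Ident D (X (\<gamma> 0))" using S(2) xy by (simp add: S'_def)
        ultimately show ?thesis by blast
      qed
    qed
  qed
  from this[of 1] show ?thesis using that by auto
qed

section \<open>Holonomy of a path\<close>

definition holonomy :: "(real \<Rightarrow> 'm) \<Rightarrow> 'a" where
  "holonomy \<gamma> = (SOME S. parallel \<gamma> (X (\<gamma> 0)) I01 S \<and> S 0 = Ident D (X (\<gamma> 0))) 1"

lemma holonomy_eq:
  assumes \<gamma>: "smooth_curve M \<gamma>" and S: "parallel \<gamma> (X (\<gamma> 0)) I01 S" "S 0 = Ident D (X (\<gamma> 0))"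
  shows "holonomy \<gamma> = S 1"
proof -
  let ?S = "SOME S. parallel \<gamma> (X (\<gamma> 0)) I01 S \<and> S 0 = Ident D (X (\<gamma> 0))"
  have "parallel \<gamma> (X (\<gamma> 0)) I01 ?S \<and> ?S 0 = Ident D (X (\<gamma> 0))" by (rule someI[of _ S]) (simp add: S)
  then show ?thesis unfolding holonomy_def using parallel_unique[OF \<gamma> _ S(1), of ?S 1] S(2) by simp
qed

lemma arc_cong: "a \<in> I01 \<Longrightarrow> b \<in> I01 \<Longrightarrow> (\<And>t. t \<in> I01 \<Longrightarrow> \<gamma> t = \<gamma>' t) \<Longrightarrow> arc \<gamma> a b = arc \<gamma>' a b"
  unfolding arc_eq
proof (rule restrict_ext)
  fix r assume "a \<in> I01" "b \<in> I01" "\<And>t. t \<in> I01 \<Longrightarrow> \<gamma> t = \<gamma>' t"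
  moreover have "(a + step r * (b - a), 0 + step r * (0 - 0)) \<in> I01 \<times> {0::real}"
    by (rule convex_pair) (use calculation in \<open>auto intro!: convex_Times simp: step_nonneg step_le_1\<close>)
  ultimately show "\<gamma> (a + step r * (b - a)) = \<gamma>' (a + step r * (b - a))" by simp
qed

lemma parallel_cong:
  assumes S: "parallel \<gamma> Y I01 S" and eq: "\<And>t. t \<in> I01 \<Longrightarrow> \<gamma> t = \<gamma>' t"
  shows "parallel \<gamma>' Y I01 S"
  unfolding parallel_def
proof (intro conjI ballI impI)
  fix a b :: real assume ab: "a \<in> I01" "b \<in> I01" "local_seg \<gamma>' a b"
  have "local_seg \<gamma> a b" using ab(3) segment_I01[OF ab(1,2)] eq unfolding local_seg_def by (metis subsetD)
  then show "S b = Comp D (E (arc \<gamma>' a b)) (S a)" using S ab arc_cong[OF ab(1,2) eq] by (auto simp: parallel_def)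
next
  fix t assume t: "t \<in> I01"
  show "S t \<in> Arr D" "Dom D (S t) = Y" "Cod D (S t) = X (\<gamma>' t)"
    using S t eq[OF t, symmetric] unfolding parallel_def by simp_all
qed

text \<open>Inside one member the local transport along the arc from 0 to \<open>t\<close> is itself
  a parallel section, and the arc from 0 to 1 is thinly homotopic to the path.\<close>

lemma holonomy_local:
  assumes U: "U \<in> \<U>" and \<gamma>: "\<gamma> \<in> paths (open_sub M U)"
  shows "holonomy \<gamma> = E \<gamma>"
proof -
  have \<gamma>M: "\<gamma> \<in> paths M" "\<And>t. t \<in> I01 \<Longrightarrow> \<gamma> t \<in> U" using paths_open_sub[OF M cover_open[OF U]] \<gamma> by auto
  note \<gamma>s = path_smooth[OF \<gamma>M(1)]
  note e = E_arc_seg[OF \<gamma>s U convex_real_interval(5)[of 0 1] order_refl \<gamma>M(2)]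
  have x: "\<gamma> 0 \<in> pts M" by (rule path_pts[OF \<gamma>M(1)]) simp
  have "parallel \<gamma> (X (\<gamma> 0)) I01 (\<lambda>t. E (arc \<gamma> 0 t))"
    unfolding parallel_def
  proof (intro conjI ballI impI)
    fix t :: real assume t: "t \<in> I01"
    show "E (arc \<gamma> 0 t) \<in> Arr D" "Dom D (E (arc \<gamma> 0 t)) = X (\<gamma> 0)" "Cod D (E (arc \<gamma> 0 t)) = X (\<gamma> t)"
      by (rule e(1) e(2) e(3); use t in auto)+
  next
    fix a b :: real assume "a \<in> I01" "b \<in> I01"
    then show "E (arc \<gamma> 0 b) = Comp D (E (arc \<gamma> a b)) (E (arc \<gamma> 0 a))" by (intro e(4)) auto
  qed
  then have "holonomy \<gamma> = E (arc \<gamma> 0 1)"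
    by (rule holonomy_eq[OF \<gamma>s]) (simp add: arc_const E_const[OF x])
  also have "\<dots> = E \<gamma>"
    using E_thin[OF U path_thin_arc[OF locally_euclidean_open_sub[OF M cover_open[OF U]] \<gamma>]] by simp
  finally show ?thesis .
qed

lemma holonomy_hom:
  assumes "\<gamma> \<in> paths M"
  shows "holonomy \<gamma> \<in> Arr D \<and> Dom D (holonomy \<gamma>) = X (\<gamma> 0) \<and> Cod D (holonomy \<gamma>) = X (\<gamma> 1)"
proof -
  obtain S where S: "parallel \<gamma> (X (\<gamma> 0)) I01 S" "S 0 = Ident D (X (\<gamma> 0))" using parallel_exists[OF path_smooth[OF assms]] by blast
  show ?thesis using holonomy_eq[OF path_smooth[OF assms] S] S(1) by (auto simp: parallel_def)
qed

text \<open>A parallel section along the concatenation restricts to each half. On the second half it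
  agrees with a section of \<open>\<gamma>\<close> composed with the value reached at 1/2, because
  both are parallel and start alike.\<close>

lemma holonomy_concat:
  assumes \<gamma>: "\<gamma> \<in> paths M" and \<tau>: "\<tau> \<in> paths M" and e: "\<tau> 1 = \<gamma> 0"
  shows "holonomy (concat_path \<gamma> \<tau>) = Comp D (holonomy \<gamma>) (holonomy \<tau>)"
proof -
  define p where "p = concat_path \<gamma> \<tau>"
  have p: "p \<in> paths M" unfolding p_def by (rule concat_path_in_paths[OF M \<gamma> \<tau> e])
  have p0: "p 0 = \<tau> 0" by (simp add: p_def concat_path_simps)
  have p\<tau>: "p (t / 2) = \<tau> t" if "t \<in> I01" for t using that by (simp add: p_def concat_path_simps)
  have p\<gamma>: "p ((1 + t) / 2) = \<gamma> t" if "t \<in> I01" for t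
  proof -
    have "2 * ((1 + t) / 2) - 1 = t" by (simp add: field_simps)
    then show ?thesis using concat_path_simp2[of \<tau> \<gamma> "(1 + t) / 2", OF e] that unfolding p_def by auto
  qed
  obtain S where S: "parallel p (X (p 0)) I01 S" "S 0 = Ident D (X (p 0))" using parallel_exists[OF path_smooth[OF p]] by blast
  obtain R where R: "parallel \<gamma> (X (\<gamma> 0)) I01 R" "R 0 = Ident D (X (\<gamma> 0))" using parallel_exists[OF path_smooth[OF \<gamma>]] by blast
  have resc: "parallel \<delta> (X (\<tau> 0)) I01 (\<lambda>t. S (h t))"
    if h: "\<And>t. t \<in> I01 \<Longrightarrow> h t \<in> I01 \<and> p (h t) = \<delta> t" and aff: "\<And>x y u. h (x + u * (y - x)) = h x + u * (h y - h x)" for h \<delta>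
    unfolding parallel_def
  proof (intro conjI ballI impI)
    fix a b :: real assume ab: "a \<in> I01" "b \<in> I01" "local_seg \<delta> a b"
    obtain U where U: "U \<in> \<U>" "\<And>t. t \<in> closed_segment a b \<Longrightarrow> \<delta> t \<in> U" using ab(3) by (auto simp: local_seg_def)
    have "p t \<in> U" if t: "t \<in> closed_segment (h a) (h b)" for t
    proof -
      obtain u where u: "0 \<le> u" "u \<le> 1" "t = (1 - u) * h a + u * h b" using t by (auto simp: in_segment)
      have s: "a + u * (b - a) \<in> closed_segment a b" unfolding in_segment using u by (intro exI[of _ u]) (auto simp: algebra_simps)
      have "h (a + u * (b - a)) = h a + u * (h b - h a)" by (rule aff)
      also have "\<dots> = t" using u(3) by (simp add: algebra_simps)
      finally have "t = h (a + u * (b - a))" by simp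
      then show ?thesis using h[of "a + u * (b - a)"] U(2)[OF s] s segment_I01[OF ab(1,2)] by auto
    qed
    then have "local_seg p (h a) (h b)" using U(1) by (auto simp: local_seg_def)
    then have "S (h b) = Comp D (E (arc p (h a) (h b))) (S (h a))"
      using S(1) h[OF ab(1)] h[OF ab(2)] unfolding parallel_def by blast
    moreover have "arc p (h a) (h b) = arc \<delta> a b"
      unfolding arc_eq
    proof (rule restrict_ext)
      fix r :: real
      have "a + step r * (b - a) \<in> closed_segment a b"
        unfolding in_segment using step_nonneg[of r] step_le_1[of r] by (intro exI[of _ "step r"]) (auto simp: algebra_simps)
      then show "p (h a + step r * (h b - h a)) = \<delta> (a + step r * (b - a))"
        using h[of "a + step r * (b - a)"] segment_I01[OF ab(1,2)] aff by auto
    qed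
    ultimately show "S (h b) = Comp D (E (arc \<delta> a b)) (S (h a))" by simp
  qed (use S(1) h p0 in \<open>auto simp: parallel_def\<close>)
  have 1: "parallel \<tau> (X (\<tau> 0)) I01 (\<lambda>t. S (t / 2))"
    by (rule resc) (use p\<tau> in \<open>auto simp: field_simps\<close>)
  have h\<tau>: "holonomy \<tau> = S (1 / 2)"
    using holonomy_eq[OF path_smooth[OF \<tau>] 1] S(2) p0 by simp
  have 2: "parallel \<gamma> (X (\<tau> 0)) I01 (\<lambda>t. S ((1 + t) / 2))"
    by (rule resc) (use p\<gamma> in \<open>auto simp: field_simps\<close>)
  have h: "S (1/2) \<in> Arr D" "Dom D (S (1/2)) = X (\<tau> 0)" "Cod D (S (1/2)) = X (\<gamma> 0)"
    using holonomy_hom[OF \<tau>] by (auto simp: h\<tau> e)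
  have 3: "parallel \<gamma> (X (\<tau> 0)) I01 (\<lambda>t. Comp D (R t) (S (1/2)))"
    unfolding parallel_def
  proof (intro conjI ballI impI)
    fix t :: real assume "t \<in> I01"
    then have "R t \<in> Arr D" "Dom D (R t) = X (\<gamma> 0)" "Cod D (R t) = X (\<gamma> t)" using R(1) by (auto simp: parallel_def)
    then show "Comp D (R t) (S (1/2)) \<in> Arr D" "Dom D (Comp D (R t) (S (1/2))) = X (\<tau> 0)" "Cod D (Comp D (R t) (S (1/2))) = X (\<gamma> t)"
      using h by (simp_all add: Comp_Arr Dom_Comp Cod_Comp)
  next
    fix a b :: real assume ab: "a \<in> I01" "b \<in> I01" "local_seg \<gamma> a b"
    obtain U where U: "U \<in> \<U>" "\<And>t. t \<in> closed_segment a b \<Longrightarrow> \<gamma> t \<in> U" using ab(3) by (auto simp: local_seg_def)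
    note e = E_arc_seg[OF path_smooth[OF \<gamma>] U(1) convex_closed_segment segment_I01[OF ab(1,2)] U(2) ends_in_segment]
    have Ra: "R a \<in> Arr D" "Dom D (R a) = X (\<gamma> 0)" "Cod D (R a) = X (\<gamma> a)" using R(1) ab by (auto simp: parallel_def)
    have "R b = Comp D (E (arc \<gamma> a b)) (R a)" using R(1) ab by (auto simp: parallel_def)
    moreover have "Comp D (E (arc \<gamma> a b)) (Comp D (R a) (S (1/2))) = Comp D (Comp D (E (arc \<gamma> a b)) (R a)) (S (1/2))"
      by (rule Comp_assoc[OF h(1) Ra(1)]) (use e(1,2) Ra h in auto)
    ultimately show "Comp D (R b) (S (1/2)) = Comp D (E (arc \<gamma> a b)) (Comp D (R a) (S (1/2)))" by simp
  qed
  have "S ((1 + 0) / 2) = Comp D (R 0) (S (1/2))"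
    using Comp_Ident_left[OF h(1)] h(3) R(2) by simp
  from parallel_unique[OF path_smooth[OF \<gamma>] 2 3 this, of 1]
  have "S 1 = Comp D (R 1) (S (1/2))" by simp
  then show ?thesis
    using holonomy_eq[OF path_smooth[OF p] S] holonomy_eq[OF path_smooth[OF \<gamma>] R] h\<tau> by (simp add: p_def)
qed

text \<open>A parallel section \<open>S t\<close> is chosen on every horizontal curve of
  \<open>H\<close>. Near a given \<open>t0\<close>, the values at \<open>s\<close> of neighbouring
  sections are linked by the vertical arc. This spreads from \<open>s = 0\<close>, and at
  \<open>s = 1\<close>, where vertical arcs are constant again, it says that the end value does not
  change with \<open>t\<close>.\<close>

lemma holonomy_thin:
  assumes "(\<gamma>, \<gamma>') \<in> thin_rel M"
  shows "holonomy \<gamma> = holonomy \<gamma>'"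
proof -
  obtain H where H: "\<gamma> \<in> paths M" "\<gamma>' \<in> paths M" "\<gamma> 0 = \<gamma>' 0" "\<gamma> 1 = \<gamma>' 1" "thin_map M H"
      "\<And>s. s \<in> I01 \<Longrightarrow> H s 0 = \<gamma> s" "\<And>s. s \<in> I01 \<Longrightarrow> H s 1 = \<gamma>' s"
      "\<And>t. t \<in> I01 \<Longrightarrow> H 0 t = \<gamma> 0" "\<And>t. t \<in> I01 \<Longrightarrow> H 1 t = \<gamma> 1" "collared H" using assms by (elim thin_relE) blast
  have Hpts: "H s t \<in> pts M" if "s \<in> I01" "t \<in> I01" for s t
    using smooth_from_pts[OF thin_map_smooth[OF H(5)], of "vec2 s t"] that by simp
  have curve: "smooth_curve M (\<lambda>s. H s t)" if "t \<in> I01" for t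
    unfolding smooth_curve_def
    by (rule smooth_from_compose[OF M _ openin_topspace thin_map_smooth[OF H(5)], where h = "\<lambda>x. vec2 (x 0) t"])
      (use that in \<open>auto intro!: smooth_eucl_vec smooth_fn_intros\<close>)
  have "\<forall>t\<in>I01. \<exists>S. parallel (\<lambda>s. H s t) (X (\<gamma> 0)) I01 S \<and> S 0 = Ident D (X (\<gamma> 0))"
  proof
    fix t :: real assume t: "t \<in> I01"
    then obtain S where "parallel (\<lambda>s. H s t) (X (H 0 t)) I01 S" "S 0 = Ident D (X (H 0 t))"
      using parallel_exists[OF curve[OF t]] by blast
    then show "\<exists>S. parallel (\<lambda>s. H s t) (X (\<gamma> 0)) I01 S \<and> S 0 = Ident D (X (\<gamma> 0))" using H(8)[OF t] by auto
  qed
  then obtain S where S: "\<And>t. t \<in> I01 \<Longrightarrow> parallel (\<lambda>s. H s t) (X (\<gamma> 0)) I01 (S t)"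
    "\<And>t. t \<in> I01 \<Longrightarrow> S t 0 = Ident D (X (\<gamma> 0))" by metis
  have arc_H: "arc (\<lambda>s. H s t) a b = arc2 H (a, t) (b, t)" for a b t by (simp add: arc2_def)
  \<comment> \<open>The radius is quantified inside the property and may shrink as \<open>s\<close>
    moves, which takes the place of compactness of a horizontal strip. At \<open>s = 0\<close>
    vertical arcs are constant because the homotopy fixes the end points.\<close>
  have vert: "\<exists>\<rho>>0. \<forall>t\<in>I01. \<forall>t'\<in>I01. \<bar>t - t0\<bar> < \<rho> \<longrightarrow> \<bar>t' - t0\<bar> < \<rho> \<longrightarrow> S t' s = Comp D (E (arc2 H (s, t) (s, t'))) (S t s)"
    if t0: "t0 \<in> I01" and s: "s \<in> I01" for t0 s
  proof (rule I01_induct[OF s])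
    have x: "\<gamma> 0 \<in> pts M" by (rule path_pts[OF H(1)]) simp
    note i = Ident_Arr[OF X[OF x]]
    have vert0: "S t' 0 = Comp D (E (arc2 H (0, t) (0, t'))) (S t 0)" if "t \<in> I01" "t' \<in> I01" for t t'
    proof -
      have "t + step r * (t' - t) \<in> I01" for r
        using convex_pair_step[of "I01 \<times> I01" "(0, t)" "(0, t')" r] that by (auto intro!: convex_Times)
      then have "arc2 H (0, t) (0, t') = (\<lambda>t\<in>I01. \<gamma> 0)"
        unfolding arc2_def by (intro restrict_ext) (simp add: H(8))
      then show ?thesis
        using S(2) that E_const[OF x] Comp_Ident_left[OF i] Cod_Ident[OF X[OF x]] by simp
    qed
    show "\<exists>\<rho>>0. \<forall>t\<in>I01. \<forall>t'\<in>I01. \<bar>t - t0\<bar> < \<rho> \<longrightarrow> \<bar>t' - t0\<bar> < \<rho> \<longrightarrow> S t' 0 = Comp D (E (arc2 H (0, t) (0, t'))) (S t 0)"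
      by (intro exI[of _ "1::real"] conjI ballI impI) (simp, rule vert0)
  next
    fix a :: real assume a: "a \<in> I01"
    obtain U where U: "U \<in> \<U>" "H a t0 \<in> U" "openin (mtop M) U" using cover_at[OF Hpts[OF a t0]] by blast
    obtain r where r: "r > 0" "\<And>s t. s \<in> I01 \<Longrightarrow> t \<in> I01 \<Longrightarrow> \<bar>s - a\<bar> < r \<Longrightarrow> \<bar>t - t0\<bar> < r \<Longrightarrow> H s t \<in> U"
      using thin_map_nhd[OF H(5) a t0 U(3,2)] by blast
    let ?C = "(I01 \<inter> {t. \<bar>t - a\<bar> < r}) \<times> (I01 \<inter> {t. \<bar>t - t0\<bar> < r})"
    have C: "convex ?C" "?C \<subseteq> I01 \<times> I01" "\<forall>s t. (s, t) \<in> ?C \<longrightarrow> H s t \<in> U"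
      using r(2) by (auto intro!: convex_Times convex_I01_ball)
    note e = E_arc2[OF H(5) U(1) C] and tri = E_arc2_triangle[OF H(5) U(1) C]
    show "\<exists>r>0. \<forall>x\<in>I01. \<forall>y\<in>I01. \<bar>x - a\<bar> < r \<longrightarrow> \<bar>y - a\<bar> < r \<longrightarrow>
       (\<exists>\<rho>>0. \<forall>t\<in>I01. \<forall>t'\<in>I01. \<bar>t - t0\<bar> < \<rho> \<longrightarrow> \<bar>t' - t0\<bar> < \<rho> \<longrightarrow> S t' x = Comp D (E (arc2 H (x, t) (x, t'))) (S t x)) \<longrightarrow>
       (\<exists>\<rho>>0. \<forall>t\<in>I01. \<forall>t'\<in>I01. \<bar>t - t0\<bar> < \<rho> \<longrightarrow> \<bar>t' - t0\<bar> < \<rho> \<longrightarrow> S t' y = Comp D (E (arc2 H (y, t) (y, t'))) (S t y))"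
    proof (rule exI[of _ r], intro conjI r(1) ballI impI)
      fix x y :: real assume xy: "x \<in> I01" "y \<in> I01" "\<bar>x - a\<bar> < r" "\<bar>y - a\<bar> < r"
        and "\<exists>\<rho>>0. \<forall>t\<in>I01. \<forall>t'\<in>I01. \<bar>t - t0\<bar> < \<rho> \<longrightarrow> \<bar>t' - t0\<bar> < \<rho> \<longrightarrow> S t' x = Comp D (E (arc2 H (x, t) (x, t'))) (S t x)"
      then obtain \<rho> where \<rho>: "\<rho> > 0" "\<And>t t'. t \<in> I01 \<Longrightarrow> t' \<in> I01 \<Longrightarrow> \<bar>t - t0\<bar> < \<rho> \<Longrightarrow> \<bar>t' - t0\<bar> < \<rho> \<Longrightarrow>
          S t' x = Comp D (E (arc2 H (x, t) (x, t'))) (S t x)" by blast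
      have main: "S t' y = Comp D (E (arc2 H (y, t) (y, t'))) (S t y)"
        if t: "t \<in> I01" "t' \<in> I01" "\<bar>t - t0\<bar> < min \<rho> r" "\<bar>t' - t0\<bar> < min \<rho> r" for t t'
      proof -
        have in_C: "(x, t) \<in> ?C" "(x, t') \<in> ?C" "(y, t) \<in> ?C" "(y, t') \<in> ?C" using xy t by auto
        have seg: "S \<tau> y = Comp D (E (arc2 H (x, \<tau>) (y, \<tau>))) (S \<tau> x)" if \<tau>: "\<tau> \<in> I01" "\<bar>\<tau> - t0\<bar> < r" for \<tau>
        proof -
          have "closed_segment x y \<subseteq> I01 \<inter> {t. \<bar>t - a\<bar> < r}"
            by (rule closed_segment_subset[OF _ _ convex_I01_ball]) (use xy in auto)
          then have "local_seg (\<lambda>s. H s \<tau>) x y" unfolding local_seg_def using r(2) U(1) \<tau> by blast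
          then show ?thesis using S(1)[OF \<tau>(1)] xy arc_H by (auto simp: parallel_def)
        qed
        have Sx: "S t x \<in> Arr D" "Cod D (S t x) = X (H x t)" using S(1)[OF t(1)] xy by (auto simp: parallel_def)
        have "S t' y = Comp D (E (arc2 H (x, t') (y, t'))) (Comp D (E (arc2 H (x, t) (x, t'))) (S t x))"
          using seg[of t'] \<rho>(2)[of t t'] t by simp
        also have "\<dots> = Comp D (Comp D (E (arc2 H (x, t') (y, t'))) (E (arc2 H (x, t) (x, t')))) (S t x)"
          by (rule Comp_assoc[OF Sx(1)]) (use e[OF in_C(1,2)] e[OF in_C(2,4)] Sx in auto)
        \<comment> \<open>The two ways around the small rectangle both equal the transport along its
          diagonal from \<open>(x, t)\<close> to \<open>(y, t')\<close>; this is where thinness of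
          \<open>H\<close> is felt.\<close>
        also have "\<dots> = Comp D (Comp D (E (arc2 H (y, t) (y, t'))) (E (arc2 H (x, t) (y, t)))) (S t x)"
          by (simp only: tri[OF in_C(1,2,4), symmetric] tri[OF in_C(1,3,4), symmetric])
        also have "\<dots> = Comp D (E (arc2 H (y, t) (y, t'))) (Comp D (E (arc2 H (x, t) (y, t))) (S t x))"
          by (rule Comp_assoc[symmetric, OF Sx(1)]) (use e[OF in_C(1,3)] e[OF in_C(3,4)] Sx in auto)
        finally show ?thesis using seg[of t] t by simp
      qed
      have "min \<rho> r > 0" using \<rho>(1) r(1) by simp
      then show "\<exists>\<rho>>0. \<forall>t\<in>I01. \<forall>t'\<in>I01. \<bar>t - t0\<bar> < \<rho> \<longrightarrow> \<bar>t' - t0\<bar> < \<rho> \<longrightarrow> S t' y = Comp D (E (arc2 H (y, t) (y, t'))) (S t y)"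
        using main by blast
    qed
  qed
  have x1: "\<gamma> 1 \<in> pts M" by (rule path_pts[OF H(1)]) simp
  \<comment> \<open>Vertical arcs at \<open>s = 1\<close> are constant paths, so the end value is
    locally constant in \<open>t\<close>, hence constant.\<close>
  have const_end: "S t 1 = S 0 1" if "t \<in> I01" for t
  proof (rule I01_induct[OF that])
    fix t0 :: real assume t0: "t0 \<in> I01"
    obtain \<rho> where \<rho>: "\<rho> > 0" "\<And>t t'. t \<in> I01 \<Longrightarrow> t' \<in> I01 \<Longrightarrow> \<bar>t - t0\<bar> < \<rho> \<Longrightarrow> \<bar>t' - t0\<bar> < \<rho> \<Longrightarrow>
          S t' 1 = Comp D (E (arc2 H (1, t) (1, t'))) (S t 1)"
    proof -
      have "(1::real) \<in> I01" by simp
      from vert[OF t0 this] show ?thesis using that by blast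
    qed
    have end_eq: "S t' 1 = S t 1" if t: "t \<in> I01" "t' \<in> I01" "\<bar>t - t0\<bar> < \<rho>" "\<bar>t' - t0\<bar> < \<rho>" for t t'
    proof -
      have "t + step r * (t' - t) \<in> I01" for r
        using convex_pair_step[of "I01 \<times> I01" "(0, t)" "(0, t')" r] t by (auto intro!: convex_Times)
      then have "arc2 H (1, t) (1, t') = (\<lambda>t\<in>I01. \<gamma> 1)"
        unfolding arc2_def by (intro restrict_ext) (simp add: H(9))
      moreover have "S t 1 \<in> Arr D" "Cod D (S t 1) = X (\<gamma> 1)" using S(1)[OF t(1)] H(9)[OF t(1)] by (auto simp: parallel_def)
      ultimately show ?thesis using \<rho>(2)[OF t] E_const[OF x1] Comp_Ident_left[of "S t 1"] by simp
    qed
    show "\<exists>r>0. \<forall>x\<in>I01. \<forall>y\<in>I01. \<bar>x - t0\<bar> < r \<longrightarrow> \<bar>y - t0\<bar> < r \<longrightarrow> S x 1 = S 0 1 \<longrightarrow> S y 1 = S 0 1"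
    proof (intro exI[of _ \<rho>] conjI \<rho>(1) ballI impI)
      fix x y assume "x \<in> I01" "y \<in> I01" "\<bar>x - t0\<bar> < \<rho>" "\<bar>y - t0\<bar> < \<rho>" "S x 1 = S 0 1"
      then show "S y 1 = S 0 1" using end_eq[of x y] by simp
    qed
  qed simp
  have "S 1 1 = S 0 1" by (rule const_end) simp
  moreover have "holonomy \<gamma> = S 0 1"
    by (rule holonomy_eq[OF path_smooth[OF H(1)] parallel_cong[OF S(1)]]) (use H(6) S(2) in auto)
  moreover have "holonomy \<gamma>' = S 1 1"
  proof (rule holonomy_eq[OF path_smooth[OF H(2)], where S = "S 1"])
    have "parallel \<gamma>' (X (\<gamma> 0)) I01 (S 1)" by (rule parallel_cong[OF S(1)]) (use H(7) in auto)
    then show "parallel \<gamma>' (X (\<gamma>' 0)) I01 (S 1)" using H(3) by simp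
    show "S 1 0 = Ident D (X (\<gamma>' 0))" using S(2)[of 1] H(3) by simp
  qed
  ultimately show ?thesis by simp
qed

theorem glued_functor:
  obtains F where "is_functor (Pi_thin M) D F" "fobj F = restrict X (pts M)"
    "\<And>U \<gamma>. U \<in> \<U> \<Longrightarrow> \<gamma> \<in> paths (open_sub M U) \<Longrightarrow> farr F (cls M \<gamma>) = E \<gamma>"
proof -
  have const: "holonomy (\<lambda>t\<in>I01. x) = Ident D (X x)" if x: "x \<in> pts M" for x
  proof -
    obtain U where U: "U \<in> \<U>" "x \<in> U" "openin (mtop M) U" using cover_at[OF x] by blast
    have "(\<lambda>t\<in>I01. x) \<in> paths (open_sub M U)"
      using const_path_in_paths[OF M x] paths_open_sub[OF M U(3)] U(2) by auto
    then show ?thesis using holonomy_local[OF U(1)] E_const[OF x] by simp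
  qed
  show ?thesis
  proof (rule functor_of_paths[OF M category_axioms, of X holonomy])
    fix F assume F: "is_functor (Pi_thin M) D F" "fobj F = restrict X (pts M)" "\<And>\<gamma>. \<gamma> \<in> paths M \<Longrightarrow> farr F (cls M \<gamma>) = holonomy \<gamma>"
    show ?thesis
    proof (rule that[OF F(1,2)])
      fix U \<gamma> assume U: "U \<in> \<U>" and \<gamma>: "\<gamma> \<in> paths (open_sub M U)"
      then have "\<gamma> \<in> paths M" using paths_open_sub[OF M cover_open[OF U]] by blast
      then show "farr F (cls M \<gamma>) = E \<gamma>" using F(3) holonomy_local[OF U \<gamma>] by simp
    qed
  qed (fact X holonomy_hom holonomy_thin const holonomy_concat)+
qed

end

section \<open>Groupoids and torsors\<close>

definition homs :: "('o, 'a) cat \<Rightarrow> 'o \<Rightarrow> 'o \<Rightarrow> 'a set" where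
  "homs C x y = {a \<in> Arr C. Dom C a = x \<and> Cod C a = y}"

lemma homs_iff: "a \<in> homs C x y \<longleftrightarrow> a \<in> Arr C \<and> Dom C a = x \<and> Cod C a = y"
  by (simp add: homs_def)

context category
begin

lemma comp_homs: "b \<in> homs C y z \<Longrightarrow> a \<in> homs C x y \<Longrightarrow> Comp C b a \<in> homs C x z"
  using Comp_Arr Dom_Comp Cod_Comp by (auto simp: homs_iff)

lemma homs_assoc: "c \<in> homs C z w \<Longrightarrow> b \<in> homs C y z \<Longrightarrow> a \<in> homs C x y \<Longrightarrow> Comp C c (Comp C b a) = Comp C (Comp C c b) a"
  using Comp_assoc by (auto simp: homs_iff)

lemma ident_homs: "x \<in> Obj C \<Longrightarrow> Ident C x \<in> homs C x x"
  using Ident_Arr Dom_Ident Cod_Ident by (auto simp: homs_iff)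

lemma comp_ident_homs: "a \<in> homs C x y \<Longrightarrow> Comp C a (Ident C x) = a" "a \<in> homs C x y \<Longrightarrow> Comp C (Ident C y) a = a"
  using Comp_Ident_right Comp_Ident_left by (auto simp: homs_iff)

end

definition arr_inv :: "('o, 'a) cat \<Rightarrow> 'a \<Rightarrow> 'a" where
  "arr_inv C a = (SOME b. b \<in> Arr C \<and> Dom C b = Cod C a \<and> Cod C b = Dom C a \<and>
     Comp C b a = Ident C (Dom C a) \<and> Comp C a b = Ident C (Cod C a))"

locale groupoid = category C for C :: "('o, 'a) cat" +
  assumes all_iso: "a \<in> Arr C \<Longrightarrow> is_iso C a"
begin

lemma arr_inv:
  assumes "a \<in> homs C x y"
  shows "arr_inv C a \<in> homs C y x" "Comp C (arr_inv C a) a = Ident C x" "Comp C a (arr_inv C a) = Ident C y"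
proof -
  have "\<exists>b. b \<in> Arr C \<and> Dom C b = Cod C a \<and> Cod C b = Dom C a \<and>
     Comp C b a = Ident C (Dom C a) \<and> Comp C a b = Ident C (Cod C a)"
    using all_iso[of a] assms unfolding is_iso_def homs_iff by blast
  from someI_ex[OF this] show "arr_inv C a \<in> homs C y x" "Comp C (arr_inv C a) a = Ident C x" "Comp C a (arr_inv C a) = Ident C y"
    using assms unfolding arr_inv_def[symmetric] homs_iff by auto
qed

lemma inv_comp_cancel: "a \<in> homs C x y \<Longrightarrow> b \<in> homs C w x \<Longrightarrow> Comp C (arr_inv C a) (Comp C a b) = b"
  using homs_assoc[OF arr_inv(1), of a x y a x b w] arr_inv(2) comp_ident_homs(2) by simp

lemma comp_inv_cancel: "a \<in> homs C x y \<Longrightarrow> b \<in> homs C w y \<Longrightarrow> Comp C a (Comp C (arr_inv C a) b) = b"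
  using homs_assoc[of a x y "arr_inv C a" y b w] arr_inv(1,3) comp_ident_homs(2) by simp

lemma cancel_left:
  assumes "a \<in> homs C x y" "b \<in> homs C w x" "c \<in> homs C w x" "Comp C a b = Comp C a c"
  shows "b = c"
proof -
  have "b = Comp C (arr_inv C a) (Comp C a b)" by (rule inv_comp_cancel[OF assms(1,2), symmetric])
  also have "\<dots> = c" unfolding assms(4) by (rule inv_comp_cancel[OF assms(1,3)])
  finally show ?thesis .
qed

lemma comp_inv_right: "b \<in> homs C x y \<Longrightarrow> a \<in> homs C w x \<Longrightarrow> Comp C (Comp C b a) (arr_inv C a) = b"
  using homs_assoc[of b x y a w "arr_inv C a" x] arr_inv comp_ident_homs(1) by simp

lemma cancel_right:
  assumes a: "a \<in> homs C w x" and b: "b \<in> homs C x y" and c: "c \<in> homs C x y" and eq: "Comp C b a = Comp C c a"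
  shows "b = c"
proof -
  have "b = Comp C (Comp C b a) (arr_inv C a)" by (rule comp_inv_right[OF b a, symmetric])
  also have "\<dots> = c" unfolding eq by (rule comp_inv_right[OF c a])
  finally show ?thesis .
qed

lemma inv_comp_right: "b \<in> homs C x y \<Longrightarrow> a \<in> homs C x w \<Longrightarrow> Comp C (Comp C b (arr_inv C a)) a = b"
  using homs_assoc[of b x y "arr_inv C a" w a x] arr_inv comp_ident_homs(1) by simp

end

section \<open>Torsors and their equivariant maps\<close>

lemma torsorD:
  assumes "is_torsor G X"
  shows "manifold (tmfd X)" "pts (tmfd X) \<noteq> {}"
    "x \<in> pts (tmfd X) \<Longrightarrow> g \<in> carrier G \<Longrightarrow> act X x g \<in> pts (tmfd X)"
    "x \<in> pts (tmfd X) \<Longrightarrow> act X x (one G) = x"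
    "x \<in> pts (tmfd X) \<Longrightarrow> g \<in> carrier G \<Longrightarrow> h \<in> carrier G \<Longrightarrow> act X (act X x g) h = act X x (mult G g h)"
    "x \<in> pts (tmfd X) \<Longrightarrow> g \<in> carrier G \<Longrightarrow> act X x g = x \<Longrightarrow> g = one G"
    "x \<in> pts (tmfd X) \<Longrightarrow> y \<in> pts (tmfd X) \<Longrightarrow> \<exists>g\<in>carrier G. act X x g = y"
  using assms unfolding is_torsor_def by (blast, blast, auto simp: PiE_iff)

lemma Obj_Tors [simp]: "Obj (Tors G) = {X. is_torsor G X}"
  by (simp add: Tors_def)

lemma Dom_Tors [simp]: "Dom (Tors G) (X, h, Y) = X" and Cod_Tors [simp]: "Cod (Tors G) (X, h, Y) = Y"
  by (simp_all add: Tors_def)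

lemma Arr_Tors: "(X, h, Y) \<in> Arr (Tors G) \<longleftrightarrow> is_torsor G X \<and> is_torsor G Y \<and> h \<in> pts (tmfd X) \<rightarrow>\<^sub>E pts (tmfd Y) \<and>
   (\<forall>x\<in>pts (tmfd X). \<forall>g\<in>carrier G. h (act X x g) = act Y (h x) g)"
  by (simp add: Tors_def)

lemma Comp_Tors [simp]: "Comp (Tors G) (Y', k, Z) (X, h, Y) = (X, compose (pts (tmfd X)) k h, Z)"
  by (simp add: Tors_def)

lemma Ident_Tors [simp]: "Ident (Tors G) X = (X, \<lambda>x\<in>pts (tmfd X). x, X)"
  by (simp add: Tors_def)

lemma Arr_TorsE:
  assumes "a \<in> Arr (Tors G)"
  obtains X h Y where "a = (X, h, Y)" "is_torsor G X" "is_torsor G Y" "h \<in> pts (tmfd X) \<rightarrow>\<^sub>E pts (tmfd Y)"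
    "\<And>x g. x \<in> pts (tmfd X) \<Longrightarrow> g \<in> carrier G \<Longrightarrow> h (act X x g) = act Y (h x) g"
  using assms by (cases a) (auto simp: Arr_Tors)

lemma category_Tors: "category (Tors G)"
proof
  fix a assume a: "a \<in> Arr (Tors G)"
  then obtain X h Y where h: "a = (X, h, Y)" "is_torsor G X" "is_torsor G Y" "h \<in> pts (tmfd X) \<rightarrow>\<^sub>E pts (tmfd Y)"
    "\<And>x g. x \<in> pts (tmfd X) \<Longrightarrow> g \<in> carrier G \<Longrightarrow> h (act X x g) = act Y (h x) g" using Arr_TorsE by blast
  show "Dom (Tors G) a \<in> Obj (Tors G)" "Cod (Tors G) a \<in> Obj (Tors G)" using h by simp_all
  show "Comp (Tors G) a (Ident (Tors G) (Dom (Tors G) a)) = a" "Comp (Tors G) (Ident (Tors G) (Cod (Tors G) a)) a = a"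
    using h(1,4) by (auto simp: compose_def PiE_iff extensional_def fun_eq_iff)
  fix b assume "b \<in> Arr (Tors G)" and ab: "Cod (Tors G) a = Dom (Tors G) b"
  then obtain k Z where k: "b = (Y, k, Z)" "is_torsor G Z" "k \<in> pts (tmfd Y) \<rightarrow>\<^sub>E pts (tmfd Z)"
    "\<And>x g. x \<in> pts (tmfd Y) \<Longrightarrow> g \<in> carrier G \<Longrightarrow> k (act Y x g) = act Z (k x) g" using h(1) by (elim Arr_TorsE) simp
  show "Comp (Tors G) b a \<in> Arr (Tors G)"
    unfolding h(1) k(1) Comp_Tors Arr_Tors using h k torsorD(3)[OF h(2)] by (auto simp: compose_def PiE_iff)
  show "Dom (Tors G) (Comp (Tors G) b a) = Dom (Tors G) a" "Cod (Tors G) (Comp (Tors G) b a) = Cod (Tors G) b"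
    by (simp_all add: h k)
  fix c assume "c \<in> Arr (Tors G)" "Cod (Tors G) b = Dom (Tors G) c"
  then obtain l W where l: "c = (Z, l, W)" using k(1) by (elim Arr_TorsE) simp
  show "Comp (Tors G) c (Comp (Tors G) b a) = Comp (Tors G) (Comp (Tors G) c b) a"
    using h(4) by (auto simp: h(1) k(1) l compose_def fun_eq_iff)
next
  fix x assume "x \<in> Obj (Tors G)"
  then show "Ident (Tors G) x \<in> Arr (Tors G)" "Dom (Tors G) (Ident (Tors G) x) = x" "Cod (Tors G) (Ident (Tors G) x) = x"
    using torsorD(3)[of G x] by (auto simp: Arr_Tors)
qed

text \<open>Injectivity comes from freeness of the action on \<open>Y\<close>, surjectivity from
  transitivity there. This is the reason why every arrow of \<open>Tors\<close> is
  invertible.\<close>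

lemma torsor_map_bij:
  assumes X: "is_torsor G X" and Y: "is_torsor G Y" and h: "h \<in> pts (tmfd X) \<rightarrow> pts (tmfd Y)"
    "\<And>x g. x \<in> pts (tmfd X) \<Longrightarrow> g \<in> carrier G \<Longrightarrow> h (act X x g) = act Y (h x) g"
  shows "bij_betw h (pts (tmfd X)) (pts (tmfd Y))"
  unfolding bij_betw_def
proof
  show "inj_on h (pts (tmfd X))"
  proof
    fix x y assume xy: "x \<in> pts (tmfd X)" "y \<in> pts (tmfd X)" "h x = h y"
    then obtain g where g: "g \<in> carrier G" "act X x g = y" using torsorD(7)[OF X] by blast
    then have "act Y (h x) g = h x" using h(2)[OF xy(1) g(1)] xy(3) by simp
    then have "g = one G" using torsorD(6)[OF Y _ g(1)] h(1) xy(1) by blast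
    then show "x = y" using torsorD(4)[OF X xy(1)] g(2) by simp
  qed
  show "h ` pts (tmfd X) = pts (tmfd Y)"
  proof
    show "pts (tmfd Y) \<subseteq> h ` pts (tmfd X)"
    proof
      fix y assume y: "y \<in> pts (tmfd Y)"
      obtain x where x: "x \<in> pts (tmfd X)" using torsorD(2)[OF X] by blast
      then obtain g where g: "g \<in> carrier G" "act Y (h x) g = y" using torsorD(7)[OF Y _ y] h(1) by blast
      then show "y \<in> h ` pts (tmfd X)" using h(2)[OF x g(1)] torsorD(3)[OF X x g(1)] by force
    qed
  qed (use h(1) in auto)
qed

lemma groupoid_Tors: "groupoid (Tors G)"
proof (intro groupoid.intro category_Tors groupoid_axioms.intro)
  fix a assume "a \<in> Arr (Tors G)"
  then obtain X h Y where h: "a = (X, h, Y)" "is_torsor G X" "is_torsor G Y" "h \<in> pts (tmfd X) \<rightarrow>\<^sub>E pts (tmfd Y)"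
    "\<And>x g. x \<in> pts (tmfd X) \<Longrightarrow> g \<in> carrier G \<Longrightarrow> h (act X x g) = act Y (h x) g" using Arr_TorsE by blast
  have bij: "bij_betw h (pts (tmfd X)) (pts (tmfd Y))"
    by (rule torsor_map_bij[OF h(2,3) _ h(5)]) (use h(4) in auto)
  let ?k = "\<lambda>y\<in>pts (tmfd Y). inv_into (pts (tmfd X)) h y"
  have inv: "h (inv_into (pts (tmfd X)) h y) = y" "inv_into (pts (tmfd X)) h y \<in> pts (tmfd X)" if "y \<in> pts (tmfd Y)" for y
    using bij that by (simp_all add: bij_betw_inv_into_right bij_betw_def inv_into_into)
  have inv': "inv_into (pts (tmfd X)) h (h x) = x" if "x \<in> pts (tmfd X)" for x
    using bij that by (simp add: bij_betw_def)
  have "(Y, ?k, X) \<in> Arr (Tors G)"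
    unfolding Arr_Tors
  proof (intro conjI ballI h(2,3))
    show "?k \<in> pts (tmfd Y) \<rightarrow>\<^sub>E pts (tmfd X)" using inv by auto
    fix y g assume y: "y \<in> pts (tmfd Y)" and g: "g \<in> carrier G"
    let ?x = "inv_into (pts (tmfd X)) h y"
    have "inv_into (pts (tmfd X)) h (h (act X ?x g)) = act X ?x g"
      by (rule inv'[OF torsorD(3)[OF h(2) inv(2)[OF y] g]])
    then show "?k (act Y y g) = act X (?k y) g"
      using h(5)[OF inv(2)[OF y] g] inv(1)[OF y] y torsorD(3)[OF h(3) y g] by simp
  qed
  moreover have "Comp (Tors G) (Y, ?k, X) a = Ident (Tors G) X" "Comp (Tors G) a (Y, ?k, X) = Ident (Tors G) Y"
    using inv inv' h(4) by (auto simp: h(1) compose_def PiE_iff restrict_def fun_eq_iff)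
  ultimately show "is_iso (Tors G) a"
    unfolding is_iso_def using \<open>a \<in> Arr (Tors G)\<close> by (intro conjI bexI[of _ "(Y, ?k, X)"]) (simp_all add: h(1) del: Comp_Tors Ident_Tors)
qed

abbreviation tmap :: "('q, 'g) tors_arr \<Rightarrow> 'q \<Rightarrow> 'q" where "tmap k \<equiv> fst (snd k)"

lemma homs_Tors:
  assumes "k \<in> homs (Tors G) X Y"
  shows "is_torsor G X" "is_torsor G Y" "x \<in> pts (tmfd X) \<Longrightarrow> tmap k x \<in> pts (tmfd Y)"
    "x \<in> pts (tmfd X) \<Longrightarrow> g \<in> carrier G \<Longrightarrow> tmap k (act X x g) = act Y (tmap k x) g"
  using assms by (cases k; auto simp: homs_iff Arr_Tors)+

lemma tmap_comp: "b \<in> homs (Tors G) Y Z \<Longrightarrow> a \<in> homs (Tors G) X Y \<Longrightarrow> x \<in> pts (tmfd X) \<Longrightarrow>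
    tmap (Comp (Tors G) b a) x = tmap b (tmap a x)"
  by (cases a; cases b) (auto simp: homs_iff compose_def)

section \<open>Smooth families of torsor maps\<close>

locale lie_group_torsors =
  fixes G :: "'g lie_group"
  assumes G: "is_lie_group G"
begin

sublocale Tors: groupoid "Tors G" by (rule groupoid_Tors)

lemma group_G: "group G" and manifold_G: "manifold (gmfd G)" and pts_G: "pts (gmfd G) = carrier G"
  and mult_smooth: "smooth_map (prod_mfd (gmfd G) (gmfd G)) (gmfd G) (\<lambda>(g, h). mult G g h)"
  using G by (simp_all add: is_lie_group_def)

lemma leG: "locally_euclidean (gmfd G)"
  by (rule manifold_locally_euclidean[OF manifold_G])

text \<open>Freeness is stated for elements fixing \<open>x\<close>, so two elements with the same
  effect are compared through the product of one with the inverse of the other.\<close>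

lemma tdiff:
  assumes X: "is_torsor G X" and x: "x \<in> pts (tmfd X)" and y: "y \<in> pts (tmfd X)"
  shows "tdiff G X x y \<in> carrier G" "act X x (tdiff G X x y) = y"
    and "g \<in> carrier G \<Longrightarrow> act X x g = y \<Longrightarrow> tdiff G X x y = g"
proof -
  interpret group G by (rule group_G)
  have uniq: "g = h" if g: "g \<in> carrier G" "act X x g = y" and h: "h \<in> carrier G" "act X x h = y" for g h
  proof -
    have "act X x (mult G g (inv\<^bsub>G\<^esub> h)) = act X (act X x h) (inv\<^bsub>G\<^esub> h)" using torsorD(5)[OF X x g(1), of "inv\<^bsub>G\<^esub> h"] g h by simp
    also have "\<dots> = x" using torsorD(5)[OF X x h(1), of "inv\<^bsub>G\<^esub> h"] h torsorD(4)[OF X x] by simp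
    finally have "mult G g (inv\<^bsub>G\<^esub> h) = one G" using torsorD(6)[OF X x] g h by simp
    then show "g = h" using g h by (simp add: inv_solve_right')
  qed
  have eq: "tdiff G X x y = g" if "g \<in> carrier G" "act X x g = y" for g
    unfolding tdiff_def by (rule the_equality) (use that uniq in auto)
  then show "g \<in> carrier G \<Longrightarrow> act X x g = y \<Longrightarrow> tdiff G X x y = g" by blast
  obtain h where h: "h \<in> carrier G" "act X x h = y" using torsorD(7)[OF X x y] by blast
  then show "tdiff G X x y \<in> carrier G" "act X x (tdiff G X x y) = y" using eq[OF h] by auto
qed

lemma tdiff_comp:
  assumes X: "is_torsor G X" and x: "x \<in> pts (tmfd X)" and y: "y \<in> pts (tmfd X)" and z: "z \<in> pts (tmfd X)"
  shows "tdiff G X x z = mult G (tdiff G X x y) (tdiff G X y z)"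
proof -
  interpret group G by (rule group_G)
  show ?thesis
    using tdiff(1,2)[OF X x y] tdiff(1,2)[OF X y z] torsorD(5)[OF X x, of "tdiff G X x y" "tdiff G X y z"]
    by (intro tdiff(3)[OF X x z]) auto
qed

text \<open>Extends the diffeology of \<open>Aut_dspace\<close> to maps between two different
  torsors, as composites along a path pass through other fibers. All base points in both torsors are
  allowed, so no choice enters.\<close>

definition smooth_family :: "nat \<Rightarrow> (nat \<Rightarrow> real) set \<Rightarrow> ('q, 'g) torsor \<Rightarrow> ('q, 'g) torsor \<Rightarrow>
    ((nat \<Rightarrow> real) \<Rightarrow> ('q, 'g) tors_arr) \<Rightarrow> bool" where
  "smooth_family n V X Y k \<longleftrightarrow> (\<forall>u\<in>V. k u \<in> homs (Tors G) X Y) \<and>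
     (\<forall>x\<in>pts (tmfd X). \<forall>y\<in>pts (tmfd Y).
        smooth_map (open_sub (eucl_mfd n) V) (gmfd G) (\<lambda>u. tdiff G Y y (tmap (k u) x)))"

lemma smooth_mult:
  assumes V: "openin (Euclidean_space n) V"
    and "smooth_map (open_sub (eucl_mfd n) V) (gmfd G) a" "smooth_map (open_sub (eucl_mfd n) V) (gmfd G) b"
  shows "smooth_map (open_sub (eucl_mfd n) V) (gmfd G) (\<lambda>u. mult G (a u) (b u))"
  using smooth_map_prod_compose[OF leG leG leG V mult_smooth assms(2,3)] by simp

lemma smooth_map_eucl_cong:
  assumes V: "openin (Euclidean_space n) V" and N: "locally_euclidean N"
    and f: "smooth_map (open_sub (eucl_mfd n) V) N f" and eq: "\<And>u. u \<in> V \<Longrightarrow> f u = g u"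
  shows "smooth_map (open_sub (eucl_mfd n) V) N g"
  by (rule smooth_map_cong[OF locally_euclidean_open_eucl[OF V] N f]) (use eq in auto)

text \<open>For a fixed point y of the middle torsor, equivariance gives d(z, l(k(x))) = d(z, l(y))
  d(y, k(x)), a product of two smooth maps into the group.\<close>

lemma smooth_family_comp:
  assumes V: "openin (Euclidean_space n) V" and k: "smooth_family n V X Y k" and l: "smooth_family n V Y Z l"
    and Y: "is_torsor G Y"
  shows "smooth_family n V X Z (\<lambda>u. Comp (Tors G) (l u) (k u))"
  unfolding smooth_family_def
proof (intro conjI ballI)
  fix u assume "u \<in> V"
  then show "Comp (Tors G) (l u) (k u) \<in> homs (Tors G) X Z"
    using k l Tors.comp_homs unfolding smooth_family_def by blast
next
  fix x z assume x: "x \<in> pts (tmfd X)" and z: "z \<in> pts (tmfd Z)"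
  obtain y where y: "y \<in> pts (tmfd Y)" using torsorD(2)[OF Y] by blast
  have "smooth_map (open_sub (eucl_mfd n) V) (gmfd G) (\<lambda>u. mult G (tdiff G Z z (tmap (l u) y)) (tdiff G Y y (tmap (k u) x)))"
    by (rule smooth_mult[OF V]) (use k l x y z in \<open>auto simp: smooth_family_def\<close>)
  then show "smooth_map (open_sub (eucl_mfd n) V) (gmfd G) (\<lambda>u. tdiff G Z z (tmap (Comp (Tors G) (l u) (k u)) x))"
  proof (rule smooth_map_eucl_cong[OF V leG])
    fix u assume u: "u \<in> V"
    have ku: "k u \<in> homs (Tors G) X Y" and lu: "l u \<in> homs (Tors G) Y Z" using k l u by (auto simp: smooth_family_def)
    have Z: "is_torsor G Z" using homs_Tors(2)[OF lu] .
    have kx: "tmap (k u) x \<in> pts (tmfd Y)" by (rule homs_Tors(3)[OF ku x])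
    let ?g = "tdiff G Y y (tmap (k u) x)"
    note g = tdiff(1,2)[OF Y y kx]
    have ly: "tmap (l u) y \<in> pts (tmfd Z)" by (rule homs_Tors(3)[OF lu y])
    have lg: "tmap (l u) (tmap (k u) x) = act Z (tmap (l u) y) ?g" using homs_Tors(4)[OF lu y g(1)] g(2) by simp
    have lkx: "tmap (l u) (tmap (k u) x) \<in> pts (tmfd Z)" by (rule homs_Tors(3)[OF lu kx])
    have "tdiff G Z (tmap (l u) y) (tmap (l u) (tmap (k u) x)) = ?g"
      by (rule tdiff(3)[OF Z ly lkx g(1)]) (simp add: lg)
    then show "mult G (tdiff G Z z (tmap (l u) y)) ?g = tdiff G Z z (tmap (Comp (Tors G) (l u) (k u)) x)"
      using tdiff_comp[OF Z z ly lkx] tmap_comp[OF lu ku x] by simp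
  qed
qed

lemma smooth_family_const:
  assumes V: "openin (Euclidean_space n) V" and k: "k \<in> homs (Tors G) X Y"
  shows "smooth_family n V X Y (\<lambda>u. k)"
  unfolding smooth_family_def
proof (intro conjI ballI k)
  fix x y assume "x \<in> pts (tmfd X)" "y \<in> pts (tmfd Y)"
  then have "tdiff G Y y (tmap k x) \<in> pts (gmfd G)"
    using tdiff(1)[OF homs_Tors(2)[OF k]] homs_Tors(3)[OF k] by (simp add: pts_G)
  then show "smooth_map (open_sub (eucl_mfd n) V) (gmfd G) (\<lambda>u. tdiff G Y y (tmap k x))"
    by (rule smooth_map_const[OF locally_euclidean_open_eucl[OF V] leG])
qed

lemma smooth_family_cong:
  assumes V: "openin (Euclidean_space n) V" and k: "smooth_family n V X Y k" and eq: "\<And>u. u \<in> V \<Longrightarrow> k u = l u"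
  shows "smooth_family n V X Y l"
  unfolding smooth_family_def
proof (intro conjI ballI)
  fix x y assume xy: "x \<in> pts (tmfd X)" "y \<in> pts (tmfd Y)"
  show "smooth_map (open_sub (eucl_mfd n) V) (gmfd G) (\<lambda>u. tdiff G Y y (tmap (l u) x))"
    by (rule smooth_map_eucl_cong[OF V leG, of "\<lambda>u. tdiff G Y y (tmap (k u) x)"]) (use k xy eq in \<open>auto simp: smooth_family_def\<close>)
qed (use k eq in \<open>auto simp: smooth_family_def\<close>)

lemma smooth_family_subset: "smooth_family n V X Y k \<Longrightarrow> W \<subseteq> V \<Longrightarrow> smooth_family n W X Y k"
  unfolding smooth_family_def using smooth_map_eucl_subset by blast

lemma smooth_family_local:
  assumes V: "openin (Euclidean_space n) V"
    and loc: "\<And>u. u \<in> V \<Longrightarrow> \<exists>W. openin (Euclidean_space n) W \<and> u \<in> W \<and> W \<subseteq> V \<and> smooth_family n W X Y k"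
  shows "smooth_family n V X Y k"
  unfolding smooth_family_def
proof (intro conjI ballI)
  fix u assume "u \<in> V" then show "k u \<in> homs (Tors G) X Y" using loc[of u] by (auto simp: smooth_family_def)
next
  fix x y assume xy: "x \<in> pts (tmfd X)" "y \<in> pts (tmfd Y)"
  show "smooth_map (open_sub (eucl_mfd n) V) (gmfd G) (\<lambda>u. tdiff G Y y (tmap (k u) x))"
  proof (rule smooth_map_local[OF locally_euclidean_open_eucl[OF V] leG])
    fix u assume "u \<in> pts (open_sub (eucl_mfd n) V)"
    then have "u \<in> V" by simp
    then obtain W where W: "openin (Euclidean_space n) W" "u \<in> W" "W \<subseteq> V" "smooth_family n W X Y k" using loc by blast
    then show "\<exists>W. openin (mtop (open_sub (eucl_mfd n) V)) W \<and> u \<in> W \<and>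
       smooth_map (open_sub (open_sub (eucl_mfd n) V) W) (gmfd G) (\<lambda>u. tdiff G Y y (tmap (k u) x))"
      using xy V by (intro exI[of _ W]) (simp add: open_sub_open_sub Int_absorb1 smooth_family_def openin_open_subtopology)
  qed
qed

text \<open>\<open>Aut_dspace\<close> uses the same point as source and as reference; passing to
  another reference point \<open>y\<close> multiplies from the left by the constant
  \<open>tdiff G X y x\<close>.\<close>

lemma plot_Aut_iff:
  assumes V: "openin (Euclidean_space n) V" and X: "is_torsor G X"
  shows "plot (Aut_dspace G X) n V p \<longleftrightarrow> smooth_family n V X X p"
proof
  assume p: "plot (Aut_dspace G X) n V p"
  then have hom: "p u \<in> homs (Tors G) X X" if "u \<in> V" for u using that by (auto simp: Aut_dspace_def homs_iff)
  have sm: "smooth_map (open_sub (eucl_mfd n) V) (gmfd G) (\<lambda>u. tdiff G X x (tmap (p u) x))" if "x \<in> pts (tmfd X)" for x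
    using p that by (simp add: Aut_dspace_def mfd_dspace_def)
  show "smooth_family n V X X p"
    unfolding smooth_family_def
  proof (intro conjI ballI hom)
    fix x y assume x: "x \<in> pts (tmfd X)" and y: "y \<in> pts (tmfd X)"
    have "tdiff G X y x \<in> pts (gmfd G)" using tdiff(1)[OF X y x] by (simp add: pts_G)
    then have "smooth_map (open_sub (eucl_mfd n) V) (gmfd G) (\<lambda>u. mult G (tdiff G X y x) (tdiff G X x (tmap (p u) x)))"
      by (intro smooth_mult[OF V] sm x smooth_map_const[OF locally_euclidean_open_eucl[OF V] leG])
    then show "smooth_map (open_sub (eucl_mfd n) V) (gmfd G) (\<lambda>u. tdiff G X y (tmap (p u) x))"
      by (rule smooth_map_eucl_cong[OF V leG]) (use tdiff_comp[OF X y x] homs_Tors(3)[OF hom x] in simp)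
  qed
next
  assume "smooth_family n V X X p"
  then show "plot (Aut_dspace G X) n V p"
    using V by (auto simp: Aut_dspace_def mfd_dspace_def smooth_family_def homs_iff)
qed

text \<open>Plots of the quotient lift only locally, but smoothness of a family is local, so testing
  on plots of actual loops suffices; conversely, a plot of loops is its own lift.\<close>

lemma dsmooth_pi1_iff:
  assumes M: "locally_euclidean M" and X: "is_torsor G X"
    and f: "\<And>\<gamma>. \<gamma> \<in> paths M \<Longrightarrow> \<gamma> 0 = x \<Longrightarrow> \<gamma> 1 = x \<Longrightarrow> f (cls M \<gamma>) \<in> homs (Tors G) X X"
  shows "dsmooth (pi1_thin M x) (Aut_dspace G X) f \<longleftrightarrow>
    (\<forall>n V p. plot (path_dspace M) n V p \<longrightarrow> (\<forall>u\<in>V. p u 0 = x \<and> p u 1 = x) \<longrightarrow> smooth_family n V X X (\<lambda>u. f (cls M (p u))))"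
    (is "?L \<longleftrightarrow> ?R")
proof
  have plotD: "openin (Euclidean_space n) V" "\<And>u. u \<in> V \<Longrightarrow> p u \<in> paths M" if "plot (path_dspace M) n V p" for n V p
    using that by (auto simp: path_dspace_def)
  {
    assume L: ?L
    show ?R
    proof (intro allI impI)
      fix n V p assume p: "plot (path_dspace M) n V p" and loop: "\<forall>u\<in>V. p u 0 = x \<and> p u 1 = x"
      have "plot (pi1_thin M x) n V (\<lambda>u. cls M (p u))"
        unfolding pi1_thin_def subspace_dspace_def quotient_dspace_def dspace.simps
      proof (intro conjI ballI)
        show "openin (Euclidean_space n) V" by (rule plotD[OF p])
        fix u assume "u \<in> V"
        then show "\<exists>Va pa. u \<in> Va \<and> Va \<subseteq> V \<and> plot (path_dspace M) n Va pa \<and> (\<forall>v\<in>Va. cls M (p v) = thin_rel M `` {pa v})"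
          using p by (intro exI[of _ V] exI[of _ p]) (simp add: cls_def)
      next
        show "(\<lambda>u. cls M (p u)) ` V \<subseteq> {c \<in> Arr (Pi_thin M). Dom (Pi_thin M) c = x \<and> Cod (Pi_thin M) c = x}"
          using plotD(2)[OF p] loop Dom_cls[OF M] Cod_cls[OF M] by (auto simp: Arr_Pi_thin)
      qed
      then have "plot (Aut_dspace G X) n V (f \<circ> (\<lambda>u. cls M (p u)))" using L unfolding dsmooth_def by blast
      then show "smooth_family n V X X (\<lambda>u. f (cls M (p u)))"
        using plot_Aut_iff[OF plotD(1)[OF p] X] by (simp add: o_def)
    qed
  next
    assume R: ?R
    show ?L
      unfolding dsmooth_def
    proof (intro conjI allI impI)
      show "f ` dset (pi1_thin M x) \<subseteq> dset (Aut_dspace G X)"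
        using f Dom_cls[OF M] Cod_cls[OF M] by (auto simp: pi1_thin_def subspace_dspace_def Aut_dspace_def Arr_Pi_thin homs_iff)
      fix n V q assume q: "plot (pi1_thin M x) n V q"
      then have V: "openin (Euclidean_space n) V"
        and lift: "\<And>u. u \<in> V \<Longrightarrow> \<exists>W p. u \<in> W \<and> W \<subseteq> V \<and> plot (path_dspace M) n W p \<and> (\<forall>v\<in>W. q v = cls M (p v))"
        and loop: "\<And>u. u \<in> V \<Longrightarrow> Dom (Pi_thin M) (q u) = x \<and> Cod (Pi_thin M) (q u) = x"
        by (auto simp: pi1_thin_def subspace_dspace_def quotient_dspace_def cls_def)
      have "smooth_family n V X X (f \<circ> q)"
      proof (rule smooth_family_local[OF V])
        fix u assume "u \<in> V"
        from lift[OF this] obtain W p where W: "u \<in> W" "W \<subseteq> V" "plot (path_dspace M) n W p" "\<forall>v\<in>W. q v = cls M (p v)"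
          by (elim exE conjE)
        have "\<forall>v\<in>W. p v 0 = x \<and> p v 1 = x"
        proof
          fix v assume v: "v \<in> W"
          then show "p v 0 = x \<and> p v 1 = x"
            using loop[of v] W(2) W(4)[rule_format, OF v] Dom_cls[OF M plotD(2)[OF W(3) v]] Cod_cls[OF M plotD(2)[OF W(3) v]] by auto
        qed
        with R[rule_format, OF W(3)] have "smooth_family n W X X (\<lambda>u. f (cls M (p u)))" by simp
        then have "smooth_family n W X X (f \<circ> q)"
          by (rule smooth_family_cong[OF plotD(1)[OF W(3)]]) (simp add: W(4))
        then show "\<exists>W. openin (Euclidean_space n) W \<and> u \<in> W \<and> W \<subseteq> V \<and> smooth_family n W X X (f \<circ> q)"
          using W plotD(1)[OF W(3)] by blast
      qed
      then show "plot (Aut_dspace G X) n V (f \<circ> q)" using plot_Aut_iff[OF V X] by blast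
    qed
  }
qed

lemma functor_homs:
  assumes M: "locally_euclidean M" and F: "is_functor (Pi_thin M) D F" and \<gamma>: "\<gamma> \<in> paths M"
  shows "farr F (cls M \<gamma>) \<in> homs D (fobj F (\<gamma> 0)) (fobj F (\<gamma> 1))"
proof -
  have "cls M \<gamma> \<in> Arr (Pi_thin M)" using \<gamma> by (auto simp: Arr_Pi_thin)
  then show ?thesis using F Dom_cls[OF M \<gamma>] Cod_cls[OF M \<gamma>] unfolding is_functor_def homs_iff by auto
qed

lemma functor_Obj: "is_functor (Pi_thin M) D F \<Longrightarrow> x \<in> pts M \<Longrightarrow> fobj F x \<in> Obj D"
  unfolding is_functor_def by auto

lemma functor_concat:
  assumes M: "locally_euclidean M" and F: "is_functor (Pi_thin M) D F" and "\<gamma> \<in> paths M" "\<tau> \<in> paths M" "\<tau> 1 = \<gamma> 0"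
  shows "farr F (cls M (concat_path \<gamma> \<tau>)) = Comp D (farr F (cls M \<gamma>)) (farr F (cls M \<tau>))"
proof -
  have "cls M \<gamma> \<in> Arr (Pi_thin M)" "cls M \<tau> \<in> Arr (Pi_thin M)" using assms by (auto simp: Arr_Pi_thin)
  moreover have "Cod (Pi_thin M) (cls M \<tau>) = Dom (Pi_thin M) (cls M \<gamma>)" using assms Dom_cls[OF M] Cod_cls[OF M] by simp
  ultimately have "farr F (Comp (Pi_thin M) (cls M \<gamma>) (cls M \<tau>)) = Comp D (farr F (cls M \<gamma>)) (farr F (cls M \<tau>))"
    using F unfolding is_functor_def by blast
  then show ?thesis using Comp_cls[OF M assms(3-5)] by simp
qed

lemma functor_const:
  assumes F: "is_functor (Pi_thin M) D F" and "x \<in> pts M"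
  shows "farr F (cls M (\<lambda>t\<in>I01. x)) = Ident D (fobj F x)"
proof -
  have "farr F (Ident (Pi_thin M) x) = Ident D (fobj F x)" using assms unfolding is_functor_def by simp
  then show ?thesis by (simp only: Ident_cls)
qed

lemma transport_functor_iff:
  assumes M: "locally_euclidean M"
  shows "transport_functor G M F \<longleftrightarrow> is_functor (Pi_thin M) (Tors G) F \<and>
    (\<forall>x\<in>pts M. \<forall>n V p. plot (path_dspace M) n V p \<longrightarrow> (\<forall>u\<in>V. p u 0 = x \<and> p u 1 = x) \<longrightarrow>
      smooth_family n V (fobj F x) (fobj F x) (\<lambda>u. farr F (cls M (p u))))"
proof (cases "is_functor (Pi_thin M) (Tors G) F")
  case True
  have "dsmooth (pi1_thin M x) (Aut_dspace G (fobj F x)) (farr F) \<longleftrightarrow>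
    (\<forall>n V p. plot (path_dspace M) n V p \<longrightarrow> (\<forall>u\<in>V. p u 0 = x \<and> p u 1 = x) \<longrightarrow>
      smooth_family n V (fobj F x) (fobj F x) (\<lambda>u. farr F (cls M (p u))))" if x: "x \<in> pts M" for x
  proof (rule dsmooth_pi1_iff[OF M])
    show "is_torsor G (fobj F x)" using functor_Obj[OF True x] by simp
    fix \<gamma> assume "\<gamma> \<in> paths M" "\<gamma> 0 = x" "\<gamma> 1 = x"
    then show "farr F (cls M \<gamma>) \<in> homs (Tors G) (fobj F x) (fobj F x)" using functor_homs[OF M True, of \<gamma>] by simp
  qed
  then show ?thesis using True by (simp add: transport_functor_def)
qed (simp add: transport_functor_def)

end

lemma functor_comp:
  assumes F: "is_functor C D F" and K: "is_functor B C K"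
  shows "is_functor B D (func_comp B F K)"
proof -
  have *: "fobj K x \<in> Obj C" if "x \<in> Obj B" for x using K that unfolding is_functor_def by auto
  have **: "farr K a \<in> Arr C" if "a \<in> Arr B" for a using K that unfolding is_functor_def by auto
  interpret B: category B using K by (simp add: is_functor_def)
  show ?thesis
    using F K * ** B.Dom_Obj B.Cod_Obj B.Ident_Arr B.Comp_Arr
    unfolding is_functor_def func_comp_def
    by (auto simp: compose_def)
qed

lemma func_comp_Pi:
  assumes N: "locally_euclidean N" and M: "locally_euclidean M" and f: "smooth_map N M f"
  shows "\<gamma> \<in> paths N \<Longrightarrow> farr (func_comp (Pi_thin N) F (Pi_thin_map (N, f, M))) (cls N \<gamma>) = farr F (cls M (compose I01 f \<gamma>))"
    "x \<in> pts N \<Longrightarrow> fobj (func_comp (Pi_thin N) F (Pi_thin_map (N, f, M))) x = fobj F (f x)"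
  using Pi_thin_map_cls[OF N M f, of \<gamma>] by (auto simp: func_comp_def compose_def Arr_Pi_thin) (simp add: Pi_thin_map_def)

context lie_group_torsors
begin

text \<open>Composition with \<open>f\<close> carries plots of loops at x to plots of loops at
  \<open>f x\<close>, so smoothness is inherited from \<open>F\<close>.\<close>

lemma transport_functor_pullback:
  assumes N: "locally_euclidean N" and M: "locally_euclidean M" and f: "smooth_map N M f" and F: "transport_functor G M F"
  shows "transport_functor G N (func_comp (Pi_thin N) F (Pi_thin_map (N, f, M)))"
  unfolding transport_functor_iff[OF N]
proof (intro conjI ballI allI impI)
  have Ff: "is_functor (Pi_thin M) (Tors G) F" using F by (simp add: transport_functor_def)
  show "is_functor (Pi_thin N) (Tors G) (func_comp (Pi_thin N) F (Pi_thin_map (N, f, M)))"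
    by (rule functor_comp[OF Ff functor_Pi_thin_map[OF N M f]])
  fix x n V p assume x: "x \<in> pts N" and p: "plot (path_dspace N) n V p" and loop: "\<forall>u\<in>V. p u 0 = x \<and> p u 1 = x"
  have V: "openin (Euclidean_space n) V" and pp: "\<And>u. u \<in> V \<Longrightarrow> p u \<in> paths N" using p by (auto simp: path_dspace_def)
  let ?A = "{x \<in> topspace (Euclidean_space (Suc n)). x(n := 0) \<in> V \<and> x n \<in> I01}"
  have "smooth_from (Suc n) ?A N (\<lambda>x. p (x(n := 0)) (x n))" using p by (simp add: path_dspace_def)
  then have "smooth_from (Suc n) ?A M (\<lambda>x. f (p (x(n := 0)) (x n)))" by (rule smooth_from_postcompose[OF N M f])
  then have "smooth_from (Suc n) ?A M (\<lambda>x. compose I01 f (p (x(n := 0))) (x n))"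
    by (rule smooth_from_cong) (simp add: compose_def)
  then have "plot (path_dspace M) n V (\<lambda>u. compose I01 f (p u))"
    using V pp compose_in_paths[OF N M f] by (auto simp: path_dspace_def)
  moreover have "\<forall>u\<in>V. compose I01 f (p u) 0 = f x \<and> compose I01 f (p u) 1 = f x" using loop by (simp add: compose_def)
  ultimately have "smooth_family n V (fobj F (f x)) (fobj F (f x)) (\<lambda>u. farr F (cls M (compose I01 f (p u))))"
    using F smooth_map_pts[OF f x] unfolding transport_functor_iff[OF M] by blast
  then have "smooth_family n V (fobj F (f x)) (fobj F (f x)) (\<lambda>u. farr (func_comp (Pi_thin N) F (Pi_thin_map (N, f, M))) (cls N (p u)))"
    by (rule smooth_family_cong[OF V]) (simp add: func_comp_Pi(1)[OF N M f] pp)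
  then show "smooth_family n V (fobj (func_comp (Pi_thin N) F (Pi_thin_map (N, f, M))) x) (fobj (func_comp (Pi_thin N) F (Pi_thin_map (N, f, M))) x)
      (\<lambda>u. farr (func_comp (Pi_thin N) F (Pi_thin_map (N, f, M))) (cls N (p u)))"
    by (simp add: func_comp_Pi(2)[OF N M f x])
qed

end

section \<open>Smoothness of transport is a local property\<close>

definition spoke :: "(nat \<Rightarrow> real) \<Rightarrow> (nat \<Rightarrow> real) \<Rightarrow> real \<Rightarrow> nat \<Rightarrow> real" where
  "spoke a u r = (\<lambda>i. a i + r * (u i - a i))"

lemma spoke_simps [simp]: "spoke a u 0 = a" "spoke a u 1 = u" "spoke a a r = a"
  by (simp_all add: spoke_def)

definition cube :: "nat \<Rightarrow> (nat \<Rightarrow> real) \<Rightarrow> real \<Rightarrow> (nat \<Rightarrow> real) set" where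
  "cube n a \<rho> = {y \<in> topspace (Euclidean_space n). \<forall>i<n. \<bar>y i - a i\<bar> < \<rho>}"

lemma openin_cube: "openin (Euclidean_space n) (cube n a \<rho>)"
  unfolding cube_def by (rule openin_Euclidean_cube)

lemma cube_center: "a \<in> topspace (Euclidean_space n) \<Longrightarrow> \<rho> > 0 \<Longrightarrow> a \<in> cube n a \<rho>"
  by (simp add: cube_def)

lemma spoke_in_cube:
  assumes a: "a \<in> topspace (Euclidean_space n)" and u: "u \<in> cube n a \<rho>" and r: "r \<in> I01"
  shows "spoke a u r \<in> cube n a \<rho>"
proof -
  have "\<bar>r * (u i - a i)\<bar> < \<rho>" if i: "i < n" for i
  proof -
    have "\<bar>r * (u i - a i)\<bar> \<le> 1 * \<bar>u i - a i\<bar>" unfolding abs_mult by (rule mult_right_mono) (use r in auto)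
    also have "\<dots> < \<rho>" using u i by (simp add: cube_def)
    finally show ?thesis .
  qed
  then show ?thesis using a u by (auto simp: cube_def spoke_def topspace_Euclidean_space)
qed

lemma plot_path_subset:
  "plot (path_dspace M) n V p \<Longrightarrow> openin (Euclidean_space n) W \<Longrightarrow> W \<subseteq> V \<Longrightarrow> plot (path_dspace M) n W p"
  unfolding path_dspace_def by (auto elim!: smooth_from_subset)

text \<open>A plot is smooth in parameter and time jointly, so it can be evaluated along any smooth
  choice of both; \<open>(a x)(n := b x)\<close> is that pair in the encoding of the product with
  the unit interval.\<close>

lemma plot_path_smooth_from:
  assumes M: "locally_euclidean M" and p: "plot (path_dspace M) n V p" and W: "openin (Euclidean_space k) W" "A \<subseteq> W"
    and a: "smooth_eucl k W n a" and b: "smooth_fn k W b" and V: "\<And>x. x \<in> A \<Longrightarrow> a x \<in> V" "\<And>x. x \<in> A \<Longrightarrow> b x \<in> I01"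
  shows "smooth_from k A M (\<lambda>x. p (a x) (b x))"
proof (rule smooth_from_compose[OF M W(2,1), where h = "\<lambda>x. (a x)(n := b x)"])
  show "smooth_from (Suc n) {x \<in> topspace (Euclidean_space (Suc n)). x(n := 0) \<in> V \<and> x n \<in> I01} M (\<lambda>x. p (x(n := 0)) (x n))"
    using p by (simp add: path_dspace_def)
  have top: "a x i = 0" if "x \<in> W" "n \<le> i" for x i
    using a that by (force simp: smooth_eucl_def topspace_Euclidean_space)
  show "smooth_eucl k W (Suc n) (\<lambda>x. (a x)(n := b x))"
    unfolding smooth_eucl_iff
  proof (intro conjI allI impI)
    show "(\<lambda>x. (a x)(n := b x)) ` W \<subseteq> topspace (Euclidean_space (Suc n))"
      using top by (auto simp: topspace_Euclidean_space)
    fix j assume "j < Suc n"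
    then show "smooth_fn k W (\<lambda>x. ((a x)(n := b x)) j)"
      using a b by (cases "j = n") (auto simp: smooth_eucl_iff)
  qed
  fix x assume x: "x \<in> A"
  have "a x n = 0" using top[of x n] x W(2) by auto
  then have e: "(a x)(n := 0) = a x" by (simp add: fun_eq_iff)
  have "(a x)(n := b x) \<in> topspace (Euclidean_space (Suc n))"
    using top[of x] x W(2) by (auto simp: topspace_Euclidean_space)
  then show "(a x)(n := b x) \<in> {x \<in> topspace (Euclidean_space (Suc n)). x(n := 0) \<in> V \<and> x n \<in> I01}"
    using V[OF x] e by simp
  show "p (a x) (b x) = p (((a x)(n := b x))(n := 0)) (((a x)(n := b x)) n)" using e by simp
qed

lemma spoke_curve:
  assumes M: "locally_euclidean M" and p: "plot (path_dspace M) n (cube n a \<rho>) p" and a: "a \<in> topspace (Euclidean_space n)"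
    and u: "u \<in> cube n a \<rho>" and s: "s \<in> I01"
  shows "smooth_curve M (\<lambda>r. p (spoke a u r) s)"
  unfolding smooth_curve_def
proof (rule plot_path_smooth_from[OF M p openin_topspace])
  have "u \<in> topspace (Euclidean_space n)" using u by (simp add: cube_def)
  then show "smooth_eucl 1 (topspace (Euclidean_space 1)) n (\<lambda>x. spoke a u (x 0))"
    unfolding smooth_eucl_iff spoke_def using a
    by (auto simp: topspace_Euclidean_space[of n] intro!: smooth_fn_intros)
  show "smooth_fn 1 (topspace (Euclidean_space 1)) (\<lambda>x. s)" by (rule smooth_fn_const)
qed (use spoke_in_cube[OF a u] s in auto)

text \<open>The loop at \<open>p a t\<close> which runs out along the spoke to \<open>u\<close>, then from \<open>t\<close> to \<open>t'\<close> along \<open>p u\<close>,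
  and back along the spoke and the path \<open>p a\<close>.\<close>

definition spoke_loop :: "((nat \<Rightarrow> real) \<Rightarrow> real \<Rightarrow> 'm) \<Rightarrow> (nat \<Rightarrow> real) \<Rightarrow> real \<Rightarrow> real \<Rightarrow> (nat \<Rightarrow> real) \<Rightarrow> real \<Rightarrow> 'm" where
  "spoke_loop p a t t' u = concat_path (arc (p a) t' t) (concat_path (arc (\<lambda>r. p (spoke a u r) t') 1 0)
     (concat_path (arc (p u) t t') (arc (\<lambda>r. p (spoke a u r) t) 0 1)))"

text \<open>The nested concatenation puts the four legs on the intervals between 0, 1/8, 1/4, 1/2
  and 1. The steps drive, in this order, the way out, the move to \<open>t'\<close>, the way back
  and the return to \<open>t\<close>; each has reached 1 before the next starts, so one formula
  describes all legs.\<close>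

lemma spoke_loop_eq:
  assumes s: "s \<in> I01"
  shows "spoke_loop p a t t' u s = p (spoke a u (step (8 * s) - step (4 * s - 1))) (t + (step (8 * s - 1) - step (2 * s - 1)) * (t' - t))"
proof -
  consider "s \<le> 1/8" | "1/8 < s" "s \<le> 1/4" | "1/4 < s" "s \<le> 1/2" | "1/2 < s" by linarith
  then show ?thesis
  proof cases
    case 4
    have "t' + step (2 * s - 1) * (t - t') = t + (1 - step (2 * s - 1)) * (t' - t)" by (simp add: algebra_simps)
    then show ?thesis using 4 s by (simp add: spoke_loop_def concat_path_simps arc_eq)
  qed (use s in \<open>simp_all add: spoke_loop_def concat_path_simps arc_eq\<close>)
qed

lemma spoke_loop_paths:
  assumes M: "locally_euclidean M" and p: "plot (path_dspace M) n (cube n a \<rho>) p" and a: "a \<in> cube n a \<rho>"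
    and U: "openin (mtop M) U" and t: "t \<in> I01" "t' \<in> I01"
    and pU: "\<forall>u\<in>cube n a \<rho>. \<forall>s\<in>closed_segment t t'. p u s \<in> U" and u: "u \<in> cube n a \<rho>"
  shows "arc (p u) t t' \<in> paths (open_sub M U)" "arc (p u) t' t \<in> paths (open_sub M U)"
    "s \<in> {t, t'} \<Longrightarrow> x \<in> I01 \<Longrightarrow> y \<in> I01 \<Longrightarrow> arc (\<lambda>r. p (spoke a u r) s) x y \<in> paths (open_sub M U)"
    "spoke_loop p a t t' u \<in> paths (open_sub M U)"
proof -
  have a': "a \<in> topspace (Euclidean_space n)" using a by (simp add: cube_def)
  have seg: "closed_segment t t' \<subseteq> I01" using t by (intro closed_segment_subset) auto
  have arcs: "arc (p u) t t' \<in> paths (open_sub M U)" "arc (p u) t' t \<in> paths (open_sub M U)" if u: "u \<in> cube n a \<rho>" for u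
  proof -
    have "p u \<in> paths M" using p u by (auto simp: path_dspace_def)
    note * = arc_in_paths_open_sub[OF M path_smooth[OF this] U convex_closed_segment seg bspec[OF bspec[OF pU u]]]
    show "arc (p u) t t' \<in> paths (open_sub M U)" "arc (p u) t' t \<in> paths (open_sub M U)"
      by (rule *; simp)+
  qed
  from arcs[OF u] show "arc (p u) t t' \<in> paths (open_sub M U)" "arc (p u) t' t \<in> paths (open_sub M U)" .
  have spokes: "arc (\<lambda>r. p (spoke a u r) s) x y \<in> paths (open_sub M U)" if s: "s \<in> {t, t'}" and xy: "x \<in> I01" "y \<in> I01" for s x y
  proof (rule arc_in_paths_open_sub[OF M spoke_curve[OF M p a' u] U, where J = I01])
    fix r :: real assume "r \<in> I01"
    then show "p (spoke a u r) s \<in> U" using bspec[OF pU spoke_in_cube[OF a' u]] s by auto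
  qed (use s t xy in auto)
  then show "s \<in> {t, t'} \<Longrightarrow> x \<in> I01 \<Longrightarrow> y \<in> I01 \<Longrightarrow> arc (\<lambda>r. p (spoke a u r) s) x y \<in> paths (open_sub M U)" .
  note MU = locally_euclidean_open_sub[OF M U]
  show "spoke_loop p a t t' u \<in> paths (open_sub M U)"
    unfolding spoke_loop_def
    by (intro concat_path_in_paths[OF MU] arcs spokes u a) (simp_all add: concat_path_simps)
qed

text \<open>The closed formula is smooth in the parameter and the time jointly. The loop stays in
  \<open>U\<close> because the cube contains the spokes from its centre and only times between
  \<open>t\<close> and \<open>t'\<close> occur.\<close>

lemma plot_spoke_loop:
  assumes M: "locally_euclidean M" and p: "plot (path_dspace M) n (cube n a \<rho>) p" and a: "a \<in> cube n a \<rho>"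
    and U: "openin (mtop M) U" and t: "t \<in> I01" "t' \<in> I01"
    and pU: "\<forall>u\<in>cube n a \<rho>. \<forall>s\<in>closed_segment t t'. p u s \<in> U"
  shows "plot (path_dspace (open_sub M U)) n (cube n a \<rho>) (spoke_loop p a t t')"
proof -
  let ?A = "{x \<in> topspace (Euclidean_space (Suc n)). x(n := 0) \<in> cube n a \<rho> \<and> x n \<in> I01}"
  let ?T = "topspace (Euclidean_space (Suc n))"
  let ?\<beta> = "\<lambda>s. step (8 * s) - step (4 * s - 1)" and ?\<tau> = "\<lambda>s. t + (step (8 * s - 1) - step (2 * s - 1)) * (t' - t)"
  have a': "a \<in> topspace (Euclidean_space n)" using a by (simp add: cube_def)
  \<comment> \<open>Where the subtracted step is not 0 the first one already equals 1, so the
    difference never leaves the unit interval; the same holds for the times below.\<close>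
  have \<beta>: "?\<beta> s \<in> I01" for s
    using step_nonneg[of "8 * s"] step_le_1[of "8 * s"] step_nonneg[of "4 * s - 1"] step_le_1[of "4 * s - 1"]
    by (cases "4 * s - 1 \<le> 0") (auto)
  have \<tau>: "?\<tau> s \<in> closed_segment t t'" for s
  proof -
    have "step (8 * s - 1) - step (2 * s - 1) \<in> I01"
      using step_nonneg[of "8 * s - 1"] step_le_1[of "8 * s - 1"] step_nonneg[of "2 * s - 1"] step_le_1[of "2 * s - 1"]
      by (cases "2 * s - 1 \<le> 0") auto
    then show ?thesis unfolding in_segment by (intro exI[of _ "step (8 * s - 1) - step (2 * s - 1)"]) (auto simp: algebra_simps)
  qed
  have seg: "closed_segment t t' \<subseteq> I01" using t by (intro closed_segment_subset) auto
  have "smooth_from (Suc n) ?A M (\<lambda>x. p (spoke a (x(n := 0)) (?\<beta> (x n))) (?\<tau> (x n)))"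
  proof (rule plot_path_smooth_from[OF M p openin_topspace])
    show "smooth_eucl (Suc n) ?T n (\<lambda>x. spoke a (x(n := 0)) (?\<beta> (x n)))"
      unfolding smooth_eucl_iff
    proof (intro conjI allI impI)
      show "(\<lambda>x. spoke a (x(n := 0)) (?\<beta> (x n))) ` ?T \<subseteq> topspace (Euclidean_space n)"
        using a' by (auto simp: spoke_def topspace_Euclidean_space)
      fix j assume "j < n"
      then show "smooth_fn (Suc n) ?T (\<lambda>x. spoke a (x(n := 0)) (?\<beta> (x n)) j)"
        unfolding spoke_def by (auto intro!: smooth_fn_intros)
    qed
    show "smooth_fn (Suc n) ?T (\<lambda>x. ?\<tau> (x n))" by (auto intro!: smooth_fn_intros)
    fix x assume "x \<in> ?A"
    then show "spoke a (x(n := 0)) (?\<beta> (x n)) \<in> cube n a \<rho>" by (intro spoke_in_cube[OF a' _ \<beta>]) simp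
    show "?\<tau> (x n) \<in> I01" using \<tau> seg by blast
  qed auto
  then have "smooth_from (Suc n) ?A (open_sub M U) (\<lambda>x. p (spoke a (x(n := 0)) (?\<beta> (x n))) (?\<tau> (x n)))"
    by (rule smooth_from_corestrict[OF _ U]) (intro pU[rule_format] \<tau> spoke_in_cube[OF a' _ \<beta>], simp)
  then have "smooth_from (Suc n) ?A (open_sub M U) (\<lambda>x. spoke_loop p a t t' (x(n := 0)) (x n))"
    by (rule smooth_from_cong) (simp add: spoke_loop_eq)
  then show ?thesis
    using spoke_loop_paths(4)[OF M p a U t pU] openin_cube by (auto simp: path_dspace_def)
qed

context lie_group_torsors
begin

text \<open>When the value on the spoke loop is composed with the old family, the spoke at time
  \<open>t\<close> cancels, leaving the new family followed by transport along \<open>p a\<close>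
  from \<open>t'\<close> back to \<open>t\<close>. That last factor does not depend on the
  parameter, so the new family is a smooth family of loop values applied to the old one, corrected
  by a constant inverse.\<close>

lemma smooth_family_transport_step:
  assumes M: "locally_euclidean M" and F: "is_functor (Pi_thin M) (Tors G) F"
    and p: "plot (path_dspace M) n (cube n a \<rho>) p" and a: "a \<in> cube n a \<rho>"
    and U: "openin (mtop M) U" and t: "t \<in> I01" "t' \<in> I01"
    and pU: "\<forall>u\<in>cube n a \<rho>. \<forall>s\<in>closed_segment t t'. p u s \<in> U"
    and loc: "\<And>n V q. plot (path_dspace (open_sub M U)) n V q \<Longrightarrow> (\<forall>u\<in>V. q u 0 = p a t \<and> q u 1 = p a t) \<Longrightarrow>
      smooth_family n V (fobj F (p a t)) (fobj F (p a t)) (\<lambda>u. farr F (cls M (q u)))"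
    and y: "\<And>u. u \<in> cube n a \<rho> \<Longrightarrow> p u 0 = y"
    and ih: "smooth_family n (cube n a \<rho>) (fobj F y) (fobj F (p a t))
      (\<lambda>u. Comp (Tors G) (farr F (cls M (arc (\<lambda>r. p (spoke a u r) t) 1 0))) (farr F (cls M (arc (p u) 0 t))))"
  shows "smooth_family n (cube n a \<rho>) (fobj F y) (fobj F (p a t'))
      (\<lambda>u. Comp (Tors G) (farr F (cls M (arc (\<lambda>r. p (spoke a u r) t') 1 0))) (farr F (cls M (arc (p u) 0 t'))))"
proof -
  let ?f = "\<lambda>\<gamma>. farr F (cls M \<gamma>)" and ?T = "Tors G"
  let ?b = "arc (p a) t' t"
  note P = spoke_loop_paths[OF M p a U t pU]
  have paths_sub: "\<gamma> \<in> paths M" if "\<gamma> \<in> paths (open_sub M U)" for \<gamma> using that paths_open_sub[OF M U] by blast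
  have a': "a \<in> topspace (Euclidean_space n)" using a by (simp add: cube_def)
  have b: "?b \<in> paths M" by (rule paths_sub[OF P(2)[OF a]])
  have fb: "?f ?b \<in> homs ?T (fobj F (p a t')) (fobj F (p a t))"
    using functor_homs[OF M F b] by simp
  have tors: "is_torsor G (fobj F (p a t))" using homs_Tors(2)[OF fb] .
  have "smooth_family n (cube n a \<rho>) (fobj F (p a t)) (fobj F (p a t)) (\<lambda>u. ?f (spoke_loop p a t t' u))"
    by (rule loc[OF plot_spoke_loop[OF M p a U t pU]]) (auto simp: spoke_loop_def concat_path_simps)
  from smooth_family_comp[OF openin_cube ih this tors]
  have "smooth_family n (cube n a \<rho>) (fobj F y) (fobj F (p a t))
     (\<lambda>u. Comp ?T (?f (spoke_loop p a t t' u)) (Comp ?T (?f (arc (\<lambda>r. p (spoke a u r) t) 1 0)) (?f (arc (p u) 0 t))))" .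
  from smooth_family_comp[OF openin_cube this smooth_family_const[OF openin_cube Tors.arr_inv(1)[OF fb]] tors]
  show ?thesis
  proof (rule smooth_family_cong[OF openin_cube])
    fix u assume u: "u \<in> cube n a \<rho>"
    have pu: "p u \<in> paths M" using p u by (auto simp: path_dspace_def)
    let ?s = "\<lambda>s. \<lambda>r. p (spoke a u r) s"
    have s10: "arc (?s s) 1 0 \<in> paths M" "arc (?s s) 0 1 \<in> paths M" if "s \<in> {t, t'}" for s
      by (rule paths_sub, rule P(3)[OF u that]; simp)+
    have tt: "arc (p u) t t' \<in> paths M" "arc (p u) 0 t \<in> paths M" "arc (p u) 0 t' \<in> paths M"
      using arc_in_paths[OF M path_smooth[OF pu]] t by auto
    have h: "?f (arc (?s t) 1 0) \<in> homs ?T (fobj F (p u t)) (fobj F (p a t))" "?f (arc (?s t') 1 0) \<in> homs ?T (fobj F (p u t')) (fobj F (p a t'))"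
      "?f (arc (?s t) 0 1) \<in> homs ?T (fobj F (p a t)) (fobj F (p u t))"
      "?f (arc (p u) t t') \<in> homs ?T (fobj F (p u t)) (fobj F (p u t'))" "?f (arc (p u) 0 t) \<in> homs ?T (fobj F (p u 0)) (fobj F (p u t))"
      using functor_homs[OF M F s10(1)[of t]] functor_homs[OF M F s10(1)[of t']] functor_homs[OF M F s10(2)[of t]]
        functor_homs[OF M F tt(1)] functor_homs[OF M F tt(2)] by simp_all
    have F_comp: "?f \<gamma> = Comp ?T (?f \<gamma>2) (?f \<gamma>1)"
      if "cls M \<gamma> = Comp (Pi_thin M) (cls M \<gamma>2) (cls M \<gamma>1)" "\<gamma>2 \<in> paths M" "\<gamma>1 \<in> paths M" "\<gamma>1 1 = \<gamma>2 0" for \<gamma> \<gamma>1 \<gamma>2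
      using functor_concat[OF M F that(2-4)] Comp_cls[OF M that(2-4)] that(1) by simp
    have sp: "smooth_curve M (?s s)" if "s \<in> I01" for s by (rule spoke_curve[OF M p a' u that])
    \<comment> \<open>The spoke run through inward and then outward is an arc from 1 to 1 on the
      spoke, that is, a constant path.\<close>
    have return: "Comp ?T (?f (arc (?s t) 0 1)) (?f (arc (?s t) 1 0)) = Ident ?T (fobj F (p u t))"
    proof -
      have "Comp ?T (?f (arc (?s t) 0 1)) (?f (arc (?s t) 1 0)) = ?f (arc (?s t) 1 1)"
        by (rule F_comp[symmetric]) (use Comp_arc[OF M sp[OF t(1)], of 1 0 1] s10 in auto)
      also have "arc (?s t) 1 1 = (\<lambda>r\<in>I01. p u t)" unfolding arc_const by simp
      also have "?f \<dots> = Ident ?T (fobj F (p u t))" by (rule functor_const[OF F path_pts[OF pu t(1)]])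
      finally show ?thesis .
    qed
    have fwd: "?f (arc (p u) 0 t') = Comp ?T (?f (arc (p u) t t')) (?f (arc (p u) 0 t))"
      by (rule F_comp) (use Comp_arc[OF M path_smooth[OF pu], of 0 t t'] t tt in auto)
    let ?x = "?f (arc (p u) 0 t)"
    note cc = concat_path_in_paths[OF M] and fc = functor_concat[OF M F]
    have "?f (spoke_loop p a t t' u) = Comp ?T (?f ?b) (Comp ?T (?f (arc (?s t') 1 0)) (Comp ?T (?f (arc (p u) t t')) (?f (arc (?s t) 0 1))))"
      unfolding spoke_loop_def
      using fc[OF tt(1) s10(2)[of t]] fc[OF s10(1)[of t'] cc[OF tt(1) s10(2)[of t]]]
        fc[OF b cc[OF s10(1)[of t'] cc[OF tt(1) s10(2)[of t]]]] by (simp add: concat_path_simps)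
    note loop = this
    let ?A = "?f (arc (?s t') 1 0)" and ?B = "?f (arc (p u) t t')" and ?C = "?f (arc (?s t) 0 1)" and ?D = "?f (arc (?s t) 1 0)"
    note ch = Tors.comp_homs and as = Tors.homs_assoc
    have "Comp ?T (?f (spoke_loop p a t t' u)) (Comp ?T ?D ?x) = Comp ?T (?f ?b) (Comp ?T ?A (Comp ?T ?B (Comp ?T ?C (Comp ?T ?D ?x))))"
      unfolding loop
      by (simp only: as[OF fb ch[OF h(2) ch[OF h(4,3)]] ch[OF h(1,5)]] as[OF h(2) ch[OF h(4,3)] ch[OF h(1,5)]] as[OF h(4,3) ch[OF h(1,5)]])
    also have "Comp ?T ?C (Comp ?T ?D ?x) = ?x"
      using as[OF h(3,1,5)] return Tors.comp_ident_homs(2)[OF h(5)] by (simp only:)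
    finally have "Comp ?T (?f (spoke_loop p a t t' u)) (Comp ?T ?D ?x) = Comp ?T (?f ?b) (Comp ?T ?A (?f (arc (p u) 0 t')))"
      by (simp only: fwd)
    then show "Comp ?T (arr_inv ?T (?f ?b)) (Comp ?T (?f (spoke_loop p a t t' u)) (Comp ?T ?D ?x)) = Comp ?T ?A (?f (arc (p u) 0 t'))"
      using Tors.inv_comp_cancel[OF fb ch[OF h(2) ch[OF h(4,5)]]] by (simp only: fwd)
  qed
qed

text \<open>Smoothness around a parameter \<open>a\<close> is spread along time. The family carried
  along is transport up to \<open>t\<close> followed by the return to \<open>p a t\<close> along the
  spoke: it is trivial at \<open>t = 0\<close> and, since the ends of the loops are fixed, equals
  the wanted transport at \<open>t = 1\<close>.\<close>

lemma transport_functor_local: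
  assumes M: "locally_euclidean M" and cover: "open_cover M \<U>" and F: "is_functor (Pi_thin M) (Tors G) F"
    and loc: "\<And>U x n V p. U \<in> \<U> \<Longrightarrow> x \<in> U \<Longrightarrow> plot (path_dspace (open_sub M U)) n V p \<Longrightarrow>
      (\<forall>u\<in>V. p u 0 = x \<and> p u 1 = x) \<Longrightarrow> smooth_family n V (fobj F x) (fobj F x) (\<lambda>u. farr F (cls M (p u)))"
  shows "transport_functor G M F"
  unfolding transport_functor_iff[OF M]
proof (intro conjI F ballI allI impI)
  let ?f = "\<lambda>\<gamma>. farr F (cls M \<gamma>)"
  fix x n V p assume x: "x \<in> pts M" and p: "plot (path_dspace M) n V p" and loop: "\<forall>u\<in>V. p u 0 = x \<and> p u 1 = x"
  have V: "openin (Euclidean_space n) V" and pp: "\<And>u. u \<in> V \<Longrightarrow> p u \<in> paths M" using p by (auto simp: path_dspace_def)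
  show "smooth_family n V (fobj F x) (fobj F x) (\<lambda>u. ?f (p u))"
  proof (rule smooth_family_local[OF V])
    fix a assume aV: "a \<in> V"
    have a: "a \<in> topspace (Euclidean_space n)" using aV openin_subset[OF V] by blast
    obtain \<rho>0 where \<rho>0: "\<rho>0 > 0" "cube n a \<rho>0 \<subseteq> V"
    proof -
      obtain r where "r > 0" "\<And>y. y \<in> topspace (Euclidean_space n) \<Longrightarrow> (\<And>i. i < n \<Longrightarrow> \<bar>y i - a i\<bar> < r) \<Longrightarrow> y \<in> V"
        using openin_Euclidean_box[OF V aV] by blast
      then show ?thesis by (intro that[of r]) (auto simp: cube_def)
    qed
    have mono: "cube n a r \<subseteq> cube n a r'" if "r \<le> r'" for r r' using that by (force simp: cube_def)
    let ?W = "\<lambda>t u. Comp (Tors G) (?f (arc (\<lambda>r. p (spoke a u r) t) 1 0)) (?f (arc (p u) 0 t))"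
    \<comment> \<open>The cube may shrink from one time to the next, so its radius is quantified
      inside the property; \<open>\<rho>0\<close> only keeps it within \<open>V\<close>.\<close>
    define Sm where "Sm t \<longleftrightarrow> (\<exists>\<rho>>0. \<rho> \<le> \<rho>0 \<and> smooth_family n (cube n a \<rho>) (fobj F x) (fobj F (p a t)) (?W t))" for t
    \<comment> \<open>At times 0 and 1 all loops of the plot are at \<open>x\<close>, so the return
      along the spoke is a constant path.\<close>
    have end_W: "?W t u = ?f (arc (p u) 0 t)" if t: "t \<in> {0, 1}" and u: "u \<in> cube n a \<rho>0" for t u
    proof -
      have "arc (\<lambda>r. p (spoke a u r) t) 1 0 = (\<lambda>r\<in>I01. x)"
        unfolding arc_eq
      proof (rule restrict_ext)
        fix r :: real assume "r \<in> I01"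
        have "spoke a u (1 + step r * (0 - 1)) \<in> cube n a \<rho>0"
          by (rule spoke_in_cube[OF a u]) (use step_nonneg[of r] step_le_1[of r] in auto)
        then show "p (spoke a u (1 + step r * (0 - 1))) t = x" using \<rho>0(2) loop t by auto
      qed
      moreover have "?f (arc (p u) 0 t) \<in> homs (Tors G) (fobj F x) (fobj F x)"
        using functor_homs[OF M F arc_in_paths[OF M path_smooth[OF pp], of u 0 t]] u t \<rho>0(2) loop by auto
      ultimately show ?thesis using functor_const[OF F x] Tors.comp_ident_homs(2) by metis
    qed
    have "Sm 1"
    proof (rule I01_induct[where P = Sm])
      show "(1::real) \<in> I01" by simp
      have "smooth_family n (cube n a \<rho>0) (fobj F x) (fobj F x) (\<lambda>u. Ident (Tors G) (fobj F x))"
        by (rule smooth_family_const[OF openin_cube Tors.ident_homs[OF functor_Obj[OF F x]]])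
      then have "smooth_family n (cube n a \<rho>0) (fobj F x) (fobj F x) (?W 0)"
      proof (rule smooth_family_cong[OF openin_cube])
        fix u assume u: "u \<in> cube n a \<rho>0"
        have "arc (p u) 0 0 = (\<lambda>r\<in>I01. x)" unfolding arc_const using u \<rho>0(2) loop by auto
        then show "Ident (Tors G) (fobj F x) = ?W 0 u" using end_W[of 0 u] u functor_const[OF F x] by simp
      qed
      then show "Sm 0" using \<rho>0 loop aV by (auto simp: Sm_def)
    next
      fix t0 :: real assume t0: "t0 \<in> I01"
      have pa: "p a t0 \<in> pts M" by (rule path_pts[OF pp[OF aV] t0])
      then obtain U where U: "U \<in> \<U>" "p a t0 \<in> U" "openin (mtop M) U" using cover by (auto simp: open_cover_def)
      let ?A = "{x \<in> topspace (Euclidean_space (Suc n)). x(n := 0) \<in> V \<and> x n \<in> I01}"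
      have sm: "smooth_from (Suc n) ?A M (\<lambda>x. p (x(n := 0)) (x n))" using p by (simp add: path_dspace_def)
      have an: "y(n := 0) = y" if "y \<in> topspace (Euclidean_space n)" for y using that by (auto simp: topspace_Euclidean_space fun_eq_iff)
      have at0: "a(n := t0) \<in> ?A" using a aV t0 an[OF a] by (auto simp: topspace_Euclidean_space)
      have "p ((a(n := t0))(n := 0)) ((a(n := t0)) n) \<in> U" using U(2) an[OF a] by simp
      from smooth_from_nhd[OF sm at0 U(3) this] obtain W where W: "openin (Euclidean_space (Suc n)) W" "a(n := t0) \<in> W"
        "\<And>y. y \<in> ?A \<Longrightarrow> y \<in> W \<Longrightarrow> p (y(n := 0)) (y n) \<in> U" by blast
      obtain r where r: "r > 0" "\<And>y. y \<in> topspace (Euclidean_space (Suc n)) \<Longrightarrow> (\<And>i. i < Suc n \<Longrightarrow> \<bar>y i - (a(n := t0)) i\<bar> < r) \<Longrightarrow> y \<in> W"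
        using openin_Euclidean_box[OF W(1,2)] by blast
      \<comment> \<open>Joint continuity in parameter and time: one radius serves for all parameters
        in the cube and all times near \<open>t0\<close>.\<close>
      have pU: "p u s \<in> U" if u: "u \<in> cube n a r" "u \<in> V" and s: "s \<in> I01" "\<bar>s - t0\<bar> < r" for u s
      proof -
        have u': "u \<in> topspace (Euclidean_space n)" using u by (simp add: cube_def)
        have top: "u(n := s) \<in> topspace (Euclidean_space (Suc n))" using u' by (auto simp: topspace_Euclidean_space)
        have "u(n := s) \<in> W" by (rule r(2)[OF top]) (use u s in \<open>auto simp: cube_def less_Suc_eq\<close>)
        moreover have "u(n := s) \<in> ?A" using top u s an[OF u'] by simp
        ultimately show ?thesis using W(3)[of "u(n := s)"] an[OF u'] by simp
      qed
      show "\<exists>r>0. \<forall>t\<in>I01. \<forall>t'\<in>I01. \<bar>t - t0\<bar> < r \<longrightarrow> \<bar>t' - t0\<bar> < r \<longrightarrow> Sm t \<longrightarrow> Sm t'"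
      proof (rule exI[of _ r], intro conjI r(1) ballI impI)
        fix t t' :: real assume t: "t \<in> I01" "t' \<in> I01" and d: "\<bar>t - t0\<bar> < r" "\<bar>t' - t0\<bar> < r" and "Sm t"
        then obtain \<rho>1 where \<rho>1: "\<rho>1 > 0" "\<rho>1 \<le> \<rho>0" "smooth_family n (cube n a \<rho>1) (fobj F x) (fobj F (p a t)) (?W t)"
          by (auto simp: Sm_def)
        define \<rho> where "\<rho> = min \<rho>1 r"
        have le: "\<rho> \<le> \<rho>1" "\<rho> \<le> r" "\<rho> \<le> \<rho>0" using \<rho>1(2) by (auto simp: \<rho>_def)
        have \<rho>: "\<rho> > 0" "\<rho> \<le> \<rho>0" "cube n a \<rho> \<subseteq> cube n a \<rho>1" "cube n a \<rho> \<subseteq> cube n a r" "cube n a \<rho> \<subseteq> V"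
          using \<rho>1(1) r(1) mono[OF le(1)] mono[OF le(2)] mono[OF le(3)] \<rho>0(2) le(3) by (auto simp: \<rho>_def)
        have seg: "closed_segment t t' \<subseteq> I01 \<inter> {s. \<bar>s - t0\<bar> < r}"
          by (rule closed_segment_subset[OF _ _ convex_I01_ball]) (use t d in auto)
        have "smooth_family n (cube n a \<rho>) (fobj F x) (fobj F (p a t')) (?W t')"
        proof (rule smooth_family_transport_step[OF M F plot_path_subset[OF p openin_cube \<rho>(5)] cube_center[OF a \<rho>(1)] U(3) t])
          show "\<forall>u\<in>cube n a \<rho>. \<forall>s\<in>closed_segment t t'. p u s \<in> U" using pU \<rho>(4,5) seg by blast
        next
          fix m V q assume "plot (path_dspace (open_sub M U)) m V q" "\<forall>u\<in>V. q u 0 = p a t \<and> q u 1 = p a t"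
          moreover have "p a t \<in> U" using pU[of a t] cube_center[OF a r(1)] aV t d by blast
          ultimately show "smooth_family m V (fobj F (p a t)) (fobj F (p a t)) (\<lambda>u. ?f (q u))" using loc[OF U(1)] by blast
        next
          fix u assume "u \<in> cube n a \<rho>" then show "p u 0 = x" using \<rho>(5) loop by blast
        qed (rule smooth_family_subset[OF \<rho>1(3) \<rho>(3)])
        then show "Sm t'" using \<rho>(1,2) by (auto simp: Sm_def)
      qed
    qed
    then obtain \<rho> where \<rho>: "\<rho> > 0" "\<rho> \<le> \<rho>0" "smooth_family n (cube n a \<rho>) (fobj F x) (fobj F x) (?W 1)"
      using loop aV by (auto simp: Sm_def)
    have "smooth_family n (cube n a \<rho>) (fobj F x) (fobj F x) (\<lambda>u. ?f (p u))"
    proof (rule smooth_family_cong[OF openin_cube \<rho>(3)])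
      fix u assume "u \<in> cube n a \<rho>"
      then have u: "u \<in> cube n a \<rho>0" using mono[OF \<rho>(2)] by blast
      then have "p u \<in> paths M" using \<rho>0(2) pp by blast
      from cls_arc[OF M this] end_W[of 1 u] u show "?W 1 u = ?f (p u)" by simp
    qed
    then show "\<exists>W. openin (Euclidean_space n) W \<and> a \<in> W \<and> W \<subseteq> V \<and> smooth_family n W (fobj F x) (fobj F x) (\<lambda>u. ?f (p u))"
      using mono[OF \<rho>(2)] \<rho>0(2) by (intro exI[of _ "cube n a \<rho>"] conjI openin_cube cube_center[OF a \<rho>(1)]) auto
  qed
qed

end

section \<open>The fibered category of transport functors\<close>

lemma Obj_Man [simp]: "M \<in> Obj Man \<longleftrightarrow> manifold M"
  by (simp add: Man_def)

lemma Arr_Man: "(N, f, M) \<in> Arr Man \<longleftrightarrow> manifold N \<and> manifold M \<and> f \<in> extensional (pts N) \<and> smooth_map N M f"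
  by (simp add: Man_def)

lemma Man_simps [simp]: "Dom Man (N, f, M) = N" "Cod Man (N, f, M) = M" "Ident Man M = (M, \<lambda>x\<in>pts M. x, M)"
  "Comp Man (M', g, L) (N, f, M) = (N, compose (pts N) g f, L)"
  by (simp_all add: Man_def)

lemma smooth_map_compose_restrict:
  assumes M: "locally_euclidean M" and N: "locally_euclidean N" and L: "locally_euclidean L"
    and f: "smooth_map M N f" and g: "smooth_map N L g"
  shows "smooth_map M L (compose (pts M) g f)"
  by (rule smooth_map_cong[OF M L smooth_map_compose[OF M N L f g]]) (simp add: compose_def)

lemma smooth_map_restrict_id: "locally_euclidean M \<Longrightarrow> smooth_map M M (\<lambda>x\<in>pts M. x)"
  by (rule smooth_map_cong[OF _ _ smooth_map_id]) auto

lemma category_Man: "category Man"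
proof
  fix a :: "'m man_arr" assume a: "a \<in> Arr Man"
  obtain N f M where e: "a = (N, f, M)" by (cases a)
  note A = a[unfolded e Arr_Man]
  show "Dom Man a \<in> Obj Man" "Cod Man a \<in> Obj Man" using A by (simp_all add: e)
  have pts: "f x \<in> pts M" if "x \<in> pts N" for x using smooth_map_pts[of N M f x] A that by simp
  show "Comp Man a (Ident Man (Dom Man a)) = a" "Comp Man (Ident Man (Cod Man a)) a = a"
    using A pts by (auto simp: e compose_def extensional_def fun_eq_iff)
  fix b :: "'m man_arr" assume b: "b \<in> Arr Man" and ab: "Cod Man a = Dom Man b"
  obtain M' g L where "b = (M', g, L)" by (cases b)
  then have e': "b = (M, g, L)" using ab by (simp add: e)
  note B = b[unfolded e' Arr_Man]
  show "Comp Man b a \<in> Arr Man" "Dom Man (Comp Man b a) = Dom Man a" "Cod Man (Comp Man b a) = Cod Man b"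
    using A B smooth_map_compose_restrict[of N M L f g] manifold_locally_euclidean by (auto simp: e e' Arr_Man compose_def)
  fix c :: "'m man_arr" assume c: "c \<in> Arr Man" and bc: "Cod Man b = Dom Man c"
  obtain L' h P where "c = (L', h, P)" by (cases c)
  then have "c = (L, h, P)" using bc by (simp add: e')
  then show "Comp Man c (Comp Man b a) = Comp Man (Comp Man c b) a"
    using pts by (auto simp: e e' compose_def fun_eq_iff)
next
  fix M :: "'m mfd" assume "M \<in> Obj Man"
  then show "Ident Man M \<in> Arr Man" "Dom Man (Ident Man M) = M" "Cod Man (Ident Man M) = M"
    using smooth_map_restrict_id manifold_locally_euclidean by (auto simp: Arr_Man)
qed

context lie_group_torsors
begin

section \<open>The category of transport functors and its projection\<close>

abbreviation T :: "(('q, 'g) torsor, ('q, 'g) tors_arr) cat" where "T \<equiv> Tors G"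

abbreviation X :: "(('m, 'q, 'g) trans_obj, ('m, 'q, 'g) trans_arr) cat" where "X \<equiv> Trans G"

abbreviation \<pi> :: "(('m, 'q, 'g) trans_obj, ('m, 'q, 'g) trans_arr, 'm mfd, 'm man_arr) func" where "\<pi> \<equiv> Trans_proj G"

lemma Obj_Trans [simp]: "(M, F) \<in> Obj X \<longleftrightarrow> manifold M \<and> transport_functor G M F"
  by (simp add: Trans_def)

lemma Trans_simps [simp]: "Dom X (S, f, \<alpha>, S') = S" "Cod X (S, f, \<alpha>, S') = S'"
  "Ident X (M, F) = ((M, F), \<lambda>x\<in>pts M. x, \<lambda>x\<in>pts M. Ident T (fobj F x), (M, F))"
  "Comp X (S1, g, \<beta>, S') ((N, H), f, \<alpha>, S2) = ((N, H), compose (pts N) g f, \<lambda>x\<in>pts N. Comp T (\<beta> (f x)) (\<alpha> x), S')"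
  by (simp_all add: Trans_def)

text \<open>Invertibility of the components is automatic in a groupoid, and naturality can be tested
  on paths because every arrow of the thin groupoid is the class of one.\<close>

lemma natural_iso_iff:
  assumes N: "locally_euclidean N" and M: "locally_euclidean M" and f: "smooth_map N M f"
  shows "natural_iso (Pi_thin N) T H (func_comp (Pi_thin N) F (Pi_thin_map (N, f, M))) \<alpha> \<longleftrightarrow>
    \<alpha> \<in> extensional (pts N) \<and> (\<forall>x\<in>pts N. \<alpha> x \<in> homs T (fobj H x) (fobj F (f x))) \<and>
    (\<forall>\<gamma>\<in>paths N. Comp T (farr F (cls M (compose I01 f \<gamma>))) (\<alpha> (\<gamma> 0)) = Comp T (\<alpha> (\<gamma> 1)) (farr H (cls N \<gamma>)))"
proof -
  note fc = func_comp_Pi[OF N M f]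
  have nat: "(\<forall>a\<in>Arr (Pi_thin N). Comp T (farr (func_comp (Pi_thin N) F (Pi_thin_map (N, f, M))) a) (\<alpha> (Dom (Pi_thin N) a)) =
      Comp T (\<alpha> (Cod (Pi_thin N) a)) (farr H a)) \<longleftrightarrow>
    (\<forall>\<gamma>\<in>paths N. Comp T (farr F (cls M (compose I01 f \<gamma>))) (\<alpha> (\<gamma> 0)) = Comp T (\<alpha> (\<gamma> 1)) (farr H (cls N \<gamma>)))"
    by (simp add: Arr_Pi_thin fc(1) Dom_cls[OF N] Cod_cls[OF N])
  have "(\<alpha> \<in> Obj (Pi_thin N) \<rightarrow>\<^sub>E Arr T \<and> (\<forall>x\<in>Obj (Pi_thin N). Dom T (\<alpha> x) = fobj H x \<and>
      Cod T (\<alpha> x) = fobj (func_comp (Pi_thin N) F (Pi_thin_map (N, f, M))) x \<and> is_iso T (\<alpha> x))) \<longleftrightarrow>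
    \<alpha> \<in> extensional (pts N) \<and> (\<forall>x\<in>pts N. \<alpha> x \<in> homs T (fobj H x) (fobj F (f x)))"
  proof -
    have iso: "\<alpha> x \<in> Arr T \<Longrightarrow> is_iso T (\<alpha> x)" for x by (rule Tors.all_iso)
    have "fobj (func_comp (Pi_thin N) F (Pi_thin_map (N, f, M))) x = fobj F (f x)" if "x \<in> pts N" for x
      by (rule fc(2)[OF that])
    then show ?thesis using iso unfolding PiE_iff homs_iff Obj_Pi_thin by metis
  qed
  then show ?thesis unfolding natural_iso_def nat by blast
qed

lemma Arr_Trans:
  "((N, H), f, \<alpha>, (M, F)) \<in> Arr X \<longleftrightarrow> transport_functor G N H \<and> transport_functor G M F \<and> (N, f, M) \<in> Arr Man \<and>
    \<alpha> \<in> extensional (pts N) \<and> (\<forall>x\<in>pts N. \<alpha> x \<in> homs T (fobj H x) (fobj F (f x))) \<and>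
    (\<forall>\<gamma>\<in>paths N. Comp T (farr F (cls M (compose I01 f \<gamma>))) (\<alpha> (\<gamma> 0)) = Comp T (\<alpha> (\<gamma> 1)) (farr H (cls N \<gamma>)))"
proof (cases "(N, f, M) \<in> Arr Man")
  case True
  then show ?thesis using natural_iso_iff[of N M f] manifold_locally_euclidean by (auto simp: Trans_def Arr_Man)
qed (auto simp: Trans_def)

lemma Trans_proj_simps [simp]:
  "manifold M \<Longrightarrow> transport_functor G M F \<Longrightarrow> fobj \<pi> (M, F) = M"
  "((N, H), f, \<alpha>, (M, F)) \<in> Arr X \<Longrightarrow> farr \<pi> ((N, H), f, \<alpha>, (M, F)) = (N, f, M)"
  by (simp_all add: Trans_proj_def)

lemma Arr_TransE:
  assumes "a \<in> Arr X"
  obtains N H f \<alpha> M F where "a = ((N, H), f, \<alpha>, (M, F))" "transport_functor G N H" "transport_functor G M F" "(N, f, M) \<in> Arr Man"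
    "\<alpha> \<in> extensional (pts N)" "\<forall>x\<in>pts N. \<alpha> x \<in> homs T (fobj H x) (fobj F (f x))"
    "\<forall>\<gamma>\<in>paths N. Comp T (farr F (cls M (compose I01 f \<gamma>))) (\<alpha> (\<gamma> 0)) = Comp T (\<alpha> (\<gamma> 1)) (farr H (cls N \<gamma>))"
proof -
  obtain N H f \<alpha> M F where "a = ((N, H), f, \<alpha>, (M, F))" by (metis prod.exhaust_sel)
  then show ?thesis using assms that by (simp add: Arr_Trans)
qed

lemma transport_homs:
  assumes "locally_euclidean M" "transport_functor G M F" "\<gamma> \<in> paths M"
  shows "farr F (cls M \<gamma>) \<in> homs T (fobj F (\<gamma> 0)) (fobj F (\<gamma> 1))"
  using functor_homs assms unfolding transport_functor_def by blast

lemma transport_obj: "transport_functor G M F \<Longrightarrow> x \<in> pts M \<Longrightarrow> fobj F x \<in> Obj T"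
  unfolding transport_functor_def by (rule functor_Obj) auto

lemma compose_path_id: "\<gamma> \<in> paths M \<Longrightarrow> compose I01 (\<lambda>x\<in>pts M. x) \<gamma> = \<gamma>"
  using path_pts[of \<gamma> M] by (auto simp: compose_def paths_iff extensional_def fun_eq_iff)

lemma category_Trans: "category (X :: (('m, 'q, 'g) trans_obj, ('m, 'q, 'g) trans_arr) cat)"
proof
  fix a :: "('m, 'q, 'g) trans_arr" assume a: "a \<in> Arr X"
  obtain N H f \<alpha> M F where A0: "a = ((N, H), f, \<alpha>, (M, F))" "transport_functor G N H" "transport_functor G M F" "(N, f, M) \<in> Arr Man"
    "\<alpha> \<in> extensional (pts N)" "\<forall>x\<in>pts N. \<alpha> x \<in> homs T (fobj H x) (fobj F (f x))"
    "\<forall>\<gamma>\<in>paths N. Comp T (farr F (cls M (compose I01 f \<gamma>))) (\<alpha> (\<gamma> 0)) = Comp T (\<alpha> (\<gamma> 1)) (farr H (cls N \<gamma>))"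
    by (rule Arr_TransE[OF a])
  note A = A0[rule_format]
  note f = A(4)[unfolded Arr_Man]
  have N: "locally_euclidean N" and M: "locally_euclidean M" using f manifold_locally_euclidean by auto
  have pts: "f x \<in> pts M" if "x \<in> pts N" for x using smooth_map_pts[of N M f x] f that by simp
  show "Dom X a \<in> Obj X" "Cod X a \<in> Obj X" using A f by simp_all
  have fe: "f x = undefined" if "x \<notin> pts N" for x using f that by (auto simp: extensional_def)
  have \<alpha>e: "\<alpha> x = undefined" if "x \<notin> pts N" for x using A(5) that by (auto simp: extensional_def)
  show "Comp X a (Ident X (Dom X a)) = a"
    using Tors.comp_ident_homs(1)[OF A(6)] fe \<alpha>e by (auto simp: A(1) compose_def fun_eq_iff simp del: Ident_Tors)
  show "Comp X (Ident X (Cod X a)) a = a"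
    using Tors.comp_ident_homs(2)[OF A(6)] fe \<alpha>e pts by (auto simp: A(1) compose_def fun_eq_iff simp del: Ident_Tors)
  fix b :: "('m, 'q, 'g) trans_arr" assume b: "b \<in> Arr X" and ab: "Cod X a = Dom X b"
  obtain M' F' g \<beta> L K where B': "b = ((M', F'), g, \<beta>, (L, K))" "transport_functor G L K" "(M', g, L) \<in> Arr Man"
    "\<forall>x\<in>pts M'. \<beta> x \<in> homs T (fobj F' x) (fobj K (g x))"
    "\<forall>\<gamma>\<in>paths M'. Comp T (farr K (cls L (compose I01 g \<gamma>))) (\<beta> (\<gamma> 0)) = Comp T (\<beta> (\<gamma> 1)) (farr F' (cls M' \<gamma>))"
    by (rule Arr_TransE[OF b])
  have "M' = M" "F' = F" using ab by (simp_all add: A(1) B'(1))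
  note B = B'[unfolded this, rule_format]
  note g = B(3)[unfolded Arr_Man]
  have L: "locally_euclidean L" using g manifold_locally_euclidean by auto
  show "Dom X (Comp X b a) = Dom X a" "Cod X (Comp X b a) = Cod X b" by (simp_all add: A(1) B(1))
  show "Comp X b a \<in> Arr X"
    unfolding A(1) B(1) Trans_simps Arr_Trans
  proof (intro conjI ballI A(2) B(2))
    show "(N, compose (pts N) g f, L) \<in> Arr Man"
      using f g smooth_map_compose_restrict[OF N M L] by (auto simp: Arr_Man compose_def)
    fix x assume x: "x \<in> pts N"
    then show "(\<lambda>x\<in>pts N. Comp T (\<beta> (f x)) (\<alpha> x)) x \<in> homs T (fobj H x) (fobj K (compose (pts N) g f x))"
      using Tors.comp_homs[OF B(4)[OF pts[OF x]] A(6)[OF x]] by (simp add: compose_def)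
  next
    fix \<gamma> assume \<gamma>: "\<gamma> \<in> paths N"
    have i: "\<gamma> 0 \<in> pts N" "\<gamma> 1 \<in> pts N" using path_pts[OF \<gamma>] by simp_all
    let ?f\<gamma> = "compose I01 f \<gamma>"
    have f\<gamma>: "?f\<gamma> \<in> paths M" using compose_in_paths[OF N M _ \<gamma>] f by blast
    have gf\<gamma>: "compose I01 g ?f\<gamma> \<in> paths L" using compose_in_paths[OF M L _ f\<gamma>] g by blast
    have e: "compose I01 (compose (pts N) g f) \<gamma> = compose I01 g ?f\<gamma>"
      using path_pts[OF \<gamma>] by (auto simp: compose_def fun_eq_iff)
    have ends: "?f\<gamma> 0 = f (\<gamma> 0)" "?f\<gamma> 1 = f (\<gamma> 1)" "compose I01 g ?f\<gamma> 0 = g (f (\<gamma> 0))" "compose I01 g ?f\<gamma> 1 = g (f (\<gamma> 1))"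
      by (simp_all add: compose_def)
    note h1 = transport_homs[OF L B(2) gf\<gamma>, unfolded ends] and h2 = B(4)[OF pts[OF i(1)]] and h3 = A(6)[OF i(1)]
      and h4 = B(4)[OF pts[OF i(2)]] and h5 = A(6)[OF i(2)] and h6 = transport_homs[OF N A(2) \<gamma>]
      and h7 = transport_homs[OF M A(3) f\<gamma>, unfolded ends]
    have "Comp T (farr K (cls L (compose I01 g ?f\<gamma>))) (Comp T (\<beta> (f (\<gamma> 0))) (\<alpha> (\<gamma> 0))) =
        Comp T (Comp T (\<beta> (f (\<gamma> 1))) (farr F (cls M ?f\<gamma>))) (\<alpha> (\<gamma> 0))"
      using Tors.homs_assoc[OF h1 h2 h3] B(5)[OF f\<gamma>, unfolded ends] by (simp only:)
    also have "\<dots> = Comp T (\<beta> (f (\<gamma> 1))) (Comp T (\<alpha> (\<gamma> 1)) (farr H (cls N \<gamma>)))"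
      using Tors.homs_assoc[OF h4 h7 h3, symmetric] A(7)[OF \<gamma>] by (simp only:)
    also have "\<dots> = Comp T (Comp T (\<beta> (f (\<gamma> 1))) (\<alpha> (\<gamma> 1))) (farr H (cls N \<gamma>))"
      by (rule Tors.homs_assoc[OF h4 h5 h6])
    finally show "Comp T (farr K (cls L (compose I01 (compose (pts N) g f) \<gamma>))) ((\<lambda>x\<in>pts N. Comp T (\<beta> (f x)) (\<alpha> x)) (\<gamma> 0)) =
       Comp T ((\<lambda>x\<in>pts N. Comp T (\<beta> (f x)) (\<alpha> x)) (\<gamma> 1)) (farr H (cls N \<gamma>))"
      unfolding e using i by (simp only: restrict_apply if_True)
  qed simp
  fix c :: "('m, 'q, 'g) trans_arr" assume c: "c \<in> Arr X" and bc: "Cod X b = Dom X c"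
  obtain L' K' h \<delta> P J where C: "c = ((L', K'), h, \<delta>, (P, J))" "\<forall>x\<in>pts L'. \<delta> x \<in> homs T (fobj K' x) (fobj J (h x))"
    by (rule Arr_TransE[OF c])
  have "L' = L" "K' = K" using bc by (simp_all add: B(1) C(1))
  note C = C[unfolded this, rule_format]
  have "Comp T (\<delta> (g (f x))) (Comp T (\<beta> (f x)) (\<alpha> x)) = Comp T (Comp T (\<delta> (g (f x))) (\<beta> (f x))) (\<alpha> x)" if x: "x \<in> pts N" for x
    by (rule Tors.homs_assoc[OF C(2) B(4)[OF pts[OF x]] A(6)[OF x]]) (use smooth_map_pts[of M L g "f x"] g pts[OF x] in simp)
  then show "Comp X c (Comp X b a) = Comp X (Comp X c b) a"
    using pts by (auto simp: A(1) B(1) C(1) compose_def fun_eq_iff)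
next
  fix \<xi> :: "('m, 'q, 'g) trans_obj" assume "\<xi> \<in> Obj X"
  moreover obtain M F where e: "\<xi> = (M, F)" by (cases \<xi>)
  ultimately have F: "manifold M" "transport_functor G M F" by simp_all
  have M: "locally_euclidean M" by (rule manifold_locally_euclidean[OF F(1)])
  note id = Tors.ident_homs[OF transport_obj[OF F(2)]]
  show "Ident X \<xi> \<in> Arr X"
    unfolding e Trans_simps Arr_Trans
  proof (intro conjI ballI F(2))
    show "(M, \<lambda>x\<in>pts M. x, M) \<in> Arr Man" using F smooth_map_restrict_id[OF M] by (simp add: Arr_Man)
    fix \<gamma> assume \<gamma>: "\<gamma> \<in> paths M"
    have "\<gamma> 0 \<in> pts M" "\<gamma> 1 \<in> pts M" using path_pts[OF \<gamma>] by simp_all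
    then show "Comp T (farr F (cls M (compose I01 (\<lambda>x\<in>pts M. x) \<gamma>))) ((\<lambda>x\<in>pts M. Ident T (fobj F x)) (\<gamma> 0)) =
        Comp T ((\<lambda>x\<in>pts M. Ident T (fobj F x)) (\<gamma> 1)) (farr F (cls M \<gamma>))"
      using Tors.comp_ident_homs[OF transport_homs[OF M F(2) \<gamma>]] compose_path_id[OF \<gamma>] by (simp del: Ident_Tors)
  qed (use id in \<open>simp_all del: Ident_Tors\<close>)
  show "Dom X (Ident X \<xi>) = \<xi>" "Cod X (Ident X \<xi>) = \<xi>" by (simp_all add: e)
qed

definition nt :: "('m, 'q, 'g) trans_arr \<Rightarrow> 'm \<Rightarrow> ('q, 'g) tors_arr" where
  "nt a = fst (snd (snd a))"

lemma Trans_arr_eqI: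
  assumes "a \<in> Arr X" "b \<in> Arr X" "Dom X a = Dom X b" "Cod X a = Cod X b" "farr \<pi> a = farr \<pi> b"
    and "\<And>x. x \<in> pts (fst (Dom X a)) \<Longrightarrow> nt a x = nt b x"
  shows "a = b"
proof -
  obtain N H f \<alpha> M F where A: "a = ((N, H), f, \<alpha>, (M, F))" "\<alpha> \<in> extensional (pts N)" by (rule Arr_TransE[OF assms(1)])
  obtain N' H' f' \<alpha>' M' F' where B: "b = ((N', H'), f', \<alpha>', (M', F'))" "\<alpha>' \<in> extensional (pts N')" by (rule Arr_TransE[OF assms(2)])
  have e: "N' = N" "H' = H" "M' = M" "F' = F" using assms(3,4) by (simp_all add: A(1) B(1))
  have "f' = f" using assms(1,2,5) by (simp add: A(1) B(1) e)
  moreover have "\<alpha>' = \<alpha>" by (rule extensionalityI[OF B(2)[unfolded e] A(2)]) (use assms(6) in \<open>simp add: A(1) B(1) e nt_def\<close>)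
  ultimately show ?thesis by (simp add: A(1) B(1) e)
qed

lemma is_functor_Trans_proj: "is_functor (X :: (('m, 'q, 'g) trans_obj, ('m, 'q, 'g) trans_arr) cat) Man \<pi>"
  unfolding is_functor_def
proof (intro conjI category_Trans category_Man ballI impI)
  interpret XC: category "X :: (('m, 'q, 'g) trans_obj, ('m, 'q, 'g) trans_arr) cat" by (rule category_Trans)
  show "fobj \<pi> \<in> Obj X \<rightarrow>\<^sub>E Obj (Man :: ('m mfd, 'm man_arr) cat)" by (auto simp: Trans_proj_def)
  have mem: "farr \<pi> a \<in> Arr Man \<and> Dom Man (farr \<pi> a) = fobj \<pi> (Dom X a) \<and> Cod Man (farr \<pi> a) = fobj \<pi> (Cod X a)"
    if a: "a \<in> Arr X" for a :: "('m, 'q, 'g) trans_arr"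
  proof -
    obtain N H f \<alpha> M F where A: "a = ((N, H), f, \<alpha>, (M, F))" "transport_functor G N H" "transport_functor G M F" "(N, f, M) \<in> Arr Man"
      by (rule Arr_TransE[OF a])
    then show ?thesis using a by (auto simp: Arr_Man)
  qed
  show "farr \<pi> \<in> Arr (X :: (('m, 'q, 'g) trans_obj, ('m, 'q, 'g) trans_arr) cat) \<rightarrow>\<^sub>E Arr (Man :: ('m mfd, 'm man_arr) cat)"
    unfolding PiE_iff
  proof (intro conjI ballI)
    show "farr \<pi> \<in> extensional (Arr X)" by (simp add: Trans_proj_def)
  qed (rule mem[THEN conjunct1])
  fix a :: "('m, 'q, 'g) trans_arr" assume a: "a \<in> Arr X"
  then show "Dom Man (farr \<pi> a) = fobj \<pi> (Dom X a)" "Cod Man (farr \<pi> a) = fobj \<pi> (Cod X a)" using mem by auto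
  fix b :: "('m, 'q, 'g) trans_arr" assume b: "b \<in> Arr X" and ab: "Cod X a = Dom X b"
  note c = XC.Comp_Arr[OF a b ab]
  obtain N H f \<alpha> M F where A: "a = ((N, H), f, \<alpha>, (M, F))" by (rule Arr_TransE[OF a])
  obtain M' F' g \<beta> L K where B: "b = ((M', F'), g, \<beta>, (L, K))" by (rule Arr_TransE[OF b])
  show "farr \<pi> (Comp X b a) = Comp Man (farr \<pi> b) (farr \<pi> a)"
    using a b c by (simp add: A B)
next
  interpret XC: category "X :: (('m, 'q, 'g) trans_obj, ('m, 'q, 'g) trans_arr) cat" by (rule category_Trans)
  fix \<xi> :: "('m, 'q, 'g) trans_obj" assume \<xi>: "\<xi> \<in> Obj X"
  obtain M F where e: "\<xi> = (M, F)" by (cases \<xi>)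
  show "farr \<pi> (Ident X \<xi>) = Ident Man (fobj \<pi> \<xi>)" using XC.Ident_Arr[OF \<xi>] \<xi> by (simp add: e)
qed

text \<open>Composition with the induced functor is the pullback, and the arrow to the original
  object has identity components.\<close>

lemma Trans_pullback:
  assumes f: "(N, f, M) \<in> Arr Man" and F: "transport_functor G M F"
  shows "\<exists>a\<in>Arr X. Cod X a = (M, F) \<and> farr \<pi> a = (N, f, M)"
proof -
  note f' = f[unfolded Arr_Man]
  have N: "locally_euclidean N" and M: "locally_euclidean M" using f' manifold_locally_euclidean by auto
  let ?H = "func_comp (Pi_thin N) F (Pi_thin_map (N, f, M))"
  have H: "transport_functor G N ?H" by (rule transport_functor_pullback[OF N M _ F]) (use f' in blast)
  note fc = func_comp_Pi[OF N M, of f]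
  let ?a = "((N, ?H), f, \<lambda>x\<in>pts N. Ident T (fobj ?H x), (M, F))"
  have "?a \<in> Arr X"
    unfolding Arr_Trans
  proof (intro conjI ballI H F f)
    fix x assume x: "x \<in> pts N"
    then show "(\<lambda>x\<in>pts N. Ident T (fobj ?H x)) x \<in> homs T (fobj ?H x) (fobj F (f x))"
      using Tors.ident_homs[OF transport_obj[OF H x]] fc(2)[of x F] f' by (simp del: Ident_Tors)
  next
    fix \<gamma> assume \<gamma>: "\<gamma> \<in> paths N"
    have i: "\<gamma> 0 \<in> pts N" "\<gamma> 1 \<in> pts N" using path_pts[OF \<gamma>] by simp_all
    have e: "farr ?H (cls N \<gamma>) = farr F (cls M (compose I01 f \<gamma>))" using fc(1) \<gamma> f' by blast
    show "Comp T (farr F (cls M (compose I01 f \<gamma>))) ((\<lambda>x\<in>pts N. Ident T (fobj ?H x)) (\<gamma> 0)) =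
        Comp T ((\<lambda>x\<in>pts N. Ident T (fobj ?H x)) (\<gamma> 1)) (farr ?H (cls N \<gamma>))"
      using Tors.comp_ident_homs[OF transport_homs[OF N H \<gamma>]] i e by (simp del: Ident_Tors)
  qed simp
  then show ?thesis by (intro bexI[of _ ?a]) simp_all
qed

text \<open>The component of the factorization at x is forced to be the inverse of
  \<open>\<alpha> (h x)\<close> after \<open>\<beta> x\<close>. Its naturality follows from that of
  \<open>a\<close> and \<open>b\<close> by cancelling \<open>\<alpha>\<close> on the left.\<close>

lemma Trans_factor:
  assumes a: "a \<in> Arr X" and b: "b \<in> Arr X" and g: "g \<in> Arr Man" and cod: "Cod X a = Cod X b"
    and "Dom Man g = fobj \<pi> (Dom X b)" "Cod Man g = fobj \<pi> (Dom X a)" "Comp Man (farr \<pi> a) g = farr \<pi> b"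
  shows "\<exists>!c. c \<in> Arr X \<and> Dom X c = Dom X b \<and> Cod X c = Dom X a \<and> farr \<pi> c = g \<and> Comp X a c = b"
proof -
  obtain N H f \<alpha> M F where A0: "a = ((N, H), f, \<alpha>, (M, F))" "transport_functor G N H" "transport_functor G M F" "(N, f, M) \<in> Arr Man"
    "\<alpha> \<in> extensional (pts N)" "\<forall>x\<in>pts N. \<alpha> x \<in> homs T (fobj H x) (fobj F (f x))"
    "\<forall>\<gamma>\<in>paths N. Comp T (farr F (cls M (compose I01 f \<gamma>))) (\<alpha> (\<gamma> 0)) = Comp T (\<alpha> (\<gamma> 1)) (farr H (cls N \<gamma>))"
    by (rule Arr_TransE[OF a])
  note A = A0[rule_format]
  obtain L K k \<beta> M' F' where B': "b = ((L, K), k, \<beta>, (M', F'))" "transport_functor G L K" "(L, k, M') \<in> Arr Man"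
    "\<beta> \<in> extensional (pts L)" "\<forall>x\<in>pts L. \<beta> x \<in> homs T (fobj K x) (fobj F' (k x))"
    "\<forall>\<gamma>\<in>paths L. Comp T (farr F' (cls M' (compose I01 k \<gamma>))) (\<beta> (\<gamma> 0)) = Comp T (\<beta> (\<gamma> 1)) (farr K (cls L \<gamma>))"
    by (rule Arr_TransE[OF b])
  have "M' = M" "F' = F" using cod by (simp_all add: A(1) B'(1))
  note B = B'[unfolded this, rule_format]
  note f = A(4)[unfolded Arr_Man] and k = B(3)[unfolded Arr_Man]
  obtain L' h N' where "g = (L', h, N')" by (cases g)
  then have e: "g = (L, h, N)" and kfh: "compose (pts L) f h = k" using assms(5-7) a b A B f k by (auto simp: A(1) B(1))
  note h = g[unfolded e Arr_Man]
  have N: "locally_euclidean N" and M: "locally_euclidean M" and L: "locally_euclidean L"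
    using f h manifold_locally_euclidean by auto
  have hp: "h x \<in> pts N" if "x \<in> pts L" for x using smooth_map_pts[of L N h x] h that by simp
  have kx: "k x = f (h x)" if "x \<in> pts L" for x using fun_cong[OF kfh, of x] that by (simp add: compose_def)
  define \<kappa> where "\<kappa> x = Comp T (arr_inv T (\<alpha> (h x))) (\<beta> x)" for x
  have \<alpha>h: "\<alpha> (h x) \<in> homs T (fobj H (h x)) (fobj F (k x))" if "x \<in> pts L" for x using A(6)[OF hp[OF that]] kx[OF that] by simp
  have \<kappa>: "\<kappa> x \<in> homs T (fobj K x) (fobj H (h x))" "Comp T (\<alpha> (h x)) (\<kappa> x) = \<beta> x" if x: "x \<in> pts L" for x
    using Tors.comp_homs[OF Tors.arr_inv(1)[OF \<alpha>h[OF x]] B(5)[OF x]] Tors.comp_inv_cancel[OF \<alpha>h[OF x] B(5)[OF x]]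
    by (simp_all add: \<kappa>_def)
  let ?c = "((L, K), h, restrict \<kappa> (pts L), (N, H))"
  have c: "?c \<in> Arr X"
    unfolding Arr_Trans
  proof (intro conjI ballI A(2) B(2) g[unfolded e])
    fix \<gamma> assume \<gamma>: "\<gamma> \<in> paths L"
    have i: "\<gamma> 0 \<in> pts L" "\<gamma> 1 \<in> pts L" using path_pts[OF \<gamma>] by simp_all
    let ?h = "compose I01 h \<gamma>"
    have h\<gamma>: "?h \<in> paths N" using compose_in_paths[OF L N _ \<gamma>] h by blast
    have fh: "compose I01 f ?h = compose I01 k \<gamma>" using kx path_pts[OF \<gamma>] by (auto simp: compose_def fun_eq_iff)
    have k\<gamma>: "compose I01 k \<gamma> \<in> paths M" using compose_in_paths[OF L M _ \<gamma>] k by blast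
    have ends: "?h 0 = h (\<gamma> 0)" "?h 1 = h (\<gamma> 1)" "compose I01 k \<gamma> 0 = k (\<gamma> 0)" "compose I01 k \<gamma> 1 = k (\<gamma> 1)"
      by (simp_all add: compose_def)
    note h1 = transport_homs[OF N A(2) h\<gamma>, unfolded ends] and h2 = transport_homs[OF L B(2) \<gamma>]
      and h3 = transport_homs[OF M A(3) k\<gamma>, unfolded ends]
    note \<kappa>0 = \<kappa>[OF i(1)] and \<kappa>1 = \<kappa>[OF i(2)]
    have "Comp T (farr H (cls N ?h)) (\<kappa> (\<gamma> 0)) = Comp T (\<kappa> (\<gamma> 1)) (farr K (cls L \<gamma>))"
    proof (rule Tors.cancel_left[OF \<alpha>h[OF i(2)] Tors.comp_homs[OF h1 \<kappa>0(1)] Tors.comp_homs[OF \<kappa>1(1) h2]])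
      have "Comp T (\<alpha> (h (\<gamma> 1))) (Comp T (farr H (cls N ?h)) (\<kappa> (\<gamma> 0))) = Comp T (Comp T (\<alpha> (h (\<gamma> 1))) (farr H (cls N ?h))) (\<kappa> (\<gamma> 0))"
        by (rule Tors.homs_assoc[OF \<alpha>h[OF i(2)] h1 \<kappa>0(1)])
      also have "Comp T (\<alpha> (h (\<gamma> 1))) (farr H (cls N ?h)) = Comp T (farr F (cls M (compose I01 k \<gamma>))) (\<alpha> (h (\<gamma> 0)))"
        using A(7)[OF h\<gamma>, unfolded fh ends] by simp
      also have "Comp T \<dots> (\<kappa> (\<gamma> 0)) = Comp T (farr F (cls M (compose I01 k \<gamma>))) (\<beta> (\<gamma> 0))"
        using Tors.homs_assoc[OF h3 \<alpha>h[OF i(1)] \<kappa>0(1)] \<kappa>0(2) by (simp only:)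
      also have "\<dots> = Comp T (Comp T (\<alpha> (h (\<gamma> 1))) (\<kappa> (\<gamma> 1))) (farr K (cls L \<gamma>))"
        using B(6)[OF \<gamma>] \<kappa>1(2) by (simp only:)
      also have "\<dots> = Comp T (\<alpha> (h (\<gamma> 1))) (Comp T (\<kappa> (\<gamma> 1)) (farr K (cls L \<gamma>)))"
        by (rule Tors.homs_assoc[OF \<alpha>h[OF i(2)] \<kappa>1(1) h2, symmetric])
      finally show "Comp T (\<alpha> (h (\<gamma> 1))) (Comp T (farr H (cls N ?h)) (\<kappa> (\<gamma> 0))) = Comp T (\<alpha> (h (\<gamma> 1))) (Comp T (\<kappa> (\<gamma> 1)) (farr K (cls L \<gamma>)))" .
    qed
    then show "Comp T (farr H (cls N ?h)) (restrict \<kappa> (pts L) (\<gamma> 0)) = Comp T (restrict \<kappa> (pts L) (\<gamma> 1)) (farr K (cls L \<gamma>))"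
      using i by simp
  qed (use \<kappa> in simp_all)
  have "(\<lambda>x\<in>pts L. Comp T (\<alpha> (h x)) (restrict \<kappa> (pts L) x)) = \<beta>"
    by (rule extensionalityI[OF _ B(4)]) (use \<kappa>(2) in simp_all)
  then have ac: "Comp X a ?c = b" by (simp add: A(1) B(1) kfh)
  show ?thesis
  proof (rule ex1I[of _ ?c])
    show "?c \<in> Arr X \<and> Dom X ?c = Dom X b \<and> Cod X ?c = Dom X a \<and> farr \<pi> ?c = g \<and> Comp X a ?c = b"
      using c ac by (simp add: A(1) B(1) e)
    fix d assume d: "d \<in> Arr X \<and> Dom X d = Dom X b \<and> Cod X d = Dom X a \<and> farr \<pi> d = g \<and> Comp X a d = b"
    then have "d \<in> Arr X" by blast
    then obtain L' K' h' \<delta> N' H' where D: "d = ((L', K'), h', \<delta>, (N', H'))"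
      "\<delta> \<in> extensional (pts L')" "\<forall>x\<in>pts L'. \<delta> x \<in> homs T (fobj K' x) (fobj H' (h' x))" by (rule Arr_TransE)
    have de: "L' = L" "K' = K" "N' = N" "H' = H" "h' = h" using d by (auto simp: D(1) A(1) B(1) e)
    have "\<delta> = restrict \<kappa> (pts L)"
    proof (rule extensionalityI[OF D(2)[unfolded de]])
      fix x assume x: "x \<in> pts L"
      have "(\<lambda>x\<in>pts L. Comp T (\<alpha> (h x)) (\<delta> x)) = \<beta>" using d by (simp add: D(1) A(1) B(1) de)
      from fun_cong[OF this, of x] x have "Comp T (\<alpha> (h x)) (\<delta> x) = \<beta> x" by simp
      then have "\<delta> x = \<kappa> x"
        using Tors.cancel_left[OF \<alpha>h[OF x] bspec[OF D(3)[unfolded de] x] \<kappa>(1)[OF x]] \<kappa>(2)[OF x] by simp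
      then show "\<delta> x = restrict \<kappa> (pts L) x" using x by simp
    qed simp
    then show "d = ?c" by (simp add: D(1) de)
  qed
qed

lemma fibered_Trans: "fibered_in_groupoids (X :: (('m, 'q, 'g) trans_obj, ('m, 'q, 'g) trans_arr) cat) Man \<pi>"
  unfolding fibered_in_groupoids_def
proof (intro conjI is_functor_Trans_proj ballI impI)
  fix f :: "'m man_arr" and \<xi> :: "('m, 'q, 'g) trans_obj" assume "f \<in> Arr Man" "\<xi> \<in> Obj X" "fobj \<pi> \<xi> = Cod Man f"
  moreover obtain N g M where "f = (N, g, M)" by (cases f)
  moreover obtain M' F where "\<xi> = (M', F)" by (cases \<xi>)
  ultimately show "\<exists>a\<in>Arr X. Cod X a = \<xi> \<and> farr \<pi> a = f" using Trans_pullback[of N g M F] by simp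
qed (rule Trans_factor)

end

section \<open>Descent for transport functors\<close>

lemma incl_in_Arr:
  assumes M: "manifold M" and U: "openin (mtop M) U" and V: "openin (mtop M) V" and UV: "U \<subseteq> V"
  shows "incl (open_sub M U) (open_sub M V) \<in> Arr Man" "incl (open_sub M U) M \<in> Arr Man"
proof -
  note le = manifold_locally_euclidean[OF M]
  have *: "incl (open_sub M U) (open_sub M V) \<in> Arr Man" if "openin (mtop M) V" "U \<subseteq> V" for V
    unfolding incl_def Arr_Man
    using manifold_open_sub[OF M U] manifold_open_sub[OF M that(1)]
      smooth_map_cong[OF locally_euclidean_open_sub[OF le U] locally_euclidean_open_sub[OF le that(1)] smooth_map_inclusion[OF le that(2)],
        of "\<lambda>x\<in>pts (open_sub M U). x"]
    by simp
  show "incl (open_sub M U) (open_sub M V) \<in> Arr Man" by (rule *[OF V UV])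
  show "incl (open_sub M U) M \<in> Arr Man" using *[of "pts M"] openin_subset[OF U] open_sub_pts[OF le] by simp
qed

lemma incl_refl_Arr: "manifold M \<Longrightarrow> incl M M \<in> Arr Man"
  using category.Ident_Arr[OF category_Man, of M] by (simp add: incl_def)

context lie_group_torsors
begin

text \<open>Arrows over inclusions of open submanifolds (identities included) are composed componentwise.\<close>

definition inc_homs :: "'m mfd \<Rightarrow> 'm mfd \<Rightarrow> ('m, 'q, 'g) trans_obj \<Rightarrow> ('m, 'q, 'g) trans_obj \<Rightarrow> ('m, 'q, 'g) trans_arr set" where
  "inc_homs N M \<xi> \<eta> = {a \<in> homs X \<xi> \<eta>. farr \<pi> a = incl N M}"

lemma inc_homsD:
  assumes a: "a \<in> inc_homs N M \<xi> \<eta>"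
  shows "a \<in> homs X \<xi> \<eta>" "farr \<pi> a = incl N M" "transport_functor G N (snd \<xi>)" "transport_functor G M (snd \<eta>)"
    "fst \<xi> = N" "fst \<eta> = M" "incl N M \<in> Arr Man" "locally_euclidean N" "locally_euclidean M" "pts N \<subseteq> pts M"
    "x \<in> pts N \<Longrightarrow> nt a x \<in> homs T (fobj (snd \<xi>) x) (fobj (snd \<eta>) x)"
    "\<gamma> \<in> paths N \<Longrightarrow> Comp T (farr (snd \<eta>) (cls M \<gamma>)) (nt a (\<gamma> 0)) = Comp T (nt a (\<gamma> 1)) (farr (snd \<xi>) (cls N \<gamma>))"
proof -
  show a': "a \<in> homs X \<xi> \<eta>" and f: "farr \<pi> a = incl N M" using a by (simp_all add: inc_homs_def)
  then have aX: "a \<in> Arr X" by (simp add: homs_iff)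
  obtain N' H f \<alpha> M' F where A0: "a = ((N', H), f, \<alpha>, (M', F))" "transport_functor G N' H" "transport_functor G M' F" "(N', f, M') \<in> Arr Man"
    "\<alpha> \<in> extensional (pts N')" "\<forall>x\<in>pts N'. \<alpha> x \<in> homs T (fobj H x) (fobj F (f x))"
    "\<forall>\<gamma>\<in>paths N'. Comp T (farr F (cls M' (compose I01 f \<gamma>))) (\<alpha> (\<gamma> 0)) = Comp T (\<alpha> (\<gamma> 1)) (farr H (cls N' \<gamma>))"
    by (rule Arr_TransE[OF aX])
  have e: "N' = N" "M' = M" "f = (\<lambda>x\<in>pts N. x)" using f aX by (auto simp: A0(1) incl_def)
  note A = A0[unfolded e, rule_format]
  have s: "\<xi> = (N, H)" "\<eta> = (M, F)" using a' by (simp_all add: homs_iff A(1))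
  have al: "nt a = \<alpha>" by (simp add: nt_def A(1))
  note ar = A(4)[unfolded Arr_Man]
  show "transport_functor G N (snd \<xi>)" "transport_functor G M (snd \<eta>)" "fst \<xi> = N" "fst \<eta> = M"
    using A(2,3) by (simp_all add: s)
  show "incl N M \<in> Arr Man" using A(4) by (simp add: incl_def)
  show "locally_euclidean N" "locally_euclidean M" using ar manifold_locally_euclidean by auto
  show "pts N \<subseteq> pts M"
  proof
    fix x assume "x \<in> pts N" then show "x \<in> pts M" using smooth_map_pts[of N M "\<lambda>x\<in>pts N. x" x] ar by simp
  qed
  show "x \<in> pts N \<Longrightarrow> nt a x \<in> homs T (fobj (snd \<xi>) x) (fobj (snd \<eta>) x)" using A(6)[of x] by (simp add: s al)
  show "Comp T (farr (snd \<eta>) (cls M \<gamma>)) (nt a (\<gamma> 0)) = Comp T (nt a (\<gamma> 1)) (farr (snd \<xi>) (cls N \<gamma>))" if \<gamma>: "\<gamma> \<in> paths N"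
    using A(7)[OF \<gamma>] unfolding compose_path_id[OF \<gamma>] by (simp add: s al)
qed

lemma inc_homsI:
  assumes H: "transport_functor G N H" and F: "transport_functor G M F" and i: "incl N M \<in> Arr Man"
    and \<kappa>: "\<And>x. x \<in> pts N \<Longrightarrow> \<kappa> x \<in> homs T (fobj H x) (fobj F x)"
    and nat: "\<And>\<gamma>. \<gamma> \<in> paths N \<Longrightarrow> Comp T (farr F (cls M \<gamma>)) (\<kappa> (\<gamma> 0)) = Comp T (\<kappa> (\<gamma> 1)) (farr H (cls N \<gamma>))"
  obtains a where "a \<in> inc_homs N M (N, H) (M, F)" "\<And>x. x \<in> pts N \<Longrightarrow> nt a x = \<kappa> x"
proof -
  let ?a = "((N, H), \<lambda>x\<in>pts N. x, restrict \<kappa> (pts N), (M, F))"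
  have "?a \<in> Arr X"
    unfolding Arr_Trans
  proof (intro conjI ballI H F i[unfolded incl_def])
    fix \<gamma> assume \<gamma>: "\<gamma> \<in> paths N"
    have "\<gamma> 0 \<in> pts N" "\<gamma> 1 \<in> pts N" using path_pts[OF \<gamma>] by simp_all
    then show "Comp T (farr F (cls M (compose I01 (\<lambda>x\<in>pts N. x) \<gamma>))) (restrict \<kappa> (pts N) (\<gamma> 0)) =
        Comp T (restrict \<kappa> (pts N) (\<gamma> 1)) (farr H (cls N \<gamma>))"
      using nat[OF \<gamma>] compose_path_id[OF \<gamma>] by simp
  qed (use \<kappa> in auto)
  then show ?thesis by (intro that[of ?a]) (simp_all add: inc_homs_def homs_iff incl_def nt_def)
qed

lemma inc_comp:
  assumes b: "b \<in> inc_homs M L \<eta> \<zeta>" and a: "a \<in> inc_homs N M \<xi> \<eta>"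
  shows "Comp X b a \<in> inc_homs N L \<xi> \<zeta>" "x \<in> pts N \<Longrightarrow> nt (Comp X b a) x = Comp T (nt b x) (nt a x)"
proof -
  note A = inc_homsD[OF a] and B = inc_homsD[OF b]
  have ab: "Comp X b a \<in> homs X \<xi> \<zeta>" by (rule category.comp_homs[OF category_Trans B(1) A(1)])
  have "farr \<pi> (Comp X b a) = Comp Man (incl M L) (incl N M)"
    using is_functor_Trans_proj A(1,2) B(1,2) unfolding is_functor_def homs_iff by metis
  also have "\<dots> = incl N L" using A(10) by (auto simp: incl_def compose_def fun_eq_iff)
  finally show "Comp X b a \<in> inc_homs N L \<xi> \<zeta>" using ab by (simp add: inc_homs_def)
  have aX: "a \<in> Arr X" and bX: "b \<in> Arr X" using A(1) B(1) by (simp_all add: homs_iff)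
  obtain N' H f \<alpha> M' F where e: "a = ((N', H), f, \<alpha>, (M', F))" by (rule Arr_TransE[OF aX])
  obtain M'' F' g \<beta> L' K where e': "b = ((M'', F'), g, \<beta>, (L', K))" by (rule Arr_TransE[OF bX])
  have "N' = N" "f = (\<lambda>x\<in>pts N. x)" using A(2) aX by (auto simp: e incl_def)
  then show "x \<in> pts N \<Longrightarrow> nt (Comp X b a) x = Comp T (nt b x) (nt a x)" by (simp add: nt_def e e')
qed

lemma inc_eqI:
  assumes a: "a \<in> inc_homs N M \<xi> \<eta>" and b: "b \<in> inc_homs N M \<xi> \<eta>" and eq: "\<And>x. x \<in> pts N \<Longrightarrow> nt a x = nt b x"
  shows "a = b"
proof (rule Trans_arr_eqI)
  note A = inc_homsD[OF a] and B = inc_homsD[OF b]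
  show "a \<in> Arr X" "b \<in> Arr X" "Dom X a = Dom X b" "Cod X a = Cod X b" "farr \<pi> a = farr \<pi> b"
    using A(1,2) B(1,2) by (simp_all add: homs_iff)
  fix x assume "x \<in> pts (fst (Dom X a))"
  moreover have "fst (Dom X a) = N" using A(1,5) by (simp add: homs_iff)
  ultimately show "nt a x = nt b x" using eq by simp
qed

lemma inc_cancel:
  assumes c: "c \<in> inc_homs M L \<eta> \<zeta>" and a: "a \<in> inc_homs N M \<xi> \<eta>" and b: "b \<in> inc_homs N M \<xi> \<eta>" and eq: "Comp X c a = Comp X c b"
  shows "a = b"
proof (rule inc_eqI[OF a b])
  fix x assume x: "x \<in> pts N"
  then have x': "x \<in> pts M" using inc_homsD(10)[OF a] by blast
  have "Comp T (nt c x) (nt a x) = Comp T (nt c x) (nt b x)" using inc_comp(2)[OF c a x] inc_comp(2)[OF c b x] eq by simp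
  then show "nt a x = nt b x"
    by (rule Tors.cancel_left[OF inc_homsD(11)[OF c x'] inc_homsD(11)[OF a x] inc_homsD(11)[OF b x]])
qed

lemma fobj_inc:
  assumes a: "a \<in> inc_homs N M \<xi> \<eta>"
  shows "fobj \<pi> \<xi> = N"
proof -
  have "Dom Man (farr \<pi> a) = fobj \<pi> (Dom X a)"
    using is_functor_Trans_proj inc_homsD(1)[OF a] unfolding is_functor_def homs_iff by metis
  then show ?thesis using inc_homsD(1,2)[OF a] by (simp add: incl_def homs_iff)
qed

lemma inc_factor:
  assumes a: "a \<in> inc_homs N M \<zeta> \<eta>" and b: "b \<in> inc_homs L M \<xi> \<eta>" and i: "incl L N \<in> Arr Man"
  shows "factor X \<pi> a b (incl L N) \<in> inc_homs L N \<xi> \<zeta>" "Comp X a (factor X \<pi> a b (incl L N)) = b"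
proof -
  note A = inc_homsD[OF a] and B = inc_homsD[OF b]
  have A1: "a \<in> Arr X" "Dom X a = \<zeta>" "Cod X a = \<eta>" and B1: "b \<in> Arr X" "Dom X b = \<xi>" "Cod X b = \<eta>"
    using A(1) B(1) by (simp_all add: homs_iff)
  have LN: "pts L \<subseteq> pts N"
  proof
    fix x assume "x \<in> pts L"
    then show "x \<in> pts N" using i smooth_map_pts[of L N "\<lambda>x\<in>pts L. x" x] by (simp add: incl_def Arr_Man)
  qed
  have "\<exists>!c. c \<in> Arr X \<and> Dom X c = Dom X b \<and> Cod X c = Dom X a \<and> farr \<pi> c = incl L N \<and> Comp X a c = b"
  proof (rule Trans_factor[OF A1(1) B1(1) i])
    show "Dom Man (incl L N) = fobj \<pi> (Dom X b)" "Cod Man (incl L N) = fobj \<pi> (Dom X a)"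
      by (simp_all add: A1 B1 fobj_inc[OF a] fobj_inc[OF b] incl_def)
    show "Comp Man (farr \<pi> a) (incl L N) = farr \<pi> b"
      using LN by (auto simp: A(2) B(2) incl_def compose_def fun_eq_iff)
  qed (simp add: A1 B1)
  from theI'[OF this, folded factor_def] show "factor X \<pi> a b (incl L N) \<in> inc_homs L N \<xi> \<zeta>" "Comp X a (factor X \<pi> a b (incl L N)) = b"
    using A1 B1 by (auto simp: inc_homs_def homs_iff)
qed

text \<open>The last claim characterizes the pullback by a single equation, so that the definite
  description in \<open>factor\<close> need not be opened again.\<close>

lemma inc_pull:
  assumes p: "p \<in> inc_homs L N \<xi>' \<xi>" and q: "q \<in> inc_homs L N \<eta>' \<eta>" and \<phi>: "\<phi> \<in> inc_homs N N \<xi> \<eta>"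
  shows "pull_arr X \<pi> p q \<phi> \<in> inc_homs L L \<xi>' \<eta>'" "Comp X q (pull_arr X \<pi> p q \<phi>) = Comp X \<phi> p"
    "k \<in> inc_homs L L \<xi>' \<eta>' \<Longrightarrow> Comp X q k = Comp X \<phi> p \<Longrightarrow> pull_arr X \<pi> p q \<phi> = k"
proof -
  have "Dom X p = \<xi>'" using inc_homsD(1)[OF p] by (simp add: homs_iff)
  then have e: "pull_arr X \<pi> p q \<phi> = factor X \<pi> q (Comp X \<phi> p) (incl L L)"
    by (simp add: pull_arr_def incl_def fobj_inc[OF p])
  have "incl L L \<in> Arr Man" using inc_homsD(7)[OF p] incl_refl_Arr[of L] by (simp add: incl_def Arr_Man)
  note F = inc_factor[OF q inc_comp(1)[OF \<phi> p] this]
  show *: "pull_arr X \<pi> p q \<phi> \<in> inc_homs L L \<xi>' \<eta>'" "Comp X q (pull_arr X \<pi> p q \<phi>) = Comp X \<phi> p" using F by (simp_all add: e)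
  show "k \<in> inc_homs L L \<xi>' \<eta>' \<Longrightarrow> Comp X q k = Comp X \<phi> p \<Longrightarrow> pull_arr X \<pi> p q \<phi> = k"
    by (rule inc_cancel[OF q *(1)]) (simp_all add: *(2))
qed

lemma fiber_hom_iff: "fobj \<pi> \<xi> = M \<Longrightarrow> \<phi> \<in> fiber_hom X \<pi> \<xi> \<eta> \<longleftrightarrow> \<phi> \<in> inc_homs M M \<xi> \<eta>"
  by (auto simp: fiber_hom_def inc_homs_def homs_iff incl_def)

text \<open>A fiber arrow \<open>\<phi>\<close> between chosen restrictions, conjugated by the
  structure arrows \<open>p\<close> and \<open>q\<close> into a map between the fibers of the
  original objects. It removes the cleavage from view.\<close>

definition transfer :: "('m, 'q, 'g) trans_arr \<Rightarrow> ('m, 'q, 'g) trans_arr \<Rightarrow> ('m, 'q, 'g) trans_arr \<Rightarrow> 'm \<Rightarrow> ('q, 'g) tors_arr" where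
  "transfer q \<phi> p x = Comp T (Comp T (nt q x) (nt \<phi> x)) (arr_inv T (nt p x))"

lemma transfer:
  assumes p: "p \<in> inc_homs N M \<xi>' \<xi>" and q: "q \<in> inc_homs N M' \<eta>' \<eta>" and \<phi>: "\<phi> \<in> inc_homs N N \<xi>' \<eta>'" and x: "x \<in> pts N"
  shows "transfer q \<phi> p x \<in> homs T (fobj (snd \<xi>) x) (fobj (snd \<eta>) x)"
    "Comp T (transfer q \<phi> p x) (nt p x) = Comp T (nt q x) (nt \<phi> x)"
    "k \<in> homs T (fobj (snd \<xi>) x) (fobj (snd \<eta>) x) \<Longrightarrow> Comp T k (nt p x) = Comp T (nt q x) (nt \<phi> x) \<Longrightarrow> transfer q \<phi> p x = k"
proof -
  note P = inc_homsD(11)[OF p x] and Q = inc_homsD(11)[OF q x] and f = inc_homsD(11)[OF \<phi> x]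
  note qf = Tors.comp_homs[OF Q f]
  show *: "transfer q \<phi> p x \<in> homs T (fobj (snd \<xi>) x) (fobj (snd \<eta>) x)"
    unfolding transfer_def by (rule Tors.comp_homs[OF qf Tors.arr_inv(1)[OF P]])
  show **: "Comp T (transfer q \<phi> p x) (nt p x) = Comp T (nt q x) (nt \<phi> x)"
    unfolding transfer_def by (rule Tors.inv_comp_right[OF qf P])
  show "k \<in> homs T (fobj (snd \<xi>) x) (fobj (snd \<eta>) x) \<Longrightarrow> Comp T k (nt p x) = Comp T (nt q x) (nt \<phi> x) \<Longrightarrow> transfer q \<phi> p x = k"
    by (rule Tors.cancel_right[OF P *]) (simp_all only: **)
qed

text \<open>After cancelling \<open>p\<close> on the right, this is the naturality of
  \<open>q\<close>, of \<open>\<phi>\<close> and of \<open>p\<close> in turn.\<close>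

lemma transfer_natural:
  assumes p: "p \<in> inc_homs N M \<xi>' \<xi>" and q: "q \<in> inc_homs N M' \<eta>' \<eta>" and \<phi>: "\<phi> \<in> inc_homs N N \<xi>' \<eta>'" and \<gamma>: "\<gamma> \<in> paths N"
    and M: "\<gamma> \<in> paths M" "\<gamma> \<in> paths M'"
  shows "Comp T (farr (snd \<eta>) (cls M' \<gamma>)) (transfer q \<phi> p (\<gamma> 0)) = Comp T (transfer q \<phi> p (\<gamma> 1)) (farr (snd \<xi>) (cls M \<gamma>))"
proof -
  have i: "\<gamma> 0 \<in> pts N" "\<gamma> 1 \<in> pts N" using path_pts[OF \<gamma>] by simp_all
  note P = inc_homsD[OF p] and Q = inc_homsD[OF q] and f = inc_homsD[OF \<phi>]
  note t0 = transfer(1,2)[OF p q \<phi> i(1)] and t1 = transfer(1,2)[OF p q \<phi> i(2)]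
  let ?t0 = "transfer q \<phi> p (\<gamma> 0)" and ?t1 = "transfer q \<phi> p (\<gamma> 1)"
  let ?E = "farr (snd \<eta>) (cls M' \<gamma>)" and ?X = "farr (snd \<xi>) (cls M \<gamma>)"
    and ?E' = "farr (snd \<eta>') (cls N \<gamma>)" and ?X' = "farr (snd \<xi>') (cls N \<gamma>)"
  note hE = transport_homs[OF Q(9,4) M(2)] and hX = transport_homs[OF P(9,4) M(1)]
    and hE' = transport_homs[OF Q(8,3) \<gamma>] and hX' = transport_homs[OF P(8,3) \<gamma>]
  note as = Tors.homs_assoc
  show ?thesis
  proof (rule Tors.cancel_right[OF P(11)[OF i(1)] Tors.comp_homs[OF hE t0(1)] Tors.comp_homs[OF t1(1) hX]])
    have "Comp T (Comp T ?E ?t0) (nt p (\<gamma> 0)) = Comp T ?E (Comp T (nt q (\<gamma> 0)) (nt \<phi> (\<gamma> 0)))"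
      using as[OF hE t0(1) P(11)[OF i(1)]] t0(2) by (simp only:)
    also have "\<dots> = Comp T (Comp T (nt q (\<gamma> 1)) ?E') (nt \<phi> (\<gamma> 0))"
      using as[OF hE Q(11)[OF i(1)] f(11)[OF i(1)]] Q(12)[OF \<gamma>] by (simp only:)
    also have "\<dots> = Comp T (nt q (\<gamma> 1)) (Comp T (nt \<phi> (\<gamma> 1)) ?X')"
      using as[OF Q(11)[OF i(2)] hE' f(11)[OF i(1)], symmetric] f(12)[OF \<gamma>] by (simp only:)
    also have "\<dots> = Comp T (Comp T ?t1 (nt p (\<gamma> 1))) ?X'"
      using as[OF Q(11)[OF i(2)] f(11)[OF i(2)] hX'] t1(2) by (simp only:)
    also have "\<dots> = Comp T ?t1 (Comp T ?X (nt p (\<gamma> 0)))"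
      using as[OF t1(1) P(11)[OF i(2)] hX', symmetric] P(12)[OF \<gamma>] by (simp only:)
    also have "\<dots> = Comp T (Comp T ?t1 ?X) (nt p (\<gamma> 0))"
      by (rule as[OF t1(1) hX P(11)[OF i(1)]])
    finally show "Comp T (Comp T ?E ?t0) (nt p (\<gamma> 0)) = Comp T (Comp T ?t1 ?X) (nt p (\<gamma> 0))" .
  qed
qed

text \<open>Restriction to a smaller \<open>L\<close> does not change the transferred components, so
  data given on different overlaps can be compared point by point.\<close>

lemma transfer_restrict:
  assumes p: "p \<in> inc_homs N M \<xi>N \<xi>" and q: "q \<in> inc_homs N M' \<eta>N \<eta>" and \<phi>: "\<phi> \<in> inc_homs N N \<xi>N \<eta>N"
    and s: "s \<in> inc_homs L N \<xi>L \<xi>N" and r: "r \<in> inc_homs L N \<eta>L \<eta>N" and \<psi>: "\<psi> \<in> inc_homs L L \<xi>L \<eta>L"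
    and eq: "Comp X r \<psi> = Comp X \<phi> s" and x: "x \<in> pts L"
  shows "transfer (Comp X q r) \<psi> (Comp X p s) x = transfer q \<phi> p x"
proof (rule transfer(3)[OF inc_comp(1)[OF p s] inc_comp(1)[OF q r] \<psi> x])
  have xN: "x \<in> pts N" using inc_homsD(10)[OF s] x by blast
  note t = transfer[OF p q \<phi> xN]
  show "transfer q \<phi> p x \<in> homs T (fobj (snd \<xi>) x) (fobj (snd \<eta>) x)" by (rule t(1))
  note hp = inc_homsD(11)[OF p xN] and hq = inc_homsD(11)[OF q xN] and hf = inc_homsD(11)[OF \<phi> xN]
    and hs = inc_homsD(11)[OF s x] and hr = inc_homsD(11)[OF r x] and hpsi = inc_homsD(11)[OF \<psi> x]
  have e: "Comp T (nt r x) (nt \<psi> x) = Comp T (nt \<phi> x) (nt s x)"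
    using inc_comp(2)[OF r \<psi> x] inc_comp(2)[OF \<phi> s x] eq by simp
  have "Comp T (transfer q \<phi> p x) (nt (Comp X p s) x) = Comp T (Comp T (transfer q \<phi> p x) (nt p x)) (nt s x)"
    using Tors.homs_assoc[OF t(1) hp hs] inc_comp(2)[OF p s x] by (simp only:)
  also have "\<dots> = Comp T (nt q x) (Comp T (nt \<phi> x) (nt s x))"
    using Tors.homs_assoc[OF hq hf hs, symmetric] t(2) by (simp only:)
  also have "\<dots> = Comp T (nt (Comp X q r) x) (nt \<psi> x)"
    unfolding e[symmetric] using Tors.homs_assoc[OF hq hr hpsi] inc_comp(2)[OF q r x] by (simp only:)
  finally show "Comp T (transfer q \<phi> p x) (nt (Comp X p s) x) = Comp T (nt (Comp X q r) x) (nt \<psi> x)" .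
qed

end

section \<open>Descent for a fixed cleavage and open cover\<close>

locale transport_descent = lie_group_torsors G for G :: "'g lie_group" +
  fixes cl :: "'m man_arr \<Rightarrow> ('m, 'q, 'g) trans_obj \<Rightarrow> ('m, 'q, 'g) trans_arr" and M :: "'m mfd" and \<U> :: "'m set set"
  assumes cl: "cleavage X Man \<pi> cl" and M: "manifold M" and cover: "open_cover M \<U>"
begin

lemma leM: "locally_euclidean M"
  by (rule manifold_locally_euclidean[OF M])

lemma cover_open: "U \<in> \<U> \<Longrightarrow> openin (mtop M) U"
  using cover by (simp add: open_cover_def)

lemma pts_Int_open [simp]: "openin (mtop M) U \<Longrightarrow> pts M \<inter> U = U"
  using openin_subset[of "mtop M" U] by blast

lemma Obj_X: "\<xi> \<in> Obj X \<longleftrightarrow> manifold (fst \<xi>) \<and> transport_functor G (fst \<xi>) (snd \<xi>)"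
  by (cases \<xi>) simp

lemma fobj_fst: "\<xi> \<in> Obj X \<Longrightarrow> fobj \<pi> \<xi> = fst \<xi>"
  by (cases \<xi>) simp

lemma lift_to_inc:
  assumes \<xi>: "\<xi> \<in> Obj X" and i: "incl N (fst \<xi>) \<in> Arr Man"
  shows "lift_to \<pi> cl N \<xi> \<in> inc_homs N (fst \<xi>) (restr X \<pi> cl N \<xi>) \<xi>"
proof -
  have "cl (incl N (fst \<xi>)) \<xi> \<in> Arr X \<and> Cod X (cl (incl N (fst \<xi>)) \<xi>) = \<xi> \<and> farr \<pi> (cl (incl N (fst \<xi>)) \<xi>) = incl N (fst \<xi>)"
    using cl \<xi> i fobj_fst[OF \<xi>] unfolding cleavage_def by (simp add: incl_def)
  then show ?thesis using fobj_fst[OF \<xi>] by (simp add: inc_homs_def homs_iff restr_def lift_to_def)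
qed

lemma sub_lift_inc:
  assumes \<xi>: "\<xi> \<in> Obj X" and i: "incl L N \<in> Arr Man" "incl N (fst \<xi>) \<in> Arr Man" "incl L (fst \<xi>) \<in> Arr Man"
  shows "sub_lift X \<pi> cl L N \<xi> \<in> inc_homs L N (restr X \<pi> cl L \<xi>) (restr X \<pi> cl N \<xi>)"
    "Comp X (lift_to \<pi> cl N \<xi>) (sub_lift X \<pi> cl L N \<xi>) = lift_to \<pi> cl L \<xi>"
  using inc_factor[OF lift_to_inc[OF \<xi> i(2)] lift_to_inc[OF \<xi> i(3)] i(1)] by (simp_all add: sub_lift_def)

lemma cover_at:
  assumes "x \<in> pts M" obtains U where "U \<in> \<U>" "x \<in> U"
  using assms cover by (auto simp: open_cover_def)

text \<open>The transferred components agree on overlaps and define a single family on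
  \<open>M\<close>. Naturality is compatible with concatenation, so it is enough to have it for
  paths inside one member of the cover; uniqueness is visible in the components.\<close>

lemma transport_hom_descent: "hom_descent X \<pi> cl M \<U>"
  unfolding hom_descent_def
proof (intro ballI allI impI)
  fix \<xi> \<eta> :: "('m, 'q, 'g) trans_obj" and \<phi> :: "'m set \<Rightarrow> ('m, 'q, 'g) trans_arr"
  assume \<xi>: "\<xi> \<in> Obj X" and \<eta>: "\<eta> \<in> Obj X" and base: "fobj \<pi> \<xi> = M" "fobj \<pi> \<eta> = M"
    and \<phi>0: "\<forall>U\<in>\<U>. \<phi> U \<in> fiber_hom X \<pi> (restr X \<pi> cl (open_sub M U) \<xi>) (restr X \<pi> cl (open_sub M U) \<eta>)"
    and agree: "\<forall>U\<in>\<U>. \<forall>V\<in>\<U>. let UV = open_sub M (U \<inter> V); MU = open_sub M U; MV = open_sub M V in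
           pull_arr X \<pi> (sub_lift X \<pi> cl UV MU \<xi>) (sub_lift X \<pi> cl UV MU \<eta>) (\<phi> U) =
           pull_arr X \<pi> (sub_lift X \<pi> cl UV MV \<xi>) (sub_lift X \<pi> cl UV MV \<eta>) (\<phi> V)"
  have b: "fst \<xi> = M" "fst \<eta> = M" using base by (simp_all add: fobj_fst[OF \<xi>] fobj_fst[OF \<eta>])
  have tf: "transport_functor G M (snd \<xi>)" "transport_functor G M (snd \<eta>)" using \<xi> \<eta> b by (simp_all add: Obj_X)
  let ?lx = "\<lambda>U. lift_to \<pi> cl (open_sub M U) \<xi>" and ?ly = "\<lambda>U. lift_to \<pi> cl (open_sub M U) \<eta>"
  have inM: "incl (open_sub M U) M \<in> Arr Man" if "openin (mtop M) U" for U using incl_in_Arr(2)[OF M that openin_topspace] openin_subset[OF that] by simp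
  have lx: "?lx U \<in> inc_homs (open_sub M U) M (restr X \<pi> cl (open_sub M U) \<xi>) \<xi>"
    and ly: "?ly U \<in> inc_homs (open_sub M U) M (restr X \<pi> cl (open_sub M U) \<eta>) \<eta>" if "openin (mtop M) U" for U
    using lift_to_inc[OF \<xi>, of "open_sub M U"] lift_to_inc[OF \<eta>, of "open_sub M U"] inM[OF that] b by simp_all
  have \<phi>: "\<phi> U \<in> inc_homs (open_sub M U) (open_sub M U) (restr X \<pi> cl (open_sub M U) \<xi>) (restr X \<pi> cl (open_sub M U) \<eta>)" if "U \<in> \<U>" for U
    using \<phi>0 that fiber_hom_iff[OF fobj_inc[OF lx[OF cover_open[OF that]]]] by blast
  define \<kappa> where "\<kappa> U = transfer (?ly U) (\<phi> U) (?lx U)" for U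
  \<comment> \<open>The hypothesis compares pullbacks to the intersection; this expresses the
    component for \<open>U\<close> through exactly that pullback.\<close>
  have \<kappa>_restr: "\<kappa> U x = transfer (?ly (U \<inter> V)) (pull_arr X \<pi> (sub_lift X \<pi> cl (open_sub M (U \<inter> V)) (open_sub M U) \<xi>)
      (sub_lift X \<pi> cl (open_sub M (U \<inter> V)) (open_sub M U) \<eta>) (\<phi> U)) (?lx (U \<inter> V)) x"
    if UV: "U \<in> \<U>" "V \<in> \<U>" and x: "x \<in> U \<inter> V" for U V x
  proof -
    have o: "openin (mtop M) U" "openin (mtop M) V" "openin (mtop M) (U \<inter> V)" using UV cover_open by auto
    note i = incl_in_Arr(1)[OF M o(3) o(1) Int_lower1]
    note sx = sub_lift_inc[OF \<xi> i, unfolded b, OF inM[OF o(1)] inM[OF o(3)]] and sy = sub_lift_inc[OF \<eta> i, unfolded b, OF inM[OF o(1)] inM[OF o(3)]]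
    note pl = inc_pull[OF sx(1) sy(1) \<phi>[OF UV(1)]]
    show ?thesis
      using transfer_restrict[OF lx[OF o(1)] ly[OF o(1)] \<phi>[OF UV(1)] sx(1) sy(1) pl(1,2), of x] x o(3) by (simp add: sx(2) sy(2) \<kappa>_def)
  qed
  have \<kappa>_agree: "\<kappa> U x = \<kappa> V x" if "U \<in> \<U>" "V \<in> \<U>" "x \<in> U" "x \<in> V" for U V x
    using \<kappa>_restr[of U V x] \<kappa>_restr[of V U x, unfolded Int_commute[of V U]] agree[rule_format, OF that(1,2), unfolded Let_def] that by simp
  \<comment> \<open>Any member containing the point would do, by
    \<open>\<kappa>_agree\<close>.\<close>
  define U0 where "U0 x = (SOME U. U \<in> \<U> \<and> x \<in> U)" for x
  have U0: "U0 x \<in> \<U> \<and> x \<in> U0 x" if "x \<in> pts M" for x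
    unfolding U0_def by (rule someI_ex) (use cover_at[OF that] in blast)
  define k where "k x = \<kappa> (U0 x) x" for x
  have k: "k x = \<kappa> U x" if "U \<in> \<U>" "x \<in> U" for U x
    unfolding k_def using U0[of x] that openin_subset[OF cover_open[OF that(1)]] by (intro \<kappa>_agree) auto
  have k_hom: "k x \<in> homs T (fobj (snd \<xi>) x) (fobj (snd \<eta>) x)" if x: "x \<in> pts M" for x
  proof -
    obtain U where U: "U \<in> \<U>" "x \<in> U" using cover_at[OF x] .
    note o = cover_open[OF U(1)]
    show ?thesis unfolding k[OF U] \<kappa>_def by (rule transfer(1)[OF lx[OF o] ly[OF o] \<phi>[OF U(1)]]) (simp add: o U)
  qed
  have k_nat: "Comp T (farr (snd \<eta>) (cls M \<gamma>)) (k (\<gamma> 0)) = Comp T (k (\<gamma> 1)) (farr (snd \<xi>) (cls M \<gamma>))" if \<gamma>: "\<gamma> \<in> paths M" for \<gamma>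
  proof -
    \<comment> \<open>Written with \<open>Dom\<close> and \<open>Cod\<close> so as to be a property
      of the class, as \<open>path_class_induct\<close> requires.\<close>
    let ?P = "\<lambda>c. Comp T (farr (snd \<eta>) c) (k (Dom (Pi_thin M) c)) = Comp T (k (Cod (Pi_thin M) c)) (farr (snd \<xi>) c)"
    have "?P (cls M \<gamma>)"
    proof (rule path_class_induct[OF leM cover \<gamma>, where P = ?P])
      fix U \<gamma> assume U: "U \<in> \<U>" and \<gamma>: "\<gamma> \<in> paths (open_sub M U)"
      note o = cover_open[OF U]
      have \<gamma>M: "\<gamma> \<in> paths M" and \<gamma>U: "\<gamma> 0 \<in> U" "\<gamma> 1 \<in> U" using \<gamma> paths_open_sub[OF leM o] by auto
      show "?P (cls M \<gamma>)"
        using transfer_natural[OF lx[OF o] ly[OF o] \<phi>[OF U] \<gamma> \<gamma>M \<gamma>M] k[OF U \<gamma>U(1)] k[OF U \<gamma>U(2)]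
        by (simp add: Dom_cls[OF leM \<gamma>M] Cod_cls[OF leM \<gamma>M] \<kappa>_def)
    next
      fix \<gamma> \<tau> assume \<gamma>: "\<gamma> \<in> paths M" and \<tau>: "\<tau> \<in> paths M" and e: "\<tau> 1 = \<gamma> 0" and P: "?P (cls M \<gamma>)" "?P (cls M \<tau>)"
      let ?E = "\<lambda>\<gamma>. farr (snd \<eta>) (cls M \<gamma>)" and ?F = "\<lambda>\<gamma>. farr (snd \<xi>) (cls M \<gamma>)"
      have P1: "Comp T (?E \<gamma>) (k (\<gamma> 0)) = Comp T (k (\<gamma> 1)) (?F \<gamma>)" and P2: "Comp T (?E \<tau>) (k (\<tau> 0)) = Comp T (k (\<gamma> 0)) (?F \<tau>)"
        using P by (simp_all add: Dom_cls[OF leM] Cod_cls[OF leM] \<gamma> \<tau> e)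
      have ends: "\<tau> 0 \<in> pts M" "\<gamma> 0 \<in> pts M" "\<gamma> 1 \<in> pts M" using path_pts[OF \<gamma>] path_pts[OF \<tau>] by simp_all
      note c = concat_path_in_paths[OF leM \<gamma> \<tau> e]
      have fu: "is_functor (Pi_thin M) T (snd \<xi>)" "is_functor (Pi_thin M) T (snd \<eta>)" using tf by (simp_all add: transport_functor_def)
      note h1 = transport_homs[OF leM tf(2) \<gamma>] and h2 = transport_homs[OF leM tf(2) \<tau>, unfolded e]
        and h3 = transport_homs[OF leM tf(1) \<gamma>] and h4 = transport_homs[OF leM tf(1) \<tau>, unfolded e]
      have "Comp T (?E (concat_path \<gamma> \<tau>)) (k (\<tau> 0)) = Comp T (?E \<gamma>) (Comp T (?E \<tau>) (k (\<tau> 0)))"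
        unfolding functor_concat[OF leM fu(2) \<gamma> \<tau> e] by (rule Tors.homs_assoc[OF h1 h2 k_hom[OF ends(1)], symmetric])
      also have "\<dots> = Comp T (Comp T (?E \<gamma>) (k (\<gamma> 0))) (?F \<tau>)"
        unfolding P2 by (rule Tors.homs_assoc[OF h1 k_hom[OF ends(2)] h4])
      also have "\<dots> = Comp T (k (\<gamma> 1)) (?F (concat_path \<gamma> \<tau>))"
        unfolding P1 functor_concat[OF leM fu(1) \<gamma> \<tau> e] by (rule Tors.homs_assoc[OF k_hom[OF ends(3)] h3 h4, symmetric])
      finally show "?P (cls M (concat_path \<gamma> \<tau>))"
        by (simp add: Dom_cls[OF leM c] Cod_cls[OF leM c] concat_path_simps)
    qed
    then show ?thesis by (simp add: Dom_cls[OF leM \<gamma>] Cod_cls[OF leM \<gamma>])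
  qed
  have e: "\<xi> = (M, snd \<xi>)" "\<eta> = (M, snd \<eta>)" using b by (metis prod.collapse)+
  obtain \<psi> where "\<psi> \<in> inc_homs M M (M, snd \<xi>) (M, snd \<eta>)" and nt\<psi>: "\<And>x. x \<in> pts M \<Longrightarrow> nt \<psi> x = k x"
    using inc_homsI[OF tf incl_refl_Arr[OF M] k_hom k_nat] by blast
  then have \<psi>: "\<psi> \<in> inc_homs M M \<xi> \<eta>" using e by simp
  have fh: "\<chi>' \<in> fiber_hom X \<pi> \<xi> \<eta> \<longleftrightarrow> \<chi>' \<in> inc_homs M M \<xi> \<eta>" for \<chi>'
    by (rule fiber_hom_iff) (simp add: fobj_fst[OF \<xi>] b)
  show "\<exists>!\<psi>. \<psi> \<in> fiber_hom X \<pi> \<xi> \<eta> \<and> (\<forall>U\<in>\<U>. pull_arr X \<pi> (?lx U) (?ly U) \<psi> = \<phi> U)"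
  proof (rule ex1I[of _ \<psi>], intro conjI ballI)
    show "\<psi> \<in> fiber_hom X \<pi> \<xi> \<eta>" using \<psi> fh by blast
    fix U assume U: "U \<in> \<U>"
    note o = cover_open[OF U]
    show "pull_arr X \<pi> (?lx U) (?ly U) \<psi> = \<phi> U"
    proof (rule inc_pull(3)[OF lx[OF o] ly[OF o] \<psi> \<phi>[OF U]])
      show "Comp X (?ly U) (\<phi> U) = Comp X \<psi> (?lx U)"
      proof (rule inc_eqI[OF inc_comp(1)[OF ly[OF o] \<phi>[OF U]] inc_comp(1)[OF \<psi> lx[OF o]]])
        fix x assume x: "x \<in> pts (open_sub M U)"
        then have x': "x \<in> U" "x \<in> pts M" using o openin_subset[OF o] by auto
        show "nt (Comp X (?ly U) (\<phi> U)) x = nt (Comp X \<psi> (?lx U)) x"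
          unfolding inc_comp(2)[OF ly[OF o] \<phi>[OF U] x] inc_comp(2)[OF \<psi> lx[OF o] x] nt\<psi>[OF x'(2)] k[OF U x'(1)] \<kappa>_def
          by (rule transfer(2)[OF lx[OF o] ly[OF o] \<phi>[OF U] x, symmetric])
      qed
    qed
  next
    fix \<psi>' assume *: "\<psi>' \<in> fiber_hom X \<pi> \<xi> \<eta> \<and> (\<forall>U\<in>\<U>. pull_arr X \<pi> (?lx U) (?ly U) \<psi>' = \<phi> U)"
    then have \<psi>': "\<psi>' \<in> inc_homs M M \<xi> \<eta>" using fh by blast
    show "\<psi>' = \<psi>"
    proof (rule inc_eqI[OF \<psi>' \<psi>])
      fix x assume x: "x \<in> pts M"
      then obtain U where U: "U \<in> \<U>" "x \<in> U" using cover_at by blast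
      note o = cover_open[OF U(1)]
      have xU: "x \<in> pts (open_sub M U)" using U o by simp
      have "Comp X (?ly U) (\<phi> U) = Comp X \<psi>' (?lx U)" using inc_pull(2)[OF lx[OF o] ly[OF o] \<psi>'] * U(1) by auto
      then have "Comp T (nt \<psi>' x) (nt (?lx U) x) = Comp T (nt (?ly U) x) (nt (\<phi> U) x)"
        using inc_comp(2)[OF ly[OF o] \<phi>[OF U(1)] xU] inc_comp(2)[OF \<psi>' lx[OF o] xU] by simp
      then have "\<kappa> U x = nt \<psi>' x"
        unfolding \<kappa>_def by (rule transfer(3)[OF lx[OF o] ly[OF o] \<phi>[OF U(1)] xU inc_homsD(11)[OF \<psi>' x]])
      then show "nt \<psi>' x = nt \<psi> x" using nt\<psi>[OF x] k[OF U] by simp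
    qed
  qed
qed

end

context transport_descent
begin

text \<open>The datum is unwound into a cocycle of torsor maps \<open>g U V x\<close>. Over each
  point the fiber of one chosen member is taken, and the local transports are conjugated into the
  chosen fibers. By naturality of \<open>g\<close> the results agree on overlaps, hence form a
  \<open>local_system\<close>, and its glued functor is the object sought.\<close>

lemma transport_effective:
  assumes dd: "descent_datum X \<pi> cl M \<U> \<xi> \<phi>"
  shows "effective_descent_datum X \<pi> cl M \<U> \<xi> \<phi>"
proof -
  have oI: "openin (mtop M) (U \<inter> V)" if "U \<in> \<U>" "V \<in> \<U>" for U V using that cover_open by auto
  have \<xi>: "\<xi> U \<in> Obj X" "fst (\<xi> U) = open_sub M U" if "U \<in> \<U>" for U
    using dd that fobj_fst[of "\<xi> U"] by (auto simp: descent_datum_def)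
  let ?F = "\<lambda>U. snd (\<xi> U)"
  have tF: "transport_functor G (open_sub M U) (?F U)" if "U \<in> \<U>" for U using \<xi>[OF that] by (simp add: Obj_X)
  have leU: "locally_euclidean (open_sub M U)" if "U \<in> \<U>" for U by (rule locally_euclidean_open_sub[OF leM cover_open[OF that]])
  have in_sub: "incl (open_sub M A) (fst (\<xi> U)) \<in> Arr Man" if "U \<in> \<U>" "openin (mtop M) A" "A \<subseteq> U" for A U
    using incl_in_Arr(1)[OF M that(2) cover_open[OF that(1)] that(3)] \<xi>(2)[OF that(1)] by simp
  let ?l = "\<lambda>A U. lift_to \<pi> cl (open_sub M A) (\<xi> U)"
  have l: "?l A U \<in> inc_homs (open_sub M A) (open_sub M U) (restr X \<pi> cl (open_sub M A) (\<xi> U)) (\<xi> U)"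
    if "U \<in> \<U>" "openin (mtop M) A" "A \<subseteq> U" for A U
    using lift_to_inc[OF \<xi>(1)[OF that(1)] in_sub[OF that]] \<xi>(2)[OF that(1)] by simp
  have \<phi>: "\<phi> U V \<in> inc_homs (open_sub M (U \<inter> V)) (open_sub M (U \<inter> V)) (restr X \<pi> cl (open_sub M (U \<inter> V)) (\<xi> U)) (restr X \<pi> cl (open_sub M (U \<inter> V)) (\<xi> V))"
    if "U \<in> \<U>" "V \<in> \<U>" for U V
  proof -
    have "\<phi> U V \<in> fiber_hom X \<pi> (restr X \<pi> cl (open_sub M (U \<inter> V)) (\<xi> U)) (restr X \<pi> cl (open_sub M (U \<inter> V)) (\<xi> V))"
      using dd that by (auto simp: descent_datum_def Let_def)
    then show ?thesis using fiber_hom_iff[OF fobj_inc[OF l[OF that(1) oI[OF that] Int_lower1]]] by blast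
  qed
  \<comment> \<open>The gluing arrows of the datum, seen as maps from the fiber of
    \<open>\<xi> U\<close> to that of \<open>\<xi> V\<close>, without the chosen
    restrictions.\<close>
  define g where "g U V = transfer (?l (U \<inter> V) V) (\<phi> U V) (?l (U \<inter> V) U)" for U V
  have g_hom: "g U V x \<in> homs T (fobj (?F U) x) (fobj (?F V) x)" if UV: "U \<in> \<U>" "V \<in> \<U>" and x: "x \<in> U" "x \<in> V" for U V x
    unfolding g_def
    by (rule transfer(1)[OF l[OF UV(1) oI[OF UV] Int_lower1] l[OF UV(2) oI[OF UV] Int_lower2] \<phi>[OF UV]]) (use oI[OF UV] x in simp)
  have g_nat: "Comp T (farr (?F V) (cls (open_sub M V) \<gamma>)) (g U V (\<gamma> 0)) = Comp T (g U V (\<gamma> 1)) (farr (?F U) (cls (open_sub M U) \<gamma>))"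
    if UV: "U \<in> \<U>" "V \<in> \<U>" and \<gamma>: "\<gamma> \<in> paths (open_sub M U)" "\<gamma> \<in> paths (open_sub M V)" for U V \<gamma>
  proof -
    have "\<gamma> \<in> paths (open_sub M (U \<inter> V))"
      using \<gamma> paths_open_sub[OF leM cover_open[OF UV(1)]] paths_open_sub[OF leM cover_open[OF UV(2)]] paths_open_sub[OF leM oI[OF UV]] by auto
    then show ?thesis
      unfolding g_def by (rule transfer_natural[OF l[OF UV(1) oI[OF UV] Int_lower1] l[OF UV(2) oI[OF UV] Int_lower2] \<phi>[OF UV] _ \<gamma>])
  qed
  \<comment> \<open>Pullback of a gluing arrow to an open set \<open>D\<close> inside the overlap;
    triple overlaps are the case in which the cocycle condition of the datum is stated.\<close>
  define P where "P D A B = pull_arr X \<pi> (sub_lift X \<pi> cl (open_sub M D) (open_sub M (A \<inter> B)) (\<xi> A))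
      (sub_lift X \<pi> cl (open_sub M D) (open_sub M (A \<inter> B)) (\<xi> B)) (\<phi> A B)" for D A B
  have P: "P D A B \<in> inc_homs (open_sub M D) (open_sub M D) (restr X \<pi> cl (open_sub M D) (\<xi> A)) (restr X \<pi> cl (open_sub M D) (\<xi> B))"
    and g_P: "x \<in> D \<Longrightarrow> g A B x = transfer (?l D B) (P D A B) (?l D A) x"
    if AB: "A \<in> \<U>" "B \<in> \<U>" and D: "openin (mtop M) D" "D \<subseteq> A" "D \<subseteq> B" for A B D x
  proof -
    have DAB: "D \<subseteq> A \<inter> B" using D by blast
    note i = incl_in_Arr(1)[OF M D(1) oI[OF AB] DAB]
    note sA = sub_lift_inc[OF \<xi>(1)[OF AB(1)] i in_sub[OF AB(1) oI[OF AB] Int_lower1] in_sub[OF AB(1) D(1,2)]]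
      and sB = sub_lift_inc[OF \<xi>(1)[OF AB(2)] i in_sub[OF AB(2) oI[OF AB] Int_lower2] in_sub[OF AB(2) D(1,3)]]
    note pl = inc_pull[OF sA(1) sB(1) \<phi>[OF AB], folded P_def]
    show "P D A B \<in> inc_homs (open_sub M D) (open_sub M D) (restr X \<pi> cl (open_sub M D) (\<xi> A)) (restr X \<pi> cl (open_sub M D) (\<xi> B))"
      by (rule pl(1))
    show "x \<in> D \<Longrightarrow> g A B x = transfer (?l D B) (P D A B) (?l D A) x"
      using transfer_restrict[OF l[OF AB(1) oI[OF AB] Int_lower1] l[OF AB(2) oI[OF AB] Int_lower2] \<phi>[OF AB] sA(1) sB(1) pl(1,2), of x] D(1)
      by (simp add: sA(2) sB(2) g_def)
  qed
  have cocycle: "Comp T (g V W x) (g U V x) = g U W x" if UVW: "U \<in> \<U>" "V \<in> \<U>" "W \<in> \<U>" and x: "x \<in> U" "x \<in> V" "x \<in> W" for U V W x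
  proof -
    let ?D = "U \<inter> V \<inter> W"
    have D: "openin (mtop M) ?D" "?D \<subseteq> U" "?D \<subseteq> V" "?D \<subseteq> W" "x \<in> ?D" using UVW cover_open x by auto
    have xD: "x \<in> pts (open_sub M ?D)" using D(1,5) by simp
    have c: "Comp X (P ?D V W) (P ?D U V) = P ?D U W"
      using dd UVW by (simp add: descent_datum_def Let_def P_def)
    note P1 = P[OF UVW(1,2) D(1,2,3)] and P2 = P[OF UVW(2,3) D(1,3,4)] and P3 = P[OF UVW(1,3) D(1,2,4)]
    note lU = l[OF UVW(1) D(1,2)] and lV = l[OF UVW(2) D(1,3)] and lW = l[OF UVW(3) D(1,4)]
    note t1 = transfer(2)[OF lU lV P1 xD, folded g_P[OF UVW(1,2) D(1,2,3,5)]]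
      and t2 = transfer(2)[OF lV lW P2 xD, folded g_P[OF UVW(2,3) D(1,3,4,5)]]
    note g1 = g_hom[OF UVW(1,2) x(1,2)] and g2 = g_hom[OF UVW(2,3) x(2,3)]
    have "transfer (?l ?D W) (P ?D U W) (?l ?D U) x = Comp T (g V W x) (g U V x)"
    proof (rule transfer(3)[OF lU lW P3 xD Tors.comp_homs[OF g2 g1]])
      have "Comp T (Comp T (g V W x) (g U V x)) (nt (?l ?D U) x) = Comp T (g V W x) (Comp T (nt (?l ?D V) x) (nt (P ?D U V) x))"
        using Tors.homs_assoc[OF g2 g1 inc_homsD(11)[OF lU xD]] t1 by (simp only:)
      also have "\<dots> = Comp T (Comp T (nt (?l ?D W) x) (nt (P ?D V W) x)) (nt (P ?D U V) x)"
        using Tors.homs_assoc[OF g2 inc_homsD(11)[OF lV xD] inc_homsD(11)[OF P1 xD]] t2 by (simp only:)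
      also have "\<dots> = Comp T (nt (?l ?D W) x) (nt (P ?D U W) x)"
        using Tors.homs_assoc[OF inc_homsD(11)[OF lW xD] inc_homsD(11)[OF P2 xD] inc_homsD(11)[OF P1 xD], symmetric] inc_comp(2)[OF P2 P1 xD]
        by (simp only: c)
      finally show "Comp T (Comp T (g V W x) (g U V x)) (nt (?l ?D U) x) = Comp T (nt (?l ?D W) x) (nt (P ?D U W) x)" .
    qed
    then show ?thesis using g_P[OF UVW(1,3) D(1,2,4,5)] by simp
  qed
  define U0 where "U0 x = (SOME U. U \<in> \<U> \<and> x \<in> U)" for x
  have U0: "U0 x \<in> \<U>" "x \<in> U0 x" if "x \<in> pts M" for x
  proof -
    have "\<exists>U. U \<in> \<U> \<and> x \<in> U" using cover_at[OF that] by blast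
    from someI_ex[OF this] show "U0 x \<in> \<U>" "x \<in> U0 x" by (auto simp: U0_def)
  qed
  \<comment> \<open>The fiber over x of an arbitrarily chosen member. No continuity in x is asked of
    this choice.\<close>
  define Y where "Y x = fobj (?F (U0 x)) x" for x
  \<comment> \<open>Trivializes the cocycle: \<open>h U x\<close> leads from the fiber of
    \<open>\<xi> U\<close> to the chosen fiber, and \<open>h_g\<close> is the cocycle condition for
    the chosen member.\<close>
  define h where "h U x = g U (U0 x) x" for U x
  have ptU: "x \<in> pts M" if "U \<in> \<U>" "x \<in> U" for U x using openin_subset[OF cover_open[OF that(1)]] that(2) by blast
  have h: "h U x \<in> homs T (fobj (?F U) x) (Y x)" if "U \<in> \<U>" "x \<in> U" for U x
    unfolding h_def Y_def by (rule g_hom[OF that(1) U0(1)[OF ptU[OF that]] that(2) U0(2)[OF ptU[OF that]]])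
  have h_g: "Comp T (h V x) (g U V x) = h U x" if "U \<in> \<U>" "V \<in> \<U>" "x \<in> U" "x \<in> V" for U V x
    unfolding h_def by (rule cocycle[OF that(1,2) U0(1) that(3,4) U0(2)]) (rule ptU[OF that(1,3)])+
  \<comment> \<open>The transport of \<open>\<xi> U\<close>, conjugated by \<open>h U\<close> into
    the chosen fibers.\<close>
  define e where "e U \<gamma> = Comp T (Comp T (h U (\<gamma> 1)) (farr (?F U) (cls (open_sub M U) \<gamma>))) (arr_inv T (h U (\<gamma> 0)))" for U \<gamma>
  have endsU: "\<gamma> 0 \<in> U" "\<gamma> 1 \<in> U" "\<gamma> \<in> paths M" if "U \<in> \<U>" "\<gamma> \<in> paths (open_sub M U)" for U \<gamma>
    using paths_open_sub[OF leM cover_open[OF that(1)]] that(2) by auto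
  have e: "e U \<gamma> \<in> homs T (Y (\<gamma> 0)) (Y (\<gamma> 1))" "Comp T (e U \<gamma>) (h U (\<gamma> 0)) = Comp T (h U (\<gamma> 1)) (farr (?F U) (cls (open_sub M U) \<gamma>))"
    if "U \<in> \<U>" "\<gamma> \<in> paths (open_sub M U)" for U \<gamma>
  proof -
    note hf = Tors.comp_homs[OF h[OF that(1) endsU(2)[OF that]] transport_homs[OF leU[OF that(1)] tF[OF that(1)] that(2)]]
    note h0 = h[OF that(1) endsU(1)[OF that]]
    show "e U \<gamma> \<in> homs T (Y (\<gamma> 0)) (Y (\<gamma> 1))" unfolding e_def by (rule Tors.comp_homs[OF hf Tors.arr_inv(1)[OF h0]])
    show "Comp T (e U \<gamma>) (h U (\<gamma> 0)) = Comp T (h U (\<gamma> 1)) (farr (?F U) (cls (open_sub M U) \<gamma>))"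
      unfolding e_def by (rule Tors.inv_comp_right[OF hf h0])
  qed
  have e_unique: "e U \<gamma> = k"
    if "U \<in> \<U>" "\<gamma> \<in> paths (open_sub M U)" "k \<in> homs T (Y (\<gamma> 0)) (Y (\<gamma> 1))"
      "Comp T k (h U (\<gamma> 0)) = Comp T (h U (\<gamma> 1)) (farr (?F U) (cls (open_sub M U) \<gamma>))" for U \<gamma> k
    by (rule Tors.cancel_right[OF h[OF that(1) endsU(1)[OF that(1,2)]] e(1)[OF that(1,2)] that(3)]) (simp only: e(2)[OF that(1,2)] that(4))
  \<comment> \<open>Both are the same transport in the chosen fibers: \<open>g\<close> intertwines
    the two local transports and relates \<open>h U\<close> to \<open>h V\<close>.\<close>
  have e_agree: "e U \<gamma> = e V \<gamma>" if UV: "U \<in> \<U>" "V \<in> \<U>" and \<gamma>: "\<gamma> \<in> paths (open_sub M U)" "\<gamma> \<in> paths (open_sub M V)" for U V \<gamma>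
  proof (rule e_unique[OF UV(1) \<gamma>(1) e(1)[OF UV(2) \<gamma>(2)]])
    note u = endsU[OF UV(1) \<gamma>(1)] and v = endsU[OF UV(2) \<gamma>(2)]
    note g0 = g_hom[OF UV u(1) v(1)] and g1 = g_hom[OF UV u(2) v(2)]
    note fU = transport_homs[OF leU[OF UV(1)] tF[OF UV(1)] \<gamma>(1)] and fV = transport_homs[OF leU[OF UV(2)] tF[OF UV(2)] \<gamma>(2)]
    have "Comp T (e V \<gamma>) (h U (\<gamma> 0)) = Comp T (Comp T (e V \<gamma>) (h V (\<gamma> 0))) (g U V (\<gamma> 0))"
      using Tors.homs_assoc[OF e(1)[OF UV(2) \<gamma>(2)] h[OF UV(2) v(1)] g0] h_g[OF UV u(1) v(1)] by (simp only:)
    also have "\<dots> = Comp T (h V (\<gamma> 1)) (Comp T (g U V (\<gamma> 1)) (farr (?F U) (cls (open_sub M U) \<gamma>)))"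
      using Tors.homs_assoc[OF h[OF UV(2) v(2)] fV g0, symmetric] e(2)[OF UV(2) \<gamma>(2)] g_nat[OF UV \<gamma>] by (simp only:)
    also have "\<dots> = Comp T (h U (\<gamma> 1)) (farr (?F U) (cls (open_sub M U) \<gamma>))"
      using Tors.homs_assoc[OF h[OF UV(2) v(2)] g1 fU] h_g[OF UV u(2) v(2)] by (simp only:)
    finally show "Comp T (e V \<gamma>) (h U (\<gamma> 0)) = Comp T (h U (\<gamma> 1)) (farr (?F U) (cls (open_sub M U) \<gamma>))" .
  qed
  \<comment> \<open>Depends on the path alone, as \<open>local_system\<close> demands;
    \<open>e_agree\<close> makes the choice of the member immaterial.\<close>
  define E where "E \<gamma> = e (SOME U. U \<in> \<U> \<and> \<gamma> \<in> paths (open_sub M U)) \<gamma>" for \<gamma>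
  have E: "E \<gamma> = e U \<gamma>" if "U \<in> \<U>" "\<gamma> \<in> paths (open_sub M U)" for U \<gamma>
  proof -
    have "\<exists>U. U \<in> \<U> \<and> \<gamma> \<in> paths (open_sub M U)" using that by blast
    from someI_ex[OF this] show ?thesis unfolding E_def by (intro e_agree that) auto
  qed
  have YO: "Y x \<in> Obj T" if "x \<in> pts M" for x
    unfolding Y_def by (rule transport_obj[OF tF[OF U0(1)[OF that]]]) (simp add: cover_open U0 that)
  interpret L: local_system T M \<U> Y E
  proof (intro local_system.intro category_Tors local_system_axioms.intro leM cover YO)
    fix U \<gamma> assume U: "U \<in> \<U>" "\<gamma> \<in> paths (open_sub M U)"
    then show "E \<gamma> \<in> Arr T \<and> Dom T (E \<gamma>) = Y (\<gamma> 0) \<and> Cod T (E \<gamma>) = Y (\<gamma> 1)"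
      using e(1)[OF U] E[OF U] by (simp add: homs_iff)
  next
    fix U \<gamma> \<gamma>' assume U: "U \<in> \<U>" and r: "(\<gamma>, \<gamma>') \<in> thin_rel (open_sub M U)"
    note t = thin_rel_ends[OF r]
    show "E \<gamma> = E \<gamma>'"
      using t E[OF U, of \<gamma>] E[OF U, of \<gamma>'] cls_eqI[OF leU[OF U] r] by (simp add: e_def)
  next
    fix x assume x: "x \<in> pts M"
    obtain U where U: "U \<in> \<U>" "x \<in> U" using cover_at[OF x] .
    have xU: "x \<in> pts (open_sub M U)" using U cover_open by simp
    let ?c = "\<lambda>t\<in>I01. x"
    note c = const_path_in_paths[OF leU[OF U(1)] xU]
    have fU: "is_functor (Pi_thin (open_sub M U)) T (?F U)" using tF[OF U(1)] by (simp add: transport_functor_def)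
    have "e U ?c = Ident T (Y x)"
    proof (rule e_unique[OF U(1) c])
      show "Ident T (Y x) \<in> homs T (Y (?c 0)) (Y (?c 1))" using Tors.ident_homs[OF YO[OF x]] by simp
      show "Comp T (Ident T (Y x)) (h U (?c 0)) = Comp T (h U (?c 1)) (farr (?F U) (cls (open_sub M U) ?c))"
        using functor_const[OF fU xU] Tors.comp_ident_homs[OF h[OF U]] by (simp del: Ident_Tors)
    qed
    then show "E ?c = Ident T (Y x)" using E[OF U(1) c] by simp
  next
    fix U \<gamma> \<tau> assume U: "U \<in> \<U>" and \<gamma>: "\<gamma> \<in> paths (open_sub M U)" and \<tau>: "\<tau> \<in> paths (open_sub M U)" and j: "\<tau> 1 = \<gamma> 0"
    note c = concat_path_in_paths[OF leU[OF U] \<gamma> \<tau> j]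
    have fU: "is_functor (Pi_thin (open_sub M U)) T (?F U)" using tF[OF U] by (simp add: transport_functor_def)
    note e1 = e[OF U \<gamma>] and e2 = e[OF U \<tau>, unfolded j]
    note h0 = h[OF U endsU(1)[OF U \<tau>]] and h1 = h[OF U endsU(1)[OF U \<gamma>]] and h2 = h[OF U endsU(2)[OF U \<gamma>]]
    note f1 = transport_homs[OF leU[OF U] tF[OF U] \<gamma>] and f2 = transport_homs[OF leU[OF U] tF[OF U] \<tau>, unfolded j]
    have "Comp T (Comp T (e U \<gamma>) (e U \<tau>)) (h U (\<tau> 0)) = Comp T (Comp T (e U \<gamma>) (h U (\<gamma> 0))) (farr (?F U) (cls (open_sub M U) \<tau>))"
      using Tors.homs_assoc[OF e1(1) e2(1) h0] Tors.homs_assoc[OF e1(1) h1 f2] e2(2) by (simp only:)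
    also have "\<dots> = Comp T (h U (\<gamma> 1)) (farr (?F U) (cls (open_sub M U) (concat_path \<gamma> \<tau>)))"
      using Tors.homs_assoc[OF h2 f1 f2, symmetric] e1(2) functor_concat[OF leU[OF U] fU \<gamma> \<tau> j] by (simp only:)
    finally have "e U (concat_path \<gamma> \<tau>) = Comp T (e U \<gamma>) (e U \<tau>)"
      by (intro e_unique[OF U c]) (use Tors.comp_homs[OF e1(1) e2(1)] in \<open>simp_all add: concat_path_simps\<close>)
    then show "E (concat_path \<gamma> \<tau>) = Comp T (E \<gamma>) (E \<tau>)" using E[OF U c] E[OF U \<gamma>] E[OF U \<tau>] by simp
  qed
  obtain F where F: "is_functor (Pi_thin M) T F" "fobj F = restrict Y (pts M)"
    "\<And>U \<gamma>. U \<in> \<U> \<Longrightarrow> \<gamma> \<in> paths (open_sub M U) \<Longrightarrow> farr F (cls M \<gamma>) = E \<gamma>"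
    using L.glued_functor by blast
  have FY: "fobj F x = Y x" if "x \<in> pts M" for x using that by (simp add: F(2))
  have tM: "transport_functor G M F"
  \<comment> \<open>On loops at \<open>x\<close> inside \<open>U\<close> the glued functor is the
    smooth transport of \<open>\<xi> U\<close> conjugated by the fixed map \<open>h U x\<close>, so
    it is smooth.\<close>
  proof (rule transport_functor_local[OF leM cover F(1)])
    fix U x n V p assume U: "U \<in> \<U>" and x: "x \<in> U" and p: "plot (path_dspace (open_sub M U)) n V p" and loop: "\<forall>u\<in>V. p u 0 = x \<and> p u 1 = x"
    have V: "openin (Euclidean_space n) V" and pp: "\<And>u. u \<in> V \<Longrightarrow> p u \<in> paths (open_sub M U)" using p by (auto simp: path_dspace_def)
    have xU: "x \<in> pts (open_sub M U)" using x cover_open[OF U] by simp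
    have sm: "smooth_family n V (fobj (?F U) x) (fobj (?F U) x) (\<lambda>u. farr (?F U) (cls (open_sub M U) (p u)))"
      using tF[OF U] xU p loop unfolding transport_functor_iff[OF leU[OF U]] by blast
    note hx = h[OF U x]
    have tor: "is_torsor G (fobj (?F U) x)" by (rule homs_Tors(1)[OF hx])
    have "smooth_family n V (Y x) (Y x) (\<lambda>u. Comp T (Comp T (h U x) (farr (?F U) (cls (open_sub M U) (p u)))) (arr_inv T (h U x)))"
      by (intro smooth_family_comp[OF V _ _ tor] smooth_family_const[OF V] Tors.arr_inv(1)[OF hx] hx sm)
    then have "smooth_family n V (Y x) (Y x) (\<lambda>u. farr F (cls M (p u)))"
      by (rule smooth_family_cong[OF V]) (simp add: F(3)[OF U pp] E[OF U pp] e_def loop)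
    then show "smooth_family n V (fobj F x) (fobj F x) (\<lambda>u. farr F (cls M (p u)))" by (simp add: FY[OF ptU[OF U x]])
  qed
  let ?\<zeta> = "(M, F)"
  have \<zeta>: "?\<zeta> \<in> Obj X" "fst ?\<zeta> = M" using M tM by simp_all
  \<comment> \<open>The maps \<open>h U\<close> are the components of an arrow from
    \<open>\<xi> U\<close> to the glued object over the inclusion; its naturality is the equation
    that characterizes \<open>e\<close>.\<close>
  have "\<forall>U\<in>\<U>. \<exists>a. a \<in> inc_homs (open_sub M U) M (\<xi> U) ?\<zeta> \<and> (\<forall>x\<in>U. nt a x = h U x)"
  proof
    fix U assume U: "U \<in> \<U>"
    note o = cover_open[OF U]
    have eU: "(open_sub M U, ?F U) = \<xi> U" using \<xi>(2)[OF U] by (metis prod.collapse)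
    have "incl (open_sub M U) M \<in> Arr Man" by (rule incl_in_Arr(2)[OF M o o subset_refl])
    then obtain a where a: "a \<in> inc_homs (open_sub M U) M (open_sub M U, ?F U) (M, F)" "\<And>x. x \<in> pts (open_sub M U) \<Longrightarrow> nt a x = h U x"
    proof (rule inc_homsI[OF tF[OF U] tM])
      show "h U x \<in> homs T (fobj (?F U) x) (fobj F x)" if "x \<in> pts (open_sub M U)" for x
        using h[OF U, of x] FY[OF ptU[OF U, of x]] that o by simp
      show "Comp T (farr F (cls M \<gamma>)) (h U (\<gamma> 0)) = Comp T (h U (\<gamma> 1)) (farr (?F U) (cls (open_sub M U) \<gamma>))"
        if "\<gamma> \<in> paths (open_sub M U)" for \<gamma>
        using e(2)[OF U that] F(3)[OF U that] E[OF U that] by simp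
    qed blast
    then show "\<exists>a. a \<in> inc_homs (open_sub M U) M (\<xi> U) ?\<zeta> \<and> (\<forall>x\<in>U. nt a x = h U x)"
      using a(1)[unfolded eU] a(2) o by (intro exI[of _ a]) simp
  qed
  then obtain a where a: "a U \<in> inc_homs (open_sub M U) M (\<xi> U) ?\<zeta>" and nta: "x \<in> U \<Longrightarrow> nt (a U) x = h U x" if "U \<in> \<U>" for U x
    by metis
  have inM: "incl (open_sub M A) (fst ?\<zeta>) \<in> Arr Man" if "openin (mtop M) A" for A
    using incl_in_Arr(2)[OF M that that] \<zeta>(2) by simp
  let ?z = "\<lambda>A. lift_to \<pi> cl (open_sub M A) ?\<zeta>"
  have z: "?z A \<in> inc_homs (open_sub M A) M (restr X \<pi> cl (open_sub M A) ?\<zeta>) ?\<zeta>" if "openin (mtop M) A" for A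
    using lift_to_inc[OF \<zeta>(1) inM[OF that]] by simp
  \<comment> \<open>Both \<open>a U\<close> and the lift chosen by the cleavage are pullbacks of the
    glued object to \<open>U\<close>; \<open>\<psi> U\<close> is the comparison between
    them.\<close>
  define \<psi> where "\<psi> U = factor X \<pi> (a U) (?z U) (incl (open_sub M U) (open_sub M U))" for U
  have \<psi>: "\<psi> U \<in> inc_homs (open_sub M U) (open_sub M U) (restr X \<pi> cl (open_sub M U) ?\<zeta>) (\<xi> U)" "Comp X (a U) (\<psi> U) = ?z U"
    if U: "U \<in> \<U>" for U
    using inc_factor[OF a[OF U] z[OF cover_open[OF U]] incl_refl_Arr[OF manifold_open_sub[OF M cover_open[OF U]]]] by (simp_all add: \<psi>_def)
  interpret XC: category "X :: (('m, 'q, 'g) trans_obj, ('m, 'q, 'g) trans_arr) cat" by (rule category_Trans)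
  note asX = XC.homs_assoc[OF inc_homsD(1) inc_homsD(1) inc_homsD(1)]
  show ?thesis
    unfolding effective_descent_datum_def
  proof (intro bexI[of _ ?\<zeta>] exI[of _ \<psi>] conjI ballI \<zeta>(1))
    show "fobj \<pi> ?\<zeta> = M" using fobj_fst[OF \<zeta>(1)] by simp
    show "\<psi> U \<in> fiber_hom X \<pi> (restr X \<pi> cl (open_sub M U) ?\<zeta>) (\<xi> U)" if "U \<in> \<U>" for U
      using \<psi>(1)[OF that] fiber_hom_iff[OF fobj_inc[OF z[OF cover_open[OF that]]]] by blast
    fix U V assume UV: "U \<in> \<U>" "V \<in> \<U>"
    let ?UV = "open_sub M (U \<inter> V)"
    note o = oI[OF UV]
    define Q where "Q A = pull_arr X \<pi> (sub_lift X \<pi> cl ?UV (open_sub M A) ?\<zeta>) (?l (U \<inter> V) A) (\<psi> A)" for A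
    have Q: "Q A \<in> inc_homs ?UV ?UV (restr X \<pi> cl ?UV ?\<zeta>) (restr X \<pi> cl ?UV (\<xi> A))"
      "Comp X (a A) (Comp X (?l (U \<inter> V) A) (Q A)) = ?z (U \<inter> V)" if A: "A \<in> \<U>" "U \<inter> V \<subseteq> A" for A
    proof -
      note oA = cover_open[OF A(1)]
      note s = sub_lift_inc[OF \<zeta>(1) incl_in_Arr(1)[OF M o oA A(2)] inM[OF oA] inM[OF o]]
      note lA = l[OF A(1) o A(2)]
      note pl = inc_pull[OF s(1) lA \<psi>(1)[OF A(1)], folded Q_def]
      show "Q A \<in> inc_homs ?UV ?UV (restr X \<pi> cl ?UV ?\<zeta>) (restr X \<pi> cl ?UV (\<xi> A))" by (rule pl(1))
      have "Comp X (a A) (Comp X (?l (U \<inter> V) A) (Q A)) = Comp X (Comp X (a A) (\<psi> A)) (sub_lift X \<pi> cl ?UV (open_sub M A) ?\<zeta>)"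
        unfolding pl(2) by (rule asX[OF a[OF A(1)] \<psi>(1)[OF A(1)] s(1)])
      then show "Comp X (a A) (Comp X (?l (U \<inter> V) A) (Q A)) = ?z (U \<inter> V)" using s(2) \<psi>(2)[OF A(1)] by simp
    qed
    note QU = Q[OF UV(1) Int_lower1] and QV = Q[OF UV(2) Int_lower2]
    note lU = l[OF UV(1) o Int_lower1] and lV = l[OF UV(2) o Int_lower2]
    note aU = inc_comp[OF a[OF UV(1)] lU] and aV = inc_comp[OF a[OF UV(2)] lV]
    \<comment> \<open>In components this is \<open>h_g\<close> together with the description of
      \<open>g\<close> as the transfer of \<open>\<phi>\<close>.\<close>
    have glue: "Comp X (Comp X (a V) (?l (U \<inter> V) V)) (\<phi> U V) = Comp X (a U) (?l (U \<inter> V) U)"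
    proof (rule inc_eqI[OF inc_comp(1)[OF aV(1) \<phi>[OF UV]] aU(1)])
      fix x assume x: "x \<in> pts ?UV"
      then have xUV: "x \<in> U" "x \<in> V" using o by auto
      have t: "Comp T (g U V x) (nt (?l (U \<inter> V) U) x) = Comp T (nt (?l (U \<inter> V) V) x) (nt (\<phi> U V) x)"
        unfolding g_def by (rule transfer(2)[OF lU lV \<phi>[OF UV] x])
      note hV = h[OF UV(2) xUV(2)] and nl = inc_homsD(11)[OF lU x] and ml = inc_homsD(11)[OF lV x] and nf = inc_homsD(11)[OF \<phi>[OF UV] x]
      have "nt (Comp X (Comp X (a V) (?l (U \<inter> V) V)) (\<phi> U V)) x = Comp T (Comp T (h V x) (nt (?l (U \<inter> V) V) x)) (nt (\<phi> U V) x)"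
        using inc_comp(2)[OF aV(1) \<phi>[OF UV] x] aV(2)[OF x] nta[OF UV(2) xUV(2)] by simp
      also have "\<dots> = Comp T (h V x) (Comp T (g U V x) (nt (?l (U \<inter> V) U) x))"
        unfolding t by (rule Tors.homs_assoc[OF hV ml nf, symmetric])
      also have "\<dots> = Comp T (h U x) (nt (?l (U \<inter> V) U) x)"
        using Tors.homs_assoc[OF hV g_hom[OF UV xUV] nl] h_g[OF UV xUV] by (simp only:)
      also have "\<dots> = nt (Comp X (a U) (?l (U \<inter> V) U)) x" using aU(2)[OF x] nta[OF UV(1) xUV(1)] by simp
      finally show "nt (Comp X (Comp X (a V) (?l (U \<inter> V) V)) (\<phi> U V)) x = nt (Comp X (a U) (?l (U \<inter> V) U)) x" .
    qed
    \<comment> \<open>Followed by the arrow of the restriction of \<open>\<xi> V\<close> into the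
      glued object, both sides become the chosen lift over the intersection, and that arrow can be
      cancelled.\<close>
    have "Comp X (\<phi> U V) (Q U) = Q V"
    proof (rule inc_cancel[OF aV(1) inc_comp(1)[OF \<phi>[OF UV] QU(1)] QV(1)])
      have "Comp X (Comp X (a V) (?l (U \<inter> V) V)) (Comp X (\<phi> U V) (Q U)) = Comp X (Comp X (a U) (?l (U \<inter> V) U)) (Q U)"
        unfolding glue[symmetric] by (rule asX[OF aV(1) \<phi>[OF UV] QU(1)])
      also have "\<dots> = ?z (U \<inter> V)" using asX[OF a[OF UV(1)] lU QU(1)] QU(2) by simp
      also have "\<dots> = Comp X (Comp X (a V) (?l (U \<inter> V) V)) (Q V)" using asX[OF a[OF UV(2)] lV QV(1)] QV(2) by simp
      finally show "Comp X (Comp X (a V) (?l (U \<inter> V) V)) (Comp X (\<phi> U V) (Q U)) = Comp X (Comp X (a V) (?l (U \<inter> V) V)) (Q V)" .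
    qed
    then show "let UV = open_sub M (U \<inter> V);
               \<psi>UV = (\<lambda>A. pull_arr X \<pi> (sub_lift X \<pi> cl UV (open_sub M A) ?\<zeta>) (lift_to \<pi> cl UV (\<xi> A)) (\<psi> A))
           in Comp X (\<phi> U V) (\<psi>UV U) = \<psi>UV V"
      by (simp add: Let_def Q_def)
  qed
qed

end

theorem corollary5p5:
  fixes G :: "'g lie_group"
  assumes "is_lie_group G"
  shows "stack_over_Man
    (Trans G :: (('m, 'q, 'g) trans_obj, ('m, 'q, 'g) trans_arr) cat)
    (Trans_proj G)"
proof -
  interpret lie_group_torsors G by unfold_locales (rule assms)
  show ?thesis
    unfolding stack_over_Man_def
  proof (intro conjI allI impI fibered_Trans)
    fix cl :: "'m man_arr \<Rightarrow> ('m, 'q, 'g) trans_obj \<Rightarrow> ('m, 'q, 'g) trans_arr" and M :: "'m mfd" and \<U> :: "'m set set"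
    assume "cleavage (Trans G) Man (Trans_proj G) cl" "manifold M" "open_cover M \<U>"
    then interpret transport_descent G cl M \<U>
      by (intro transport_descent.intro transport_descent_axioms.intro lie_group_torsors_axioms)
    show "hom_descent (Trans G) (Trans_proj G) cl M \<U>" by (rule transport_hom_descent)
    fix \<xi> \<phi> assume "descent_datum (Trans G) (Trans_proj G) cl M \<U> \<xi> \<phi>"
    then show "effective_descent_datum (Trans G) (Trans_proj G) cl M \<U> \<xi> \<phi>" by (rule transport_effective)
  qed
qed

end
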